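(* Suppose that $\Lambda$ is a row-finite $k$-graph with no sources, that $\eta:\Lambda\to G$ is a functor into a group $G$, that $B$ is the Fell bundle over $G$ with fibres $B_g=\overline{\operatorname{span}}\{s_\lambda s_\mu^*:\eta(\lambda)\eta(\mu)^{-1}=g\}\subset C^*(\Lambda)$, and that $\sigma\in Z^2(G,\mathbb{T})$. Define $c_\sigma:\{(\lambda,\mu)\in\Lambda\times\Lambda:s(\lambda)=r(\mu)\}\to\mathbb{T}$ by $c_\sigma(\lambda,\mu)=\sigma(\eta(\lambda),\eta(\mu))$. Then there is an isomorphism of the twisted $k$-graph algebra $C^*(\Lambda,c_\sigma)$ onto $C^*(B(\sigma))$ which carries the canonical Cuntz--Krieger $(\Lambda,c_\sigma)$-family into $\{t_\lambda\}=\{\pi^\sigma_{\eta(\lambda)}(s_\lambda)\}$, where $\pi^\sigma$ is the canonical representation of the deformed Fell bundle $B(\sigma)$ in $C^*(B(\sigma))$.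
   Context: All groups are discrete. A $k$-graph is a countable small category $\Lambda$ with a functor $d:\Lambda\to\mathbb{N}^k$ satisfying the factorisation property: if $d(\lambda)=m+n$, there are unique $\mu,\nu$ with $\lambda=\mu\nu$, $d(\mu)=m$, $d(\nu)=n$. Range and source (codomain and domain) are written $r,s$, so $\lambda\mu$ is defined exactly when $s(\lambda)=r(\mu)$. $\Lambda^n:=d^{-1}(n)$, $\Lambda^0$ is identified with the set of objects, $v\Lambda^n:=\{\lambda\in\Lambda^n:r(\lambda)=v\}$. Row-finite with no sources means every $v\Lambda^n$ is finite and nonempty. A functor $\eta:\Lambda\to G$ is a map with $\eta(\lambda\mu)=\eta(\lambda)\eta(\mu)$ for composable $\lambda,\mu$ and $\eta(v)=e$ for $v\in\Lambda^0$. A (normalised, $\mathbb{T}$-valued) categorical $2$-cocycle on $\Lambda$ is a function $c:\{(\lambda,\mu):s(\lambda)=r(\mu)\}\to\mathbb{T}$ with $c(\lambda,\mu)c(\lambda\mu,\nu)=c(\mu,\nu)c(\lambda,\mu\nu)$ for composable triples and $c(\lambda,s(\lambda))=c(r(\lambda),\lambda)=1$. For such $c$, a Cuntz--Krieger $(\Lambda,c)$-family (Kumjian--Pask--Sims) is a family $\{T_\lambda:\lambda\in\Lambda\}$ in a $C^*$-algebra such that: the $T_v$, $v\in\Lambda^0$, are mutually orthogonal projections; $T_\lambda T_\mu=c(\lambda,\mu)T_{\lambda\mu}$ if $s(\lambda)=r(\mu)$; $T_\lambda^*T_\lambda=T_{s(\lambda)}$; and $T_v=\sum_{\lambda\in v\Lambda^n}T_\lambda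 T_\lambda^*$ for all $v\in\Lambda^0$, $n\in\mathbb{N}^k$. $C^*(\Lambda,c)$ is the universal $C^*$-algebra generated by such a (canonical) family. For $c\equiv1$ this is the usual graph algebra $C^*(\Lambda)$, with canonical Cuntz--Krieger family $\{s_\lambda\}$. The function $c_\sigma$ of the claim is a categorical $2$-cocycle. A Fell bundle over $G$ is a set $B$ with a map $p:B\to G$ whose fibres $B_g=p^{-1}(g)$ are complex Banach spaces, with an associative multiplication and an involution such that: $p(bc)=p(b)p(c)$; multiplication is bilinear $B_g\times B_h\to B_{gh}$ with $\|bc\|\le\|b\|\,\|c\|$; $b\mapsto b^*$ is conjugate linear $B_g\to B_{g^{-1}}$ with $(bc)^*=c^*b^*$, $\|b^*b\|=\|b\|^2$ (so $B_e$ is a $C^*$-algebra); and $b^*b\ge0$ in $B_e$. The subspaces $B_g\subset C^*(\Lambda)$ of the claim form such a bundle with the operations and norm of $C^*(\Lambda)$. $Z^2(G,\mathbb{T})$ is the set of $\sigma:G\times G\to\mathbb{T}$ with $\sigma(e,g)=\sigma(g,e)=1$ and $\sigma(g,h)\sigma(gh,k)=\sigma(g,hk)\sigma(h,k)$. The deformed bundle $B(\sigma)$ is the Fell bundle with the same set, projection and Banach space fibres as $B$, and operations $b\cdot_\sigma c=\sigma(g,h)bc$, $b^{*_\sigma}=\overline{\sigma(g,g^{-1})}b^*$ for $b\in B_g$, $c\in B_h$. A representation of a Fell bundle $B$ in a $C^*$-algebra $C$ consists of linear maps $\pi_g:B_g\to C$ with $\pi_{gh}(bc)=\pi_g(b)\pi_h(c)$,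 $\pi_g(b)^*=\pi_{g^{-1}}(b^* )$ and $\pi_e$ nondegenerate. $C^*(B)$ is the $C^*$-algebra generated by a universal such representation (the canonical representation). *)

theory Defs
  imports Complex_Main "HOL-Algebra.Module" "HOL-Library.Poly_Mapping" "HOL-Library.Countable_Set"
begin

section \<open>C*-algebras\<close>

text \<open>C*-algebras need not be unital, so the \<open>one\<close> field inherited from the ring record
  is left unconstrained.\<close>

record 'a cstar = "(complex, 'a) module" +
  star :: "'a \<Rightarrow> 'a"
  cnorm :: "'a \<Rightarrow> real"

definition complex_ring :: "complex ring" where
  "complex_ring = \<lparr>carrier = UNIV, mult = (*), one = 1, zero = 0, add = (+)\<rparr>"

locale cstar_algebra = Module.module complex_ring A for A :: "'a cstar" (structure) +
  assumes mult_closed: "\<lbrakk>x \<in> carrier A; y \<in> carrier A\<rbrakk> \<Longrightarrow> x \<otimes> y \<in> carrier A"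
    and mult_assoc: "\<lbrakk>x \<in> carrier A; y \<in> carrier A; z \<in> carrier A\<rbrakk>
          \<Longrightarrow> (x \<otimes> y) \<otimes> z = x \<otimes> (y \<otimes> z)"
    and mult_add_left: "\<lbrakk>x \<in> carrier A; y \<in> carrier A; z \<in> carrier A\<rbrakk>
          \<Longrightarrow> (x \<oplus> y) \<otimes> z = x \<otimes> z \<oplus> y \<otimes> z"
    and mult_add_right: "\<lbrakk>x \<in> carrier A; y \<in> carrier A; z \<in> carrier A\<rbrakk>
          \<Longrightarrow> x \<otimes> (y \<oplus> z) = x \<otimes> y \<oplus> x \<otimes> z"
    and mult_smult_left: "\<lbrakk>x \<in> carrier A; y \<in> carrier A\<rbrakk> \<Longrightarrow> (a \<odot> x) \<otimes> y = a \<odot> (x \<otimes> y)"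
    and mult_smult_right: "\<lbrakk>x \<in> carrier A; y \<in> carrier A\<rbrakk> \<Longrightarrow> x \<otimes> (a \<odot> y) = a \<odot> (x \<otimes> y)"
    and star_closed: "x \<in> carrier A \<Longrightarrow> star A x \<in> carrier A"
    and star_star: "x \<in> carrier A \<Longrightarrow> star A (star A x) = x"
    and star_add: "\<lbrakk>x \<in> carrier A; y \<in> carrier A\<rbrakk> \<Longrightarrow> star A (x \<oplus> y) = star A x \<oplus> star A y"
    and star_smult: "x \<in> carrier A \<Longrightarrow> star A (a \<odot> x) = cnj a \<odot> star A x"
    and star_mult: "\<lbrakk>x \<in> carrier A; y \<in> carrier A\<rbrakk> \<Longrightarrow> star A (x \<otimes> y) = star A y \<otimes> star A x"
    and norm_nonneg: "x \<in> carrier A \<Longrightarrow> 0 \<le> cnorm A x"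
    and norm_eq_zero_iff: "x \<in> carrier A \<Longrightarrow> cnorm A x = 0 \<longleftrightarrow> x = \<zero>"
    and norm_triangle: "\<lbrakk>x \<in> carrier A; y \<in> carrier A\<rbrakk> \<Longrightarrow> cnorm A (x \<oplus> y) \<le> cnorm A x + cnorm A y"
    and norm_smult: "x \<in> carrier A \<Longrightarrow> cnorm A (a \<odot> x) = cmod a * cnorm A x"
    and norm_mult: "\<lbrakk>x \<in> carrier A; y \<in> carrier A\<rbrakk> \<Longrightarrow> cnorm A (x \<otimes> y) \<le> cnorm A x * cnorm A y"
    and cstar_identity: "x \<in> carrier A \<Longrightarrow> cnorm A (star A x \<otimes> x) = (cnorm A x)\<^sup>2"
    and complete: "\<lbrakk>\<And>n. X n \<in> carrier A;
            \<And>e. 0 < e \<Longrightarrow> \<exists>N. \<forall>m\<ge>N. \<forall>n\<ge>N. cnorm A (X m \<ominus> X n) < e\<rbrakk>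
          \<Longrightarrow> \<exists>x \<in> carrier A. (\<lambda>n. cnorm A (X n \<ominus> x)) \<longlonglongrightarrow> 0"

definition star_hom :: "'a cstar \<Rightarrow> 'b cstar \<Rightarrow> ('a \<Rightarrow> 'b) set" where
  "star_hom A C = {\<phi> \<in> carrier A \<rightarrow> carrier C.
     (\<forall>x\<in>carrier A. \<forall>y\<in>carrier A. \<phi> (x \<oplus>\<^bsub>A\<^esub> y) = \<phi> x \<oplus>\<^bsub>C\<^esub> \<phi> y \<and> \<phi> (x \<otimes>\<^bsub>A\<^esub> y) = \<phi> x \<otimes>\<^bsub>C\<^esub> \<phi> y) \<and>
     (\<forall>x\<in>carrier A. \<phi> (star A x) = star C (\<phi> x) \<and> (\<forall>a. \<phi> (a \<odot>\<^bsub>A\<^esub> x) = a \<odot>\<^bsub>C\<^esub> \<phi> x))}"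

definition star_iso :: "'a cstar \<Rightarrow> 'b cstar \<Rightarrow> ('a \<Rightarrow> 'b) set" where
  "star_iso A C = {\<phi> \<in> star_hom A C. bij_betw \<phi> (carrier A) (carrier C)}"

inductive_set lin_span :: "'a cstar \<Rightarrow> 'a set \<Rightarrow> 'a set" for A S where
  zero: "\<zero>\<^bsub>A\<^esub> \<in> lin_span A S"
| step: "\<lbrakk>x \<in> S; y \<in> lin_span A S\<rbrakk> \<Longrightarrow> a \<odot>\<^bsub>A\<^esub> x \<oplus>\<^bsub>A\<^esub> y \<in> lin_span A S"

definition closed_span :: "'a cstar \<Rightarrow> 'a set \<Rightarrow> 'a set" where
  "closed_span A S =
     {x \<in> carrier A. \<forall>e>0. \<exists>y \<in> lin_span A S. cnorm A (x \<ominus>\<^bsub>A\<^esub> y) < e}"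


section \<open>Universal C*-algebras\<close>

text \<open>The free complex *-algebra on a set \<open>X\<close> of generators is spanned by the nonempty words in the
  letters \<open>(x, False)\<close>, standing for the generator \<open>x\<close>, and \<open>(x, True)\<close>, standing for its adjoint.
  It sits inside the unital algebra of all finitely supported complex functions on words, whose
  (convolution) product is the one that \<open>Poly_Mapping\<close> derives from concatenation of words.\<close>

datatype 'x star_word = Word (letters: "('x \<times> bool) list")

instantiation star_word :: (type) monoid_add
begin
definition zero_star_word :: "'a star_word" where "0 = Word []"
definition plus_star_word :: "'a star_word \<Rightarrow> 'a star_word \<Rightarrow> 'a star_word"
  where "u + v = Word (letters u @ letters v)"
instance by standard (simp_all add: zero_star_word_def plus_star_word_def)
end

definition word_star :: "'x star_word \<Rightarrow> 'x star_word" where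
  "word_star w = Word (rev (map (\<lambda>(x, b). (x, \<not> b)) (letters w)))"

type_synonym 'x free_star = "'x star_word \<Rightarrow>\<^sub>0 complex"

definition free_carrier :: "'x set \<Rightarrow> 'x free_star set" where
  "free_carrier X = {f. \<forall>w \<in> Poly_Mapping.keys f. letters w \<noteq> [] \<and> fst ` set (letters w) \<subseteq> X}"

definition free_scale :: "complex \<Rightarrow> 'x free_star \<Rightarrow> 'x free_star" where
  "free_scale a f = Poly_Mapping.map ((*) a) f"

definition free_star :: "'x free_star \<Rightarrow> 'x free_star" where
  "free_star f = Poly_Mapping.map cnj (Poly_Mapping.map_key word_star f)"

definition free_gen :: "'x \<Rightarrow> 'x free_star" where
  "free_gen x = Poly_Mapping.single (Word [(x, False)]) 1"

definition cstar_seminorm :: "'x set \<Rightarrow> ('x free_star \<Rightarrow> real) \<Rightarrow> bool" where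
  "cstar_seminorm X p \<longleftrightarrow>
     (\<forall>f\<in>free_carrier X. 0 \<le> p f \<and> p (free_star f * f) = (p f)\<^sup>2 \<and>
        (\<forall>a. p (free_scale a f) = cmod a * p f)) \<and>
     (\<forall>f\<in>free_carrier X. \<forall>g\<in>free_carrier X. p (f + g) \<le> p f + p g \<and> p (f * g) \<le> p f * p g)"

text \<open>The Hausdorff completion of the free *-algebra in a C*-seminorm \<open>p\<close>: Cauchy sequences modulo
  null sequences.\<close>

definition cauchy_seqs :: "'x set \<Rightarrow> ('x free_star \<Rightarrow> real) \<Rightarrow> (nat \<Rightarrow> 'x free_star) set" where
  "cauchy_seqs X p = {F. (\<forall>n. F n \<in> free_carrier X) \<and>
     (\<forall>e>0. \<exists>N. \<forall>m\<ge>N. \<forall>n\<ge>N. p (F m - F n) < e)}"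

definition null_rel ::
  "'x set \<Rightarrow> ('x free_star \<Rightarrow> real) \<Rightarrow> ((nat \<Rightarrow> 'x free_star) \<times> (nat \<Rightarrow> 'x free_star)) set" where
  "null_rel X p =
     {(F, H). F \<in> cauchy_seqs X p \<and> H \<in> cauchy_seqs X p \<and> (\<lambda>n. p (F n - H n)) \<longlonglongrightarrow> 0}"

definition seq_class :: "'x set \<Rightarrow> ('x free_star \<Rightarrow> real) \<Rightarrow> (nat \<Rightarrow> 'x free_star)
    \<Rightarrow> (nat \<Rightarrow> 'x free_star) set" where
  "seq_class X p F = null_rel X p `` {F}"

definition representative :: "(nat \<Rightarrow> 'x free_star) set \<Rightarrow> nat \<Rightarrow> 'x free_star" where
  "representative u = (SOME F. F \<in> u)"

type_synonym 'x completion = "(nat \<Rightarrow> 'x free_star) set"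

definition completion :: "'x set \<Rightarrow> ('x free_star \<Rightarrow> real) \<Rightarrow> 'x completion cstar" where
  "completion X p =
     \<lparr>carrier = cauchy_seqs X p // null_rel X p,
      mult = (\<lambda>u v. seq_class X p (\<lambda>n. representative u n * representative v n)),
      one = undefined,
      zero = seq_class X p (\<lambda>n. 0),
      add = (\<lambda>u v. seq_class X p (\<lambda>n. representative u n + representative v n)),
      smult = (\<lambda>a u. seq_class X p (\<lambda>n. free_scale a (representative u n))),
      star = (\<lambda>u. seq_class X p (\<lambda>n. free_star (representative u n))),
      cnorm = (\<lambda>u. lim (\<lambda>n. p (representative u n)))\<rparr>"

definition completion_gen :: "'x set \<Rightarrow> ('x free_star \<Rightarrow> real) \<Rightarrow> 'x \<Rightarrow> 'x completion" where
  "completion_gen X p x = seq_class X p (\<lambda>n. free_gen x)"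

text \<open>Let \<open>R A T\<close> express that \<open>T\<close> is a family in the C*-algebra \<open>A\<close>, indexed by \<open>X\<close>, which satisfies
  given relations.  Up to isomorphism, the C*-algebras generated by such families are the completions
  of the free *-algebra on \<open>X\<close> in those C*-seminorms for which the images of the generators
  satisfy \<open>R\<close>; the universal one is the completion in the largest such seminorm.  Phrasing
  this through seminorms avoids quantifying over all C*-algebras on all types (for graph
  algebras the universal property is recovered below).\<close>

definition universal_seminorm ::
  "'x set \<Rightarrow> ('x completion cstar \<Rightarrow> ('x \<Rightarrow> 'x completion) \<Rightarrow> bool) \<Rightarrow> 'x free_star \<Rightarrow> real" where
  "universal_seminorm X R f =
     Sup {p f |p. cstar_seminorm X p \<and> R (completion X p) (completion_gen X p)}"

definition universal_cstar ::
  "'x set \<Rightarrow> ('x completion cstar \<Rightarrow> ('x \<Rightarrow> 'x completion) \<Rightarrow> bool) \<Rightarrow> 'x completion cstar" where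
  "universal_cstar X R = completion X (universal_seminorm X R)"

definition universal_family ::
  "'x set \<Rightarrow> ('x completion cstar \<Rightarrow> ('x \<Rightarrow> 'x completion) \<Rightarrow> bool) \<Rightarrow> 'x \<Rightarrow> 'x completion" where
  "universal_family X R = completion_gen X (universal_seminorm X R)"


section \<open>Higher-rank graphs and twisted graph algebras\<close>

text \<open>Categories are given by their morphisms alone, objects being identified with identity
  morphisms; so \<open>rng\<close> and \<open>src\<close> take values in \<open>morphs\<close>.\<close>

record 'l graph_data =
  morphs :: "'l set"
  rng :: "'l \<Rightarrow> 'l"
  src :: "'l \<Rightarrow> 'l"
  pcomp :: "'l \<Rightarrow> 'l \<Rightarrow> 'l"
  deg :: "'l \<Rightarrow> nat \<Rightarrow> nat"

definition degrees :: "nat \<Rightarrow> (nat \<Rightarrow> nat) set" where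
  "degrees k = {n. \<forall>i\<ge>k. n i = 0}"

locale k_graph =
  fixes k :: nat and \<Lambda> :: "'l graph_data"
  assumes countable_morphs: "countable (morphs \<Lambda>)"
    and rng_closed: "\<xi> \<in> morphs \<Lambda> \<Longrightarrow> rng \<Lambda> \<xi> \<in> morphs \<Lambda>"
    and src_closed: "\<xi> \<in> morphs \<Lambda> \<Longrightarrow> src \<Lambda> \<xi> \<in> morphs \<Lambda>"
    and rng_rng: "\<xi> \<in> morphs \<Lambda> \<Longrightarrow> rng \<Lambda> (rng \<Lambda> \<xi>) = rng \<Lambda> \<xi>"
    and src_rng: "\<xi> \<in> morphs \<Lambda> \<Longrightarrow> src \<Lambda> (rng \<Lambda> \<xi>) = rng \<Lambda> \<xi>"
    and rng_src: "\<xi> \<in> morphs \<Lambda> \<Longrightarrow> rng \<Lambda> (src \<Lambda> \<xi>) = src \<Lambda> \<xi>"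
    and src_src: "\<xi> \<in> morphs \<Lambda> \<Longrightarrow> src \<Lambda> (src \<Lambda> \<xi>) = src \<Lambda> \<xi>"
    and comp_closed: "\<lbrakk>\<xi> \<in> morphs \<Lambda>; \<mu> \<in> morphs \<Lambda>; src \<Lambda> \<xi> = rng \<Lambda> \<mu>\<rbrakk>
          \<Longrightarrow> pcomp \<Lambda> \<xi> \<mu> \<in> morphs \<Lambda>"
    and rng_comp: "\<lbrakk>\<xi> \<in> morphs \<Lambda>; \<mu> \<in> morphs \<Lambda>; src \<Lambda> \<xi> = rng \<Lambda> \<mu>\<rbrakk>
          \<Longrightarrow> rng \<Lambda> (pcomp \<Lambda> \<xi> \<mu>) = rng \<Lambda> \<xi>"
    and src_comp: "\<lbrakk>\<xi> \<in> morphs \<Lambda>; \<mu> \<in> morphs \<Lambda>; src \<Lambda> \<xi> = rng \<Lambda> \<mu>\<rbrakk>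
          \<Longrightarrow> src \<Lambda> (pcomp \<Lambda> \<xi> \<mu>) = src \<Lambda> \<mu>"
    and comp_assoc: "\<lbrakk>\<xi> \<in> morphs \<Lambda>; \<mu> \<in> morphs \<Lambda>; \<nu> \<in> morphs \<Lambda>;
            src \<Lambda> \<xi> = rng \<Lambda> \<mu>; src \<Lambda> \<mu> = rng \<Lambda> \<nu>\<rbrakk>
          \<Longrightarrow> pcomp \<Lambda> (pcomp \<Lambda> \<xi> \<mu>) \<nu> = pcomp \<Lambda> \<xi> (pcomp \<Lambda> \<mu> \<nu>)"
    and comp_rng: "\<xi> \<in> morphs \<Lambda> \<Longrightarrow> pcomp \<Lambda> (rng \<Lambda> \<xi>) \<xi> = \<xi>"
    and comp_src: "\<xi> \<in> morphs \<Lambda> \<Longrightarrow> pcomp \<Lambda> \<xi> (src \<Lambda> \<xi>) = \<xi>"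
    and deg_closed: "\<xi> \<in> morphs \<Lambda> \<Longrightarrow> deg \<Lambda> \<xi> \<in> degrees k"
    and deg_comp: "\<lbrakk>\<xi> \<in> morphs \<Lambda>; \<mu> \<in> morphs \<Lambda>; src \<Lambda> \<xi> = rng \<Lambda> \<mu>\<rbrakk>
          \<Longrightarrow> deg \<Lambda> (pcomp \<Lambda> \<xi> \<mu>) = (\<lambda>i. deg \<Lambda> \<xi> i + deg \<Lambda> \<mu> i)"
    and factorisation: "\<lbrakk>\<xi> \<in> morphs \<Lambda>; m \<in> degrees k; n \<in> degrees k; deg \<Lambda> \<xi> = (\<lambda>i. m i + n i)\<rbrakk>
          \<Longrightarrow> \<exists>!(\<mu>, \<nu>). \<mu> \<in> morphs \<Lambda> \<and> \<nu> \<in> morphs \<Lambda> \<and> src \<Lambda> \<mu> = rng \<Lambda> \<nu> \<and>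
                pcomp \<Lambda> \<mu> \<nu> = \<xi> \<and> deg \<Lambda> \<mu> = m \<and> deg \<Lambda> \<nu> = n"

definition paths :: "'l graph_data \<Rightarrow> (nat \<Rightarrow> nat) \<Rightarrow> 'l set" where
  "paths \<Lambda> n = {\<xi> \<in> morphs \<Lambda>. deg \<Lambda> \<xi> = n}"

definition vertices :: "'l graph_data \<Rightarrow> 'l set" where
  "vertices \<Lambda> = paths \<Lambda> (\<lambda>_. 0)"

definition paths_from :: "'l graph_data \<Rightarrow> 'l \<Rightarrow> (nat \<Rightarrow> nat) \<Rightarrow> 'l set" where
  "paths_from \<Lambda> v n = {\<xi> \<in> paths \<Lambda> n. rng \<Lambda> \<xi> = v}"

definition row_finite_no_sources :: "nat \<Rightarrow> 'l graph_data \<Rightarrow> bool" where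
  "row_finite_no_sources k \<Lambda> \<longleftrightarrow>
     (\<forall>v \<in> vertices \<Lambda>. \<forall>n \<in> degrees k. finite (paths_from \<Lambda> v n) \<and> paths_from \<Lambda> v n \<noteq> {})"

definition graph_functor :: "'l graph_data \<Rightarrow> ('g, 'm) monoid_scheme \<Rightarrow> ('l \<Rightarrow> 'g) \<Rightarrow> bool" where
  "graph_functor \<Lambda> G \<eta> \<longleftrightarrow> \<eta> \<in> morphs \<Lambda> \<rightarrow> carrier G \<and>
     (\<forall>\<xi>\<in>morphs \<Lambda>. \<forall>\<mu>\<in>morphs \<Lambda>. src \<Lambda> \<xi> = rng \<Lambda> \<mu> \<longrightarrow> \<eta> (pcomp \<Lambda> \<xi> \<mu>) = \<eta> \<xi> \<otimes>\<^bsub>G\<^esub> \<eta> \<mu>) \<and>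
     (\<forall>v\<in>vertices \<Lambda>. \<eta> v = \<one>\<^bsub>G\<^esub>)"

definition categorical_2_cocycle :: "'l graph_data \<Rightarrow> ('l \<Rightarrow> 'l \<Rightarrow> complex) \<Rightarrow> bool" where
  "categorical_2_cocycle \<Lambda> c \<longleftrightarrow>
     (\<forall>\<xi>\<in>morphs \<Lambda>. \<forall>\<mu>\<in>morphs \<Lambda>. src \<Lambda> \<xi> = rng \<Lambda> \<mu> \<longrightarrow> cmod (c \<xi> \<mu>) = 1) \<and>
     (\<forall>\<xi>\<in>morphs \<Lambda>. \<forall>\<mu>\<in>morphs \<Lambda>. \<forall>\<nu>\<in>morphs \<Lambda>. src \<Lambda> \<xi> = rng \<Lambda> \<mu> \<longrightarrow> src \<Lambda> \<mu> = rng \<Lambda> \<nu> \<longrightarrow>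
        c \<xi> \<mu> * c (pcomp \<Lambda> \<xi> \<mu>) \<nu> = c \<mu> \<nu> * c \<xi> (pcomp \<Lambda> \<mu> \<nu>)) \<and>
     (\<forall>\<xi>\<in>morphs \<Lambda>. c \<xi> (src \<Lambda> \<xi>) = 1 \<and> c (rng \<Lambda> \<xi>) \<xi> = 1)"

definition cuntz_krieger_family ::
  "nat \<Rightarrow> 'l graph_data \<Rightarrow> ('l \<Rightarrow> 'l \<Rightarrow> complex) \<Rightarrow> 'a cstar \<Rightarrow> ('l \<Rightarrow> 'a) \<Rightarrow> bool" where
  "cuntz_krieger_family k \<Lambda> c A T \<longleftrightarrow> cstar_algebra A \<and> T \<in> morphs \<Lambda> \<rightarrow> carrier A \<and>
     (\<forall>v\<in>vertices \<Lambda>. star A (T v) = T v \<and> T v \<otimes>\<^bsub>A\<^esub> T v = T v) \<and>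
     (\<forall>v\<in>vertices \<Lambda>. \<forall>w\<in>vertices \<Lambda>. v \<noteq> w \<longrightarrow> T v \<otimes>\<^bsub>A\<^esub> T w = \<zero>\<^bsub>A\<^esub>) \<and>
     (\<forall>\<xi>\<in>morphs \<Lambda>. \<forall>\<mu>\<in>morphs \<Lambda>. src \<Lambda> \<xi> = rng \<Lambda> \<mu> \<longrightarrow>
        T \<xi> \<otimes>\<^bsub>A\<^esub> T \<mu> = c \<xi> \<mu> \<odot>\<^bsub>A\<^esub> T (pcomp \<Lambda> \<xi> \<mu>)) \<and>
     (\<forall>\<xi>\<in>morphs \<Lambda>. star A (T \<xi>) \<otimes>\<^bsub>A\<^esub> T \<xi> = T (src \<Lambda> \<xi>)) \<and>
     (\<forall>v\<in>vertices \<Lambda>. \<forall>n\<in>degrees k.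
        T v = (\<Oplus>\<^bsub>A\<^esub>\<xi>\<in>paths_from \<Lambda> v n. T \<xi> \<otimes>\<^bsub>A\<^esub> star A (T \<xi>)))"

definition twisted_graph_cstar ::
  "nat \<Rightarrow> 'l graph_data \<Rightarrow> ('l \<Rightarrow> 'l \<Rightarrow> complex) \<Rightarrow> 'l completion cstar" where
  "twisted_graph_cstar k \<Lambda> c = universal_cstar (morphs \<Lambda>) (cuntz_krieger_family k \<Lambda> c)"

definition twisted_graph_family ::
  "nat \<Rightarrow> 'l graph_data \<Rightarrow> ('l \<Rightarrow> 'l \<Rightarrow> complex) \<Rightarrow> 'l \<Rightarrow> 'l completion" where
  "twisted_graph_family k \<Lambda> c = universal_family (morphs \<Lambda>) (cuntz_krieger_family k \<Lambda> c)"

abbreviation graph_cstar :: "nat \<Rightarrow> 'l graph_data \<Rightarrow> 'l completion cstar" where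
  "graph_cstar k \<Lambda> \<equiv> twisted_graph_cstar k \<Lambda> (\<lambda>_ _. 1)"

abbreviation graph_family :: "nat \<Rightarrow> 'l graph_data \<Rightarrow> 'l \<Rightarrow> 'l completion" where
  "graph_family k \<Lambda> \<equiv> twisted_graph_family k \<Lambda> (\<lambda>_ _. 1)"


section \<open>Fell bundles\<close>

record ('g, 'b) bundle_data =
  btotal :: "'b set"
  bproj :: "'b \<Rightarrow> 'g"
  badd :: "'b \<Rightarrow> 'b \<Rightarrow> 'b"
  bzero :: "'g \<Rightarrow> 'b"
  bscale :: "complex \<Rightarrow> 'b \<Rightarrow> 'b"
  bmult :: "'b \<Rightarrow> 'b \<Rightarrow> 'b"
  bstar :: "'b \<Rightarrow> 'b"
  bnorm :: "'b \<Rightarrow> real"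

definition fibre :: "('g, 'b) bundle_data \<Rightarrow> 'g \<Rightarrow> 'b set" where
  "fibre B g = {b \<in> btotal B. bproj B b = g}"

text \<open>The fibre over \<open>g\<close> with its structure as an additive group and complex vector space
  (the ring multiplication of the record is irrelevant).\<close>

definition fibre_module :: "('g, 'b) bundle_data \<Rightarrow> 'g \<Rightarrow> (complex, 'b) module" where
  "fibre_module B g = \<lparr>carrier = fibre B g, mult = undefined, one = undefined,
     zero = bzero B g, add = badd B, smult = bscale B\<rparr>"

locale fell_bundle = group G for G :: "('g, 'm) monoid_scheme" (structure) +
  fixes B :: "('g, 'b) bundle_data"
  assumes proj_closed: "b \<in> btotal B \<Longrightarrow> bproj B b \<in> carrier G"
    and fibre_vector_space: "g \<in> carrier G \<Longrightarrow> Module.module complex_ring (fibre_module B g)"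
    and fibre_norm_nonneg: "b \<in> btotal B \<Longrightarrow> 0 \<le> bnorm B b"
    and fibre_norm_zero: "b \<in> fibre B g \<Longrightarrow> bnorm B b = 0 \<longleftrightarrow> b = bzero B g"
    and fibre_norm_triangle: "\<lbrakk>b \<in> fibre B g; c \<in> fibre B g\<rbrakk>
          \<Longrightarrow> bnorm B (badd B b c) \<le> bnorm B b + bnorm B c"
    and fibre_norm_scale: "b \<in> btotal B \<Longrightarrow> bnorm B (bscale B a b) = cmod a * bnorm B b"
    and fibre_complete: "\<lbrakk>g \<in> carrier G; \<And>n. X n \<in> fibre B g;
            \<And>e. 0 < e \<Longrightarrow> \<exists>N. \<forall>m\<ge>N. \<forall>n\<ge>N. bnorm B (X m \<ominus>\<^bsub>fibre_module B g\<^esub> X n) < e\<rbrakk>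
          \<Longrightarrow> \<exists>x \<in> fibre B g. (\<lambda>n. bnorm B (X n \<ominus>\<^bsub>fibre_module B g\<^esub> x)) \<longlonglongrightarrow> 0"
    and bmult_closed: "\<lbrakk>b \<in> btotal B; c \<in> btotal B\<rbrakk> \<Longrightarrow> bmult B b c \<in> fibre B (bproj B b \<otimes> bproj B c)"
    and bmult_assoc: "\<lbrakk>b \<in> btotal B; c \<in> btotal B; d \<in> btotal B\<rbrakk>
          \<Longrightarrow> bmult B (bmult B b c) d = bmult B b (bmult B c d)"
    and bmult_add_left: "\<lbrakk>b \<in> fibre B g; c \<in> fibre B g; d \<in> btotal B\<rbrakk>
          \<Longrightarrow> bmult B (badd B b c) d = badd B (bmult B b d) (bmult B c d)"
    and bmult_add_right: "\<lbrakk>b \<in> btotal B; c \<in> fibre B g; d \<in> fibre B g\<rbrakk>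
          \<Longrightarrow> bmult B b (badd B c d) = badd B (bmult B b c) (bmult B b d)"
    and bmult_scale_left: "\<lbrakk>b \<in> btotal B; c \<in> btotal B\<rbrakk>
          \<Longrightarrow> bmult B (bscale B a b) c = bscale B a (bmult B b c)"
    and bmult_scale_right: "\<lbrakk>b \<in> btotal B; c \<in> btotal B\<rbrakk>
          \<Longrightarrow> bmult B b (bscale B a c) = bscale B a (bmult B b c)"
    and bnorm_mult: "\<lbrakk>b \<in> btotal B; c \<in> btotal B\<rbrakk> \<Longrightarrow> bnorm B (bmult B b c) \<le> bnorm B b * bnorm B c"
    and bstar_closed: "b \<in> btotal B \<Longrightarrow> bstar B b \<in> fibre B (inv (bproj B b))"
    and bstar_bstar: "b \<in> btotal B \<Longrightarrow> bstar B (bstar B b) = b"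
    and bstar_add: "\<lbrakk>b \<in> fibre B g; c \<in> fibre B g\<rbrakk>
          \<Longrightarrow> bstar B (badd B b c) = badd B (bstar B b) (bstar B c)"
    and bstar_scale: "b \<in> btotal B \<Longrightarrow> bstar B (bscale B a b) = bscale B (cnj a) (bstar B b)"
    and bstar_mult: "\<lbrakk>b \<in> btotal B; c \<in> btotal B\<rbrakk>
          \<Longrightarrow> bstar B (bmult B b c) = bmult B (bstar B c) (bstar B b)"
    and bnorm_bstar_mult: "b \<in> btotal B \<Longrightarrow> bnorm B (bmult B (bstar B b) b) = (bnorm B b)\<^sup>2"
    and bstar_mult_positive: "b \<in> btotal B
          \<Longrightarrow> \<exists>a \<in> fibre B \<one>. bmult B (bstar B b) b = bmult B (bstar B a) a"

definition two_cocycles :: "('g, 'm) monoid_scheme \<Rightarrow> ('g \<Rightarrow> 'g \<Rightarrow> complex) set" where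
  "two_cocycles G = {\<sigma>.
     (\<forall>g\<in>carrier G. \<forall>h\<in>carrier G. cmod (\<sigma> g h) = 1) \<and>
     (\<forall>g\<in>carrier G. \<sigma> \<one>\<^bsub>G\<^esub> g = 1 \<and> \<sigma> g \<one>\<^bsub>G\<^esub> = 1) \<and>
     (\<forall>g\<in>carrier G. \<forall>h\<in>carrier G. \<forall>k\<in>carrier G.
        \<sigma> g h * \<sigma> (g \<otimes>\<^bsub>G\<^esub> h) k = \<sigma> g (h \<otimes>\<^bsub>G\<^esub> k) * \<sigma> h k)}"

definition deform ::
  "('g, 'm) monoid_scheme \<Rightarrow> ('g, 'b) bundle_data \<Rightarrow> ('g \<Rightarrow> 'g \<Rightarrow> complex) \<Rightarrow> ('g, 'b) bundle_data" where
  "deform G B \<sigma> = B\<lparr>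
     bmult := (\<lambda>b c. bscale B (\<sigma> (bproj B b) (bproj B c)) (bmult B b c)),
     bstar := (\<lambda>b. bscale B (cnj (\<sigma> (bproj B b) (inv\<^bsub>G\<^esub> (bproj B b)))) (bstar B b))\<rparr>"

text \<open>The maps \<open>\<pi>\<^sub>g\<close> of a representation are the restrictions of \<open>\<pi>\<close> to the fibres.\<close>

definition bundle_representation ::
  "('g, 'm) monoid_scheme \<Rightarrow> ('g, 'b) bundle_data \<Rightarrow> 'c cstar \<Rightarrow> ('b \<Rightarrow> 'c) \<Rightarrow> bool" where
  "bundle_representation G B C \<pi> \<longleftrightarrow> cstar_algebra C \<and> \<pi> \<in> btotal B \<rightarrow> carrier C \<and>
     (\<forall>g\<in>carrier G. \<forall>b\<in>fibre B g. \<forall>c\<in>fibre B g. \<pi> (badd B b c) = \<pi> b \<oplus>\<^bsub>C\<^esub> \<pi> c) \<and>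
     (\<forall>b\<in>btotal B. \<forall>a. \<pi> (bscale B a b) = a \<odot>\<^bsub>C\<^esub> \<pi> b) \<and>
     (\<forall>b\<in>btotal B. \<forall>c\<in>btotal B. \<pi> (bmult B b c) = \<pi> b \<otimes>\<^bsub>C\<^esub> \<pi> c) \<and>
     (\<forall>b\<in>btotal B. star C (\<pi> b) = \<pi> (bstar B b)) \<and>
     closed_span C {\<pi> b \<otimes>\<^bsub>C\<^esub> x |b x. b \<in> fibre B \<one>\<^bsub>G\<^esub> \<and> x \<in> carrier C} = carrier C"

definition bundle_cstar :: "('g, 'm) monoid_scheme \<Rightarrow> ('g, 'b) bundle_data \<Rightarrow> 'b completion cstar" where
  "bundle_cstar G B = universal_cstar (btotal B) (bundle_representation G B)"

definition bundle_canonical ::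
  "('g, 'm) monoid_scheme \<Rightarrow> ('g, 'b) bundle_data \<Rightarrow> 'b \<Rightarrow> 'b completion" where
  "bundle_canonical G B = universal_family (btotal B) (bundle_representation G B)"


section \<open>The Fell bundle of a functor and the induced cocycle\<close>

definition graph_fibre ::
  "nat \<Rightarrow> 'l graph_data \<Rightarrow> ('g, 'm) monoid_scheme \<Rightarrow> ('l \<Rightarrow> 'g) \<Rightarrow> 'g \<Rightarrow> 'l completion set" where
  "graph_fibre k \<Lambda> G \<eta> g = closed_span (graph_cstar k \<Lambda>)
     {graph_family k \<Lambda> \<xi> \<otimes>\<^bsub>graph_cstar k \<Lambda>\<^esub> star (graph_cstar k \<Lambda>) (graph_family k \<Lambda> \<mu>) |\<xi> \<mu>.
        \<xi> \<in> morphs \<Lambda> \<and> \<mu> \<in> morphs \<Lambda> \<and> \<eta> \<xi> \<otimes>\<^bsub>G\<^esub> inv\<^bsub>G\<^esub> (\<eta> \<mu>) = g}"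

text \<open>As subspaces of the graph algebra the fibres all contain 0, so the total space is their
  disjoint union.\<close>

definition graph_bundle ::
  "nat \<Rightarrow> 'l graph_data \<Rightarrow> ('g, 'm) monoid_scheme \<Rightarrow> ('l \<Rightarrow> 'g) \<Rightarrow> ('g, 'g \<times> 'l completion) bundle_data" where
  "graph_bundle k \<Lambda> G \<eta> =
     (let A = graph_cstar k \<Lambda> in
      \<lparr>btotal = Sigma (carrier G) (graph_fibre k \<Lambda> G \<eta>),
       bproj = fst,
       badd = (\<lambda>(g, b) (h, c). (g, b \<oplus>\<^bsub>A\<^esub> c)),
       bzero = (\<lambda>g. (g, \<zero>\<^bsub>A\<^esub>)),
       bscale = (\<lambda>a (g, b). (g, a \<odot>\<^bsub>A\<^esub> b)),
       bmult = (\<lambda>(g, b) (h, c). (g \<otimes>\<^bsub>G\<^esub> h, b \<otimes>\<^bsub>A\<^esub> c)),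
       bstar = (\<lambda>(g, b). (inv\<^bsub>G\<^esub> g, star A b)),
       bnorm = (\<lambda>(g, b). cnorm A b)\<rparr>)"

definition functor_cocycle :: "('g \<Rightarrow> 'g \<Rightarrow> complex) \<Rightarrow> ('l \<Rightarrow> 'g) \<Rightarrow> 'l \<Rightarrow> 'l \<Rightarrow> complex" where
  "functor_cocycle \<sigma> \<eta> \<xi> \<mu> = \<sigma> (\<eta> \<xi>) (\<eta> \<mu>)"


section \<open>The universal property\<close>

text \<open>The remaining sections justify the definitions above.  The completion in any C*-seminorm is a
  C*-algebra (\<open>completion_cstar\<close>) generated by the images of the generators
  (\<open>completion_generated\<close>); \<open>twisted_graph_family\<close> is a Cuntz--Krieger family
  (\<open>twisted_graph_family_ck\<close>), and it is universal among Cuntz--Krieger families in C*-algebras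
  on arbitrary types (\<open>twisted_graph_cstar_universal\<close>).\<close>

lemma inj_word_star: "inj word_star"
proof -
  have "word_star (word_star w) = w" for w :: "'a star_word"
    by (cases w) (simp add: word_star_def rev_map o_def case_prod_unfold)
  thus ?thesis by (metis injI)
qed

lemma word_star_word_star [simp]: "word_star (word_star w) = w"
  by (cases w) (simp add: word_star_def rev_map o_def case_prod_unfold)

lemma word_star_plus: "word_star (u + v) = word_star v + word_star u"
  by (simp add: word_star_def plus_star_word_def)

lemma lookup_free_star: "Poly_Mapping.lookup (free_star f) w = cnj (Poly_Mapping.lookup f (word_star w))"
  by (simp add: free_star_def Poly_Mapping.map.rep_eq map_key.rep_eq inj_word_star when_def)

lemma lookup_free_scale: "Poly_Mapping.lookup (free_scale a f) w = a * Poly_Mapping.lookup f w"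
  by (simp add: free_scale_def Poly_Mapping.map.rep_eq when_def)

lemma free_scale_conv: "free_scale a f = Poly_Mapping.single 0 a * f"
  by (simp add: free_scale_def mult_map_scale_conv_mult)

lemma free_scale_mult_left: "free_scale a f * g = free_scale a (f * g)"
  by (simp add: free_scale_conv mult.assoc)

lemma free_scale_add: "free_scale a (f + g) = free_scale a f + free_scale a g"
  by (simp add: free_scale_conv distrib_left)

lemma free_scale_diff: "free_scale a (f - g) = free_scale a f - free_scale a g"
  by (rule poly_mapping_eqI) (simp add: lookup_free_scale lookup_minus right_diff_distrib)

lemma free_scale_minus1: "free_scale (-1) g = - g"
  by (rule poly_mapping_eqI) (simp add: lookup_free_scale)

lemma free_scale_0: "free_scale 0 g = 0"
  by (rule poly_mapping_eqI) (simp add: lookup_free_scale)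

lemma free_scale_one: "free_scale 1 g = g"
  by (rule poly_mapping_eqI) (simp add: lookup_free_scale)

lemma free_scale_scale: "free_scale a (free_scale b g) = free_scale (a*b) g"
  by (rule poly_mapping_eqI) (simp add: lookup_free_scale)

lemma free_scale_add_left: "free_scale (a + b) g = free_scale a g + free_scale b g"
  by (rule poly_mapping_eqI) (simp add: lookup_free_scale lookup_add distrib_right)

lemma free_star_add: "free_star (f + g) = free_star f + free_star g"
  by (rule poly_mapping_eqI) (simp add: lookup_free_star lookup_add)

lemma free_star_diff: "free_star (f - g) = free_star f - free_star g"
  by (rule poly_mapping_eqI) (simp add: lookup_free_star lookup_minus)

lemma free_star_0: "free_star 0 = 0"
  by (rule poly_mapping_eqI) (simp add: lookup_free_star)

lemma free_star_free_star: "free_star (free_star f) = f"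
  by (rule poly_mapping_eqI) (simp add: lookup_free_star)

lemma free_star_scale: "free_star (free_scale a f) = free_scale (cnj a) (free_star f)"
  by (rule poly_mapping_eqI) (simp add: lookup_free_star lookup_free_scale)

lemma word_star_eq_iff: "word_star u = w \<longleftrightarrow> u = word_star w"
  by (metis word_star_word_star)

lemma free_star_single: "free_star (Poly_Mapping.single w a) = Poly_Mapping.single (word_star w) (cnj a)"
  by (rule poly_mapping_eqI) (auto simp: lookup_free_star lookup_single when_def word_star_eq_iff)

lemma poly_mapping_single_induct:
  fixes f :: "'a \<Rightarrow>\<^sub>0 complex"
  assumes "P 0" "\<And>w a f. P f \<Longrightarrow> P (Poly_Mapping.single w a + f)"
  shows "P f"
proof -
  have "f = (\<Sum>w\<in>Poly_Mapping.keys f. Poly_Mapping.single w (Poly_Mapping.lookup f w))"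
    by (rule poly_mapping_eqI)
       (auto simp: lookup_sum lookup_single when_def in_keys_iff sum.delta' if_distrib cong: if_cong)
  moreover have "finite A \<Longrightarrow> P (\<Sum>w\<in>A. Poly_Mapping.single w (Poly_Mapping.lookup f w))" for A
    by (induction A rule: finite_induct) (auto intro: assms)
  ultimately show ?thesis by (metis finite_keys)
qed

lemma free_star_mult_single: "free_star (Poly_Mapping.single w a * g) = free_star g * free_star (Poly_Mapping.single w a)"
proof (induction g rule: poly_mapping_single_induct)
  case 1 show ?case by (simp add: free_star_0)
next
  case (2 v b g) thus ?case
    by (simp add: distrib_left distrib_right free_star_add free_star_single mult_single word_star_plus mult.commute)
qed

lemma free_star_mult: "free_star (f * g) = free_star g * free_star f"
proof (induction f rule: poly_mapping_single_induct)
  case 1 show ?case by (simp add: free_star_0)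
next
  case (2 w a f) thus ?case
    by (simp add: distrib_left distrib_right free_star_add free_star_mult_single)
qed

lemma free_scale_mult_right: "f * free_scale a g = free_scale a (f * g)"
proof (induction f rule: poly_mapping_single_induct)
  case 1 show ?case by (simp add: free_scale_conv)
next
  case (2 w b f)
  have "Poly_Mapping.single w b * (Poly_Mapping.single 0 a * g) = Poly_Mapping.single 0 a * (Poly_Mapping.single w b * g)"
    by (simp add: mult.assoc[symmetric] mult_single mult.commute)
  thus ?case using 2 by (simp add: distrib_left distrib_right free_scale_conv)
qed

lemma free_carrier_0: "0 \<in> free_carrier X" by (simp add: free_carrier_def)

lemma free_carrier_add: "f \<in> free_carrier X \<Longrightarrow> g \<in> free_carrier X \<Longrightarrow> f + g \<in> free_carrier X"
  unfolding free_carrier_def using Poly_Mapping.keys_add[of f g] by blast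

lemma free_carrier_scale: "f \<in> free_carrier X \<Longrightarrow> free_scale a f \<in> free_carrier X"
  by (auto simp: free_carrier_def in_keys_iff lookup_free_scale)

lemma free_carrier_diff: "f \<in> free_carrier X \<Longrightarrow> g \<in> free_carrier X \<Longrightarrow> f - g \<in> free_carrier X"
  using free_carrier_add[OF _ free_carrier_scale[of g X "-1"]] by (simp add: free_scale_minus1)

lemma free_carrier_mult: "f \<in> free_carrier X \<Longrightarrow> g \<in> free_carrier X \<Longrightarrow> f * g \<in> free_carrier X"
  unfolding free_carrier_def using keys_mult[of f g]
  by (fastforce simp: plus_star_word_def)

lemma letters_word_star: "fst ` set (letters (word_star w)) = fst ` set (letters w)"
  by (simp add: word_star_def image_image case_prod_unfold)

lemma letters_word_star_Nil: "letters (word_star w) = [] \<longleftrightarrow> letters w = []"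
  by (simp add: word_star_def)

lemma free_carrier_star:
  assumes "f \<in> free_carrier X" shows "free_star f \<in> free_carrier X"
  unfolding free_carrier_def
proof (intro CollectI ballI)
  fix w assume "w \<in> Poly_Mapping.keys (free_star f)"
  hence "word_star w \<in> Poly_Mapping.keys f" by (simp add: in_keys_iff lookup_free_star)
  hence "letters (word_star w) \<noteq> [] \<and> fst ` set (letters (word_star w)) \<subseteq> X"
    using assms by (auto simp: free_carrier_def)
  thus "letters w \<noteq> [] \<and> fst ` set (letters w) \<subseteq> X"
    by (simp add: letters_word_star letters_word_star_Nil)
qed

locale free_seminorm = fixes X :: "'x set" and p assumes p: "cstar_seminorm X p"
begin
abbreviation "F0 \<equiv> free_carrier X"
lemmas cl = free_carrier_0 free_carrier_add free_carrier_diff free_carrier_mult free_carrier_star free_carrier_scale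
declare cl[simp]
lemma nn: "f \<in> F0 \<Longrightarrow> 0 \<le> p f" using p by (simp add: cstar_seminorm_def)
lemma ps: "f \<in> F0 \<Longrightarrow> p (free_scale a f) = cmod a * p f" using p by (simp add: cstar_seminorm_def)
lemma pc: "f \<in> F0 \<Longrightarrow> p (free_star f * f) = (p f)\<^sup>2" using p by (simp add: cstar_seminorm_def)
lemma pt: "f \<in> F0 \<Longrightarrow> g \<in> F0 \<Longrightarrow> p (f + g) \<le> p f + p g" using p by (simp add: cstar_seminorm_def)
lemma pm: "f \<in> F0 \<Longrightarrow> g \<in> F0 \<Longrightarrow> p (f * g) \<le> p f * p g" using p by (simp add: cstar_seminorm_def)
lemma p0: "p 0 = 0" using ps[of 0 0] by (simp add: free_scale_0)
lemma pneg: "f \<in> F0 \<Longrightarrow> p (- f) = p f" using ps[of f "-1"] by (simp add: free_scale_minus1)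
lemma psym: "f \<in> F0 \<Longrightarrow> g \<in> F0 \<Longrightarrow> p (f - g) = p (g - f)" using pneg[of "f-g"] by simp
lemma ptd: "f \<in> F0 \<Longrightarrow> g \<in> F0 \<Longrightarrow> h \<in> F0 \<Longrightarrow> p (f - h) \<le> p (f - g) + p (g - h)"
  using pt[of "f-g" "g-h"] by simp
lemma prev: "f \<in> F0 \<Longrightarrow> g \<in> F0 \<Longrightarrow> \<bar>p f - p g\<bar> \<le> p (f - g)"
  using pt[of "f-g" g] pt[of "g-f" f] psym[of f g] by simp
lemma pstar: assumes f: "f \<in> F0" shows "p (free_star f) = p f"
proof -
  have *: "p f \<le> p (free_star f)" if "f \<in> F0" for f
  proof (cases "p f = 0")
    case True thus ?thesis using nn that by simp
  next
    case False hence "p f > 0" using nn that by force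
    moreover have "p f * p f \<le> p (free_star f) * p f" using pc[of f] pm[of "free_star f" f] that
      by (simp add: power2_eq_square)
    ultimately show ?thesis by simp
  qed
  show ?thesis using *[OF f] *[of "free_star f"] f by (simp add: free_star_free_star)
qed

abbreviation "CS \<equiv> cauchy_seqs X p"
abbreviation "cls \<equiv> seq_class X p"
abbreviation "C \<equiv> completion X p"
abbreviation "nr F H \<equiv> (\<lambda>n. p (F n - H n)) \<longlonglongrightarrow> 0"

lemma CSD: "F \<in> CS \<Longrightarrow> F n \<in> F0" by (simp add: cauchy_seqs_def)
lemma CSC: "F \<in> CS \<Longrightarrow> e > 0 \<Longrightarrow> \<exists>N. \<forall>m\<ge>N. \<forall>n\<ge>N. p (F m - F n) < e" by (simp add: cauchy_seqs_def)

lemma CS_conv: assumes F: "F \<in> CS" shows "Cauchy (\<lambda>n. p (F n))"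
  unfolding Cauchy_def dist_real_def using CSC[OF F] prev[OF CSD[OF F] CSD[OF F]] by (meson le_less_trans)

lemma CS_lim: assumes F: "F \<in> CS" shows "(\<lambda>n. p (F n)) \<longlonglongrightarrow> lim (\<lambda>n. p (F n))"
  using CS_conv[OF F] by (simp add: Cauchy_convergent convergent_LIMSEQ_iff[symmetric])

lemma CS_bdd: assumes F: "F \<in> CS" shows "\<exists>M>0. \<forall>n. p (F n) \<le> M"
proof -
  obtain M where "M > 0" "\<And>n. norm (p (F n)) \<le> M" using Cauchy_Bseq[OF CS_conv[OF F]] unfolding Bseq_def by blast
  thus ?thesis by (auto simp: abs_le_iff)
qed

lemma CSI: "(\<And>n. F n \<in> F0) \<Longrightarrow> (\<And>e. e > 0 \<Longrightarrow> \<exists>N. \<forall>m\<ge>N. \<forall>n\<ge>N. p (F m - F n) < e) \<Longrightarrow> F \<in> CS"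
  by (simp add: cauchy_seqs_def)

lemma CS_const: "f \<in> F0 \<Longrightarrow> (\<lambda>n. f) \<in> CS" by (rule CSI) (simp_all add: p0)

lemma CS_add: assumes "F \<in> CS" "H \<in> CS" shows "(\<lambda>n. F n + H n) \<in> CS"
proof (rule CSI)
  fix e :: real assume "e > 0"
  then obtain N M where N: "\<forall>m\<ge>N. \<forall>n\<ge>N. p (F m - F n) < e/2" and M: "\<forall>m\<ge>M. \<forall>n\<ge>M. p (H m - H n) < e/2"
    using CSC[OF assms(1), of "e/2"] CSC[OF assms(2), of "e/2"] by auto
  have "p (F m + H m - (F n + H n)) < e" if "m \<ge> max N M" "n \<ge> max N M" for m n
    using pt[of "F m - F n" "H m - H n"] N M that assms[THEN CSD] by (simp add: algebra_simps) (smt (verit) field_sum_of_halves)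
  thus "\<exists>N. \<forall>m\<ge>N. \<forall>n\<ge>N. p (F m + H m - (F n + H n)) < e" by blast
qed (use assms[THEN CSD] in simp)

lemma CS_scale: assumes "F \<in> CS" shows "(\<lambda>n. free_scale a (F n)) \<in> CS"
proof (rule CSI)
  fix e :: real assume "e > 0"
  hence "e / (cmod a + 1) > 0" by (simp add: add_nonneg_pos)
  then obtain N where N: "\<forall>m\<ge>N. \<forall>n\<ge>N. p (F m - F n) < e / (cmod a + 1)" using CSC[OF assms] by blast
  have "p (free_scale a (F m) - free_scale a (F n)) < e" if "m\<ge>N" "n\<ge>N" for m n
  proof -
    have "p (free_scale a (F m) - free_scale a (F n)) = cmod a * p (F m - F n)"
      using ps[of "F m - F n" a] CSD[OF assms] by (simp add: free_scale_diff)
    also have "\<dots> \<le> (cmod a + 1) * p (F m - F n)" using nn CSD[OF assms] by (simp add: mult_right_mono)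
    also have "\<dots> < e" using N that by (simp add: pos_less_divide_eq add_nonneg_pos mult.commute)
    finally show ?thesis .
  qed
  thus "\<exists>N. \<forall>m\<ge>N. \<forall>n\<ge>N. p (free_scale a (F m) - free_scale a (F n)) < e" by blast
qed (use assms[THEN CSD] in simp)

lemma CS_star: assumes "F \<in> CS" shows "(\<lambda>n. free_star (F n)) \<in> CS"
  using CSC[OF assms] pstar CSD[OF assms] by (intro CSI) (simp_all flip: free_star_diff)

lemma mult_est: assumes "f \<in> F0" "f' \<in> F0" "g \<in> F0" "g' \<in> F0"
  shows "p (f * g - f' * g') \<le> p (f - f') * p g + p f' * p (g - g')"
proof -
  have "f * g - f' * g' = (f - f') * g + f' * (g - g')" by (simp add: algebra_simps)
  thus ?thesis using pt[of "(f - f') * g" "f' * (g - g')"] pm[of "f-f'" g] pm[of f' "g-g'"] assms by simp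
qed

lemma CS_mult: assumes "F \<in> CS" "H \<in> CS" shows "(\<lambda>n. F n * H n) \<in> CS"
proof (rule CSI)
  fix e :: real assume e: "e > 0"
  obtain A where A: "A > 0" "\<And>n. p (F n) \<le> A" using CS_bdd[OF assms(1)] by blast
  obtain B where B: "B > 0" "\<And>n. p (H n) \<le> B" using CS_bdd[OF assms(2)] by blast
  have "e/(2*B) > 0" "e/(2*A) > 0" using A B e by simp_all
  then obtain N M where N: "\<forall>m\<ge>N. \<forall>n\<ge>N. p (F m - F n) < e/(2*B)" and M: "\<forall>m\<ge>M. \<forall>n\<ge>M. p (H m - H n) < e/(2*A)"
    using CSC[OF assms(1)] CSC[OF assms(2)] by meson
  have "p (F m * H m - (F n * H n)) < e" if "m \<ge> max N M" "n \<ge> max N M" for m n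
  proof -
    have "p (F m * H m - (F n * H n)) \<le> p (F m - F n) * p (H m) + p (F n) * p (H m - H n)"
      using mult_est assms[THEN CSD] by simp
    also have "\<dots> \<le> p (F m - F n) * B + A * p (H m - H n)"
      using A B nn assms[THEN CSD] by (intro add_mono mult_left_mono mult_right_mono) auto
    also have "\<dots> < e/(2*B) * B + A * (e/(2*A))"
      using N M that A B by (intro add_strict_mono mult_strict_right_mono mult_strict_left_mono) auto
    also have "\<dots> = e" using A B by (simp add: field_simps)
    finally show ?thesis .
  qed
  thus "\<exists>N. \<forall>m\<ge>N. \<forall>n\<ge>N. p (F m * H m - (F n * H n)) < e" by blast
qed (use assms[THEN CSD] in simp)

lemma nr_sym: "F \<in> CS \<Longrightarrow> H \<in> CS \<Longrightarrow> nr F H \<Longrightarrow> nr H F"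
  using psym CSD by (simp)

lemma nr_trans: assumes "F \<in> CS" "H \<in> CS" "K \<in> CS" "nr F H" "nr H K" shows "nr F K"
proof (rule tendsto_sandwich[OF _ _ tendsto_const])
  show "(\<lambda>n. p (F n - H n) + p (H n - K n)) \<longlonglongrightarrow> 0" using tendsto_add[OF assms(4,5)] by simp
qed (use assms(1-3)[THEN CSD] ptd nn in auto)

lemma equiv_nr: "equiv CS (null_rel X p)"
proof (rule equivI)
  show "null_rel X p \<subseteq> CS \<times> CS" by (auto simp: null_rel_def)
  show "refl_on CS (null_rel X p)" by (auto simp: null_rel_def refl_on_def p0)
  show "sym (null_rel X p)" using nr_sym by (auto simp: null_rel_def sym_def)
  show "trans (null_rel X p)" using nr_trans by (auto simp: null_rel_def trans_def)
qed

lemma cls_eq: "F \<in> CS \<Longrightarrow> H \<in> CS \<Longrightarrow> cls F = cls H \<longleftrightarrow> nr F H"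
  unfolding seq_class_def using eq_equiv_class_iff[OF equiv_nr] by (auto simp: null_rel_def)

lemma cls_in: "F \<in> CS \<Longrightarrow> cls F \<in> carrier C"
  by (simp add: completion_def seq_class_def quotientI)

lemma carE: assumes "u \<in> carrier C" obtains F where "F \<in> CS" "u = cls F"
  using assms by (auto simp: completion_def seq_class_def elim!: quotientE)

lemma rep: assumes "F \<in> CS" shows "representative (cls F) \<in> CS" "nr (representative (cls F)) F"
proof -
  have "F \<in> cls F" using assms equiv_nr by (simp add: seq_class_def null_rel_def p0)
  hence "representative (cls F) \<in> cls F" unfolding representative_def by (rule someI[of "\<lambda>G. G \<in> cls F"])
  thus "representative (cls F) \<in> CS" "nr (representative (cls F)) F"
    using nr_sym by (auto simp: seq_class_def null_rel_def)
qed

lemma add_cls: assumes "F \<in> CS" "H \<in> CS" shows "cls F \<oplus>\<^bsub>C\<^esub> cls H = cls (\<lambda>n. F n + H n)"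
proof -
  note r = rep[OF assms(1)] rep[OF assms(2)]
  have "nr (\<lambda>n. representative (cls F) n + representative (cls H) n) (\<lambda>n. F n + H n)"
    using pt[of "representative (cls F) n - F n" "representative (cls H) n - H n" for n]
      CSD r assms nn
    by (intro tendsto_sandwich[OF _ _ tendsto_const tendsto_eq_rhs[OF tendsto_add[OF r(2,4)]]] always_eventually)
       (simp_all add: algebra_simps)
  thus ?thesis using assms r by (simp add: completion_def cls_eq CS_add)
qed

lemma mult_cls: assumes "F \<in> CS" "H \<in> CS" shows "cls F \<otimes>\<^bsub>C\<^esub> cls H = cls (\<lambda>n. F n * H n)"
proof -
  note r = rep[OF assms(1)] rep[OF assms(2)]
  obtain A where A: "A > 0" "\<And>n. p (F n) \<le> A" using CS_bdd[OF assms(1)] by blast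
  obtain B where B: "B > 0" "\<And>n. p (representative (cls H) n) \<le> B" using CS_bdd[OF r(3)] by blast
  have t: "(\<lambda>n. p (representative (cls F) n - F n) * B + A * p (representative (cls H) n - H n)) \<longlonglongrightarrow> 0"
    using tendsto_add[OF tendsto_mult_right[OF r(2), of B] tendsto_mult_left[OF r(4), of A]] by simp
  have "nr (\<lambda>n. representative (cls F) n * representative (cls H) n) (\<lambda>n. F n * H n)"
  proof (rule tendsto_sandwich[OF _ _ tendsto_const t]; rule always_eventually; rule allI)
    fix n
    show "0 \<le> p (representative (cls F) n * representative (cls H) n - F n * H n)"
      using nn CSD r assms by simp
    have "p (representative (cls F) n * representative (cls H) n - F n * H n) \<le> 
      p (representative (cls F) n - F n) * p (representative (cls H) n) + p (F n) * p (representative (cls H) n - H n)"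
      using mult_est CSD r assms by simp
    also have "\<dots> \<le> p (representative (cls F) n - F n) * B + A * p (representative (cls H) n - H n)"
      using A B nn CSD r assms by (intro add_mono mult_left_mono mult_right_mono) auto
    finally show "p (representative (cls F) n * representative (cls H) n - F n * H n) \<le> p (representative (cls F) n - F n) * B + A * p (representative (cls H) n - H n)" .
  qed
  thus ?thesis using assms r by (simp add: completion_def cls_eq CS_mult)
qed

lemma smult_cls: assumes "F \<in> CS" shows "a \<odot>\<^bsub>C\<^esub> cls F = cls (\<lambda>n. free_scale a (F n))"
proof -
  note r = rep[OF assms(1)]
  have "nr (\<lambda>n. free_scale a (representative (cls F) n)) (\<lambda>n. free_scale a (F n))"
    using tendsto_mult_left[OF r(2), of "cmod a"] ps CSD r assms by (simp flip: free_scale_diff)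
  thus ?thesis using assms r by (simp add: completion_def cls_eq CS_scale)
qed

lemma star_cls: assumes "F \<in> CS" shows "star C (cls F) = cls (\<lambda>n. free_star (F n))"
proof -
  note r = rep[OF assms(1)]
  have "nr (\<lambda>n. free_star (representative (cls F) n)) (\<lambda>n. free_star (F n))"
    using r(2) pstar CSD r assms by (simp flip: free_star_diff)
  thus ?thesis using assms r by (simp add: completion_def cls_eq CS_star)
qed

lemma norm_cls: assumes "F \<in> CS" shows "(\<lambda>n. p (F n)) \<longlonglongrightarrow> cnorm C (cls F)"
proof -
  note r = rep[OF assms(1)]
  have "(\<lambda>n. p (F n) - p (representative (cls F) n)) \<longlonglongrightarrow> 0"
    using prev[of "F n" "representative (cls F) n" for n] psym[of "F n" "representative (cls F) n" for n] CSD r assms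
    by (intro tendsto_0_le[OF r(2), of _ 1]) (auto intro!: always_eventually intro: order_trans[OF _ abs_ge_self])
  from tendsto_add[OF this CS_lim[OF r(1)]] show ?thesis by (simp add: completion_def)
qed

lemma zero_cls: "\<zero>\<^bsub>C\<^esub> = cls (\<lambda>n. 0)" by (simp add: completion_def)

lemmas CSs = CS_add CS_mult CS_scale CS_star CS_const[OF free_carrier_0]
lemmas ops = add_cls mult_cls smult_cls star_cls zero_cls

lemma ball_car: "(\<And>F. F \<in> CS \<Longrightarrow> P (cls F)) \<Longrightarrow> x \<in> carrier C \<Longrightarrow> P x"
  by (metis carE)

lemma abg: "abelian_group C"
proof (rule abelian_groupI)
  show "\<zero>\<^bsub>C\<^esub> \<in> carrier C" by (simp add: zero_cls cls_in CSs)
  fix x assume "x \<in> carrier C"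
  then obtain F where F: "F \<in> CS" "x = cls F" by (rule carE)
  have m: "(\<lambda>n. - F n) \<in> CS" using CS_scale[OF F(1), of "-1"] by (simp add: free_scale_minus1)
  have "cls (\<lambda>n. - F n) \<oplus>\<^bsub>C\<^esub> x = \<zero>\<^bsub>C\<^esub>"
    using F(1) m by (simp add: F(2) add_cls zero_cls)
  thus "\<exists>y\<in>carrier C. y \<oplus>\<^bsub>C\<^esub> x = \<zero>\<^bsub>C\<^esub>" using m cls_in by blast
  show "\<zero>\<^bsub>C\<^esub> \<oplus>\<^bsub>C\<^esub> x = x" using F by (simp add: zero_cls add_cls CSs)
  fix y assume "y \<in> carrier C"
  then obtain H where H: "H \<in> CS" "y = cls H" by (rule carE)
  show "x \<oplus>\<^bsub>C\<^esub> y \<in> carrier C" using F H by (simp add: add_cls cls_in CSs)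
  show "x \<oplus>\<^bsub>C\<^esub> y = y \<oplus>\<^bsub>C\<^esub> x" using F H by (simp add: add_cls add.commute)
  fix z assume "z \<in> carrier C"
  then obtain K where K: "K \<in> CS" "z = cls K" by (rule carE)
  show "(x \<oplus>\<^bsub>C\<^esub> y) \<oplus>\<^bsub>C\<^esub> z = x \<oplus>\<^bsub>C\<^esub> (y \<oplus>\<^bsub>C\<^esub> z)" using F H K by (simp add: add_cls CSs add.assoc)
qed

lemma minus_cls: assumes "F \<in> CS" "H \<in> CS" shows "cls F \<ominus>\<^bsub>C\<^esub> cls H = cls (\<lambda>n. F n - H n)"
proof -
  interpret abelian_group C by (rule abg)
  have m: "(\<lambda>n. - H n) \<in> CS" using CS_scale[OF assms(2), of "-1"] by (simp add: free_scale_minus1)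
  have "cls (\<lambda>n. - H n) \<oplus>\<^bsub>C\<^esub> cls H = \<zero>\<^bsub>C\<^esub>" using assms m by (simp add: ops)
  hence "\<ominus>\<^bsub>C\<^esub> cls H = cls (\<lambda>n. - H n)" using cls_in assms m by (metis minus_equality)
  thus ?thesis using assms m by (simp add: a_minus_def ops)
qed

lemma CS_diff: assumes "F \<in> CS" "H \<in> CS" shows "(\<lambda>n. F n - H n) \<in> CS"
  using CS_add[OF assms(1) CS_scale[OF assms(2), of "-1"]] by (simp add: free_scale_minus1)

lemma cring_c: "cring complex_ring"
  by (rule cringI[OF abelian_groupI comm_monoidI])
     (auto simp: complex_ring_def algebra_simps intro: exI[of _ "- x" for x])

lemma compl: assumes X: "\<And>n. Y n \<in> carrier C"
  and Ca: "\<And>e. 0 < e \<Longrightarrow> \<exists>N. \<forall>m\<ge>N. \<forall>n\<ge>N. cnorm C (Y m \<ominus>\<^bsub>C\<^esub> Y n) < e"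
  shows "\<exists>x \<in> carrier C. (\<lambda>n. cnorm C (Y n \<ominus>\<^bsub>C\<^esub> x)) \<longlonglongrightarrow> 0"
proof -
  have "\<forall>n. \<exists>F. F \<in> CS \<and> Y n = cls F" using X by (meson carE)
  then obtain F where F: "\<And>n. F n \<in> CS" "\<And>n. Y n = cls (F n)" by metis
  have "\<forall>n. \<exists>N. \<forall>i\<ge>N. \<forall>j\<ge>N. p (F n i - F n j) < 1 / real (Suc n)" using CSC[OF F(1)] by simp
  then obtain N where N: "\<And>n i j. i \<ge> N n \<Longrightarrow> j \<ge> N n \<Longrightarrow> p (F n i - F n j) < 1 / real (Suc n)" by metis
  define D where "D n = F n (N n)" for n
  have FD: "\<And>n i. F n i \<in> F0" using F(1) CSD by blast
  have Dc: "\<And>n. D n \<in> F0" by (simp add: D_def FD)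
  have key: "\<exists>M. \<forall>m\<ge>M. \<forall>n\<ge>M. \<exists>I. \<forall>i\<ge>I. p (F m i - F n i) < e \<and> p (D m - D n) < 3 * e \<and> p (F m i - D n) < 2 * e" if "e > 0" for e
  proof -
    obtain M where M: "\<forall>m\<ge>M. \<forall>n\<ge>M. cnorm C (Y m \<ominus>\<^bsub>C\<^esub> Y n) < e" using Ca \<open>e>0\<close> by blast
    obtain M' where M': "1 / real (Suc M') < e" using \<open>e>0\<close> nat_approx_posE by blast
    show ?thesis
    proof (rule exI[of _ "max M M'"], intro allI impI)
      fix m n assume mn: "m \<ge> max M M'" "n \<ge> max M M'"
      have "cnorm C (Y m \<ominus>\<^bsub>C\<^esub> Y n) < e" using M mn by simp
      moreover have "(\<lambda>i. p (F m i - F n i)) \<longlonglongrightarrow> cnorm C (Y m \<ominus>\<^bsub>C\<^esub> Y n)"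
        using norm_cls[OF CS_diff[OF F(1) F(1)]] F by (simp add: minus_cls)
      ultimately have "\<forall>\<^sub>F i in sequentially. p (F m i - F n i) < e" by (rule order_tendstoD(2)[rotated])
      then obtain I where I: "\<And>i. i \<ge> I \<Longrightarrow> p (F m i - F n i) < e" by (auto simp: eventually_sequentially)
      have le: "1 / real (Suc m) < e" "1 / real (Suc n) < e" using mn M' by (smt (verit) frac_less2 of_nat_mono Suc_le_mono max.bounded_iff of_nat_0_less_iff zero_less_Suc divide_left_mono frac_le)+
      show "\<exists>I. \<forall>i\<ge>I. p (F m i - F n i) < e \<and> p (D m - D n) < 3 * e \<and> p (F m i - D n) < 2 * e"
      proof (intro exI[of _ "max I (max (N m) (N n))"] allI impI)
        fix i assume i: "i \<ge> max I (max (N m) (N n))"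
        have 1: "p (F m i - F n i) < e" using I i by simp
        have 2: "p (D m - F m i) < e" using N[of m "N m" i] i le by (simp add: D_def)
        have 3: "p (F n i - D n) < e" using N[of n i "N n"] i le by (simp add: D_def)
        show "p (F m i - F n i) < e \<and> p (D m - D n) < 3 * e \<and> p (F m i - D n) < 2 * e"
          using 1 2 3 ptd[of "F m i" "F n i" "D n"] ptd[of "D m" "F m i" "D n"] FD Dc by auto
      qed
    qed
  qed
  have D: "D \<in> CS"
  proof (rule CSI)
    fix e :: real assume "e > 0"
    thus "\<exists>N. \<forall>m\<ge>N. \<forall>n\<ge>N. p (D m - D n) < e" using key[of "e/3"] by fastforce
  qed (rule Dc)
  have "(\<lambda>n. cnorm C (Y n \<ominus>\<^bsub>C\<^esub> cls D)) \<longlonglongrightarrow> 0"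
  proof (rule LIMSEQ_I)
    fix e :: real assume "e > 0"
    then obtain M where M: "\<forall>m\<ge>M. \<forall>n\<ge>M. \<exists>I. \<forall>i\<ge>I. p (F m i - D n) < e/2" using key[of "e/4"] by fastforce
    obtain K where K: "\<forall>m\<ge>K. \<forall>n\<ge>K. p (D m - D n) < e/4" using CSC[OF D, of "e/4"] \<open>e>0\<close> by auto
    have *: "norm (cnorm C (Y m \<ominus>\<^bsub>C\<^esub> cls D) - 0) < e" if m: "m \<ge> max M K" for m
    proof -
      have l: "(\<lambda>i. p (F m i - D i)) \<longlonglongrightarrow> cnorm C (Y m \<ominus>\<^bsub>C\<^esub> cls D)"
        using norm_cls[OF CS_diff[OF F(1) D]] F D by (simp add: minus_cls)
      obtain I where I: "\<forall>i\<ge>I. p (F m i - D m) < e/2" using M m by (meson max.bounded_iff)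
      have "p (F m i - D i) \<le> 3/4*e" if "i \<ge> max I K" for i
      proof -
        have "p (F m i - D m) < e/2" "p (D m - D i) < e/4" using I K m that by auto
        thus ?thesis using ptd[of "F m i" "D m" "D i"] FD Dc by simp
      qed
      hence "cnorm C (Y m \<ominus>\<^bsub>C\<^esub> cls D) \<le> 3/4*e" by (intro Lim_bounded[OF l]) blast
      moreover have "0 \<le> cnorm C (Y m \<ominus>\<^bsub>C\<^esub> cls D)" using nn FD Dc by (intro LIMSEQ_le_const[OF l]) auto
      ultimately show ?thesis using \<open>e>0\<close> by simp
    qed
    show "\<exists>M. \<forall>m\<ge>M. norm (cnorm C (Y m \<ominus>\<^bsub>C\<^esub> cls D) - 0) < e" using * by blast
  qed
  thus ?thesis using cls_in D by blast
qed

theorem completion_cstar: "cstar_algebra C"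
proof (intro cstar_algebra.intro Module.moduleI cstar_algebra_axioms.intro)
  show "abelian_group C" by (rule abg)
  show "cring complex_ring" by (rule cring_c)
next
  fix x y z a b assume "x \<in> carrier C" "y \<in> carrier C" "z \<in> carrier C"
  then obtain F H K where F: "F \<in> CS" "x = cls F" and H: "H \<in> CS" "y = cls H" and K: "K \<in> CS" "z = cls K"
    by (metis carE)
  note S = F(2) H(2) K(2)
  note [simp] = F(1) H(1) K(1) cls_in CSs ops
  show "x \<otimes>\<^bsub>C\<^esub> y \<otimes>\<^bsub>C\<^esub> z = x \<otimes>\<^bsub>C\<^esub> (y \<otimes>\<^bsub>C\<^esub> z)" by (simp add: S mult.assoc)
  show "(x \<oplus>\<^bsub>C\<^esub> y) \<otimes>\<^bsub>C\<^esub> z = x \<otimes>\<^bsub>C\<^esub> z \<oplus>\<^bsub>C\<^esub> y \<otimes>\<^bsub>C\<^esub> z" by (simp add: S distrib_right)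
  show "x \<otimes>\<^bsub>C\<^esub> (y \<oplus>\<^bsub>C\<^esub> z) = x \<otimes>\<^bsub>C\<^esub> y \<oplus>\<^bsub>C\<^esub> x \<otimes>\<^bsub>C\<^esub> z" by (simp add: S distrib_left)
next
  fix x y a b assume "x \<in> carrier C" "y \<in> carrier C"
  then obtain F H where F: "F \<in> CS" "x = cls F" and H: "H \<in> CS" "y = cls H" by (metis carE)
  note S = F(2) H(2)
  note [simp] = F(1) H(1) cls_in CSs ops
  show "x \<otimes>\<^bsub>C\<^esub> y \<in> carrier C" by (simp add: S)
  show "a \<odot>\<^bsub>C\<^esub> (x \<oplus>\<^bsub>C\<^esub> y) = a \<odot>\<^bsub>C\<^esub> x \<oplus>\<^bsub>C\<^esub> a \<odot>\<^bsub>C\<^esub> y" by (simp add: S free_scale_add)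
  show "(a \<odot>\<^bsub>C\<^esub> x) \<otimes>\<^bsub>C\<^esub> y = a \<odot>\<^bsub>C\<^esub> (x \<otimes>\<^bsub>C\<^esub> y)" by (simp add: S free_scale_mult_left)
  show "x \<otimes>\<^bsub>C\<^esub> (a \<odot>\<^bsub>C\<^esub> y) = a \<odot>\<^bsub>C\<^esub> (x \<otimes>\<^bsub>C\<^esub> y)" by (simp add: S free_scale_mult_right)
  show "star C (x \<oplus>\<^bsub>C\<^esub> y) = star C x \<oplus>\<^bsub>C\<^esub> star C y" by (simp add: S free_star_add)
  show "star C (x \<otimes>\<^bsub>C\<^esub> y) = star C y \<otimes>\<^bsub>C\<^esub> star C x" by (simp add: S free_star_mult)
  note FH = CSD[OF F(1)] CSD[OF H(1)]
  note lF = norm_cls[OF F(1), folded F(2)] and lH = norm_cls[OF H(1), folded H(2)]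
  show "cnorm C (x \<oplus>\<^bsub>C\<^esub> y) \<le> cnorm C x + cnorm C y"
    unfolding S add_cls[OF F(1) H(1)]
    by (rule LIMSEQ_le[OF norm_cls[OF CS_add[OF F(1) H(1)]] tendsto_add[OF lF lH, unfolded S]]) (use pt FH in auto)
  show "cnorm C (x \<otimes>\<^bsub>C\<^esub> y) \<le> cnorm C x * cnorm C y"
    unfolding S mult_cls[OF F(1) H(1)]
    by (rule LIMSEQ_le[OF norm_cls[OF CS_mult[OF F(1) H(1)]] tendsto_mult[OF lF lH, unfolded S]]) (use pm FH in auto)
next
  fix x a b assume "x \<in> carrier C"
  then obtain F where F: "F \<in> CS" "x = cls F" by (metis carE)
  note S = F(2)
  note [simp] = F(1) cls_in CSs ops complex_ring_def
  note FH = CSD[OF F(1)]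
  note lF = norm_cls[OF F(1), folded F(2)]
  show "a \<odot>\<^bsub>C\<^esub> x \<in> carrier C" by (simp add: S)
  show "star C x \<in> carrier C" by (simp add: S)
  show "star C (star C x) = x" by (simp add: S free_star_free_star)
  show "\<one>\<^bsub>complex_ring\<^esub> \<odot>\<^bsub>C\<^esub> x = x" by (simp add: S free_scale_one)
  show "star C (a \<odot>\<^bsub>C\<^esub> x) = cnj a \<odot>\<^bsub>C\<^esub> star C x" by (simp add: S free_star_scale)
  show "(a \<oplus>\<^bsub>complex_ring\<^esub> b) \<odot>\<^bsub>C\<^esub> x = a \<odot>\<^bsub>C\<^esub> x \<oplus>\<^bsub>C\<^esub> b \<odot>\<^bsub>C\<^esub> x" by (simp add: S free_scale_add_left)
  show "(a \<otimes>\<^bsub>complex_ring\<^esub> b) \<odot>\<^bsub>C\<^esub> x = a \<odot>\<^bsub>C\<^esub> (b \<odot>\<^bsub>C\<^esub> x)" by (simp add: S free_scale_scale)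
  show "0 \<le> cnorm C x" using nn FH by (intro LIMSEQ_le_const[OF lF]) auto
  show "cnorm C x = 0 \<longleftrightarrow> x = \<zero>\<^bsub>C\<^esub>"
  proof
    assume "cnorm C x = 0" thus "x = \<zero>\<^bsub>C\<^esub>" using lF by (simp add: S cls_eq)
  next
    assume "x = \<zero>\<^bsub>C\<^esub>"
    hence "(\<lambda>n. p (F n)) \<longlonglongrightarrow> 0" by (simp add: S cls_eq)
    thus "cnorm C x = 0" using lF LIMSEQ_unique by blast
  qed
  show "cnorm C (a \<odot>\<^bsub>C\<^esub> x) = cmod a * cnorm C x"
    unfolding S smult_cls[OF F(1)]
    by (rule LIMSEQ_unique[OF norm_cls[OF CS_scale[OF F(1)]]])
       (use tendsto_mult_left[OF lF, of "cmod a"] ps FH in \<open>simp add: S\<close>)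
  show "cnorm C (star C x \<otimes>\<^bsub>C\<^esub> x) = (cnorm C x)\<^sup>2"
    unfolding S star_cls[OF F(1)] mult_cls[OF CS_star[OF F(1)] F(1)]
    by (rule LIMSEQ_unique[OF norm_cls[OF CS_mult[OF CS_star[OF F(1)] F(1)]]])
       (use tendsto_power[OF lF, of 2] pc FH in \<open>simp add: S\<close>)
qed (use compl in blast)+

end

context free_seminorm begin

lemma completion_generated:
  assumes "S \<subseteq> carrier C" and gen: "completion_gen X p ` X \<subseteq> S" and z: "\<zero>\<^bsub>C\<^esub> \<in> S"
    and ad: "\<And>u v. \<lbrakk>u \<in> S; v \<in> S\<rbrakk> \<Longrightarrow> u \<oplus>\<^bsub>C\<^esub> v \<in> S"
    and mu: "\<And>u v. \<lbrakk>u \<in> S; v \<in> S\<rbrakk> \<Longrightarrow> u \<otimes>\<^bsub>C\<^esub> v \<in> S"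
    and sc: "\<And>a u. u \<in> S \<Longrightarrow> a \<odot>\<^bsub>C\<^esub> u \<in> S"
    and st: "\<And>u. u \<in> S \<Longrightarrow> star C u \<in> S"
    and lim: "\<And>Y u. \<lbrakk>\<And>n. Y n \<in> S; u \<in> carrier C; (\<lambda>n. cnorm C (Y n \<ominus>\<^bsub>C\<^esub> u)) \<longlonglongrightarrow> 0\<rbrakk> \<Longrightarrow> u \<in> S"
  shows "S = carrier C"
proof
  let ?k = "\<lambda>f. cls (\<lambda>n. f)"
  have letter: "?k (Poly_Mapping.single (Word [(x, b)]) 1) \<in> S" if "x \<in> X" for x b
  proof -
    have g: "free_gen x \<in> F0" using that by (simp add: free_carrier_def free_gen_def)
    have "?k (free_gen x) \<in> S" using gen that by (auto simp: completion_gen_def)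
    moreover from st[OF this] have "?k (free_star (free_gen x)) \<in> S" using g by (simp add: star_cls CS_const)
    ultimately show ?thesis
      by (cases b) (simp_all add: free_gen_def free_star_single word_star_def)
  qed
  have word: "l \<noteq> [] \<Longrightarrow> fst ` set l \<subseteq> X \<Longrightarrow> ?k (Poly_Mapping.single (Word l) 1) \<in> S" for l
  proof (induction l)
    case (Cons y l)
    show ?case
    proof (cases "l = []")
      case True thus ?thesis using letter Cons.prems by (cases y) auto
    next
      case False
      have "Poly_Mapping.single (Word (y # l)) (1::complex) = Poly_Mapping.single (Word [y]) 1 * Poly_Mapping.single (Word l) 1"
        by (simp add: mult_single plus_star_word_def)
      moreover have "?k (Poly_Mapping.single (Word [y]) 1) \<in> S" using letter Cons.prems by (cases y) auto
      moreover have "?k (Poly_Mapping.single (Word l) 1) \<in> S" using Cons False by auto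
      moreover have "Poly_Mapping.single (Word [y]) (1::complex) \<in> F0" "Poly_Mapping.single (Word l) (1::complex) \<in> F0"
        using Cons.prems False by (auto simp: free_carrier_def)
      ultimately show ?thesis using mu[of "?k (Poly_Mapping.single (Word [y]) 1)" "?k (Poly_Mapping.single (Word l) 1)"]
        by (simp add: mult_cls CS_const)
    qed
  qed simp
  have poly: "?k f \<in> S" if "f \<in> F0" for f
  proof -
    have eq: "f = (\<Sum>w\<in>Poly_Mapping.keys f. Poly_Mapping.single w (Poly_Mapping.lookup f w))"
      by (rule poly_mapping_eqI)
         (auto simp: lookup_sum lookup_single when_def in_keys_iff sum.delta' if_distrib cong: if_cong)
    have "finite B \<Longrightarrow> B \<subseteq> Poly_Mapping.keys f \<Longrightarrow> (\<Sum>w\<in>B. Poly_Mapping.single w (Poly_Mapping.lookup f w)) \<in> F0 \<and>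
       ?k (\<Sum>w\<in>B. Poly_Mapping.single w (Poly_Mapping.lookup f w)) \<in> S" for B
    proof (induction B rule: finite_induct)
      case empty show ?case using z by (simp add: zero_cls)
    next
      case (insert w B)
      obtain l where l: "w = Word l" by (cases w)
      have "letters w \<noteq> [] \<and> fst ` set (letters w) \<subseteq> X"
        using insert.prems that unfolding free_carrier_def by blast
      hence wl: "l \<noteq> []" "fst ` set l \<subseteq> X" by (simp_all add: l)
      have one: "Poly_Mapping.single w (1::complex) \<in> F0" using wl l by (auto simp: free_carrier_def)
      have sw: "Poly_Mapping.single w a = free_scale a (Poly_Mapping.single w 1)" for a
        by (simp add: free_scale_conv mult_single)
      have "Poly_Mapping.single w a \<in> F0" "?k (Poly_Mapping.single w a) \<in> S" for a
        using one sc[OF word[OF wl], of a] unfolding sw[of a] by (simp_all add: smult_cls CS_const l)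
      note sin = this
      let ?s = "\<Sum>w\<in>B. Poly_Mapping.single w (Poly_Mapping.lookup f w)"
      have IH: "?s \<in> F0" "?k ?s \<in> S" using insert by auto
      have "?k (Poly_Mapping.single w (Poly_Mapping.lookup f w) + ?s) \<in> S"
        using ad[OF sin(2) IH(2)] sin(1) IH(1) by (simp add: add_cls CS_const)
      thus ?case using insert.hyps sin(1) IH(1) by simp
    qed
    from this[OF finite_keys subset_refl] show ?thesis using eq by metis
  qed
  show "carrier C \<subseteq> S"
  proof
    fix u assume "u \<in> carrier C"
    then obtain F where F: "F \<in> CS" "u = cls F" by (rule carE)
    note D = CSD[OF F(1)]
    have "(\<lambda>n. cnorm C (?k (F n) \<ominus>\<^bsub>C\<^esub> u)) \<longlonglongrightarrow> 0"
    proof (rule LIMSEQ_I)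
      fix e :: real assume "e > 0"
      then obtain N where N: "\<forall>m\<ge>N. \<forall>n\<ge>N. p (F m - F n) < e/2" using CSC[OF F(1), of "e/2"] by auto
      have "norm (cnorm C (?k (F n) \<ominus>\<^bsub>C\<^esub> u) - 0) < e" if n: "n \<ge> N" for n
      proof -
        have l: "(\<lambda>i. p (F n - F i)) \<longlonglongrightarrow> cnorm C (?k (F n) \<ominus>\<^bsub>C\<^esub> u)"
          using norm_cls[OF CS_diff[OF CS_const[OF D] F(1)]] F D by (simp add: minus_cls CS_const)
        have "cnorm C (?k (F n) \<ominus>\<^bsub>C\<^esub> u) \<le> e/2"
          using N n by (intro Lim_bounded[OF l, of N]) (auto intro: less_imp_le)
        moreover have "0 \<le> cnorm C (?k (F n) \<ominus>\<^bsub>C\<^esub> u)" using nn D by (intro LIMSEQ_le_const[OF l]) auto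
        ultimately show ?thesis using \<open>e > 0\<close> by simp
      qed
      thus "\<exists>M. \<forall>n\<ge>M. norm (cnorm C (?k (F n) \<ominus>\<^bsub>C\<^esub> u) - 0) < e" by blast
    qed
    moreover have "u \<in> carrier C" using F cls_in by simp
    ultimately show "u \<in> S" by (intro lim[OF poly[OF D]])
  qed
qed (rule assms(1))

end

definition star_words :: "'x set \<Rightarrow> 'x star_word set" where
  "star_words X = {w. letters w \<noteq> [] \<and> fst ` set (letters w) \<subseteq> X}"

lemma free_carrier_keys: "f \<in> free_carrier X \<longleftrightarrow> Poly_Mapping.keys f \<subseteq> star_words X"
  by (auto simp: free_carrier_def star_words_def)

lemma free_carrier_single: "w \<in> star_words X \<Longrightarrow> Poly_Mapping.single w a \<in> free_carrier X"
  by (auto simp: free_carrier_keys)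

lemma free_gen_carrier: "x \<in> X \<Longrightarrow> free_gen x \<in> free_carrier X"
  by (auto simp: free_gen_def star_words_def intro: free_carrier_single)

lemma free_induct [consumes 1, case_names 0 add]:
  assumes f: "f \<in> free_carrier X" and "P 0"
    "\<And>w a f. w \<in> star_words X \<Longrightarrow> f \<in> free_carrier X \<Longrightarrow> P f \<Longrightarrow> P (Poly_Mapping.single w a + f)"
  shows "P f"
proof -
  have eq: "f = (\<Sum>w\<in>Poly_Mapping.keys f. Poly_Mapping.single w (Poly_Mapping.lookup f w))"
    by (rule poly_mapping_eqI)
       (auto simp: lookup_sum lookup_single when_def in_keys_iff sum.delta' if_distrib cong: if_cong)
  have "finite A \<Longrightarrow> A \<subseteq> star_words X \<Longrightarrow> (\<Sum>w\<in>A. Poly_Mapping.single w (Poly_Mapping.lookup f w)) \<in> free_carrier X \<and>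
     P (\<Sum>w\<in>A. Poly_Mapping.single w (Poly_Mapping.lookup f w))" for A
  proof (induction A rule: finite_induct)
    case empty show ?case using assms(2) free_carrier_0 by (metis sum.empty)
  next
    case (insert w A)
    hence "Poly_Mapping.single w (Poly_Mapping.lookup f w) \<in> free_carrier X" by (intro free_carrier_single) auto
    thus ?case using insert assms(3) free_carrier_add by auto
  qed
  thus ?thesis using eq f unfolding free_carrier_keys by (metis finite_keys)
qed

fun word_eval :: "'a cstar \<Rightarrow> ('x \<Rightarrow> 'a) \<Rightarrow> ('x \<times> bool) list \<Rightarrow> 'a" where
  "word_eval A T [] = \<zero>\<^bsub>A\<^esub>"
| "word_eval A T [(x, b)] = (if b then star A (T x) else T x)"
| "word_eval A T ((x, b) # y # w) = (if b then star A (T x) else T x) \<otimes>\<^bsub>A\<^esub> word_eval A T (y # w)"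

definition free_eval :: "'a cstar \<Rightarrow> ('x \<Rightarrow> 'a) \<Rightarrow> 'x free_star \<Rightarrow> 'a" where
  "free_eval A T f = (\<Oplus>\<^bsub>A\<^esub>w\<in>Poly_Mapping.keys f. Poly_Mapping.lookup f w \<odot>\<^bsub>A\<^esub> word_eval A T (letters w))"

context cstar_algebra begin

lemma cr [simp]: "carrier complex_ring = UNIV" "mult complex_ring = (*)" "one complex_ring = 1" "zero complex_ring = 0" "add complex_ring = (+)"
  by (simp_all add: complex_ring_def)

lemma sc [simp]: "x \<in> carrier A \<Longrightarrow> a \<odot> x \<in> carrier A" using smult_closed by simp
declare mult_closed [simp] star_closed [simp]
lemma sl: "x \<in> carrier A \<Longrightarrow> (a + b) \<odot> x = a \<odot> x \<oplus> b \<odot> x" using smult_l_distr by simp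
lemma sr: "x \<in> carrier A \<Longrightarrow> y \<in> carrier A \<Longrightarrow> a \<odot> (x \<oplus> y) = a \<odot> x \<oplus> a \<odot> y" using smult_r_distr by simp
lemma sa: "x \<in> carrier A \<Longrightarrow> (a * b) \<odot> x = a \<odot> (b \<odot> x)" using smult_assoc1 by simp
lemma s1: "x \<in> carrier A \<Longrightarrow> 1 \<odot> x = x" using smult_one by simp
lemma s0: "x \<in> carrier A \<Longrightarrow> 0 \<odot> x = \<zero>" using smult_l_null by simp
lemma s0r [simp]: "a \<odot> \<zero> = \<zero>" using smult_r_null[of a] by simp
lemma m0l [simp]: "x \<in> carrier A \<Longrightarrow> \<zero> \<otimes> x = \<zero>" using mult_smult_left[of \<zero> x 0] by (simp add: s0)
lemma m0r [simp]: "x \<in> carrier A \<Longrightarrow> x \<otimes> \<zero> = \<zero>" using mult_smult_right[of x \<zero> 0] by (simp add: s0)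
lemma st0 [simp]: "star A \<zero> = \<zero>" using star_smult[of \<zero> 0] by (simp add: s0)
lemma neg: "x \<in> carrier A \<Longrightarrow> \<ominus> x = (-1) \<odot> x"
  using sl[of x 1 "-1"] by (simp add: s0 s1) (metis sc M.add.m_comm M.minus_equality)
lemma diff: "x \<in> carrier A \<Longrightarrow> y \<in> carrier A \<Longrightarrow> x \<ominus> y = x \<oplus> (-1) \<odot> y"
  by (simp add: a_minus_def neg)
lemma norm_star: assumes "x \<in> carrier A" shows "cnorm A (star A x) = cnorm A x"
proof -
  have *: "cnorm A f \<le> cnorm A (star A f)" if "f \<in> carrier A" for f
  proof (cases "cnorm A f = 0")
    case True thus ?thesis using norm_nonneg that by simp
  next
    case False hence "cnorm A f > 0" using norm_nonneg[OF that] by linarith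
    moreover have "cnorm A f * cnorm A f \<le> cnorm A (star A f) * cnorm A f"
      using cstar_identity[of f] norm_mult[of "star A f" f] that by (simp add: power2_eq_square)
    ultimately show ?thesis by simp
  qed
  show ?thesis using *[OF assms] *[of "star A x"] assms by (simp add: star_star)
qed
lemma norm0 [simp]: "cnorm A \<zero> = 0" using norm_eq_zero_iff by simp

lemma diff0: "x \<in> carrier A \<Longrightarrow> y \<in> carrier A \<Longrightarrow> x \<ominus> y = \<zero> \<longleftrightarrow> x = y"
  by (metis M.a_inv_closed M.minus_minus M.minus_equality M.r_neg a_minus_def)
lemma ndiff: "x \<in> carrier A \<Longrightarrow> y \<in> carrier A \<Longrightarrow> cnorm A (x \<ominus> y) = cnorm A (y \<ominus> x)"
  using norm_smult[of "y \<ominus> x" "-1"] by (simp add: neg[symmetric] M.minus_add a_minus_def M.a_comm)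
lemma ntri: assumes "x \<in> carrier A" "y \<in> carrier A" "z \<in> carrier A"
  shows "cnorm A (x \<ominus> z) \<le> cnorm A (x \<ominus> y) + cnorm A (y \<ominus> z)"
proof -
  have "x \<ominus> z = (x \<ominus> y) \<oplus> (y \<ominus> z)" using assms
    by (simp add: a_minus_def M.a_assoc) (metis M.a_assoc M.a_inv_closed M.l_neg M.l_zero)
  thus ?thesis using norm_triangle assms by simp
qed

definition conv_to :: "(nat \<Rightarrow> 'a) \<Rightarrow> 'a \<Rightarrow> bool" where
  "conv_to Y y \<longleftrightarrow> range Y \<subseteq> carrier A \<and> y \<in> carrier A \<and> (\<lambda>n. cnorm A (Y n \<ominus> y)) \<longlonglongrightarrow> 0"

lemma cvD: "conv_to Y y \<Longrightarrow> Y n \<in> carrier A" "conv_to Y y \<Longrightarrow> y \<in> carrier A" by (auto simp: conv_to_def)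

lemma cv_unique: assumes "conv_to Y y" "conv_to Y z" shows "y = z"
proof -
  have "(\<lambda>n. cnorm A (Y n \<ominus> y) + cnorm A (Y n \<ominus> z)) \<longlonglongrightarrow> 0"
    using assms tendsto_add[of _ 0 _ _ 0] unfolding conv_to_def by fastforce
  moreover have "cnorm A (y \<ominus> z) \<le> cnorm A (Y n \<ominus> y) + cnorm A (Y n \<ominus> z)" for n
    using ntri[of y "Y n" z] ndiff[of y "Y n"] assms cvD by simp
  ultimately have "cnorm A (y \<ominus> z) \<le> 0" by (intro LIMSEQ_le_const) auto
  hence "cnorm A (y \<ominus> z) = 0" using norm_nonneg[of "y \<ominus> z"] assms cvD by simp
  thus ?thesis using norm_eq_zero_iff diff0 assms cvD by simp
qed

lemma cv_const: "y \<in> carrier A \<Longrightarrow> conv_to (\<lambda>n. y) y" by (simp add: conv_to_def diff0[THEN iffD2])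

lemma add_diff: assumes "x \<in> carrier A" "y \<in> carrier A" "z \<in> carrier A" "w \<in> carrier A"
  shows "(x \<oplus> y) \<ominus> (z \<oplus> w) = (x \<ominus> z) \<oplus> (y \<ominus> w)"
  using assms by (simp add: a_minus_def M.minus_add M.a_ac)

lemma cv_add: assumes "conv_to Y y" "conv_to Z z" shows "conv_to (\<lambda>n. Y n \<oplus> Z n) (y \<oplus> z)"
proof -
  note m = assms[THEN cvD(1)] assms[THEN cvD(2)]
  have "(\<lambda>n. cnorm A (Y n \<ominus> y) + cnorm A (Z n \<ominus> z)) \<longlonglongrightarrow> 0"
    using assms tendsto_add[of _ 0 _ _ 0] unfolding conv_to_def by fastforce
  hence "(\<lambda>n. cnorm A (Y n \<oplus> Z n \<ominus> (y \<oplus> z))) \<longlonglongrightarrow> 0"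
    by (rule tendsto_sandwich[OF _ _ tendsto_const, rotated -1])
       (use norm_triangle norm_nonneg m in \<open>simp_all add: add_diff\<close>)
  thus ?thesis using m by (auto simp: conv_to_def)
qed

lemma cv_smult: assumes "conv_to Y y" shows "conv_to (\<lambda>n. a \<odot> Y n) (a \<odot> y)"
proof -
  note m = assms[THEN cvD(1)] assms[THEN cvD(2)]
  have "a \<odot> Y n \<ominus> a \<odot> y = a \<odot> (Y n \<ominus> y)" for n
    using m by (simp add: diff sr sa[symmetric])
  thus ?thesis using m assms tendsto_mult_left[of "\<lambda>n. cnorm A (Y n \<ominus> y)" 0 sequentially "cmod a"]
    by (auto simp: conv_to_def norm_smult)
qed

lemma cv_star: assumes "conv_to Y y" shows "conv_to (\<lambda>n. star A (Y n)) (star A y)"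
proof -
  note m = assms[THEN cvD(1)] assms[THEN cvD(2)]
  have "star A (Y n) \<ominus> star A y = star A (Y n \<ominus> y)" for n
    using m by (simp add: diff star_add star_smult)
  thus ?thesis using m assms by (auto simp: conv_to_def norm_star)
qed

lemma cv_norm: assumes "conv_to Y y" shows "(\<lambda>n. cnorm A (Y n)) \<longlonglongrightarrow> cnorm A y"
proof -
  note m = assms[THEN cvD(1)] assms[THEN cvD(2)]
  have d: "x \<ominus> \<zero> = x" if "x \<in> carrier A" for x using that by (simp add: a_minus_def)
  have "\<bar>cnorm A (Y n) - cnorm A y\<bar> \<le> cnorm A (Y n \<ominus> y)" for n
    using ntri[of "Y n" y \<zero>] ntri[of y "Y n" \<zero>] ndiff[of y "Y n"] m by (simp add: d)
  hence *: "norm (cnorm A (Y n) - cnorm A y) \<le> norm (cnorm A (Y n \<ominus> y)) * 1" for n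
    using norm_nonneg[of "Y n \<ominus> y"] m by simp
  have l: "(\<lambda>n. cnorm A (Y n \<ominus> y)) \<longlonglongrightarrow> 0" using assms by (simp add: conv_to_def)
  have "(\<lambda>n. cnorm A (Y n) - cnorm A y) \<longlonglongrightarrow> 0"
    by (rule tendsto_0_le[OF l always_eventually]) (use * in blast)
  thus ?thesis by (rule LIM_zero_cancel)
qed

lemma cv_mult: assumes "conv_to Y y" "conv_to Z z" shows "conv_to (\<lambda>n. Y n \<otimes> Z n) (y \<otimes> z)"
proof -
  note m = assms[THEN cvD(1)] assms[THEN cvD(2)]
  have "(\<lambda>n. cnorm A (Y n \<ominus> y) * cnorm A (Z n) + cnorm A y * cnorm A (Z n \<ominus> z)) \<longlonglongrightarrow> 0 * cnorm A z + cnorm A y * 0"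
    using assms cv_norm by (intro tendsto_intros) (auto simp: conv_to_def)
  hence t: "(\<lambda>n. cnorm A (Y n \<ominus> y) * cnorm A (Z n) + cnorm A y * cnorm A (Z n \<ominus> z)) \<longlonglongrightarrow> 0" by simp
  have e: "Y n \<otimes> Z n \<ominus> y \<otimes> z = ((Y n \<ominus> y) \<otimes> Z n) \<oplus> (y \<otimes> (Z n \<ominus> z))" for n
  proof -
    have "((Y n \<ominus> y) \<otimes> Z n) \<oplus> (y \<otimes> (Z n \<ominus> z)) = (Y n \<otimes> Z n \<ominus> y \<otimes> Z n) \<oplus> (y \<otimes> Z n \<ominus> y \<otimes> z)"
      using m by (simp add: diff mult_add_left mult_add_right mult_smult_left mult_smult_right)
    also have "\<dots> = Y n \<otimes> Z n \<ominus> y \<otimes> z" using m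
      by (simp add: a_minus_def M.a_assoc) (metis M.a_assoc M.a_inv_closed M.l_neg M.l_zero mult_closed)
    finally show ?thesis ..
  qed
  have "cnorm A (Y n \<otimes> Z n \<ominus> y \<otimes> z) \<le> cnorm A (Y n \<ominus> y) * cnorm A (Z n) + cnorm A y * cnorm A (Z n \<ominus> z)" for n
    unfolding e using m by (intro order_trans[OF norm_triangle add_mono] norm_mult) auto
  hence "(\<lambda>n. cnorm A (Y n \<otimes> Z n \<ominus> y \<otimes> z)) \<longlonglongrightarrow> 0"
    by (intro tendsto_sandwich[OF _ _ tendsto_const t]) (use norm_nonneg m in simp_all)
  thus ?thesis using m by (auto simp: conv_to_def)
qed

end

locale cstar_family = cstar_algebra A for A :: "'a cstar" (structure) +
  fixes X :: "'x set" and T assumes T: "T \<in> X \<rightarrow> carrier A"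
begin

abbreviation "E \<equiv> free_eval A T"
abbreviation "ev \<equiv> word_eval A T"

lemma ev_closed: "fst ` set l \<subseteq> X \<Longrightarrow> ev l \<in> carrier A"
proof (induction l)
  case (Cons a l)
  obtain x b where a: "a = (x, b)" by (cases a)
  have "T x \<in> carrier A" using T Cons.prems a by auto
  thus ?case using Cons by (cases l) (auto simp: a)
qed simp

lemma ev_append: "fst ` set l \<subseteq> X \<Longrightarrow> fst ` set l' \<subseteq> X \<Longrightarrow> l \<noteq> [] \<Longrightarrow> l' \<noteq> [] \<Longrightarrow> ev (l @ l') = ev l \<otimes> ev l'"
proof (induction l)
  case (Cons a l)
  obtain x b where a: "a = (x, b)" by (cases a)
  show ?case
  proof (cases l)
    case Nil thus ?thesis using Cons.prems by (cases l') (auto simp: a)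
  next
    case (Cons y l2)
    have "T x \<in> carrier A" using T Cons.prems a by auto
    thus ?thesis using Cons.IH Cons Cons.prems ev_closed[of l] ev_closed[of l'] by (auto simp: a mult_assoc)
  qed
qed simp

lemma ev_star: "fst ` set l \<subseteq> X \<Longrightarrow> l \<noteq> [] \<Longrightarrow> ev (rev (map (\<lambda>(x, b). (x, \<not> b)) l)) = star A (ev l)"
proof (induction l)
  case (Cons a l)
  obtain x b where a: "a = (x, b)" by (cases a)
  have Tx: "T x \<in> carrier A" using T Cons.prems a by auto
  show ?case
  proof (cases l)
    case Nil thus ?thesis using Tx by (simp add: a star_star)
  next
    case (Cons y l2)
    have r: "fst ` set (rev (map (\<lambda>(x, b). (x, \<not> b)) l)) \<subseteq> X" using Cons.prems by auto
    have "ev (rev (map (\<lambda>(x, b). (x, \<not> b)) (a # l))) = ev (rev (map (\<lambda>(x, b). (x, \<not> b)) l)) \<otimes> ev [(x, \<not> b)]"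
      using r Cons Cons.prems by (simp only: list.map rev.simps a prod.case) (rule ev_append, auto)
    also have "\<dots> = star A (ev l) \<otimes> ev [(x, \<not> b)]" using Cons.IH Cons Cons.prems by simp
    also have "\<dots> = star A (ev (a # l))"
      using Tx ev_closed[of l] Cons.prems Cons by (simp add: a star_mult star_star)
    finally show ?thesis .
  qed
qed simp

lemma evW: "w \<in> star_words X \<Longrightarrow> ev (letters w) \<in> carrier A" by (simp add: star_words_def ev_closed)

lemma E_super: assumes "finite S" "Poly_Mapping.keys f \<subseteq> S" "S \<subseteq> star_words X"
  shows "E f = (\<Oplus>w\<in>S. Poly_Mapping.lookup f w \<odot> ev (letters w))"
  unfolding free_eval_def
  by (rule M.add.finprod_mono_neutral_cong_left)
     (use assms evW in \<open>auto simp: s0 in_keys_iff\<close>)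

lemma E_closed [simp]: "f \<in> free_carrier X \<Longrightarrow> E f \<in> carrier A"
  unfolding free_eval_def free_carrier_keys using evW by (intro M.finsum_closed) auto

lemma E_add: assumes "f \<in> free_carrier X" "g \<in> free_carrier X" shows "E (f + g) = E f \<oplus> E g"
proof -
  let ?S = "Poly_Mapping.keys f \<union> Poly_Mapping.keys g"
  have S: "finite ?S" "?S \<subseteq> star_words X" using assms by (auto simp: free_carrier_keys)
  have "E (f + g) = (\<Oplus>w\<in>?S. Poly_Mapping.lookup f w \<odot> ev (letters w) \<oplus> Poly_Mapping.lookup g w \<odot> ev (letters w))"
    using S evW by (subst E_super[OF S(1) Poly_Mapping.keys_add S(2)], intro M.finsum_cong') (auto simp: lookup_add sl)
  also have "\<dots> = E f \<oplus> E g"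
    using S evW by (subst M.finsum_addf) (auto simp: E_super[OF S(1) _ S(2)])
  finally show ?thesis .
qed

lemma E_0: "E 0 = \<zero>" by (simp add: free_eval_def)

lemma E_single: "w \<in> star_words X \<Longrightarrow> E (Poly_Mapping.single w a) = a \<odot> ev (letters w)"
  using evW by (subst E_super[of "{w}"]) auto

lemma E_scale: "f \<in> free_carrier X \<Longrightarrow> E (free_scale a f) = a \<odot> E f"
proof (induction f rule: free_induct)
  case 0 thus ?case by (simp add: E_0 free_scale_conv)
next
  case (add w b f)
  have "E (free_scale a (Poly_Mapping.single w b + f)) = E (Poly_Mapping.single w (a * b)) \<oplus> E (free_scale a f)"
  proof -
    have "free_scale a (Poly_Mapping.single w b) = Poly_Mapping.single w (a * b)"
      by (simp add: free_scale_conv mult_single)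
    thus ?thesis using add by (simp add: free_scale_add free_carrier_scale free_carrier_single E_add)
  qed
  thus ?case using add evW by (simp add: E_single E_add free_carrier_single sr sa)
qed

lemma W_plus: "u \<in> star_words X \<Longrightarrow> v \<in> star_words X \<Longrightarrow> u + v \<in> star_words X" by (auto simp: star_words_def plus_star_word_def)
lemma W_star: "u \<in> star_words X \<Longrightarrow> word_star u \<in> star_words X"
  using letters_word_star[of u] by (simp add: star_words_def letters_word_star_Nil)

lemma E_mult1: "g \<in> free_carrier X \<Longrightarrow> w \<in> star_words X \<Longrightarrow> E (Poly_Mapping.single w a * g) = (a \<odot> ev (letters w)) \<otimes> E g"
proof (induction g rule: free_induct)
  case 0 thus ?case by (simp add: E_0 evW)
next
  case (add v b g)
  have "ev (letters (w + v)) = ev (letters w) \<otimes> ev (letters v)"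
    using add by (simp add: plus_star_word_def star_words_def ev_append)
  thus ?case using add evW
    by (simp add: distrib_left mult_single E_add free_carrier_single free_carrier_mult W_plus E_single
       mult_add_right mult_smult_left mult_smult_right sa[symmetric] mult.commute)
qed

lemma E_mult: "f \<in> free_carrier X \<Longrightarrow> g \<in> free_carrier X \<Longrightarrow> E (f * g) = E f \<otimes> E g"
proof (induction f rule: free_induct)
  case 0 thus ?case by (simp add: E_0)
next
  case (add w a f) thus ?case using evW
    by (simp add: distrib_right E_add free_carrier_single free_carrier_mult E_mult1 E_single mult_add_left)
qed

lemma E_star: "f \<in> free_carrier X \<Longrightarrow> E (free_star f) = star A (E f)"
proof (induction f rule: free_induct)
  case 0 thus ?case by (simp add: E_0 free_star_0)
next
  case (add w a f)
  have "ev (letters (word_star w)) = star A (ev (letters w))"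
    using add by (simp add: star_words_def ev_star word_star_def)
  thus ?case using add evW
    by (simp add: free_star_add free_star_single E_add free_carrier_single free_carrier_star E_single W_star star_add star_smult)
qed

lemma E_gen: "x \<in> X \<Longrightarrow> E (free_gen x) = T x"
  unfolding free_gen_def using T by (subst E_single) (auto simp: star_words_def intro!: s1)

lemma E_diff: "f \<in> free_carrier X \<Longrightarrow> g \<in> free_carrier X \<Longrightarrow> E (f - g) = E f \<ominus> E g"
  using E_add[of f "free_scale (-1) g"] by (simp add: E_scale free_scale_minus1 free_carrier_scale[of g X "-1", simplified free_scale_minus1] diff E_scale[of g "-1", simplified free_scale_minus1])

lemma E_seminorm: "cstar_seminorm X (\<lambda>f. cnorm A (E f))"
  unfolding cstar_seminorm_def
  by (auto simp: norm_nonneg E_mult E_star free_carrier_star cstar_identity E_scale norm_smult E_add norm_triangle norm_mult)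

lemma hom_exists:
  assumes p: "cstar_seminorm X p" and le: "\<And>f. f \<in> free_carrier X \<Longrightarrow> cnorm A (E f) \<le> p f"
  shows "\<exists>\<phi> \<in> star_hom (completion X p) A. \<forall>x\<in>X. \<phi> (completion_gen X p x) = T x"
proof -
  interpret free_seminorm X p by unfold_locales (rule p)
  have cv_ex: "\<exists>y. conv_to (\<lambda>n. E (F n)) y" if F: "F \<in> CS" for F
  proof -
    have "\<exists>N. \<forall>m\<ge>N. \<forall>n\<ge>N. cnorm A (E (F m) \<ominus> E (F n)) < e" if "e > 0" for e
      using CSC[OF F that] le[OF free_carrier_diff[OF CSD[OF F] CSD[OF F]]] CSD[OF F]
      by (simp add: E_diff) (meson le_less_trans)
    with complete[of "\<lambda>n. E (F n)"] show ?thesis using CSD[OF F] by (auto simp: conv_to_def)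
  qed
  define \<phi> where "\<phi> u = (SOME y. conv_to (\<lambda>n. E (representative u n)) y)" for u
  have \<phi>: "\<phi> (cls F) = y" if F: "F \<in> CS" and y: "conv_to (\<lambda>n. E (F n)) y" for F y
  proof -
    note r = rep[OF F]
    have "conv_to (\<lambda>n. E (representative (cls F) n)) (\<phi> (cls F))"
      unfolding \<phi>_def using cv_ex[OF r(1)] by (rule someI_ex)
    moreover have "conv_to (\<lambda>n. E (representative (cls F) n)) y"
    proof -
      have t: "(\<lambda>n. p (representative (cls F) n - F n) + cnorm A (E (F n) \<ominus> y)) \<longlonglongrightarrow> 0"
        using tendsto_add[OF r(2), of "\<lambda>n. cnorm A (E (F n) \<ominus> y)" 0] y by (simp add: conv_to_def)
      have b: "cnorm A (E (representative (cls F) n) \<ominus> y) \<le> p (representative (cls F) n - F n) + cnorm A (E (F n) \<ominus> y)" for n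
        using ntri[of "E (representative (cls F) n)" "E (F n)" y] le[of "representative (cls F) n - F n"] CSD[OF F] CSD[OF r(1)] cvD[OF y]
        by (simp add: E_diff)
      have c: "0 \<le> cnorm A (E (representative (cls F) n) \<ominus> y)" for n
        using norm_nonneg CSD[OF r(1)] cvD[OF y] by simp
      have "(\<lambda>n. cnorm A (E (representative (cls F) n) \<ominus> y)) \<longlonglongrightarrow> 0"
        by (rule tendsto_sandwich[OF always_eventually always_eventually tendsto_const t]) (use b c in blast)+
      thus ?thesis using CSD[OF r(1)] cvD[OF y] by (auto simp: conv_to_def)
    qed
    ultimately show ?thesis by (rule cv_unique)
  qed
  have cvp: "conv_to (\<lambda>n. E (F n)) (\<phi> (cls F))" if "F \<in> CS" for F
    using cv_ex[OF that] \<phi>[OF that] by metis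
  have "\<phi> \<in> star_hom C A"
    unfolding star_hom_def
  proof (safe)
    fix x assume "x \<in> carrier C"
    then obtain F where F: "F \<in> CS" "x = cls F" by (rule carE)
    note D = CSD[OF F(1)]
    show "\<phi> x \<in> carrier A" using cvD(2)[OF cvp] F by simp
    show "\<phi> (star C x) = star A (\<phi> x)"
      using \<phi>[OF CS_star[OF F(1)]] cv_star[OF cvp[OF F(1)]] D F by (simp add: star_cls E_star)
    show "\<phi> (a \<odot>\<^bsub>C\<^esub> x) = a \<odot> \<phi> x" for a
      using \<phi>[OF CS_scale[OF F(1)]] cv_smult[OF cvp[OF F(1)]] D F by (simp add: smult_cls E_scale)
    fix y assume "y \<in> carrier C"
    then obtain H where H: "H \<in> CS" "y = cls H" by (rule carE)
    note D' = CSD[OF H(1)]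
    show "\<phi> (x \<oplus>\<^bsub>C\<^esub> y) = \<phi> x \<oplus> \<phi> y"
      using \<phi>[OF CS_add[OF F(1) H(1)]] cv_add[OF cvp[OF F(1)] cvp[OF H(1)]] D D' F H by (simp add: add_cls E_add)
    show "\<phi> (x \<otimes>\<^bsub>C\<^esub> y) = \<phi> x \<otimes> \<phi> y"
      using \<phi>[OF CS_mult[OF F(1) H(1)]] cv_mult[OF cvp[OF F(1)] cvp[OF H(1)]] D D' F H by (simp add: mult_cls E_mult)
  qed
  moreover have "\<phi> (completion_gen X p x) = T x" if "x \<in> X" for x
    unfolding completion_gen_def
    by (rule \<phi>) (use that T in \<open>auto simp: CS_const free_gen_carrier E_gen intro!: cv_const\<close>)
  ultimately show ?thesis by blast
qed

end

text \<open>The Cuntz--Krieger relations for the generators, read off from the seminorm.\<close>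

definition ck_rel where
 "ck_rel k \<Lambda> c p \<longleftrightarrow> 
     (\<forall>v\<in>vertices \<Lambda>. p (free_star (free_gen v) - free_gen v) = 0 \<and> p (free_gen v * free_gen v - free_gen v) = (0::real)) \<and>
     (\<forall>v\<in>vertices \<Lambda>. \<forall>w\<in>vertices \<Lambda>. v \<noteq> w \<longrightarrow> p (free_gen v * free_gen w) = 0) \<and>
     (\<forall>\<xi>\<in>morphs \<Lambda>. \<forall>\<mu>\<in>morphs \<Lambda>. src \<Lambda> \<xi> = rng \<Lambda> \<mu> \<longrightarrow>
        p (free_gen \<xi> * free_gen \<mu> - free_scale (c \<xi> \<mu>) (free_gen (pcomp \<Lambda> \<xi> \<mu>))) = 0) \<and>
     (\<forall>\<xi>\<in>morphs \<Lambda>. p (free_star (free_gen \<xi>) * free_gen \<xi> - free_gen (src \<Lambda> \<xi>)) = 0) \<and>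
     (\<forall>v\<in>vertices \<Lambda>. \<forall>n\<in>degrees k.
        p (free_gen v - (\<Sum>\<xi>\<in>paths_from \<Lambda> v n. free_gen \<xi> * free_star (free_gen \<xi>))) = 0)"

lemma free_carrier_sum: "(\<And>i. i \<in> S \<Longrightarrow> h i \<in> free_carrier X) \<Longrightarrow> sum h S \<in> free_carrier X"
  by (induction S rule: infinite_finite_induct) (auto simp: free_carrier_0 free_carrier_add)

context k_graph begin
lemma vm: "v \<in> vertices \<Lambda> \<Longrightarrow> v \<in> morphs \<Lambda>" by (simp add: vertices_def paths_def)
lemma pm: "v \<in> paths_from \<Lambda> w n \<Longrightarrow> v \<in> morphs \<Lambda>" by (simp add: paths_from_def paths_def)
lemma src_vertex: assumes "\<xi> \<in> morphs \<Lambda>" shows "src \<Lambda> \<xi> \<in> vertices \<Lambda>"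
  using deg_comp[OF assms src_closed[OF assms]] comp_src[OF assms] rng_src[OF assms] src_closed[OF assms]
  by (simp add: vertices_def paths_def fun_eq_iff)

lemmas fcl = free_carrier_mult free_carrier_star free_carrier_scale free_gen_carrier free_carrier_diff free_carrier_sum vm pm comp_closed src_closed

lemma ck_iff: assumes p: "cstar_seminorm (morphs \<Lambda>) p"
  shows "cuntz_krieger_family k \<Lambda> c (completion (morphs \<Lambda>) p) (completion_gen (morphs \<Lambda>) p) \<longleftrightarrow> ck_rel k \<Lambda> c p"
proof -
  interpret free_seminorm "morphs \<Lambda>" p by unfold_locales (rule p)
  let ?k = "\<lambda>f. cls (\<lambda>n. f)"
  interpret CA: cstar_algebra C by (rule completion_cstar)
  have eq: "?k f = ?k g \<longleftrightarrow> p (f - g) = 0" if "f \<in> F0" "g \<in> F0" for f g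
    using that by (simp add: cls_eq CS_const LIMSEQ_const_iff)
  have su: "finsum C (\<lambda>i. ?k (h i)) S = ?k (sum h S)" if "\<And>i. i \<in> S \<Longrightarrow> h i \<in> F0" for h :: "'b \<Rightarrow> _" and S
    using that
  proof (induction S rule: infinite_finite_induct)
    case (insert x S)
    have "finsum C (\<lambda>i. ?k (h i)) (insert x S) = ?k (h x) \<oplus>\<^bsub>C\<^esub> finsum C (\<lambda>i. ?k (h i)) S"
      using insert by (intro CA.M.finsum_insert) (auto intro!: cls_in CS_const)
    thus ?case using insert by (simp add: add_cls CS_const free_carrier_sum)
  qed (simp_all add: zero_cls CA.M.add.finprod_infinite)
  have k: "?k f \<otimes>\<^bsub>C\<^esub> ?k g = ?k (f * g)" "star C (?k f) = ?k (free_star f)" "a \<odot>\<^bsub>C\<^esub> ?k f = ?k (free_scale a f)"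
    if "f \<in> F0" "g \<in> F0" for f g a using that by (simp_all add: ops CS_const)
  note k = k(1) k(2)[OF _ free_carrier_0] k(3)[OF _ free_carrier_0]
  have fs: "finsum C (\<lambda>\<xi>. ?k (free_gen \<xi>) \<otimes>\<^bsub>C\<^esub> star C (?k (free_gen \<xi>))) (paths_from \<Lambda> v n)
     = ?k (\<Sum>\<xi>\<in>paths_from \<Lambda> v n. free_gen \<xi> * free_star (free_gen \<xi>))" for v n
  proof -
    have "finsum C (\<lambda>\<xi>. ?k (free_gen \<xi>) \<otimes>\<^bsub>C\<^esub> star C (?k (free_gen \<xi>))) (paths_from \<Lambda> v n) =
       finsum C (\<lambda>\<xi>. ?k (free_gen \<xi> * free_star (free_gen \<xi>))) (paths_from \<Lambda> v n)"
      by (rule CA.M.finsum_cong') (auto simp: fcl k intro!: cls_in CS_const)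
    thus ?thesis by (simp add: su fcl)
  qed
  show ?thesis
    unfolding cuntz_krieger_family_def ck_rel_def completion_gen_def fs
    by (auto simp: completion_cstar eq k fcl zero_cls cls_in CS_const)
qed

lemma ck_bound: assumes "f \<in> free_carrier (morphs \<Lambda>)"
  shows "\<exists>M. \<forall>p. cstar_seminorm (morphs \<Lambda>) p \<and> ck_rel k \<Lambda> c p \<longrightarrow> p f \<le> M"
  using assms
proof (induction f rule: free_induct)
  case 0 show ?case
    by (rule exI[of _ 0]) (auto simp: free_seminorm.p0[OF free_seminorm.intro])
next
  case (add w a f)
  then obtain M where M: "\<And>p. cstar_seminorm (morphs \<Lambda>) p \<and> ck_rel k \<Lambda> c p \<Longrightarrow> p f \<le> M" by blast
  show ?case
  proof (intro exI[of _ "cmod a + M"] allI impI)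
    fix p assume pp: "cstar_seminorm (morphs \<Lambda>) p \<and> ck_rel k \<Lambda> c p"
    then interpret free_seminorm "morphs \<Lambda>" p by unfold_locales auto
    have z: "p f = p g" if "p (f - g) = 0" "f \<in> F0" "g \<in> F0" for f g using prev[of f g] that by simp
    have sq: "x \<le> 1" if "x^2 = x" for x :: real using that by (auto simp: power2_eq_square)
    have v: "p (free_gen v) \<le> 1" if "v \<in> vertices \<Lambda>" for v
    proof -
      have g: "free_gen v \<in> F0" using that by (simp add: fcl)
      have v0: "p (free_star (free_gen v) - free_gen v) = 0" using pp that unfolding ck_rel_def by blast
      have "p (free_star (free_gen v) * free_gen v - free_gen v * free_gen v) \<le> p (free_star (free_gen v) - free_gen v) * p (free_gen v)"
        using free_seminorm.pm[OF free_seminorm.intro[OF conjunct1[OF pp]], of "free_star (free_gen v) - free_gen v" "free_gen v"] pp g by (simp add: left_diff_distrib)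
      hence "p (free_star (free_gen v) * free_gen v - free_gen v * free_gen v) = 0"
        using g nn[of "free_star (free_gen v) * free_gen v - free_gen v * free_gen v"] v0 by simp
      hence "p (free_star (free_gen v) * free_gen v) = p (free_gen v * free_gen v)" using g z by simp
      also have "\<dots> = p (free_gen v)" using pp that g by (intro z) (auto simp: ck_rel_def)
      finally show ?thesis using sq pc[OF g] by simp
    qed
    have l: "p (free_gen \<xi>) \<le> 1" if "\<xi> \<in> morphs \<Lambda>" for \<xi>
    proof -
      have "(p (free_gen \<xi>))^2 = p (free_gen (src \<Lambda> \<xi>))"
        using pp that z pc by (auto simp: ck_rel_def fcl simp flip: pc)
      also have "\<dots> \<le> 1" using v src_vertex that by simp
      finally show ?thesis by (simp add: abs_square_le_1)
    qed
    have "p (Poly_Mapping.single (Word l) 1) \<le> 1" if "Word l \<in> star_words (morphs \<Lambda>)" for l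
      using that
    proof (induction l)
      case (Cons y l)
      obtain x b where y: "y = (x, b)" by (cases y)
      have x: "x \<in> morphs \<Lambda>" using Cons.prems by (auto simp: star_words_def y)
      have s: "p (Poly_Mapping.single (Word [y]) 1) \<le> 1"
      proof (cases b)
        case True
        have "Poly_Mapping.single (Word [y]) 1 = free_star (free_gen x)"
          by (simp add: free_gen_def free_star_single y True word_star_def)
        thus ?thesis using l[OF x] x by (simp add: pstar fcl)
      next
        case False thus ?thesis using l[OF x] by (simp add: free_gen_def y)
      qed
      show ?case
      proof (cases l)
        case Nil thus ?thesis using s by simp
      next
        case (Cons z l')
        have Wl: "Word l \<in> star_words (morphs \<Lambda>)" "Word [y] \<in> star_words (morphs \<Lambda>)" using Cons.prems Cons by (auto simp: star_words_def)
        have "Poly_Mapping.single (Word (y # l)) (1::complex) = Poly_Mapping.single (Word [y]) 1 * Poly_Mapping.single (Word l) 1"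
          by (simp add: mult_single plus_star_word_def)
        hence "p (Poly_Mapping.single (Word (y # l)) 1) \<le> p (Poly_Mapping.single (Word [y]) 1) * p (Poly_Mapping.single (Word l) 1)"
          using free_seminorm.pm[OF free_seminorm.intro[OF conjunct1[OF pp]]] Wl by (simp add: free_carrier_single)
        also have "\<dots> \<le> 1" using s Cons.IH Wl nn free_carrier_single by (intro mult_le_one) auto
        finally show ?thesis .
      qed
    qed (simp add: star_words_def)
    hence "p (Poly_Mapping.single w 1) \<le> 1" using add.hyps by (cases w) auto
    moreover have "Poly_Mapping.single w a = free_scale a (Poly_Mapping.single w 1)" by (simp add: free_scale_conv mult_single)
    ultimately have "p (Poly_Mapping.single w a) \<le> cmod a"
      using ps[OF free_carrier_single[OF add.hyps(1)], of a 1] mult_left_le[of "p (Poly_Mapping.single w 1)" "cmod a"] by simp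
    thus "p (Poly_Mapping.single w a + f) \<le> cmod a + M"
      using pt[of "Poly_Mapping.single w a" f] M[OF pp] add.hyps free_carrier_single by fastforce
  qed
qed

abbreviation (input) "ck_seminorms c \<equiv> {p. cstar_seminorm (morphs \<Lambda>) p \<and> ck_rel k \<Lambda> c p}"

lemma universal_ck_seminorm_eq: "universal_seminorm (morphs \<Lambda>) (cuntz_krieger_family k \<Lambda> c) f = (SUP p\<in>ck_seminorms c. p f)"
  unfolding universal_seminorm_def by (rule arg_cong[of _ _ Sup]) (use ck_iff in auto)

lemma zeroP: "(\<lambda>_. 0) \<in> ck_seminorms c" by (auto simp: cstar_seminorm_def ck_rel_def)

lemma bdd: "f \<in> free_carrier (morphs \<Lambda>) \<Longrightarrow> bdd_above ((\<lambda>p. p f) ` ck_seminorms c)"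
  using ck_bound[of f c] by (auto simp: bdd_above_def)

lemma universal_ck_seminorm: "universal_seminorm (morphs \<Lambda>) (cuntz_krieger_family k \<Lambda> c) \<in> ck_seminorms c"
proof -
  let ?u = "universal_seminorm (morphs \<Lambda>) (cuntz_krieger_family k \<Lambda> c)"
  let ?F = "free_carrier (morphs \<Lambda>)"
  have up: "p f \<le> ?u f" if "p \<in> ck_seminorms c" "f \<in> ?F" for p f
    unfolding universal_ck_seminorm_eq using that bdd by (intro cSUP_upper) auto
  have le: "?u f \<le> M" if "\<And>p. p \<in> ck_seminorms c \<Longrightarrow> p f \<le> M" for f M
    unfolding universal_ck_seminorm_eq using that zeroP by (intro cSUP_least) auto
  have nn: "0 \<le> ?u f" if "f \<in> ?F" for f using up[OF zeroP that] by simp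
  have zero: "?u f = 0" if "\<And>p. p \<in> ck_seminorms c \<Longrightarrow> p f = 0" "f \<in> ?F" for f
    using le[of f 0] nn[of f] that by fastforce
  have free_seminorm: "free_seminorm (morphs \<Lambda>) p" if "p \<in> ck_seminorms c" for p using that by (simp add: free_seminorm_def)
  have "cstar_seminorm (morphs \<Lambda>) ?u"
    unfolding cstar_seminorm_def
  proof (intro ballI conjI allI)
    fix f assume f: "f \<in> ?F"
    show "0 \<le> ?u f" by (rule nn[OF f])
    show "?u (free_star f * f) = (?u f)\<^sup>2"
    proof (rule antisym)
      show "?u (free_star f * f) \<le> (?u f)\<^sup>2"
      proof (rule le)
        fix p assume pP: "p \<in> ck_seminorms c"
        show "p (free_star f * f) \<le> (?u f)\<^sup>2"
          unfolding free_seminorm.pc[OF free_seminorm[OF pP] f] by (intro power_mono up[OF pP f] free_seminorm.nn[OF free_seminorm[OF pP] f])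
      qed
      have "?u f \<le> sqrt (?u (free_star f * f))"
      proof (rule le)
        fix p assume p: "p \<in> ck_seminorms c"
        have "(p f)^2 \<le> ?u (free_star f * f)" using up[OF p, of "free_star f * f"] free_seminorm.pc[OF free_seminorm[OF p] f] f by (simp add: fcl)
        thus "p f \<le> sqrt (?u (free_star f * f))" by (rule real_le_rsqrt)
      qed
      thus "(?u f)\<^sup>2 \<le> ?u (free_star f * f)"
        using nn[OF f] nn[of "free_star f * f"] f by (simp add: fcl real_le_lsqrt sqrt_le_D power_mono[of "?u f" _ 2, THEN order_trans])
    qed
    show "?u (free_scale a f) = cmod a * ?u f" for a
    proof (rule antisym)
      show "?u (free_scale a f) \<le> cmod a * ?u f"
      proof (rule le)
        fix p assume pP: "p \<in> ck_seminorms c"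
        show "p (free_scale a f) \<le> cmod a * ?u f"
          unfolding free_seminorm.ps[OF free_seminorm[OF pP] f] by (intro mult_left_mono up[OF pP f]) simp
      qed
      show "cmod a * ?u f \<le> ?u (free_scale a f)"
      proof (cases "a = 0")
        case True thus ?thesis using nn[of "free_scale a f"] f by (simp add: fcl)
      next
        case False
        have "?u f \<le> ?u (free_scale a f) / cmod a"
        proof (rule le)
          fix p assume pP: "p \<in> ck_seminorms c"
          have "p (free_scale a f) \<le> ?u (free_scale a f)" using up[OF pP] f by (simp add: fcl)
          thus "p f \<le> ?u (free_scale a f) / cmod a"
            unfolding free_seminorm.ps[OF free_seminorm[OF pP] f] using False by (simp add: pos_le_divide_eq mult.commute)
        qed
        thus ?thesis using False by (simp add: pos_le_divide_eq mult.commute)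
      qed
    qed
    fix g assume g: "g \<in> ?F"
    show "?u (f + g) \<le> ?u f + ?u g"
    proof (rule le)
      fix p assume pP: "p \<in> ck_seminorms c"
      show "p (f + g) \<le> ?u f + ?u g"
        using free_seminorm.pt[OF free_seminorm[OF pP] f g] up[OF pP f] up[OF pP g] by linarith
    qed
    show "?u (f * g) \<le> ?u f * ?u g"
    proof (rule le)
      fix p assume pP: "p \<in> ck_seminorms c"
      show "p (f * g) \<le> ?u f * ?u g"
        by (rule order_trans[OF free_seminorm.pm[OF free_seminorm[OF pP] f g] mult_mono[OF up[OF pP f] up[OF pP g] nn[OF f] free_seminorm.nn[OF free_seminorm[OF pP] g]]])
    qed
  qed
  moreover have "ck_rel k \<Lambda> c ?u"
    unfolding ck_rel_def by (intro conjI ballI impI; rule zero) (auto simp: ck_rel_def fcl)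
  ultimately show ?thesis by simp
qed

theorem twisted_graph_family_ck: "cuntz_krieger_family k \<Lambda> c (twisted_graph_cstar k \<Lambda> c) (twisted_graph_family k \<Lambda> c)"
  unfolding twisted_graph_cstar_def twisted_graph_family_def universal_cstar_def universal_family_def
  using universal_ck_seminorm ck_iff by simp

theorem twisted_graph_cstar_universal: assumes ck: "cuntz_krieger_family k \<Lambda> c A T"
  shows "\<exists>\<phi> \<in> star_hom (twisted_graph_cstar k \<Lambda> c) A. \<forall>\<xi>\<in>morphs \<Lambda>. \<phi> (twisted_graph_family k \<Lambda> c \<xi>) = T \<xi>"
proof -
  interpret cstar_family A "morphs \<Lambda>" T
    using ck by (simp add: cuntz_krieger_family_def cstar_family_def cstar_family_axioms_def)
  let ?u = "universal_seminorm (morphs \<Lambda>) (cuntz_krieger_family k \<Lambda> c)"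
  have E_sum: "E (sum h S) = finsum A (\<lambda>i. E (h i)) S" if "\<And>i. i \<in> S \<Longrightarrow> h i \<in> free_carrier (morphs \<Lambda>)" for h :: "'b \<Rightarrow> _" and S
    using that
  proof (induction S rule: infinite_finite_induct)
    case (insert x S) thus ?case by (simp add: E_add free_carrier_sum Pi_def)
  qed (simp_all add: E_0 M.add.finprod_infinite)
  have "(\<lambda>f. cnorm A (E f)) \<in> ck_seminorms c"
    using ck E_seminorm T
    by (auto simp: cuntz_krieger_family_def ck_rel_def E_diff E_mult E_star E_scale E_gen E_sum fcl diff0 norm_eq_zero_iff
        Pi_def cong: finsum_cong)
  hence "cnorm A (E f) \<le> ?u f" if "f \<in> free_carrier (morphs \<Lambda>)" for f
    unfolding universal_ck_seminorm_eq using that bdd by (intro cSUP_upper2[of _ _ "\<lambda>f. cnorm A (E f)"]) auto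
  thus ?thesis
    unfolding twisted_graph_cstar_def twisted_graph_family_def universal_cstar_def universal_family_def
    using universal_ck_seminorm by (intro hom_exists) auto
qed

end


section \<open>Cocycles and deformation\<close>

lemma functor_cocycle_is_cocycle:
  assumes "k_graph k \<Lambda>" "graph_functor \<Lambda> G \<eta>" "\<sigma> \<in> two_cocycles G"
  shows "categorical_2_cocycle \<Lambda> (functor_cocycle \<sigma> \<eta>)"
proof -
  interpret k_graph k \<Lambda> by fact
  have v: "src \<Lambda> \<xi> \<in> vertices \<Lambda>" "rng \<Lambda> \<xi> \<in> vertices \<Lambda>" if "\<xi> \<in> morphs \<Lambda>" for \<xi>
    using deg_comp[OF that src_closed[OF that]] comp_src[OF that] rng_src[OF that] src_closed[OF that]
      deg_comp[OF rng_closed[OF that] that] comp_rng[OF that] src_rng[OF that] rng_closed[OF that]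
    by (simp_all add: vertices_def paths_def fun_eq_iff)
  show ?thesis
    using assms(2,3) v unfolding categorical_2_cocycle_def functor_cocycle_def graph_functor_def two_cocycles_def
    by (auto simp: Pi_iff mult.commute)
qed

theorem (in fell_bundle) deform_fell_bundle:
  assumes \<sigma>: "\<sigma> \<in> two_cocycles G"
  shows "fell_bundle G (deform G B \<sigma>)"
proof -
  let ?D = "deform G B \<sigma>"
  have s1: "cmod (\<sigma> g h) = 1" "\<sigma> \<one> g = 1" "\<sigma> g \<one> = 1" if "g \<in> carrier G" "h \<in> carrier G" for g h
    using \<sigma> that by (auto simp: two_cocycles_def)
  have sc: "\<sigma> g h * \<sigma> (g \<otimes> h) k = \<sigma> g (h \<otimes> k) * \<sigma> h k" if "g \<in> carrier G" "h \<in> carrier G" "k \<in> carrier G" for g h k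
    using \<sigma> that by (auto simp: two_cocycles_def)
  have cc: "cnj (\<sigma> g h) * \<sigma> g h = 1" if "g \<in> carrier G" "h \<in> carrier G" for g h
    using s1[OF that] by (metis complex_norm_square mult.commute of_real_1 one_power2)
  have inv: "\<sigma> g (inv g) = \<sigma> (inv g) g" if g: "g \<in> carrier G" for g
    using sc[of g "inv g" g] s1[of g g] g by simp
  have f: "fibre ?D = fibre B" "fibre_module ?D = fibre_module B" "btotal ?D = btotal B" "bproj ?D = bproj B"
    "bnorm ?D = bnorm B" "badd ?D = badd B" "bscale ?D = bscale B" "bzero ?D = bzero B"
    by (auto simp: deform_def fibre_def fibre_module_def fun_eq_iff)
  have m: "bmult ?D b c = bscale B (\<sigma> (bproj B b) (bproj B c)) (bmult B b c)"
     "bstar ?D b = bscale B (cnj (\<sigma> (bproj B b) (inv (bproj B b)))) (bstar B b)" for b c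
    by (simp_all add: deform_def)
  have mod: "Module.module complex_ring (fibre_module B (bproj B b))" if "b \<in> btotal B" for b
    using fibre_vector_space proj_closed that by blast
  have mem: "b \<in> fibre B g \<longleftrightarrow> b \<in> btotal B \<and> bproj B b = g" for b g by (auto simp: fibre_def)
  have scl: "bscale B a b \<in> btotal B" "bproj B (bscale B a b) = bproj B b" if "b \<in> btotal B" for a b
    using module.smult_closed[OF mod[OF that], of a b] that by (auto simp: fibre_module_def complex_ring_def fibre_def)
  have scsc: "bscale B a (bscale B a' b) = bscale B (a * a') b" if "b \<in> btotal B" for a a' b
    using module.smult_assoc1[OF mod[OF that], of a a' b] that by (auto simp: fibre_module_def complex_ring_def fibre_def)
  have sc1: "bscale B 1 b = b" if "b \<in> btotal B" for b
    using module.smult_one[OF mod[OF that], of b] that by (auto simp: fibre_module_def complex_ring_def fibre_def)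
  have scadd: "bscale B a (badd B b c) = badd B (bscale B a b) (bscale B a c)" if "b \<in> btotal B" "c \<in> btotal B" "bproj B b = bproj B c" for a b c
    using module.smult_r_distr[OF mod[OF that(1)], of a b c] that by (auto simp: fibre_module_def complex_ring_def fibre_def)
  have addcl: "badd B b c \<in> btotal B \<and> bproj B (badd B b c) = bproj B b" if "b \<in> btotal B" "c \<in> btotal B" "bproj B b = bproj B c" for b c
  proof -
    interpret M: Module.module complex_ring "fibre_module B (bproj B b)" by (rule mod[OF that(1)])
    show ?thesis using M.M.a_closed[of b c] that by (simp add: fibre_module_def fibre_def)
  qed
  have mc: "bmult B b c \<in> btotal B" "bproj B (bmult B b c) = bproj B b \<otimes> bproj B c" if "b \<in> btotal B" "c \<in> btotal B" for b c
    using bmult_closed[OF that] by (auto simp: mem)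
  have stc: "bstar B b \<in> btotal B" "bproj B (bstar B b) = inv (bproj B b)" if "b \<in> btotal B" for b
    using bstar_closed[OF that] by (auto simp: mem)
  note P = proj_closed
  note R = scl scsc mc stc P bmult_scale_left bmult_scale_right bstar_scale scadd addcl
  have D: "bmult ?D (bstar ?D b) b = bmult B (bstar B b) b" if b: "b \<in> btotal B" for b
    using b inv[of "bproj B b"] cc[of "inv (bproj B b)" "bproj B b"]
    by (simp add: m R mult.commute sc1)
  show ?thesis
    unfolding fell_bundle_def fell_bundle_axioms_def f
  proof (intro conjI allI impI)
    show "Group.group G" by (rule is_group)
    fix b assume b: "b \<in> btotal B"
    note gb = P[OF b]
    show "bstar ?D b \<in> fibre B (inv bproj B b)" using b by (simp add: m mem R)
    show "bstar ?D (bstar ?D b) = b"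
      using b gb inv[of "bproj B b"] cc[of "inv (bproj B b)" "bproj B b"]
      by (simp add: m R bstar_bstar sc1)
    show "bstar ?D (bscale B a b) = bscale B (cnj a) (bstar ?D b)" for a
      using b by (simp add: m R mult.commute)
    show "bnorm B (bmult ?D (bstar ?D b) b) = (bnorm B b)\<^sup>2"
      using b by (simp add: D bnorm_bstar_mult)
    show "\<exists>a\<in>fibre B \<one>. bmult ?D (bstar ?D b) b = bmult ?D (bstar ?D a) a"
      using bstar_mult_positive[OF b] b by (auto simp: D mem)
    fix c assume c: "c \<in> btotal B"
    note gc = P[OF c]
    show "bmult ?D b c \<in> fibre B (bproj B b \<otimes> bproj B c)" using b c by (simp add: m mem R)
    show "bmult ?D (bscale B a b) c = bscale B a (bmult ?D b c)" for a using b c by (simp add: m R mult.commute)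
    show "bmult ?D b (bscale B a c) = bscale B a (bmult ?D b c)" for a using b c by (simp add: m R mult.commute)
    show "bnorm B (bmult ?D b c) \<le> bnorm B b * bnorm B c"
      using b c gb gc s1 bnorm_mult by (simp add: m R fibre_norm_scale)
    show "bstar ?D (bmult ?D b c) = bmult ?D (bstar ?D c) (bstar ?D b)"
    proof -
      let ?g = "bproj B b" and ?h = "bproj B c"
      have i: "inv (?g \<otimes> ?h) = inv ?h \<otimes> inv ?g" using gb gc by (simp add: inv_mult_group)
      have "?g \<otimes> ?h \<otimes> inv ?h = ?g" using gb gc by (simp add: m_assoc)
      hence "\<sigma> (?g \<otimes> ?h) (inv ?h) * \<sigma> ?g (inv ?g) = \<sigma> (?g \<otimes> ?h) (inv ?h \<otimes> inv ?g) * \<sigma> (inv ?h) (inv ?g)"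
        using sc[of "?g \<otimes> ?h" "inv ?h" "inv ?g"] gb gc by simp
      moreover have "\<sigma> ?g ?h * \<sigma> (?g \<otimes> ?h) (inv ?h) = \<sigma> ?h (inv ?h)"
        using sc[of ?g ?h "inv ?h"] s1[of ?g ?g] gb gc by simp
      ultimately have e: "\<sigma> ?g ?h * \<sigma> (?g \<otimes> ?h) (inv ?h \<otimes> inv ?g) * \<sigma> (inv ?h) (inv ?g) = \<sigma> ?h (inv ?h) * \<sigma> ?g (inv ?g)"
        by (metis mult.assoc mult.left_commute)
      have "cnj (\<sigma> ?g ?h) * cnj (\<sigma> (?g \<otimes> ?h) (inv ?h \<otimes> inv ?g)) =
         (cnj (\<sigma> ?g ?h) * cnj (\<sigma> (?g \<otimes> ?h) (inv ?h \<otimes> inv ?g)) * cnj (\<sigma> (inv ?h) (inv ?g))) * \<sigma> (inv ?h) (inv ?g)"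
        using cc[of "inv ?h" "inv ?g"] gb gc by simp
      also have "\<dots> = cnj (\<sigma> ?h (inv ?h) * \<sigma> ?g (inv ?g)) * \<sigma> (inv ?h) (inv ?g)"
        unfolding e[symmetric] by simp
      finally have "cnj (\<sigma> ?g ?h) * cnj (\<sigma> (?g \<otimes> ?h) (inv ?h \<otimes> inv ?g)) = cnj (\<sigma> ?h (inv ?h)) * cnj (\<sigma> ?g (inv ?g)) * \<sigma> (inv ?h) (inv ?g)"
        by simp
      thus ?thesis using b c gb gc by (simp add: m R i bstar_mult ac_simps)
    qed
    fix d assume d: "d \<in> btotal B"
    note gd = P[OF d]
    show "bmult ?D (bmult ?D b c) d = bmult ?D b (bmult ?D c d)"
      using b c d gb gc gd sc[of "bproj B b" "bproj B c" "bproj B d"] by (simp add: m R bmult_assoc ac_simps)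
  next
    fix b c g assume b: "b \<in> fibre B g" and c: "c \<in> fibre B g"
    show "bstar ?D (badd B b c) = badd B (bstar ?D b) (bstar ?D c)"
      using b c by (simp add: m mem R bstar_add[of b g c])
    fix d assume d: "d \<in> btotal B"
    show "bmult ?D (badd B b c) d = badd B (bmult ?D b d) (bmult ?D c d)"
      using b c d by (simp add: m mem R bmult_add_left[of b g c])
  next
    fix b c d g assume b: "b \<in> btotal B" and c: "c \<in> fibre B g" and d: "d \<in> fibre B g"
    show "bmult ?D b (badd B c d) = badd B (bmult ?D b c) (bmult ?D b d)"
      using b c d by (simp add: m mem R bmult_add_right[of b c g d])
  next
    fix b a assume b: "b \<in> btotal B"
    show "bproj B b \<in> carrier G" by (rule proj_closed[OF b])
    show "0 \<le> bnorm B b" by (rule fibre_norm_nonneg[OF b])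
    show "bnorm B (bscale B a b) = cmod a * bnorm B b" by (rule fibre_norm_scale[OF b])
  next
    fix b c g assume b: "b \<in> fibre B g"
    show "(bnorm B b = 0) = (b = bzero B g)" by (rule fibre_norm_zero[OF b])
    assume "c \<in> fibre B g"
    thus "bnorm B (badd B b c) \<le> bnorm B b + bnorm B c" by (rule fibre_norm_triangle[OF b])
  next
    fix g assume "g \<in> carrier G"
    thus "Module.module complex_ring (fibre_module B g)" by (rule fibre_vector_space)
  next
    fix g and X :: "nat \<Rightarrow> 'b"
    assume "g \<in> carrier G" "\<forall>n. X n \<in> fibre B g"
      "\<forall>e>0. \<exists>N. \<forall>m\<ge>N. \<forall>n\<ge>N. bnorm B (X m \<ominus>\<^bsub>fibre_module B g\<^esub> X n) < e"
    thus "\<exists>x \<in> fibre B g. (\<lambda>n. bnorm B (X n \<ominus>\<^bsub>fibre_module B g\<^esub> x)) \<longlonglongrightarrow> 0"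
      by (intro fibre_complete) auto
  qed
qed

end

theory Submission
  imports Defs
begin

text \<open>The elements \<open>t\<^sub>\<lambda>\<close> form a Cuntz--Krieger \<open>(\<Lambda>, c\<^sub>\<sigma>)\<close>-family, because the factors
  \<open>\<sigma> (\<eta> \<lambda>) (\<eta> \<mu>)\<close> come from the deformed product; this gives a homomorphism from
  \<open>C*(\<Lambda>, c\<^sub>\<sigma>)\<close>.  Its inverse needs a representation of \<open>B(\<sigma>)\<close> that sends
  \<open>s\<^sub>\<lambda> s\<^sub>\<mu>\<^sup>*\<close> to a phase times \<open>T\<^sub>\<lambda> T\<^sub>\<mu>\<^sup>*\<close>.  To see that this prescription is contractive on each
  fibre, let \<open>T\<^sub>\<lambda>\<close> act with the twisted regular representation of \<open>G\<close>: the tensor product satisfies the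
  untwisted Cuntz--Krieger relations, hence defines a C*-seminorm below the norm of \<open>C*(\<Lambda>)\<close>, and on
  elements of a fixed degree this seminorm dominates the norm of their image in \<open>C*(\<Lambda>, c\<^sub>\<sigma>)\<close>.

  The pre-Hilbert module of this representation is the free *-algebra itself, graded by \<open>G\<close>, with
  values in \<open>C*(\<Lambda>, c\<^sub>\<sigma>)\<close>.  Its Cauchy--Schwarz inequality rests on the positivity of \<open>x\<^sup>* x\<close> in
  C*-algebras, obtained in the free unital *-algebra by power series estimates that avoid
  spectral theory.\<close>

section \<open>Positivity in a C*-seminorm\<close>

text \<open>An element of a fibre is a limit of many different polynomials in the generators, so
  well-definedness and continuity of the prescription both reduce to the single inequality
  \<open>norm_twist_le\<close>. The universal property of \<open>graph_cstar\<close> bounds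
  untwisted families only, whereas \<open>T\<close> is twisted by sigma; the regular representation
  is twisted by \<open>cnj \<sigma>\<close> so that the two factors cancel. A homogeneous element
  then acts as one coefficient times a unitary shift, hence its coefficient can be recovered from
  its operator norm.

  A vector v of the module stands for v applied to the unit at the basis vector of the identity of
  G; its component at g is the evaluation of \<open>twist g v\<close>. Operators and vectors are
  therefore both polynomials, and adjointness is an identity between words.

  The norm axioms contain only the C*-identity, so order properties must be derived. The empty word
  supplies a unit for every algebra, which permits measuring positivity of p by the distance of p
  from t 1. Roots are needed only approximately, but they must commute with whatever the radicand
  commutes with.\<close>

definition self_adjoint :: "'x free_star \<Rightarrow> bool" where
  "self_adjoint f \<longleftrightarrow> free_star f = f"

lemma free_star_1: "free_star 1 = 1"
proof -
  have "free_star (Poly_Mapping.single 0 1) = Poly_Mapping.single 0 (1::complex)"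
    unfolding free_star_single by (simp add: word_star_def zero_star_word_def)
  thus ?thesis by simp
qed

lemma free_star_minus: "free_star (- f) = - free_star f"
  using free_star_diff[of 0 f] by (simp add: free_star_0)

lemma free_star_sum: "free_star (sum f A) = (\<Sum>x\<in>A. free_star (f x))"
  by (induction A rule: infinite_finite_induct) (simp_all add: free_star_0 free_star_add)

lemma free_scale_sum: "free_scale a (sum f A) = (\<Sum>x\<in>A. free_scale a (f x))"
  by (induction A rule: infinite_finite_induct) (simp_all add: free_scale_add, simp_all add: free_scale_conv)

lemma free_scale_minus_left: "free_scale (- a) f = - free_scale a f"
  by (rule poly_mapping_eqI) (simp add: lookup_free_scale)

lemma free_scale_half: "free_scale (1/2) f + free_scale (1/2) f = f"
  unfolding free_scale_add_left[symmetric] by (simp add: free_scale_one)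

lemma free_star_power: "free_star (f ^ n) = free_star f ^ n"
  by (induction n) (simp_all add: free_star_1 free_star_mult power_commutes)

lemma free_scale_of_nat: "free_scale (of_nat n) f = of_nat n * f"
  by (induction n) (simp_all add: free_scale_0 free_scale_add_left free_scale_one distrib_right)

lemmas free_star_simps = free_star_add free_star_diff free_star_mult free_star_free_star free_star_scale
  free_star_0 free_star_1 free_star_minus free_star_power free_star_sum

lemma self_adjoint_intros [intro]:
  "self_adjoint 0" "self_adjoint 1"
  "self_adjoint f \<Longrightarrow> self_adjoint g \<Longrightarrow> self_adjoint (f + g)"
  "self_adjoint f \<Longrightarrow> self_adjoint g \<Longrightarrow> self_adjoint (f - g)"
  "self_adjoint f \<Longrightarrow> self_adjoint (free_scale (complex_of_real r) f)"
  "self_adjoint f \<Longrightarrow> self_adjoint (f * f)"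
  "self_adjoint f \<Longrightarrow> self_adjoint (f ^ n)"
  "self_adjoint (free_star f * f)" "self_adjoint (f * free_star f)"
  by (auto simp: self_adjoint_def free_star_simps)

text \<open>The empty word is the unit, so a seminorm on all finitely supported functions gives
  meaning to expressions such as 1 - g even where the C*-algebra behind it has no unit.\<close>

locale unital_seminorm =
  fixes q :: "'x free_star \<Rightarrow> real"
  assumes tri: "q (f + g) \<le> q f + q g"
    and submult: "q (f * g) \<le> q f * q g"
    and cstar: "q (free_star f * f) = (q f)\<^sup>2"
    and scale: "q (free_scale a f) = cmod a * q f"
begin

lemma q_0 [simp]: "q 0 = 0" using scale[of 0 0] by (simp add: free_scale_0)
lemma q_minus [simp]: "q (- f) = q f" using scale[of "-1" f] by (simp add: free_scale_minus1)
lemma q_nonneg [simp]: "0 \<le> q f" using tri[of f "- f"] by simp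
lemma q_scale_real: "q (free_scale (complex_of_real r) f) = \<bar>r\<bar> * q f" by (simp add: scale)
lemma q_diff_sym: "q (f - g) = q (g - f)" using q_minus[of "f - g"] by simp
lemma q_le_diff: "q f \<le> q g + q (f - g)" using tri[of g "f - g"] by simp

lemma q_star [simp]: "q (free_star f) = q f"
proof -
  have *: "q f \<le> q (free_star f)" for f
  proof (cases "q f = 0")
    case False
    hence "0 < q f" using q_nonneg[of f] by linarith
    moreover have "q f * q f \<le> q (free_star f) * q f"
      using cstar[of f] submult[of "free_star f" f] by (simp add: power2_eq_square)
    ultimately show ?thesis by simp
  qed simp
  show ?thesis using *[of f] *[of "free_star f"] by (simp add: free_star_free_star)
qed

lemma q_1: "q 1 \<le> 1"
proof -
  have "q 1 * q 1 = q 1" using cstar[of 1] by (simp add: free_star_1 power2_eq_square)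
  thus ?thesis using q_nonneg[of 1] by (metis mult_cancel_right1 order_refl zero_le_one)
qed

lemma q_square: "self_adjoint f \<Longrightarrow> q (f * f) = (q f)\<^sup>2"
  using cstar[of f] by (simp add: self_adjoint_def)

text \<open>If \<open>h\<close> and \<open>k\<close> commute, then \<open>h + ik\<close> is normal and \<open>h\<close> is its real part.\<close>

lemma q_real_part:
  assumes "self_adjoint h" "self_adjoint k"
  shows "(q h)\<^sup>2 \<le> q (h * h + k * k) + q (h * k - k * h)"
proof -
  let ?u = "h + free_scale \<i> k"
  have st: "free_star ?u = h - free_scale \<i> k"
    using assms by (simp add: self_adjoint_def free_star_simps free_scale_minus_left)
  have e: "free_star ?u * ?u = (h * h + k * k) + free_scale \<i> (h * k - k * h)"
  proof -
    have "free_scale \<i> (free_scale \<i> (k * k)) = - (k * k)"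
      by (simp add: free_scale_scale free_scale_minus1)
    thus ?thesis unfolding st
      by (simp add: algebra_simps free_scale_mult_left free_scale_mult_right free_scale_diff)
  qed
  have "(q ?u)\<^sup>2 \<le> q (h * h + k * k) + q (h * k - k * h)"
    using tri[of "h * h + k * k" "free_scale \<i> (h * k - k * h)"] cstar[of ?u] by (simp add: e scale)
  moreover have "q h \<le> q ?u"
  proof -
    have "free_scale (1/2) (?u + free_star ?u) = h"
      unfolding st by (simp add: free_scale_add free_scale_half)
    from scale[of "1/2" "?u + free_star ?u", unfolded this] show ?thesis
      using tri[of ?u "free_star ?u"] by simp
  qed
  ultimately show ?thesis by (meson power_mono q_nonneg order_trans)
qed

end

text \<open>The iterates converge to the solution \<open>z\<close> of \<open>2 z = g + z\<^sup>2\<close>, that is \<open>(1 - z)\<^sup>2 = 1 - g\<close>.\<close>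

primrec sqrt_iter :: "'x free_star \<Rightarrow> nat \<Rightarrow> 'x free_star" where
  "sqrt_iter g 0 = 0"
| "sqrt_iter g (Suc n) = free_scale (1/2) (g + sqrt_iter g n * sqrt_iter g n)"

lemma self_adjoint_sqrt_iter: "self_adjoint g \<Longrightarrow> self_adjoint (sqrt_iter g n)"
  using self_adjoint_intros(5)[of "g + sqrt_iter g n * sqrt_iter g n" "1/2" for n]
  by (induction n) auto

lemma free_carrier_sqrt_iter: "g \<in> free_carrier X \<Longrightarrow> sqrt_iter g n \<in> free_carrier X"
  by (induction n) (auto intro: free_carrier_0 free_carrier_scale free_carrier_add free_carrier_mult)

lemma sqrt_iter_double: "sqrt_iter g (Suc n) + sqrt_iter g (Suc n) = g + sqrt_iter g n * sqrt_iter g n"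
  by (simp add: free_scale_half)

lemma sqrt_iter_commute:
  assumes "x * g = g * x" shows "x * sqrt_iter g n = sqrt_iter g n * x"
proof (induction n)
  case (Suc n)
  have "x * (sqrt_iter g n * sqrt_iter g n) = (sqrt_iter g n * sqrt_iter g n) * x" using Suc by (metis mult.assoc)
  thus ?case using assms by (simp add: free_scale_mult_left free_scale_mult_right distrib_left distrib_right)
qed simp

section \<open>Approximate square roots, positivity and the Cauchy-Schwarz inequality\<close>

context unital_seminorm begin

text \<open>With r = q g the iterates stay in the ball of radius r because (r + r^2)/2 <= r. A
  difference of squares z z - y y splits as z (z - y) + (z - y) y, so every further step shrinks by
  the factor r.\<close>

lemma q_sqrt_iter_step:
  assumes g: "q g < 1"
  shows "q (sqrt_iter g (Suc n) - sqrt_iter g n) \<le> q g ^ Suc n"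
proof (induction n)
  case 0 thus ?case by (simp add: scale)
next
  case (Suc n)
  let ?z = "sqrt_iter g"
  have bd: "q (?z n) \<le> q g" for n
  proof (induction n)
    case (Suc n)
    have "q (?z n) * q (?z n) \<le> q g * 1" using Suc g q_nonneg by (intro mult_mono) auto
    hence "q (g + ?z n * ?z n) \<le> 2 * q g" using tri[of g "?z n * ?z n"] submult[of "?z n" "?z n"] by simp
    thus ?case using scale[of "1/2" "g + ?z n * ?z n"] by simp
  qed simp
  have "?z (Suc (Suc n)) - ?z (Suc n) =
      free_scale (1/2) (?z (Suc n) * (?z (Suc n) - ?z n) + (?z (Suc n) - ?z n) * ?z n)"
    by (subst (1 2) sqrt_iter.simps(2)) (simp add: free_scale_diff[symmetric] algebra_simps)
  hence "q (?z (Suc (Suc n)) - ?z (Suc n)) \<le>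
      (1/2) * (q (?z (Suc n)) * q (?z (Suc n) - ?z n) + q (?z (Suc n) - ?z n) * q (?z n))"
    using tri[of "?z (Suc n) * (?z (Suc n) - ?z n)" "(?z (Suc n) - ?z n) * ?z n"]
      submult[of "?z (Suc n)" "?z (Suc n) - ?z n"] submult[of "?z (Suc n) - ?z n" "?z n"]
    by (simp add: scale del: sqrt_iter.simps)
  also have "\<dots> \<le> (1/2) * (q g * q g ^ Suc n + q g ^ Suc n * q g)"
    using Suc bd by (intro mult_left_mono add_mono mult_mono) (auto simp del: sqrt_iter.simps)
  finally show ?case by (simp add: mult.commute del: sqrt_iter.simps)
qed

text \<open>The root is 1 minus an iterate, and the defect of its square is exactly twice one step
  of the iteration. Iterates are polynomials in g, whence the last clause, which later makes roots
  of related elements commute. The root is approximate because the free algebra is not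
  complete.\<close>

lemma approx_sqrt_one_minus:
  assumes g: "self_adjoint g" "q g < 1" and e: "0 < e"
  shows "\<exists>k. self_adjoint k \<and> q (k * k - (1 - g)) < e \<and> (\<forall>x. x * g = g * x \<longrightarrow> x * k = k * x)"
proof -
  let ?z = "sqrt_iter g"
  have "(\<lambda>n. 2 * q g ^ Suc n) \<longlonglongrightarrow> 2 * 0"
    using g by (intro tendsto_mult_left LIMSEQ_power_zero[THEN LIMSEQ_Suc]) auto
  hence "\<forall>\<^sub>F n in sequentially. 2 * q g ^ Suc n < e" using e by (intro order_tendstoD(2)) auto
  then obtain n where n: "2 * q g ^ Suc n < e" by (auto simp: eventually_sequentially)
  have d: "(1 - ?z n) * (1 - ?z n) - (1 - g) = (?z (Suc n) - ?z n) + (?z (Suc n) - ?z n)"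
    using sqrt_iter_double[of g n] by (simp add: algebra_simps del: sqrt_iter.simps)
  have "q ((1 - ?z n) * (1 - ?z n) - (1 - g)) < e"
    unfolding d using tri[of "?z (Suc n) - ?z n" "?z (Suc n) - ?z n"] q_sqrt_iter_step[OF g(2), of n] n by linarith
  moreover have "x * (1 - ?z n) = (1 - ?z n) * x" if "x * g = g * x" for x
    using sqrt_iter_commute[OF that, of n] by (simp add: algebra_simps)
  moreover have "self_adjoint (1 - ?z n)" using self_adjoint_sqrt_iter[OF g(1)] by blast
  ultimately show ?thesis by blast
qed

text \<open>In terms of the spectrum, \<open>p \<ge> 0\<close> if and only if \<open>\<parallel>t - p\<parallel> \<le> t\<close> for some \<open>t \<ge> 0\<close>.\<close>

definition npos :: "'x free_star \<Rightarrow> bool" where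
  "npos p \<longleftrightarrow> self_adjoint p \<and> (\<forall>e>0. \<exists>t\<ge>0. q (free_scale (complex_of_real t) 1 - p) \<le> t + e)"

lemma nposI: "self_adjoint p \<Longrightarrow> 0 \<le> t \<Longrightarrow> q (free_scale (complex_of_real t) 1 - p) \<le> t \<Longrightarrow> npos p"
  unfolding npos_def by (metis add.commute add_increasing less_eq_real_def)

lemma npos_sa: "npos p \<Longrightarrow> self_adjoint p" by (simp add: npos_def)

lemma npos_limit:
  assumes "self_adjoint p" "\<And>e. e > 0 \<Longrightarrow> \<exists>p'. npos p' \<and> q (p' - p) \<le> e"
  shows "npos p"
  unfolding npos_def
proof (intro conjI allI impI assms(1))
  fix e :: real assume "e > 0"
  then obtain p' where p': "npos p'" "q (p' - p) \<le> e/2" using assms(2)[of "e/2"] by auto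
  then obtain t where t: "t \<ge> 0" "q (free_scale (complex_of_real t) 1 - p') \<le> t + e/2"
    using \<open>e > 0\<close> unfolding npos_def by (meson half_gt_zero)
  have "free_scale (complex_of_real t) 1 - p = (free_scale (complex_of_real t) 1 - p') + (p' - p)" by simp
  hence "q (free_scale (complex_of_real t) 1 - p) \<le> t + e" using tri p' t by (smt (verit) field_sum_of_halves)
  thus "\<exists>t\<ge>0. q (free_scale (complex_of_real t) 1 - p) \<le> t + e" using t by blast
qed

text \<open>Additivity is the reason for expressing positivity through the norm: by the triangle
  inequality the two thresholds simply add up.\<close>

lemma npos_add: assumes "npos p" "npos r" shows "npos (p + r)"
  unfolding npos_def
proof (intro conjI allI impI)
  fix e :: real assume "e > 0"
  hence "e/2 > 0" by simp
  then obtain t s where t: "t \<ge> 0" "q (free_scale (complex_of_real t) 1 - p) \<le> t + e/2"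
    and s: "s \<ge> 0" "q (free_scale (complex_of_real s) 1 - r) \<le> s + e/2"
    using assms unfolding npos_def by meson
  have "free_scale (complex_of_real (t + s)) 1 - (p + r) =
      (free_scale (complex_of_real t) 1 - p) + (free_scale (complex_of_real s) 1 - r)"
    by (simp add: free_scale_add_left)
  hence "q (free_scale (complex_of_real (t + s)) 1 - (p + r)) \<le> (t + s) + e"
    using tri t s by (smt (verit) field_sum_of_halves)
  thus "\<exists>t\<ge>0. q (free_scale (complex_of_real t) 1 - (p + r)) \<le> t + e" using t s by (metis add_nonneg_nonneg)
qed (use assms npos_sa in blast)

lemma npos_0: "npos 0" by (rule nposI[of _ 0]) (auto simp: free_scale_0)

lemma npos_sum: "(\<And>i. i \<in> K \<Longrightarrow> npos (h i)) \<Longrightarrow> npos (sum h K)"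
  by (induction K rule: infinite_finite_induct) (auto simp: npos_0 npos_add)

lemma npos_scale: assumes "npos p" "0 \<le> a" shows "npos (free_scale (complex_of_real a) p)"
  unfolding npos_def
proof (intro conjI allI impI)
  fix e :: real assume "e > 0"
  hence "e / (a + 1) > 0" using assms by simp
  then obtain t where t: "t \<ge> 0" "q (free_scale (complex_of_real t) 1 - p) \<le> t + e/(a+1)"
    using assms unfolding npos_def by meson
  have "free_scale (complex_of_real (a * t)) 1 - free_scale (complex_of_real a) p =
     free_scale (complex_of_real a) (free_scale (complex_of_real t) 1 - p)"
    by (simp add: free_scale_diff free_scale_scale)
  hence "q (free_scale (complex_of_real (a * t)) 1 - free_scale (complex_of_real a) p) =
     a * q (free_scale (complex_of_real t) 1 - p)" using assms by (simp add: scale)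
  also have "\<dots> \<le> a * (t + e/(a+1))" using assms t by (intro mult_left_mono) auto
  also have "\<dots> \<le> a * t + e" using assms \<open>e > 0\<close> by (simp add: field_simps)
  finally show "\<exists>t\<ge>0. q (free_scale (complex_of_real t) 1 - free_scale (complex_of_real a) p) \<le> t + e"
    using t assms by (metis mult_nonneg_nonneg)
qed (use assms npos_sa in blast)

lemma npos_approx_sqrt:
  assumes p: "npos p" and e: "0 < e"
  shows "\<exists>k. self_adjoint k \<and> q (k * k - p) < e \<and> (\<forall>x. x * p = p * x \<longrightarrow> x * k = k * x)"
proof -
  have "e/8 > 0" using e by simp
  then obtain t where t: "t \<ge> 0" "q (free_scale (complex_of_real t) 1 - p) \<le> t + e/8"
    using p unfolding npos_def by meson
  \<comment> \<open>Exceeding t + e/8 makes g a strict contraction, and s (1 - g) = p + e/4. The two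
    errors, s times e/(4 s) from the root and e/4 from the shift, add up to less than e.\<close>
  define s where "s = t + e/4"
  have s: "s > 0" "s \<ge> e/4" using t e by (auto simp: s_def)
  let ?g = "free_scale (complex_of_real (1/s)) (free_scale (complex_of_real t) 1 - p)"
  have sag: "self_adjoint ?g" using p npos_sa by (intro self_adjoint_intros) auto
  have "q ?g < 1" using t s e by (simp only: q_scale_real) (simp add: s_def field_simps)
  then obtain l where l: "self_adjoint l" "q (l * l - (1 - ?g)) < e/(4*s)" "\<And>x. x * ?g = ?g * x \<Longrightarrow> x * l = l * x"
    using approx_sqrt_one_minus[OF sag, of "e/(4*s)"] s e by (metis divide_pos_pos mult_pos_pos zero_less_numeral)
  let ?k = "free_scale (complex_of_real (sqrt s)) l"
  have ss: "complex_of_real (sqrt s) * complex_of_real (sqrt s) = complex_of_real s"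
    using s by (simp flip: of_real_mult)
  have kk: "?k * ?k = free_scale (complex_of_real s) (l * l)"
    by (simp only: free_scale_mult_left free_scale_mult_right free_scale_scale ss)
  have sg: "free_scale (complex_of_real s) ?g = free_scale (complex_of_real t) 1 - p"
    using s by (simp only: free_scale_scale of_real_mult[symmetric]) (simp add: free_scale_one)
  have s1: "free_scale (complex_of_real s) 1 = free_scale (complex_of_real t) 1 + free_scale (complex_of_real (e/4)) 1"
    by (simp add: s_def free_scale_add_left)
  have "?k * ?k - p = free_scale (complex_of_real s) (l * l - (1 - ?g)) + free_scale (complex_of_real (e/4)) 1"
    by (simp only: kk free_scale_diff[of "complex_of_real s"] sg s1) simp
  hence "q (?k * ?k - p) \<le> s * q (l * l - (1 - ?g)) + e/4 * q 1"
    using tri[of "free_scale (complex_of_real s) (l * l - (1 - ?g))" "free_scale (complex_of_real (e/4)) 1"] s e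
    by (simp only: q_scale_real)
  also have "s * q (l * l - (1 - ?g)) < s * (e/(4*s))" using l(2) s(1) by (rule mult_strict_left_mono)
  also have "s * (e/(4*s)) = e/4" using s by simp
  also have "e/4 * q 1 \<le> e/4 * 1" using e q_1 by (intro mult_left_mono) auto
  finally have "q (?k * ?k - p) < e" using e by simp
  moreover have "x * ?k = ?k * x" if "x * p = p * x" for x
    using l(3)[of x] that by (simp add: free_scale_mult_left free_scale_mult_right left_diff_distrib right_diff_distrib)
  ultimately show ?thesis using l(1) by blast
qed

text \<open>After scaling, k k becomes a strict contraction g, and an approximate root l of 1 - g
  commutes with k. Then l is the real part of a normal element whose square modulus l l + g is
  nearly 1, so the norm of l l, and with it that of 1 - g, is at most about 1.\<close>

lemma npos_square: assumes k: "self_adjoint k" shows "npos (k * k)"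
proof -
  define t where "t = q (k * k) + 1"
  have t: "t > 0" "q (k * k) < t" by (simp_all add: t_def add_nonneg_pos)
  let ?g = "free_scale (complex_of_real (1/t)) (k * k)"
  have g: "self_adjoint ?g" using k by blast
  have g1: "q ?g < 1" using t by (simp only: q_scale_real) (simp add: field_simps)
  have "q (1 - ?g) \<le> 1"
  proof (rule field_le_epsilon)
    fix e :: real assume "e > 0"
    then obtain l where l: "self_adjoint l" "q (l * l - (1 - ?g)) < e/2" "\<And>x. x * ?g = ?g * x \<Longrightarrow> x * l = l * x"
      using approx_sqrt_one_minus[OF g g1, of "e/2"] by (meson half_gt_zero)
    let ?k = "free_scale (complex_of_real (sqrt (1/t))) k"
    have ss: "complex_of_real (sqrt (1/t)) * complex_of_real (sqrt (1/t)) = complex_of_real (1/t)"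
      using t by (simp only: of_real_mult[symmetric]) simp
    have kk: "?k * ?k = ?g" by (simp only: free_scale_mult_left free_scale_mult_right free_scale_scale ss)
    have "k * ?g = ?g * k" by (simp add: free_scale_mult_left free_scale_mult_right mult.assoc)
    hence "l * ?k - ?k * l = 0" using l(3)[of k] by (simp add: free_scale_mult_left free_scale_mult_right)
    hence "(q l)\<^sup>2 \<le> q (l * l + ?g)"
      using q_real_part[OF l(1), of ?k] k kk by (simp add: self_adjoint_intros)
    also have "l * l + ?g = 1 + (l * l - (1 - ?g))" by simp
    also have "q \<dots> \<le> 1 + e/2" using tri[of 1 "l * l - (1 - ?g)"] q_1 l by linarith
    finally have "q (l * l) \<le> 1 + e/2" using q_square[OF l(1)] by simp
    thus "q (1 - ?g) \<le> 1 + e" using q_le_diff[of "1 - ?g" "l * l"] q_diff_sym[of "1 - ?g" "l * l"] l(2) by linarith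
  qed
  hence "t * q (1 - ?g) \<le> t" using t by (simp add: mult_left_le)
  moreover have "free_scale (complex_of_real t) (1 - ?g) = free_scale (complex_of_real t) 1 - k * k"
    using t by (simp add: free_scale_diff free_scale_scale free_scale_one flip: of_real_mult of_real_divide)
  ultimately show ?thesis using t k scale[of "complex_of_real t" "1 - ?g"] by (intro nposI[of _ t]) auto
qed

text \<open>With T the norm of p + r, the element c = T 1 - p is positive, because (T + t) 1 - c =
  (p + r) + (t 1 - r). Approximate roots h of p and k of c commute, so \<open>q_real_part\<close>
  bounds the norm of h h by that of h h + k k, which is nearly T 1.\<close>

lemma npos_mono: assumes p: "npos p" and r: "npos r" shows "q p \<le> q (p + r)"
proof (rule field_le_epsilon)
  fix e :: real assume e: "e > 0"
  let ?T = "q (p + r)"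
  let ?c = "free_scale (complex_of_real ?T) 1 - p"
  have c: "npos ?c"
    unfolding npos_def
  proof (intro conjI allI impI)
    fix e :: real assume "e > 0"
    then obtain t where t: "t \<ge> 0" "q (free_scale (complex_of_real t) 1 - r) \<le> t + e"
      using r unfolding npos_def by meson
    have d: "free_scale (complex_of_real (?T + t)) 1 - ?c = (p + r) + (free_scale (complex_of_real t) 1 - r)"
      by (simp add: free_scale_add_left)
    have "q (free_scale (complex_of_real (?T + t)) 1 - ?c) \<le> (?T + t) + e"
      unfolding d using tri[of "p + r" "free_scale (complex_of_real t) 1 - r"] t by linarith
    thus "\<exists>t\<ge>0. q (free_scale (complex_of_real t) 1 - ?c) \<le> t + e" using t by (metis add_nonneg_nonneg q_nonneg)
  qed (use p npos_sa in blast)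
  obtain h where h: "self_adjoint h" "q (h * h - p) < e/3" "\<And>x. x * p = p * x \<Longrightarrow> x * h = h * x"
    using npos_approx_sqrt[OF p, of "e/3"] e by (meson divide_pos_pos zero_less_numeral)
  obtain k where k: "self_adjoint k" "q (k * k - ?c) < e/3" "\<And>x. x * ?c = ?c * x \<Longrightarrow> x * k = k * x"
    using npos_approx_sqrt[OF c, of "e/3"] e by (meson divide_pos_pos zero_less_numeral)
  have "h * p = p * h" using h(3)[of p] by simp
  hence "h * k - k * h = 0"
    using k(3)[of h] by (simp add: left_diff_distrib right_diff_distrib free_scale_mult_left free_scale_mult_right)
  hence "(q h)\<^sup>2 \<le> q (h * h + k * k)" using q_real_part[OF h(1) k(1)] by simp
  also have "h * h + k * k = (h * h - p) + ((k * k - ?c) + free_scale (complex_of_real ?T) 1)" by simp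
  also have "q \<dots> \<le> e/3 + (e/3 + ?T * 1)"
  proof -
    have "?T * q 1 \<le> ?T * 1" using q_1 by (intro mult_left_mono) auto
    thus ?thesis
      using tri[of "h * h - p" "(k * k - ?c) + free_scale (complex_of_real ?T) 1"]
        tri[of "k * k - ?c" "free_scale (complex_of_real ?T) 1"] h(2) k(2) q_scale_real[of ?T 1] by simp
  qed
  finally have "q (h * h) \<le> e/3 + (e/3 + ?T)" using q_square[OF h(1)] by simp
  thus "q p \<le> q (p + r) + e"
    using q_le_diff[of p "h * h"] q_diff_sym[of p "h * h"] h(2) by linarith
qed

text \<open>If k is an approximate root of p commuting with f, then f k is self-adjoint and
  \<open>npos_square\<close> applies to it. Conjugation by arbitrary elements has to wait for the
  positivity of x* x, which rests on this case.\<close>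

lemma npos_conj:
  assumes p: "npos p" and f: "self_adjoint f" "f * p = p * f"
  shows "npos (f * p * f)"
proof (rule npos_limit)
  show "self_adjoint (f * p * f)" using npos_sa[OF p] f(1) by (simp add: self_adjoint_def free_star_simps mult.assoc)
  fix e :: real assume e: "e > 0"
  have Q: "q f * q f + 1 > 0" by (metis add_pos_pos add.commute add_nonneg_pos mult_nonneg_nonneg q_nonneg zero_less_one)
  then obtain k where k: "self_adjoint k" "q (k * k - p) < e / (q f * q f + 1)" "\<And>x. x * p = p * x \<Longrightarrow> x * k = k * x"
    using npos_approx_sqrt[OF p, of "e / (q f * q f + 1)"] e by (meson divide_pos_pos)
  have fk: "f * k = k * f" using k(3) f by simp
  have sa: "self_adjoint (f * k)" using f(1) k(1) fk by (simp add: self_adjoint_def free_star_mult)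
  have d: "(f * k) * (f * k) - f * p * f = f * (k * k - p) * f" using fk
    by (simp add: algebra_simps) (metis mult.assoc fk)
  have "q ((f * k) * (f * k) - f * p * f) \<le> q f * q (k * k - p) * q f"
    unfolding d by (rule order_trans[OF submult mult_right_mono[OF submult q_nonneg]])
  also have "\<dots> = (q f * q f) * q (k * k - p)" by simp
  also have "\<dots> \<le> (q f * q f + 1) * q (k * k - p)" by (intro mult_right_mono) auto
  also have "\<dots> \<le> e" using k(2) Q by (simp add: pos_less_divide_eq mult.commute)
  finally show "\<exists>p'. npos p' \<and> q (p' - f * p * f) \<le> e" using npos_square[OF sa] by blast
qed

text \<open>Two factors s are absorbed by replacing f with s f, which leaves a square for even n and
  a conjugate of s for odd n.\<close>

lemma npos_power_mult:
  assumes s: "npos s" and f: "self_adjoint f" "f * s = s * f"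
  shows "npos (s ^ n * f * f)"
  using f
proof (induction n arbitrary: f rule: induct_nat_012)
  case 0 thus ?case by (simp add: npos_square)
next
  case 1 thus ?case using npos_conj[OF s, of f] by (simp add: mult.assoc)
next
  case (ge2 n)
  have sa: "self_adjoint (s * f)" using ge2.prems npos_sa[OF s] by (simp add: self_adjoint_def free_star_simps)
  have c: "(s * f) * s = s * (s * f)" using ge2.prems by (simp add: mult.assoc)
  have "s ^ n * (s * f) * (s * f) = s ^ Suc (Suc n) * f * f"
    using ge2.prems(2) by (simp add: power_Suc2 mult.assoc del: power_Suc) (metis mult.assoc power_commutes)
  thus ?case using ge2.IH(1)[OF sa c] by simp
qed

text \<open>For exponents that are powers of two this is the C*-identity iterated. Any other n is
  padded to 2^n, and submultiplicativity of the padding factor gives the missing lower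
  bound.\<close>

lemma q_power: assumes t: "self_adjoint t" and n: "n > 0" shows "q (t ^ n) = q t ^ n"
proof -
  have le: "n > 0 \<Longrightarrow> q (t ^ n) \<le> q t ^ n" for n
  proof (induction n rule: nat_induct_non_zero)
    case (Suc n)
    thus ?case using submult[of t "t ^ n"] mult_left_mono[of "q (t ^ n)" "q t ^ n" "q t"] by simp
  qed simp
  have p2: "q (t ^ (2 ^ j)) = q t ^ (2 ^ j)" for j
  proof (induction j)
    case (Suc j)
    have "t ^ (2 ^ Suc j) = (t ^ (2 ^ j)) * (t ^ (2 ^ j))" by (simp add: mult_2 power_add)
    thus ?case using Suc q_square[of "t ^ (2 ^ j)"] t by (auto simp: mult_2 power_add power2_eq_square)
  qed simp
  have j: "n < 2 ^ n" by (rule less_exp)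
  let ?m = "2 ^ n - n"
  have "q t ^ n * q t ^ ?m = q (t ^ n * t ^ ?m)"
    using p2[of n] j by (simp flip: power_add)
  also have "\<dots> \<le> q (t ^ n) * q t ^ ?m"
    using j by (intro order_trans[OF submult mult_left_mono[OF le]]) auto
  finally have "q t = 0 \<or> q t ^ n \<le> q (t ^ n)"
    by (smt (verit) mult_le_cancel_right q_nonneg zero_le_power power_eq_0_iff)
  thus ?thesis using le[OF n] n by (smt (verit) power_0_left q_nonneg zero_power)
qed

text \<open>For \<open>0 \<le> s\<close> one has \<open>(n + 1) s\<^sup>n (1 - s) \<le> 1\<close>; the difference is
  \<open>s ^ Suc n + (1 - s)\<^sup>2 * (\<Sum>j<n. (j + 1) s ^ j)\<close>.\<close>

lemma npos_bernoulli: assumes s: "npos s" shows "npos (1 - of_nat (Suc n) * (s ^ n * (1 - s)))"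
proof -
  \<comment> \<open>The polynomial is the closed form of (1 - s)^2 times the sum of (j + 1) s^j over
    j < n; passing to n + 1 adds the term with index n.\<close>
  have P: "npos (1 - of_nat (Suc n) * s ^ n + of_nat n * s ^ Suc n)" for n
  proof (induction n)
    case 0 show ?case by (simp add: npos_0)
  next
    case (Suc n)
    have c: "(1 - s) * s = s * (1 - s)" by (simp add: algebra_simps)
    have "npos (s ^ n * (1 - s) * (1 - s))"
      using npos_sa[OF s] c by (intro npos_power_mult[OF s]) auto
    from npos_scale[OF this, of "real (Suc n)"]
    have 1: "npos (of_nat (Suc n) * (s ^ n * (1 - s) * (1 - s)))"
      using free_scale_of_nat[of "Suc n" "s ^ n * (1 - s) * (1 - s)"] by (simp del: of_nat_Suc)
    have eq: "1 - of_nat (Suc (Suc n)) * s ^ Suc n + of_nat (Suc n) * s ^ Suc (Suc n) =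
      (1 - of_nat (Suc n) * s ^ n + of_nat n * s ^ Suc n) + of_nat (Suc n) * (s ^ n * (1 - s) * (1 - s))"
      by (simp add: algebra_simps power_commutes)
    show ?case unfolding eq by (rule npos_add[OF Suc 1])
  qed
  have "npos (s ^ Suc n * 1 * 1)" using s by (intro npos_power_mult) auto
  from npos_add[OF P[of n] this] show ?thesis by (simp add: algebra_simps power_commutes)
qed

text \<open>With \<open>s = 1 - x\<^sup>* x\<close>, \<open>t = 1 - x x\<^sup>*\<close> and \<open>y = x s\<^sup>m\<close>,
  the sum of \<open>y\<^sup>* y = s\<^sup>2\<^sup>m (1 - s)\<close> and \<open>y y\<^sup>* = t\<^sup>2\<^sup>m (1 - t)\<close> is a sum of squares of self-adjoint
  elements, and \<open>y\<^sup>* y\<close> is at most \<open>1 / (2m + 1)\<close>; letting \<open>m\<close> grow, this forces \<open>t \<le> 1\<close>.\<close>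

lemma npos_mult_star_contraction: assumes x: "q x < 1" shows "npos (x * free_star x)"
proof -
  let ?xs = "free_star x"
  define s where "s = 1 - ?xs * x"
  define t where "t = 1 - x * ?xs"
  have sas: "self_adjoint s" "self_adjoint t" unfolding s_def t_def by auto
  have lt: "q (?xs * x) < 1" "q (x * ?xs) < 1"
    using x cstar[of x] cstar[of ?xs] by (auto simp: free_star_free_star power_less_one_iff abs_square_less_1)
  have s: "npos s" and t: "npos t"
    using lt sas by (auto intro!: nposI[of _ 1] simp: free_scale_one s_def t_def)
  \<comment> \<open>x intertwines s and t, which converts the powers of s inside y y* into powers of
    t.\<close>
  have xs: "x * s = t * x" by (simp add: s_def t_def algebra_simps)
  have xsn: "x * s ^ n = t ^ n * x" for n
  proof (induction n)
    case (Suc n)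
    have "x * s ^ Suc n = (x * s) * s ^ n" by (simp add: mult.assoc)
    also have "\<dots> = t * (x * s ^ n)" by (simp add: xs mult.assoc)
    finally show ?case by (simp add: Suc mult.assoc)
  qed simp
  \<comment> \<open>With n = 2m, both (n + 1) t^(n + 1) and 1 + (n + 1) t^n (1 - t) are shown
    positive. Their sum is 1 + (n + 1) t^n, and \<open>npos_mono\<close> compares its norm with that
    of the first summand. The exponent must be positive for \<open>q_power\<close>, as q 1 may be
    0.\<close>
  have key: "of_nat (Suc (2*m)) * q t ^ Suc (2*m) \<le> 1 + of_nat (Suc (2*m)) * q t ^ (2*m)" if m: "m > 0" for m
  proof -
    let ?n = "2*m"
    let ?y = "x * s ^ m"
    have ys: "free_star ?y = s ^ m * ?xs" using sas by (simp add: free_star_simps self_adjoint_def)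
    have com: "s ^ m * (1 - s) = (1 - s) * s ^ m" by (simp add: algebra_simps power_commutes)
    have "free_star ?y * ?y = s ^ m * (?xs * x) * s ^ m" by (simp add: ys mult.assoc)
    also have "?xs * x = 1 - s" by (simp add: s_def)
    finally have yy: "free_star ?y * ?y = s ^ ?n * (1 - s)"
      by (simp only: com[symmetric] mult_2 power_add mult.assoc)
    have "?y * free_star ?y = (x * s ^ ?n) * ?xs" by (simp add: ys mult_2 power_add mult.assoc)
    hence yy': "?y * free_star ?y = t ^ ?n * (1 - t)" by (simp add: xsn t_def mult.assoc)
    let ?a = "?y + free_star ?y" and ?b = "free_scale \<i> (?y - free_star ?y)"
    have "self_adjoint ?b"
      by (simp add: self_adjoint_def free_star_diff free_star_scale free_star_free_star free_scale_minus_left free_scale_diff)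
    moreover have "self_adjoint ?a" by (simp add: self_adjoint_def free_star_add free_star_free_star add.commute)
    ultimately have "npos (?a * ?a + ?b * ?b)" by (intro npos_add npos_square)
    moreover have "?b * ?b = - ((?y - free_star ?y) * (?y - free_star ?y))"
      by (simp only: free_scale_mult_left free_scale_mult_right free_scale_scale) (simp add: free_scale_minus1)
    moreover have "(y + z) * (y + z) + - ((y - z) * (y - z)) = free_scale 2 (z * y + y * z)" for y z :: "'x free_star"
      using free_scale_of_nat[of 2 "z * y + y * z"] by (simp add: algebra_simps mult_2)
    ultimately have "npos (free_scale 2 (s ^ ?n * (1 - s) + t ^ ?n * (1 - t)))" by (simp only: yy yy')
    from npos_scale[OF this, of "real (Suc ?n) / 2"]
    have "npos (free_scale (of_nat (Suc ?n)) (s ^ ?n * (1 - s) + t ^ ?n * (1 - t)))"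
      unfolding free_scale_scale by (simp add: add_divide_distrib mult.commute)
    hence "npos (of_nat (Suc ?n) * (s ^ ?n * (1 - s) + t ^ ?n * (1 - t)))"
      by (simp only: free_scale_of_nat)
    \<comment> \<open>Adding this positive element cancels the part in s and leaves an expression in
      t alone.\<close>
    from npos_add[OF this npos_bernoulli[OF s, of ?n]]
    have R: "npos (1 + of_nat (Suc ?n) * (t ^ ?n * (1 - t)))" by (simp only: distrib_left) (simp add: add.commute)
    have "npos (t ^ Suc ?n * 1 * 1)" using t by (intro npos_power_mult) auto
    from npos_scale[OF this, of "real (Suc ?n)"]
    have T: "npos (free_scale (of_nat (Suc ?n)) (t ^ Suc ?n))" by simp
    have e: "free_scale (of_nat (Suc ?n)) (t ^ Suc ?n) + (1 + of_nat (Suc ?n) * (t ^ ?n * (1 - t)))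
        = 1 + free_scale (of_nat (Suc ?n)) (t ^ ?n)"
      unfolding free_scale_of_nat by (simp add: algebra_simps power_commutes del: of_nat_Suc)
    have "q (free_scale (of_nat (Suc ?n)) (t ^ Suc ?n)) \<le> q (1 + free_scale (of_nat (Suc ?n)) (t ^ ?n))"
      using npos_mono[OF T R] unfolding e .
    also have "\<dots> \<le> 1 + q (free_scale (of_nat (Suc ?n)) (t ^ ?n))"
      using tri[of 1 "free_scale (of_nat (Suc ?n)) (t ^ ?n)"] q_1 by linarith
    finally show ?thesis using sas m by (simp add: scale q_power del: of_nat_Suc power_Suc)
  qed
  have "q t \<le> 1"
  proof (rule ccontr)
    assume "\<not> q t \<le> 1"
    hence t1: "q t > 1" by simp
    then obtain N where N: "1 < of_nat N * (q t - 1)" using reals_Archimedean3[of "q t - 1"] by auto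
    let ?m = "Suc N"
    have "1 \<le> q t ^ (2 * ?m)" using t1 by (simp only: one_le_power)
    hence "of_nat (Suc (2 * ?m)) * (q t - 1) * 1 \<le> of_nat (Suc (2 * ?m)) * (q t - 1) * q t ^ (2 * ?m)"
      using t1 by (intro mult_left_mono) auto
    also have "\<dots> \<le> 1" using key[of ?m] by (simp add: algebra_simps)
    finally have "of_nat (Suc (2 * ?m)) * (q t - 1) \<le> 1" by simp
    moreover have "of_nat N * (q t - 1) \<le> of_nat (Suc (2 * ?m)) * (q t - 1)" using t1 by (intro mult_right_mono) auto
    ultimately show False using N by linarith
  qed
  thus ?thesis by (intro nposI[of _ 1]) (auto simp: free_scale_one t_def)
qed

theorem npos_mult_star: "npos (x * free_star x)"
proof -
  let ?c = "q x + 1"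
  have c: "?c > 0" by (simp add: add_nonneg_pos)
  let ?y = "free_scale (complex_of_real (1/?c)) x"
  have "q ?y < 1" using c by (simp only: q_scale_real) (simp add: field_simps)
  hence "npos (?y * free_star ?y)" by (rule npos_mult_star_contraction)
  hence "npos (free_scale (complex_of_real (1/?c * (1/?c))) (x * free_star x))"
    by (simp add: free_star_scale free_scale_mult_left free_scale_mult_right free_scale_scale)
  from npos_scale[OF this, of "?c * ?c"] c show ?thesis
    by (simp only: free_scale_scale of_real_mult[symmetric]) (simp add: free_scale_one)
qed

corollary npos_star_mult: "npos (free_star x * x)"
  using npos_mult_star[of "free_star x"] by (simp add: free_star_free_star)

text \<open>With k an approximate root of p, the element k c need not be self-adjoint:
  \<open>npos_star_mult\<close> covers (k c)* (k c).\<close>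

lemma npos_conj_star: assumes p: "npos p" shows "npos (free_star c * p * c)"
proof (rule npos_limit)
  show "self_adjoint (free_star c * p * c)" using npos_sa[OF p] by (simp add: self_adjoint_def free_star_simps mult.assoc)
  fix e :: real assume e: "e > 0"
  have Q: "q c * q c + 1 > 0" by (simp add: add_nonneg_pos)
  then obtain k where k: "self_adjoint k" "q (k * k - p) < e / (q c * q c + 1)"
    using npos_approx_sqrt[OF p, of "e / (q c * q c + 1)"] e by (meson divide_pos_pos)
  have d: "free_star (k * c) * (k * c) - free_star c * p * c = free_star c * (k * k - p) * c"
    using k(1) by (simp add: free_star_simps self_adjoint_def algebra_simps)
  have "q (free_star (k * c) * (k * c) - free_star c * p * c) \<le> q c * q (k * k - p) * q c"
    unfolding d by (rule order_trans[OF submult mult_right_mono[OF order_trans[OF submult] q_nonneg]]) simp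
  also have "\<dots> \<le> (q c * q c + 1) * q (k * k - p)" by (simp add: algebra_simps)
  also have "\<dots> \<le> e" using k(2) Q by (simp add: pos_less_divide_eq mult.commute)
  finally show "\<exists>p'. npos p' \<and> q (p' - free_star c * p * c) \<le> e" using npos_star_mult by blast
qed

text \<open>Write h, w and c for the sums of a* a, b* b and a* b. If h has norm at most 1, then w is
  c* c plus the positive elements c* (1 - h) c and the sum of (a c - b)* (a c - b), so c* c is
  dominated by w. The general case follows by rescaling a.\<close>

theorem cauchy_schwarz:
  assumes "finite K"
  shows "(q (\<Sum>i\<in>K. free_star (a i) * b i))\<^sup>2 \<le> q (\<Sum>i\<in>K. free_star (a i) * a i) * q (\<Sum>i\<in>K. free_star (b i) * b i)"
proof -
  have unit: "(q (\<Sum>i\<in>K. free_star (a i) * b i))\<^sup>2 \<le> q (\<Sum>i\<in>K. free_star (b i) * b i)"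
    if "q (\<Sum>i\<in>K. free_star (a i) * a i) \<le> 1" for a
  proof -
    let ?h = "\<Sum>i\<in>K. free_star (a i) * a i" and ?w = "\<Sum>i\<in>K. free_star (b i) * b i"
    let ?c = "\<Sum>i\<in>K. free_star (a i) * b i" and ?cs = "\<Sum>i\<in>K. free_star (b i) * a i"
    have cs: "free_star ?c = ?cs" by (simp add: free_star_simps)
    have "npos (1 - ?h)"
      using that by (intro nposI[of _ 1] self_adjoint_intros) (auto simp: free_scale_one self_adjoint_def free_star_simps)
    hence 1: "npos (?cs * (1 - ?h) * ?c)" using npos_conj_star[of "1 - ?h" ?c] by (simp add: cs)
    have 2: "npos (\<Sum>i\<in>K. free_star (a i * ?c - b i) * (a i * ?c - b i))"
      by (intro npos_sum npos_star_mult)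
    have "(\<Sum>i\<in>K. free_star (a i * ?c - b i) * (a i * ?c - b i)) = ?cs * ?h * ?c - ?cs * ?c - ?cs * ?c + ?w"
    proof -
      have "free_star (a i * ?c - b i) * (a i * ?c - b i) = ?cs * (free_star (a i) * a i) * ?c
        - ?cs * (free_star (a i) * b i) - (free_star (b i) * a i) * ?c + free_star (b i) * b i" for i
        unfolding free_star_diff free_star_mult cs by (simp add: algebra_simps)
      moreover have "(\<Sum>i\<in>K. d * (free_star (a i) * a i) * c - d * (free_star (a i) * b i)
          - (free_star (b i) * a i) * c + free_star (b i) * b i) = d * ?h * c - d * ?c - ?cs * c + ?w" for c d
        by (simp only: sum.distrib sum_subtractf sum_distrib_left sum_distrib_right)
      ultimately show ?thesis by simp
    qed
    hence "?w = free_star ?c * ?c + (?cs * (1 - ?h) * ?c + (\<Sum>i\<in>K. free_star (a i * ?c - b i) * (a i * ?c - b i)))"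
      by (simp add: algebra_simps cs)
    hence "q (free_star ?c * ?c) \<le> q ?w" using npos_mono[OF npos_star_mult npos_add[OF 1 2], of ?c] by simp
    thus ?thesis by (simp only: cstar)
  qed
  let ?h = "\<Sum>i\<in>K. free_star (a i) * a i" and ?w = "\<Sum>i\<in>K. free_star (b i) * b i"
  let ?c = "\<Sum>i\<in>K. free_star (a i) * b i"
  \<comment> \<open>The norm of h may be 0, so the scaling divides by a strictly larger t, which
    afterwards tends to that norm.\<close>
  have *: "(q ?c)\<^sup>2 \<le> t * q ?w" if t: "t > q ?h" for t
  proof -
    have t0: "t > 0" using t q_nonneg[of ?h] by linarith
    let ?r = "complex_of_real (1 / sqrt t)"
    have rr: "?r * ?r = complex_of_real (1/t)" using t0 by (simp only: of_real_mult[symmetric]) simp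
    have A: "(\<Sum>i\<in>K. free_star (free_scale ?r (a i)) * free_scale ?r (a i)) = free_scale (complex_of_real (1/t)) ?h"
      unfolding free_scale_sum
      by (simp only: free_star_scale complex_cnj_complex_of_real free_scale_mult_left free_scale_mult_right free_scale_scale rr)
    have "q (free_scale (complex_of_real (1/t)) ?h) \<le> 1" using t t0 by (simp only: q_scale_real) (simp add: field_simps)
    hence "(q (\<Sum>i\<in>K. free_star (free_scale ?r (a i)) * b i))\<^sup>2 \<le> q ?w" using unit[of "\<lambda>i. free_scale ?r (a i)"] A by simp
    moreover have "(\<Sum>i\<in>K. free_star (free_scale ?r (a i)) * b i) = free_scale ?r ?c"
      unfolding free_scale_sum by (simp only: free_star_scale complex_cnj_complex_of_real free_scale_mult_left)
    ultimately have "(1 / sqrt t * q ?c)\<^sup>2 \<le> q ?w" using t0 by (simp only: q_scale_real) simp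
    thus ?thesis using t0 by (simp add: power_divide pos_divide_le_eq mult.commute)
  qed
  show ?thesis
  proof (rule tendsto_lowerbound)
    have "((\<lambda>t. t) \<longlongrightarrow> q ?h) (at_right (q ?h))" by (rule tendsto_ident_at)
    thus "((\<lambda>t. t * q ?w) \<longlongrightarrow> q ?h * q ?w) (at_right (q ?h))" by (rule tendsto_mult_right)
    show "\<forall>\<^sub>F t in at_right (q ?h). (q ?c)\<^sup>2 \<le> t * q ?w"
      using * by (auto simp: eventually_at_filter)
  qed simp
qed

end

section \<open>Operator seminorms and contractivity of homomorphisms\<close>

lemma quotient_square_le: "(a::real) \<ge> 0 \<Longrightarrow> a * a \<le> b * a \<Longrightarrow> 0 \<le> b \<Longrightarrow> a \<le> b"
  by (metis mult_le_cancel_right order_le_less)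

definition opnorm :: "'x free_star set \<Rightarrow> ('x free_star \<Rightarrow> real) \<Rightarrow> 'x free_star \<Rightarrow> real" where
  "opnorm H n f = (SUP v\<in>{v \<in> H. n v \<le> 1}. n (f * v))"

text \<open>The seminorm \<open>n\<close> behaves like the norm of an inner product for which \<open>f\<^sup>*\<close> acts as the
  adjoint of \<open>f\<close>.\<close>

locale left_action =
  fixes S H :: "'x free_star set" and n :: "'x free_star \<Rightarrow> real"
  assumes S: "f \<in> S \<Longrightarrow> free_star f \<in> S" "f \<in> S \<Longrightarrow> g \<in> S \<Longrightarrow> f * g \<in> S"
    and H: "0 \<in> H" "f \<in> S \<Longrightarrow> v \<in> H \<Longrightarrow> f * v \<in> H" "v \<in> H \<Longrightarrow> free_scale a v \<in> H"
    and n_nonneg: "v \<in> H \<Longrightarrow> 0 \<le> n v"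
    and n_tri: "v \<in> H \<Longrightarrow> w \<in> H \<Longrightarrow> n (v + w) \<le> n v + n w"
    and n_scale: "v \<in> H \<Longrightarrow> n (free_scale a v) = cmod a * n v"
    and n_adjoint: "f \<in> S \<Longrightarrow> v \<in> H \<Longrightarrow> (n (f * v))\<^sup>2 \<le> n v * n (free_star f * f * v)"
    and n_bounded: "f \<in> S \<Longrightarrow> \<exists>M. \<forall>v\<in>H. n (f * v) \<le> M * n v"
begin

abbreviation "op \<equiv> opnorm H n"

lemma n_0: "n 0 = 0" using n_scale[of 0 0] H(1) by (simp add: free_scale_0)

lemma bdd_op: assumes "f \<in> S" shows "bdd_above ((\<lambda>v. n (f * v)) ` {v \<in> H. n v \<le> 1})"
proof -
  obtain M where M: "\<And>v. v \<in> H \<Longrightarrow> n (f * v) \<le> M * n v" using n_bounded assms by blast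
  have "n (f * v) \<le> \<bar>M\<bar>" if "v \<in> H" "n v \<le> 1" for v
  proof -
    have "M * n v \<le> \<bar>M\<bar> * n v" using n_nonneg[OF that(1)] by (intro mult_right_mono) auto
    also have "\<dots> \<le> \<bar>M\<bar>" using that by (simp add: mult_left_le)
    finally show ?thesis using M[OF that(1)] by linarith
  qed
  thus ?thesis by (auto simp: bdd_above_def)
qed

lemma op_least: "(\<And>v. v \<in> H \<Longrightarrow> n v \<le> 1 \<Longrightarrow> n (f * v) \<le> M) \<Longrightarrow> op f \<le> M"
  unfolding opnorm_def using H(1) n_0 by (intro cSUP_least) force+

lemma op_upper1: "f \<in> S \<Longrightarrow> v \<in> H \<Longrightarrow> n v \<le> 1 \<Longrightarrow> n (f * v) \<le> op f"
  unfolding opnorm_def by (intro cSUP_upper bdd_op) auto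

lemma op_nonneg: "f \<in> S \<Longrightarrow> 0 \<le> op f"
  using op_upper1[of f 0] H(1) n_0 by simp

lemma op_upper: assumes "f \<in> S" "v \<in> H" shows "n (f * v) \<le> op f * n v"
proof (cases "n v = 0")
  \<comment> \<open>A vector of seminorm 0 cannot be normalised; it is boundedness that forces its
    image to have seminorm 0.\<close>
  case True
  obtain M where "n (f * v) \<le> M * n v" using n_bounded assms by blast
  thus ?thesis using True by simp
next
  case False
  hence p: "n v > 0" using n_nonneg[OF assms(2)] by linarith
  let ?w = "free_scale (complex_of_real (1 / n v)) v"
  have w: "?w \<in> H" "n ?w \<le> 1" using assms H p n_scale[OF assms(2), of "complex_of_real (1 / n v)"] by (auto simp: norm_divide)
  have "n (f * ?w) = (1 / n v) * n (f * v)"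
    using n_scale[of "f * v" "complex_of_real (1 / n v)"] assms H p
    by (simp add: free_scale_mult_right norm_divide)
  hence "(1 / n v) * n (f * v) \<le> op f" using op_upper1[OF assms(1) w] by simp
  thus ?thesis using p by (simp add: pos_divide_le_eq)
qed

lemma op_add: "f \<in> S \<Longrightarrow> g \<in> S \<Longrightarrow> op (f + g) \<le> op f + op g"
  by (rule op_least) (use op_upper1 n_tri H in \<open>smt (verit) distrib_right\<close>)

lemma op_mult: assumes "f \<in> S" "g \<in> S" shows "op (f * g) \<le> op f * op g"
proof (rule op_least)
  fix v assume v: "v \<in> H" "n v \<le> 1"
  have "n (f * (g * v)) \<le> op f * n (g * v)" using assms v H by (intro op_upper) auto
  also have "\<dots> \<le> op f * op g" using assms v by (intro mult_left_mono op_upper1 op_nonneg) auto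
  finally show "n (f * g * v) \<le> op f * op g" by (simp add: mult.assoc)
qed

lemma op_scale: assumes "f \<in> S" shows "op (free_scale a f) = cmod a * op f"
proof (rule antisym)
  show "op (free_scale a f) \<le> cmod a * op f"
    using assms H op_upper1 by (intro op_least) (auto simp: free_scale_mult_left n_scale intro!: mult_left_mono)
  show "cmod a * op f \<le> op (free_scale a f)"
  proof (cases "a = 0")
    case True thus ?thesis using H(1) n_0 by (simp add: free_scale_0 opnorm_def)
      (subst cSUP_const, auto)
  next
    case False
    have b: "n (free_scale a f * v) \<le> cmod a * op f" if "v \<in> H" "n v \<le> 1" for v
      using assms H op_upper1 that by (auto simp: free_scale_mult_left n_scale intro!: mult_left_mono)
    have up: "cmod a * n (f * v) \<le> op (free_scale a f)" if "v \<in> H" "n v \<le> 1" for v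
    proof -
      have "n (free_scale a f * v) \<le> op (free_scale a f)"
        unfolding opnorm_def using b that by (intro cSUP_upper) (auto simp: bdd_above_def)
      thus ?thesis using assms H that by (simp add: free_scale_mult_left n_scale)
    qed
    have "op f \<le> op (free_scale a f) / cmod a"
      using up False by (intro op_least) (simp add: pos_le_divide_eq mult.commute)
    thus ?thesis using False by (simp add: pos_le_divide_eq mult.commute)
  qed
qed

lemma op_cstar: assumes f: "f \<in> S" shows "op (free_star f * f) = (op f)\<^sup>2"
proof -
  have sq: "(op f)\<^sup>2 \<le> op (free_star f * f)" if f: "f \<in> S" for f
  proof -
    have "op f \<le> sqrt (op (free_star f * f))"
    proof (rule op_least)
      fix v assume v: "v \<in> H" "n v \<le> 1"
      have "(n (f * v))\<^sup>2 \<le> n v * n (free_star f * f * v)" by (rule n_adjoint[OF f v(1)])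
      also have "\<dots> \<le> 1 * op (free_star f * f)"
        using v f S H n_nonneg by (intro mult_mono op_upper1) auto
      finally show "n (f * v) \<le> sqrt (op (free_star f * f))" by (simp add: real_le_rsqrt)
    qed
    from power_mono[OF this op_nonneg[OF f], of 2] show ?thesis using op_nonneg[of "free_star f * f"] f S by simp
  qed
  have le: "op f \<le> op (free_star f)" if f: "f \<in> S" for f
    using sq[OF f] op_mult[of "free_star f" f] f S op_nonneg
    by (intro quotient_square_le[OF op_nonneg[OF f]]) (auto simp: power2_eq_square)
  have "op (free_star f) \<le> op f" using le[of "free_star f"] f S by (simp add: free_star_free_star)
  hence "op (free_star f * f) \<le> op f * op f"
    using op_mult[of "free_star f" f] f S op_nonneg[OF f] by (meson mult_right_mono order_trans)
  thus ?thesis using sq[OF f] by (simp add: power2_eq_square)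
qed

end

text \<open>The usual unitisation: polynomials without constant term form an ideal, and the whole
  unital algebra acts on it by left multiplication. The operator seminorm of this action is the
  extension.\<close>

theorem unital_extension:
  fixes p :: "'x free_star \<Rightarrow> real"
  assumes p: "cstar_seminorm UNIV p"
  obtains q where "unital_seminorm q" "\<And>f. f \<in> free_carrier UNIV \<Longrightarrow> q f = p f"
proof -
  interpret free_seminorm UNIV p by unfold_locales (rule p)
  have dec: "\<exists>a g. f = free_scale a 1 + g \<and> g \<in> F0" for f :: "'x free_star"
  proof -
    let ?a = "Poly_Mapping.lookup f 0"
    have "f - free_scale ?a 1 \<in> F0"
    proof -
      have "letters w \<noteq> []" if "w \<in> Poly_Mapping.keys (f - free_scale ?a 1)" for w
      proof
        assume "letters w = []"
        hence "w = 0" by (cases w) (simp add: zero_star_word_def)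
        thus False using that by (simp add: in_keys_iff lookup_minus lookup_free_scale)
      qed
      thus ?thesis by (auto simp: free_carrier_def)
    qed
    thus ?thesis by (metis add.commute diff_add_cancel)
  qed
  have ideal: "f * v \<in> F0" if v: "v \<in> F0" for f v
  proof -
    obtain a g where "f = free_scale a 1 + g" "g \<in> F0" using dec by blast
    thus ?thesis using v by (simp add: distrib_right free_scale_mult_left)
  qed
  interpret L: left_action UNIV F0 p
  proof
    fix f v :: "'x free_star"
    assume v: "v \<in> F0"
    have "(p (f * v))\<^sup>2 = p (free_star v * (free_star f * f * v))"
      using pc[of "f * v"] ideal[OF v] by (simp add: free_star_mult mult.assoc)
    also have "\<dots> \<le> p v * p (free_star f * f * v)"
      using pm[of "free_star v" "free_star f * f * v"] pstar ideal v by simp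
    finally show "(p (f * v))\<^sup>2 \<le> p v * p (free_star f * f * v)" .
  next
    fix f :: "'x free_star"
    obtain a g where f: "f = free_scale a 1 + g" "g \<in> F0" using dec by blast
    have "p (f * v) \<le> (cmod a + p g) * p v" if v: "v \<in> F0" for v
      using pt[of "free_scale a v" "g * v"] ps[OF v, of a] pm[OF f(2) v] v f(2)
      by (simp add: f(1) distrib_right free_scale_mult_left)
    thus "\<exists>M. \<forall>v\<in>F0. p (f * v) \<le> M * p v" by blast
  qed (simp_all add: nn pt ps ideal)
  have "unital_seminorm L.op"
    by unfold_locales (simp_all add: L.op_add L.op_mult L.op_cstar L.op_scale)
  moreover have "L.op f = p f" if f: "f \<in> F0" for f
  proof (rule antisym)
    show "L.op f \<le> p f"
    proof (rule L.op_least)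
      fix v assume "v \<in> F0" "p v \<le> 1"
      thus "p (f * v) \<le> p f" using pm[OF f, of v] mult_left_le[of "p v" "p f"] nn[OF f] by linarith
    qed
    \<comment> \<open>The vector f* shows that the operator seminorm of f is no smaller than p
      f.\<close>
    have "p f * p f = p (f * free_star f)"
      using pc[of "free_star f"] f pstar[OF f] by (simp add: free_star_free_star power2_eq_square)
    also have "\<dots> \<le> L.op f * p f" using L.op_upper[of f "free_star f"] f pstar[OF f] by simp
    finally show "p f \<le> L.op f" by (rule quotient_square_le[OF nn[OF f] _ L.op_nonneg]) simp
  qed
  ultimately show ?thesis using that by blast
qed

section \<open>Contractivity of *-homomorphisms\<close>

context cstar_algebra begin

text \<open>Every element of the algebra is its own generator. The value 0 outside the carrier lets
  the index set be \<open>UNIV\<close>, as \<open>unital_extension\<close> requires.\<close>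

definition total_gen :: "'a \<Rightarrow> 'a" where "total_gen x = (if x \<in> carrier A then x else \<zero>)"

lemma family_total_gen: "cstar_family A UNIV total_gen"
  by unfold_locales (auto simp: total_gen_def)

abbreviation "total_eval \<equiv> free_eval A total_gen"

lemma minus_self: "x \<in> carrier A \<Longrightarrow> x \<ominus> x = \<zero>"
  by (simp add: diff0)

text \<open>A self-adjoint element needs a self-adjoint lift to the free algebra, and its generator
  there is not one.\<close>

definition sym_gen :: "'a \<Rightarrow> 'a free_star" where
  "sym_gen x = free_scale (1/2) (free_gen x + free_star (free_gen x))"

lemma sym_gen:
  assumes "x \<in> carrier A" "star A x = x"
  shows "sym_gen x \<in> free_carrier UNIV" "self_adjoint (sym_gen x)" "total_eval (sym_gen x) = x"
proof -
  interpret F: cstar_family A UNIV total_gen by (rule family_total_gen)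
  have g: "free_gen x \<in> free_carrier UNIV" by (simp add: free_gen_carrier)
  show "sym_gen x \<in> free_carrier UNIV"
    using g by (simp add: sym_gen_def free_carrier_scale free_carrier_add free_carrier_star)
  show "self_adjoint (sym_gen x)"
    by (simp add: sym_gen_def self_adjoint_def free_star_simps add.commute)
  have "total_eval (sym_gen x) = (1/2) \<odot> (x \<oplus> x)"
    using g assms by (simp add: sym_gen_def F.E_scale F.E_add F.E_star F.E_gen free_carrier_add free_carrier_star total_gen_def)
  also have "\<dots> = x" using assms sl[of x "1/2" "1/2"] by (simp add: sr s1)
  finally show "total_eval (sym_gen x) = x" .
qed

lemma unital_norm: obtains q where "unital_seminorm q" "\<And>f. f \<in> free_carrier UNIV \<Longrightarrow> q f = cnorm A (total_eval f)"
proof -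
  interpret F: cstar_family A UNIV total_gen by (rule family_total_gen)
  show ?thesis using unital_extension[OF F.E_seminorm] that by metis
qed

text \<open>In a unital algebra the hypothesis reads \<open>h\<^sup>2 + (1 - z)\<^sup>2 = 1\<close>.\<close>

lemma norm_le_one_of_circle:
  assumes h: "h \<in> carrier A" "star A h = h" and z: "z \<in> carrier A" "star A z = z"
    and c: "h \<otimes> z = z \<otimes> h" and eq: "h \<otimes> h \<oplus> z \<otimes> z = z \<oplus> z"
  shows "cnorm A h \<le> 1"
proof -
  interpret F: cstar_family A UNIV total_gen by (rule family_total_gen)
  obtain q where q: "unital_seminorm q" "\<And>f. f \<in> free_carrier UNIV \<Longrightarrow> q f = cnorm A (total_eval f)"
    using unital_norm by blast
  interpret Q: unital_seminorm q by (rule q(1))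
  let ?h = "sym_gen h" and ?z = "sym_gen z"
  note [simp] = sym_gen[OF h] sym_gen[OF z] free_carrier_mult free_carrier_add free_carrier_diff
  have "self_adjoint (1 - ?z)" by (intro self_adjoint_intros) simp
  hence "(q ?h)\<^sup>2 \<le> q (?h * ?h + (1 - ?z) * (1 - ?z)) + q (?h * (1 - ?z) - (1 - ?z) * ?h)"
    by (intro Q.q_real_part) simp
  also have "?h * (1 - ?z) - (1 - ?z) * ?h = ?z * ?h - ?h * ?z" by (simp add: algebra_simps)
  also have "q \<dots> = 0" by (simp add: q F.E_diff F.E_mult c minus_self h z)
  also have "?h * ?h + (1 - ?z) * (1 - ?z) = 1 + ((?h * ?h + ?z * ?z) - (?z + ?z))" by (simp add: algebra_simps)
  also have "q \<dots> \<le> 1 + q ((?h * ?h + ?z * ?z) - (?z + ?z))" using Q.tri Q.q_1 by (smt (verit))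
  also have "q ((?h * ?h + ?z * ?z) - (?z + ?z)) = 0" by (simp add: q F.E_diff F.E_mult F.E_add eq minus_self h z)
  finally have "(q ?h)\<^sup>2 \<le> 1" by simp
  hence "q ?h \<le> 1" by (simp add: power_le_one_iff abs_square_le_1)
  thus ?thesis by (simp add: q)
qed

text \<open>z plays the part of 1 - sqrt(1 - h h): it is the limit of the iterates for g = h h,
  which converge because the algebra is complete. Written without the unit, the relation passes
  through *-homomorphisms of algebras that may have none.\<close>

lemma circle_exists:
  assumes h: "h \<in> carrier A" "star A h = h" "cnorm A h < 1"
  shows "\<exists>z\<in>carrier A. star A z = z \<and> h \<otimes> z = z \<otimes> h \<and> h \<otimes> h \<oplus> z \<otimes> z = z \<oplus> z"
proof -
  interpret F: cstar_family A UNIV total_gen by (rule family_total_gen)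
  obtain q where q: "unital_seminorm q" "\<And>f. f \<in> free_carrier UNIV \<Longrightarrow> q f = cnorm A (total_eval f)"
    using unital_norm by blast
  interpret Q: unital_seminorm q by (rule q(1))
  let ?h = "sym_gen h"
  let ?g = "?h * ?h"
  let ?y = "sqrt_iter ?g"
  note H = sym_gen[OF h(1,2)]
  have g: "?g \<in> free_carrier UNIV" "self_adjoint ?g" using H by (auto simp: free_carrier_mult)
  have y: "?y n \<in> free_carrier UNIV" for n using g(1) by (rule free_carrier_sqrt_iter)
  have r1: "q ?g < 1"
  proof -
    have "q ?g \<le> cnorm A h * cnorm A h" using q(2)[OF g(1)] norm_mult[OF h(1,1)] H by (simp add: F.E_mult)
    also have "\<dots> < 1" using mult_strict_mono[OF h(3,3)] norm_nonneg[OF h(1)] by simp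
    finally show ?thesis .
  qed
  \<comment> \<open>The partial geometric sum, multiplied by 1 - r with r = q (h h), so that the
    induction involves no division.\<close>
  have step: "(1 - q ?g) * q (?y (n + d) - ?y n) \<le> q ?g ^ Suc n * (1 - q ?g ^ d)" for n d
  proof (induction d)
    case (Suc d)
    have "q (?y (n + Suc d) - ?y n) \<le> q ?g ^ Suc (n + d) + q (?y (n + d) - ?y n)"
      using Q.tri[of "?y (Suc (n + d)) - ?y (n + d)" "?y (n + d) - ?y n"] Q.q_sqrt_iter_step[OF r1, of "n + d"]
      by (simp del: sqrt_iter.simps power_Suc)
    hence "(1 - q ?g) * q (?y (n + Suc d) - ?y n) \<le>
       (1 - q ?g) * q ?g ^ Suc (n + d) + (1 - q ?g) * q (?y (n + d) - ?y n)"
      using r1 by (simp add: mult_left_mono distrib_left[symmetric] del: sqrt_iter.simps power_Suc)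
    thus ?case using Suc by (simp add: algebra_simps power_add del: sqrt_iter.simps)
  qed simp
  have "\<exists>N. \<forall>m\<ge>N. \<forall>n\<ge>N. cnorm A (total_eval (?y m) \<ominus> total_eval (?y n)) < e" if e: "e > 0" for e
  proof -
    have "(\<lambda>n. q ?g ^ Suc n) \<longlonglongrightarrow> 0" using r1 by (intro LIMSEQ_power_zero[THEN LIMSEQ_Suc]) auto
    moreover have "(1 - q ?g) * e > 0" using r1 e by simp
    ultimately obtain N where N: "\<And>n. n \<ge> N \<Longrightarrow> q ?g ^ Suc n < (1 - q ?g) * e"
      using order_tendstoD(2)[of "\<lambda>n. q ?g ^ Suc n" 0 sequentially "(1 - q ?g) * e"]
      unfolding eventually_sequentially by meson
    have lt: "q (?y m - ?y n) < e" if "n \<ge> N" "m \<ge> n" for m n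
    proof -
      have "q ?g ^ Suc n * (1 - q ?g ^ (m - n)) \<le> q ?g ^ Suc n * 1"
        by (intro mult_left_mono zero_le_power Q.q_nonneg) simp
      hence "(1 - q ?g) * q (?y m - ?y n) < (1 - q ?g) * e"
        using step[of n "m - n"] N[OF that(1)] that(2) by simp
      thus ?thesis using r1 by simp
    qed
    have "cnorm A (total_eval (?y m) \<ominus> total_eval (?y n)) < e" if "n \<ge> N" "m \<ge> N" for m n
    proof -
      have "q (?y m - ?y n) < e" using lt[of n m] lt[of m n] Q.q_diff_sym[of "?y m" "?y n"] that by (cases "m \<ge> n") auto
      thus ?thesis using y by (simp add: q F.E_diff free_carrier_diff)
    qed
    thus ?thesis by blast
  qed
  with complete[of "\<lambda>n. total_eval (?y n)"] y obtain z where z: "z \<in> carrier A" "(\<lambda>n. cnorm A (total_eval (?y n) \<ominus> z)) \<longlonglongrightarrow> 0"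
    by auto
  have cv: "conv_to (\<lambda>n. total_eval (?y n)) z" using z y by (auto simp: conv_to_def)
  have "conv_to (\<lambda>n. star A (total_eval (?y n))) z"
    using cv y self_adjoint_sqrt_iter[OF g(2)] by (simp add: F.E_star[symmetric] self_adjoint_def)
  hence sz: "star A z = z" using cv_unique cv_star[OF cv] by blast
  have "total_eval (?y n) \<otimes> h = h \<otimes> total_eval (?y n)" for n
  proof -
    have "?h * ?y n = ?y n * ?h" by (rule sqrt_iter_commute) (simp add: mult.assoc)
    thus ?thesis using F.E_mult[OF H(1) y[of n]] F.E_mult[OF y[of n] H(1)] H(3) by simp
  qed
  hence cz: "h \<otimes> z = z \<otimes> h"
    using cv_mult[OF cv_const[OF h(1)] cv] cv_mult[OF cv cv_const[OF h(1)]] cv_unique by auto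
  have cvS: "conv_to (\<lambda>n. total_eval (?y (Suc n))) z"
    using cv unfolding conv_to_def by (auto intro: LIMSEQ_Suc simp del: sqrt_iter.simps)
  have "total_eval (?y (Suc n)) \<oplus> total_eval (?y (Suc n)) = h \<otimes> h \<oplus> total_eval (?y n) \<otimes> total_eval (?y n)" for n
    using arg_cong[OF sqrt_iter_double[of ?g n], of total_eval] g H y
    by (simp add: F.E_add F.E_mult free_carrier_mult del: sqrt_iter.simps)
  hence "conv_to (\<lambda>n. h \<otimes> h \<oplus> total_eval (?y n) \<otimes> total_eval (?y n)) (z \<oplus> z)" using cv_add[OF cvS cvS] by simp
  moreover have "conv_to (\<lambda>n. h \<otimes> h \<oplus> total_eval (?y n) \<otimes> total_eval (?y n)) (h \<otimes> h \<oplus> z \<otimes> z)"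
    using h by (intro cv_add cv_mult cv cv_const) auto
  ultimately have "h \<otimes> h \<oplus> z \<otimes> z = z \<oplus> z" using cv_unique by blast
  thus ?thesis using z sz cz by blast
qed

text \<open>In a lift to the free algebra every summand is positive, so by \<open>npos_mono\<close>
  its norm is at most that of the whole sum.\<close>

lemma sum_star_mult_eq_zero:
  assumes K: "finite K" "a \<in> K \<rightarrow> carrier A" and z: "(\<Oplus>i\<in>K. star A (a i) \<otimes> a i) = \<zero>" and i: "i \<in> K"
  shows "a i = \<zero>"
proof -
  interpret F: cstar_family A UNIV total_gen by (rule family_total_gen)
  obtain q where q: "unital_seminorm q" "\<And>f. f \<in> free_carrier UNIV \<Longrightarrow> q f = cnorm A (total_eval f)"
    using unital_norm by blast
  interpret Q: unital_seminorm q by (rule q(1))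
  let ?g = "\<lambda>i. free_gen (a i)"
  have g: "?g i \<in> free_carrier UNIV" for i by (simp add: free_gen_carrier)
  have eg: "total_eval (?g i) = a i" if "i \<in> K" for i using K that by (auto simp: F.E_gen total_gen_def)
  have "total_eval (\<Sum>i\<in>L. free_star (?g i) * ?g i) = (\<Oplus>i\<in>L. star A (a i) \<otimes> a i)" if "L \<subseteq> K" for L
    using finite_subset[OF that K(1)] that
  proof (induction L rule: finite_induct)
    case (insert j L)
    have "a i \<in> carrier A" if "i \<in> insert j L" for i using K insert.prems that by blast
    with insert show ?case using g K(2) eg
      by (subst M.finsum_insert) (auto simp: F.E_add F.E_mult F.E_star free_carrier_sum free_carrier_mult free_carrier_star)
  qed (simp add: F.E_0)
  hence "q (\<Sum>i\<in>K. free_star (?g i) * ?g i) = 0"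
    using g z by (simp add: q free_carrier_sum free_carrier_mult free_carrier_star)
  moreover have "(\<Sum>i\<in>K. free_star (?g i) * ?g i) =
      free_star (?g i) * ?g i + (\<Sum>j\<in>K - {i}. free_star (?g j) * ?g j)"
    using K i by (simp add: sum.remove)
  ultimately have "q (free_star (?g i) * ?g i) \<le> 0"
    using Q.npos_mono[OF Q.npos_star_mult Q.npos_sum[OF Q.npos_star_mult], of "?g i" "?g" "K - {i}"] by simp
  hence "q (?g i) = 0" by (simp add: Q.cstar)
  hence "cnorm A (a i) = 0" using q(2)[OF g] eg[OF i] by simp
  thus ?thesis using norm_eq_zero_iff K i by auto
qed

end

lemma star_homD:
  assumes "\<phi> \<in> star_hom A C" "x \<in> carrier A"
  shows "\<phi> x \<in> carrier C" "y \<in> carrier A \<Longrightarrow> \<phi> (x \<oplus>\<^bsub>A\<^esub> y) = \<phi> x \<oplus>\<^bsub>C\<^esub> \<phi> y"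
    "y \<in> carrier A \<Longrightarrow> \<phi> (x \<otimes>\<^bsub>A\<^esub> y) = \<phi> x \<otimes>\<^bsub>C\<^esub> \<phi> y"
    "\<phi> (star A x) = star C (\<phi> x)" "\<phi> (a \<odot>\<^bsub>A\<^esub> x) = a \<odot>\<^bsub>C\<^esub> \<phi> x"
  using assms by (auto simp: star_hom_def)

text \<open>For a self-adjoint strict contraction the relation of \<open>circle_exists\<close> is
  preserved by the homomorphism, and \<open>norm_le_one_of_circle\<close> turns it into a norm bound
  for the image. The C*-identity extends this to all x through x* x, scaled slightly below norm
  1.\<close>

theorem star_hom_contractive:
  assumes A: "cstar_algebra A" and C: "cstar_algebra C" and \<phi>: "\<phi> \<in> star_hom A C" and x: "x \<in> carrier A"
  shows "cnorm C (\<phi> x) \<le> cnorm A x"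
proof -
  interpret A: cstar_algebra A by (rule A)
  interpret C: cstar_algebra C by (rule C)
  note hom = star_homD[OF \<phi>]
  have sa: "cnorm C (\<phi> h) \<le> 1" if h: "h \<in> carrier A" "star A h = h" "cnorm A h < 1" for h
  proof -
    obtain z where z: "z \<in> carrier A" "star A z = z" "h \<otimes>\<^bsub>A\<^esub> z = z \<otimes>\<^bsub>A\<^esub> h" "h \<otimes>\<^bsub>A\<^esub> h \<oplus>\<^bsub>A\<^esub> z \<otimes>\<^bsub>A\<^esub> z = z \<oplus>\<^bsub>A\<^esub> z"
      using A.circle_exists[OF h] by blast
    show ?thesis
    proof (rule C.norm_le_one_of_circle[of _ "\<phi> z"])
      show "\<phi> h \<in> carrier C" "\<phi> z \<in> carrier C" using h z hom by auto
      show "star C (\<phi> h) = \<phi> h" "star C (\<phi> z) = \<phi> z" using h z hom(4) by metis+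
      show "\<phi> h \<otimes>\<^bsub>C\<^esub> \<phi> z = \<phi> z \<otimes>\<^bsub>C\<^esub> \<phi> h" using h z hom(3) by metis
      have "\<phi> (h \<otimes>\<^bsub>A\<^esub> h \<oplus>\<^bsub>A\<^esub> z \<otimes>\<^bsub>A\<^esub> z) = \<phi> (z \<oplus>\<^bsub>A\<^esub> z)" by (simp only: z(4))
      thus "\<phi> h \<otimes>\<^bsub>C\<^esub> \<phi> h \<oplus>\<^bsub>C\<^esub> \<phi> z \<otimes>\<^bsub>C\<^esub> \<phi> z = \<phi> z \<oplus>\<^bsub>C\<^esub> \<phi> z"
        using hom(2)[of "h \<otimes>\<^bsub>A\<^esub> h" "z \<otimes>\<^bsub>A\<^esub> z"] hom(2)[of z z] hom(3)[of h h] hom(3)[of z z] h(1) z(1)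
        by (simp del: z(4))
    qed
  qed
  have "(cnorm C (\<phi> x))\<^sup>2 \<le> (cnorm A x)\<^sup>2"
  proof (rule field_le_epsilon)
    fix e :: real assume e: "e > 0"
    define c where "c = (cnorm A x)\<^sup>2 + e"
    have c: "c > 0" "(cnorm A x)\<^sup>2 < c" using e by (simp_all add: c_def add_nonneg_pos)
    let ?h = "complex_of_real (1/c) \<odot>\<^bsub>A\<^esub> (star A x \<otimes>\<^bsub>A\<^esub> x)"
    have h: "?h \<in> carrier A" "star A ?h = ?h" using x by (simp_all add: A.star_smult A.star_mult A.star_star)
    have "cnorm A ?h < 1"
      using c x A.norm_smult[of "star A x \<otimes>\<^bsub>A\<^esub> x" "complex_of_real (1/c)"]
      by (simp add: A.cstar_identity norm_divide)
    hence "cnorm C (\<phi> ?h) \<le> 1" by (rule sa[OF h])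
    moreover have "\<phi> ?h = complex_of_real (1/c) \<odot>\<^bsub>C\<^esub> (star C (\<phi> x) \<otimes>\<^bsub>C\<^esub> \<phi> x)"
      using x hom by simp
    ultimately have "(1/c) * (cnorm C (\<phi> x))\<^sup>2 \<le> 1"
      using c x hom(1,4) C.norm_smult[of "star C (\<phi> x) \<otimes>\<^bsub>C\<^esub> \<phi> x" "complex_of_real (1/c)"]
      by (simp add: C.cstar_identity norm_divide)
    thus "(cnorm C (\<phi> x))\<^sup>2 \<le> (cnorm A x)\<^sup>2 + e" using c by (simp add: pos_divide_le_eq c_def)
  qed
  thus ?thesis using A.norm_nonneg[OF x] by (rule power2_le_imp_le)
qed

text \<open>This identifies the norm of an evaluated polynomial in a completion with the value of
  the seminorm on it, so that norms can be compared before completing.\<close>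

lemma (in free_seminorm) free_eval_completion:
  assumes "f \<in> F0"
  shows "free_eval C (completion_gen X p) f = cls (\<lambda>n. f)"
proof -
  interpret C: cstar_algebra C by (rule completion_cstar)
  interpret F: cstar_family C X "completion_gen X p"
    by unfold_locales (simp add: Pi_iff completion_gen_def cls_in CS_const free_gen_carrier)
  have letter: "F.ev [(x, b)] = cls (\<lambda>n. Poly_Mapping.single (Word [(x, b)]) 1)" if "x \<in> X" for x b
    using that by (cases b)
      (simp_all add: completion_gen_def star_cls CS_const free_gen_carrier, simp_all add: free_gen_def free_star_single word_star_def)
  have one: "Poly_Mapping.single (Word l) (1::complex) \<in> F0" if "l \<noteq> []" "fst ` set l \<subseteq> X" for l
    using that by (intro free_carrier_single) (auto simp: star_words_def)
  have word: "l \<noteq> [] \<Longrightarrow> fst ` set l \<subseteq> X \<Longrightarrow> F.ev l = cls (\<lambda>n. Poly_Mapping.single (Word l) 1)" for l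
  proof (induction l rule: list_nonempty_induct)
    case (single a) thus ?case using letter by (cases a) auto
  next
    case (cons a l)
    have "F.ev (a # l) = F.ev [a] \<otimes>\<^bsub>C\<^esub> F.ev l" using F.ev_append[of "[a]" l] cons by simp
    also have "\<dots> = cls (\<lambda>n. Poly_Mapping.single (Word [a]) 1) \<otimes>\<^bsub>C\<^esub> cls (\<lambda>n. Poly_Mapping.single (Word l) 1)"
      using cons letter by (cases a) auto
    also have "\<dots> = cls (\<lambda>n. Poly_Mapping.single (Word (a # l)) 1)"
      using cons one by (subst mult_cls) (auto simp: CS_const mult_single plus_star_word_def)
    finally show ?case .
  qed
  show ?thesis using assms
  proof (induction f rule: free_induct)
    case 0 thus ?case by (simp add: F.E_0 zero_cls)
  next
    case (add w a f)
    have w1: "Poly_Mapping.single w (1::complex) \<in> F0" using add by (intro free_carrier_single) auto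
    have sw: "Poly_Mapping.single w a = free_scale a (Poly_Mapping.single w 1)"
      by (simp add: free_scale_conv mult_single)
    have "F.ev (letters w) = cls (\<lambda>n. Poly_Mapping.single w 1)"
      using word[of "letters w"] add(1) by (simp add: star_words_def)
    hence "F.E (Poly_Mapping.single w a) = cls (\<lambda>n. Poly_Mapping.single w a)"
      unfolding F.E_single[OF add(1)] by (simp add: smult_cls CS_const w1 sw)
    thus ?case using add w1 by (simp add: F.E_add free_carrier_single add_cls CS_const)
  qed
qed

section \<open>The twisted regular representation\<close>

locale cocycle_graph = k_graph k \<Lambda> + group G
  for k :: nat and \<Lambda> :: "'l graph_data" and G :: "('g, 'm) monoid_scheme" (structure) +
  fixes \<eta> :: "'l \<Rightarrow> 'g" and \<sigma> :: "'g \<Rightarrow> 'g \<Rightarrow> complex"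
  assumes row_finite: "row_finite_no_sources k \<Lambda>"
    and is_functor: "graph_functor \<Lambda> G \<eta>"
    and cocycle: "\<sigma> \<in> two_cocycles G"
begin

abbreviation "X \<equiv> morphs \<Lambda>"
abbreviation "c \<equiv> functor_cocycle \<sigma> \<eta>"
abbreviation "D \<equiv> twisted_graph_cstar k \<Lambda> c"
abbreviation "T \<equiv> twisted_graph_family k \<Lambda> c"
abbreviation "A \<equiv> graph_cstar k \<Lambda>"
abbreviation "s \<equiv> graph_family k \<Lambda>"

lemma \<eta>_closed [simp]: "x \<in> X \<Longrightarrow> \<eta> x \<in> carrier G" using is_functor by (auto simp: graph_functor_def)
lemma \<eta>_comp: "x \<in> X \<Longrightarrow> y \<in> X \<Longrightarrow> src \<Lambda> x = rng \<Lambda> y \<Longrightarrow> \<eta> (pcomp \<Lambda> x y) = \<eta> x \<otimes> \<eta> y"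
  using is_functor by (auto simp: graph_functor_def)
lemma \<eta>_vertex: "v \<in> vertices \<Lambda> \<Longrightarrow> \<eta> v = \<one>" using is_functor by (auto simp: graph_functor_def)
lemma \<sigma>_norm: "g \<in> carrier G \<Longrightarrow> h \<in> carrier G \<Longrightarrow> cmod (\<sigma> g h) = 1"
  and \<sigma>_one: "g \<in> carrier G \<Longrightarrow> \<sigma> \<one> g = 1" "g \<in> carrier G \<Longrightarrow> \<sigma> g \<one> = 1"
  and \<sigma>_cocycle: "g \<in> carrier G \<Longrightarrow> h \<in> carrier G \<Longrightarrow> k' \<in> carrier G \<Longrightarrow>
    \<sigma> g h * \<sigma> (g \<otimes> h) k' = \<sigma> g (h \<otimes> k') * \<sigma> h k'"
  using cocycle by (auto simp: two_cocycles_def)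
lemma \<sigma>_cnj: "g \<in> carrier G \<Longrightarrow> h \<in> carrier G \<Longrightarrow> cnj (\<sigma> g h) * \<sigma> g h = 1"
  using \<sigma>_norm[of g h] by (metis complex_norm_square mult.commute of_real_1 one_power2)

lemma ck_D: "cuntz_krieger_family k \<Lambda> c D T" by (rule twisted_graph_family_ck)
lemma ck_A: "cuntz_krieger_family k \<Lambda> (\<lambda>_ _. 1) A s" by (rule twisted_graph_family_ck)

lemma cstar_D: "cstar_algebra D" using ck_D by (simp add: cuntz_krieger_family_def)
lemma cstar_A: "cstar_algebra A" using ck_A by (simp add: cuntz_krieger_family_def)

lemma finite_paths_from: "v \<in> vertices \<Lambda> \<Longrightarrow> n \<in> degrees k \<Longrightarrow> finite (paths_from \<Lambda> v n)"
  using row_finite by (simp add: row_finite_no_sources_def)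

section \<open>Degrees and phases of words\<close>

fun letter_deg :: "'l \<times> bool \<Rightarrow> 'g" where
  "letter_deg (x, b) = (if b then inv (\<eta> x) else \<eta> x)"

primrec word_deg :: "('l \<times> bool) list \<Rightarrow> 'g" where
  "word_deg [] = \<one>"
| "word_deg (a # l) = letter_deg a \<otimes> word_deg l"

text \<open>The left regular representation of \<open>G\<close> twisted by \<open>cnj \<sigma>\<close> sends \<open>g\<close> to the unitary
  \<open>\<delta>\<^sub>h \<mapsto> cnj (\<sigma> g h) \<delta>\<^sub>g\<^sub>h\<close>.  A word in the unitaries of \<open>\<eta> x\<close> and their adjoints maps \<open>\<delta>\<^sub>h\<close> to
  a multiple of a basis vector, and \<open>word_phase\<close> records the factor.\<close>

fun letter_phase :: "'l \<times> bool \<Rightarrow> 'g \<Rightarrow> complex" where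
  "letter_phase (x, b) h = (if b then \<sigma> (\<eta> x) (inv (\<eta> x) \<otimes> h) else cnj (\<sigma> (\<eta> x) h))"

primrec word_phase :: "('l \<times> bool) list \<Rightarrow> 'g \<Rightarrow> complex" where
  "word_phase [] h = 1"
| "word_phase (a # l) h = letter_phase a (word_deg l \<otimes> h) * word_phase l h"

abbreviation "over l \<equiv> fst ` set l \<subseteq> X"

lemma letter_deg_closed: "fst a \<in> X \<Longrightarrow> letter_deg a \<in> carrier G" by (cases a) auto
lemma word_deg_closed [simp]: "over l \<Longrightarrow> word_deg l \<in> carrier G"
  by (induction l) (auto intro!: m_closed letter_deg_closed)
lemma word_deg_append: "over l \<Longrightarrow> over l' \<Longrightarrow> word_deg (l @ l') = word_deg l \<otimes> word_deg l'"
  by (induction l) (auto simp: m_assoc letter_deg_closed)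

lemma word_phase_append:
  "over l \<Longrightarrow> over l' \<Longrightarrow> h \<in> carrier G \<Longrightarrow>
     word_phase (l @ l') h = word_phase l (word_deg l' \<otimes> h) * word_phase l' h"
  by (induction l) (auto simp: word_deg_append m_assoc)

lemma norm_letter_phase: "fst a \<in> X \<Longrightarrow> h \<in> carrier G \<Longrightarrow> cmod (letter_phase a h) = 1"
  by (cases a) (auto simp: \<sigma>_norm)

lemma norm_word_phase: "over l \<Longrightarrow> h \<in> carrier G \<Longrightarrow> cmod (word_phase l h) = 1"
  by (induction l) (auto simp: norm_mult norm_letter_phase)

text \<open>The letters commute with the right regular representation that sends the basis vector at
  g to \<open>cnj (\<sigma> g h)\<close> times the one at gh. For a generator this is the cocycle
  identity itself.\<close>

lemma letter_phase_mult:
  assumes "fst a \<in> X" "g \<in> carrier G" "h \<in> carrier G"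
  shows "letter_phase a (g \<otimes> h) * cnj (\<sigma> g h) = cnj (\<sigma> (letter_deg a \<otimes> g) h) * letter_phase a g"
proof -
  obtain x b where a: "a = (x, b)" by (cases a)
  have x: "\<eta> x \<in> carrier G" using assms a by simp
  show ?thesis
  proof (cases b)
    case False thus ?thesis using \<sigma>_cocycle[OF x assms(2,3)]
      by (simp add: a mult.commute flip: complex_cnj_mult)
  next
    case True
    \<comment> \<open>For an adjoint letter the cocycle identity is taken at eta x, k and h;
      unimodularity then moves the remaining factors across.\<close>
    let ?k = "inv (\<eta> x) \<otimes> g"
    have k: "?k \<in> carrier G" "\<eta> x \<otimes> ?k = g" using x assms by (simp_all flip: m_assoc)
    have "\<sigma> (\<eta> x) ?k * \<sigma> g h = \<sigma> (\<eta> x) (?k \<otimes> h) * \<sigma> ?k h"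
      using \<sigma>_cocycle[OF x k(1) assms(3)] k by simp
    hence "cnj (\<sigma> ?k h) * (\<sigma> (\<eta> x) ?k * \<sigma> g h) * cnj (\<sigma> g h) = cnj (\<sigma> ?k h) * (\<sigma> (\<eta> x) (?k \<otimes> h) * \<sigma> ?k h) * cnj (\<sigma> g h)"
      by simp
    hence "cnj (\<sigma> ?k h) * \<sigma> (\<eta> x) ?k * (cnj (\<sigma> g h) * \<sigma> g h) = \<sigma> (\<eta> x) (?k \<otimes> h) * cnj (\<sigma> g h) * (cnj (\<sigma> ?k h) * \<sigma> ?k h)"
      by (simp add: ac_simps)
    hence "cnj (\<sigma> ?k h) * \<sigma> (\<eta> x) ?k = \<sigma> (\<eta> x) (?k \<otimes> h) * cnj (\<sigma> g h)"
      by (simp only: \<sigma>_cnj[OF assms(2,3)] \<sigma>_cnj[OF k(1) assms(3)] mult_1_right)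
    thus ?thesis using True x assms by (simp add: a m_assoc)
  qed
qed

text \<open>The basis vector at h is the right translate of the one at the identity, and words
  commute with right translations. Hence a word of degree g acts as the number
  \<open>word_phase l \<one>\<close> times the unitary of g.\<close>

lemma word_phase_eq:
  "over l \<Longrightarrow> h \<in> carrier G \<Longrightarrow> word_phase l h = cnj (\<sigma> (word_deg l) h) * word_phase l \<one>"
proof (induction l)
  case (Cons a l)
  have "word_phase (a # l) h = letter_phase a (word_deg l \<otimes> h) * cnj (\<sigma> (word_deg l) h) * word_phase l \<one>"
    using Cons by simp
  thus ?case using Cons letter_phase_mult[of a "word_deg l" h] by simp
qed (simp add: \<sigma>_one)

definition list_star :: "('l \<times> bool) list \<Rightarrow> ('l \<times> bool) list" where
  "list_star l = rev (map (\<lambda>(x, b). (x, \<not> b)) l)"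

lemma list_star_simps [simp]: "list_star [] = []" "list_star ((x, b) # l) = list_star l @ [(x, \<not> b)]"
  by (simp_all add: list_star_def)

lemma over_list_star [simp]: "fst ` set (list_star l) = fst ` set l"
  by (simp add: list_star_def image_image case_prod_unfold)

lemma word_star_list_star: "word_star w = Word (list_star (letters w))"
  by (simp add: word_star_def list_star_def)

lemma letter_phase_cancel:
  "fst a \<in> X \<Longrightarrow> h \<in> carrier G \<Longrightarrow> letter_phase a (letter_deg (case a of (x, b) \<Rightarrow> (x, \<not> b)) \<otimes> h) *
     letter_phase (case a of (x, b) \<Rightarrow> (x, \<not> b)) h = 1"
  using \<sigma>_cnj[of "\<eta> (fst a)" h] \<sigma>_cnj[of "\<eta> (fst a)" "inv (\<eta> (fst a)) \<otimes> h"]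
  by (cases a) (auto simp: mult.commute simp flip: m_assoc)

lemma word_deg_list_star: "over l \<Longrightarrow> word_deg (list_star l) = inv (word_deg l)"
proof (induction l)
  case (Cons a l)
  thus ?case by (cases a) (auto simp add: word_deg_append inv_mult_group)
qed simp

text \<open>Each letter and its opposite act as mutually inverse unitaries, so a word times its
  adjoint fixes every basis vector.\<close>

lemma word_phase_list_star_cancel: "over l \<Longrightarrow> h \<in> carrier G \<Longrightarrow> word_phase (l @ list_star l) h = 1"
proof (induction l arbitrary: h)
  case (Cons a l)
  obtain x b where a: "a = (x, b)" by (cases a)
  let ?a = "(x, \<not> b)"
  have x: "x \<in> X" "over l" "over (list_star l)" using Cons.prems a by simp_all
  have d: "word_deg (l @ list_star l) = \<one>" using x by (simp add: word_deg_append word_deg_list_star)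
  have ia: "letter_deg ?a \<otimes> h \<in> carrier G" using x Cons.prems by simp
  have "word_phase ((l @ list_star l) @ [?a]) h = letter_phase ?a h"
    using x Cons ia by (subst word_phase_append) (simp_all add: letter_deg_closed image_Un)
  moreover have "word_deg ((l @ list_star l) @ [?a]) = letter_deg ?a"
    using x d letter_deg_closed[of ?a] by (subst word_deg_append) (simp_all add: image_Un)
  ultimately show ?case using letter_phase_cancel[of a h] Cons.prems x by (simp add: a)
qed simp

text \<open>The unitaries multiply with the factor \<open>cnj \<sigma>\<close>, so the adjoint of
  the unitary of g is \<open>\<sigma> g (inv g)\<close> times the unitary of the inverse of g. The
  conjugate of this factor is the one in the deformed involution.\<close>

lemma word_phase_list_star:
  assumes l: "over l"
  shows "word_phase (list_star l) \<one> = \<sigma> (word_deg l) (inv (word_deg l)) * cnj (word_phase l \<one>)"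
proof -
  let ?g = "word_deg l"
  have ls: "over (list_star l)" using l by simp
  have "word_phase l (inv ?g) * word_phase (list_star l) \<one> = 1"
    using word_phase_list_star_cancel[OF l, of \<one>] word_phase_append[OF l ls, of \<one>] l
    by (simp add: word_deg_list_star)
  hence "cnj (\<sigma> ?g (inv ?g)) * word_phase l \<one> * word_phase (list_star l) \<one> = 1"
    using word_phase_eq[OF l, of "inv ?g"] l by simp
  moreover have "cnj (word_phase l \<one>) * word_phase l \<one> = 1"
    using norm_word_phase[OF l, of \<one>] by (metis complex_norm_square mult.commute of_real_1 one_closed one_power2)
  moreover have "cnj (\<sigma> ?g (inv ?g)) * \<sigma> ?g (inv ?g) = 1" using l by (intro \<sigma>_cnj) auto
  moreover have "r = a * p'" if "a' * p * r = 1" "p' * p = 1" "a' * a = 1" for a a' p p' r :: complex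
  proof -
    have "r = (a' * a) * (p' * p) * r" using that by simp
    also have "\<dots> = a * p' * (a' * p * r)" by (simp only: ac_simps)
    finally show ?thesis using that by simp
  qed
  ultimately show ?thesis by blast
qed

text \<open>This is the coefficient at g of the vector obtained by applying f to the basis vector at
  the identity: the part of f in degree g, each word weighted by its phase.\<close>

definition twist :: "'g \<Rightarrow> 'l free_star \<Rightarrow> 'l free_star" where
  "twist g f = Poly_Mapping.mapp (\<lambda>w a. if word_deg (letters w) = g then word_phase (letters w) \<one> * a else 0) f"

lemma lookup_twist: "Poly_Mapping.lookup (twist g f) w =
    (if word_deg (letters w) = g then word_phase (letters w) \<one> * Poly_Mapping.lookup f w else 0)"
  by (auto simp: twist_def lookup_mapp when_def in_keys_iff)

lemma twist_add: "twist g (f + f') = twist g f + twist g f'"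
  and twist_diff: "twist g (f - f') = twist g f - twist g f'"
  and twist_scale: "twist g (free_scale a f) = free_scale a (twist g f)"
  and twist_0 [simp]: "twist g 0 = 0"
  by (rule poly_mapping_eqI; simp add: lookup_twist lookup_add lookup_minus lookup_free_scale algebra_simps)+

lemma twist_single: "twist g (Poly_Mapping.single w a) =
    (if word_deg (letters w) = g then Poly_Mapping.single w (word_phase (letters w) \<one> * a) else 0)"
  by (rule poly_mapping_eqI) (auto simp: lookup_twist lookup_single when_def)

lemma twist_carrier: "f \<in> free_carrier Y \<Longrightarrow> twist g f \<in> free_carrier Y"
  unfolding free_carrier_keys twist_def by (rule order_trans[OF keys_mapp_subset])

lemma twist_finite: "finite {g. twist g f \<noteq> 0}"
proof (rule finite_subset)
  show "{g. twist g f \<noteq> 0} \<subseteq> (\<lambda>w. word_deg (letters w)) ` Poly_Mapping.keys f"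
  proof safe
    fix g assume "twist g f \<noteq> 0"
    then obtain w where "Poly_Mapping.lookup (twist g f) w \<noteq> 0"
      using poly_mapping_eqI[of "twist g f" 0] by auto
    thus "g \<in> (\<lambda>w. word_deg (letters w)) ` Poly_Mapping.keys f"
      by (auto simp: lookup_twist in_keys_iff split: if_splits)
  qed
qed simp

end

section \<open>The Hilbert module of the twisted regular representation\<close>

context cocycle_graph begin

definition T_total :: "'l \<Rightarrow> 'l completion" where "T_total x = (if x \<in> X then T x else \<zero>\<^bsub>D\<^esub>)"

sublocale D: cstar_algebra D by (rule cstar_D)
sublocale A: cstar_algebra A by (rule cstar_A)

lemma T_closed [simp]: "x \<in> X \<Longrightarrow> T x \<in> carrier D" using ck_D by (auto simp: cuntz_krieger_family_def)
lemma s_closed [simp]: "x \<in> X \<Longrightarrow> s x \<in> carrier A" using ck_A by (auto simp: cuntz_krieger_family_def)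

sublocale DF: cstar_family D UNIV T_total
  by unfold_locales (simp add: T_total_def Pi_iff)
sublocale AF: cstar_family A X s
  by unfold_locales (simp add: Pi_iff)

abbreviation "F0 \<equiv> free_carrier X"
abbreviation "FU \<equiv> free_carrier UNIV"

lemma F0_FU: "f \<in> F0 \<Longrightarrow> f \<in> FU" by (auto simp: free_carrier_def)

text \<open>The inner product is kept in the free algebra and evaluated in \<open>D\<close> only for
  the norm, so that \<open>cauchy_schwarz\<close> applies to it directly.\<close>

definition inner :: "'l free_star \<Rightarrow> 'l free_star \<Rightarrow> 'l free_star" where
  "inner f h = (\<Sum>g. free_star (twist g f) * twist g h)"

lemma inner_eq_sum:
  "finite K \<Longrightarrow> {g. twist g f \<noteq> 0} \<subseteq> K \<Longrightarrow> inner f h = (\<Sum>g\<in>K. free_star (twist g f) * twist g h)"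
  unfolding inner_def by (rule Sum_any.expand_superset) (auto simp: free_star_0)

lemma inner_common:
  obtains K where "finite K" "inner f f = (\<Sum>g\<in>K. free_star (twist g f) * twist g f)"
    "inner f h = (\<Sum>g\<in>K. free_star (twist g f) * twist g h)"
    "inner h f = (\<Sum>g\<in>K. free_star (twist g h) * twist g f)"
    "inner h h = (\<Sum>g\<in>K. free_star (twist g h) * twist g h)"
proof -
  let ?K = "{g. twist g f \<noteq> 0} \<union> {g. twist g h \<noteq> 0}"
  have "finite ?K" using twist_finite by auto
  thus ?thesis using that[of ?K] inner_eq_sum[of ?K] by auto
qed

lemma inner_finite: "finite {g. free_star (twist g f) * twist g h \<noteq> 0}"
  by (rule finite_subset[OF _ twist_finite[of f]]) (auto simp: free_star_0)

lemma inner_add_right: "inner f (h + h') = inner f h + inner f h'"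
  unfolding inner_def twist_add distrib_left by (rule Sum_any.distrib[OF inner_finite inner_finite])

lemma inner_add_left: "inner (f + f') h = inner f h + inner f' h"
  unfolding inner_def twist_add free_star_add distrib_right by (rule Sum_any.distrib[OF inner_finite inner_finite])

lemma inner_0 [simp]: "inner 0 h = 0" "inner f 0 = 0"
  by (simp_all add: inner_def free_star_0)

lemma inner_scale_right: "inner f (free_scale a h) = free_scale a (inner f h)"
  using inner_eq_sum[OF twist_finite subset_refl, of f]
  by (simp add: twist_scale free_scale_mult_right free_scale_sum)

lemma free_star_inner: "free_star (inner f h) = inner h f"
  by (rule inner_common[of f h]) (simp add: free_star_sum free_star_mult free_star_free_star)

lemma inner_scale_left: "inner (free_scale a f) h = free_scale (cnj a) (inner f h)"
  by (metis free_star_inner inner_scale_right free_star_scale)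

lemma inner_carrier: assumes "f \<in> free_carrier Y" "h \<in> free_carrier Y" shows "inner f h \<in> free_carrier Y"
  unfolding inner_eq_sum[OF twist_finite subset_refl, of f h]
  using assms by (intro free_carrier_sum free_carrier_mult free_carrier_star twist_carrier)

lemma inner_single:
  "inner (Poly_Mapping.single u a) (Poly_Mapping.single w b) =
    (if word_deg (letters u) = word_deg (letters w)
     then Poly_Mapping.single (word_star u + w) (cnj (word_phase (letters u) \<one> * a) * (word_phase (letters w) \<one> * b)) else 0)"
proof -
  have "{g. twist g (Poly_Mapping.single u a) \<noteq> 0} \<subseteq> {word_deg (letters u)}"
    by (auto simp: twist_single)
  from inner_eq_sum[OF _ this] show ?thesis by (simp add: twist_single free_star_single mult_single)
qed

text \<open>Both sides are the same word. They are nonzero under the same condition, since the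
  letter takes the degree of u to that of w exactly when the opposite letter takes the degree of w
  to that of u, and then the two phases are conjugate.\<close>

lemma inner_letter_single:
  assumes a: "fst a \<in> X" and u: "over (letters u)" and w: "over (letters w)"
  shows "inner (Poly_Mapping.single (Word [a]) 1 * Poly_Mapping.single u x) (Poly_Mapping.single w y) =
    inner (Poly_Mapping.single u x) (free_star (Poly_Mapping.single (Word [a]) 1) * Poly_Mapping.single w y)"
proof -
  obtain z b where z: "a = (z, b)" by (cases a)
  have zX: "z \<in> X" using a z by simp
  let ?a' = "(z, \<not> b)"
  let ?du = "word_deg (letters u)" and ?dw = "word_deg (letters w)"
  have dc: "?du \<in> carrier G" "?dw \<in> carrier G" using u w by auto
  have ws: "word_star (Word [a]) = Word [?a']" by (simp add: word_star_def z)
  have iff: "letter_deg a \<otimes> ?du = ?dw \<longleftrightarrow> ?du = letter_deg ?a' \<otimes> ?dw"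
    using inv_solve_left[OF dc(1) \<eta>_closed[OF zX] dc(2)] inv_solve_left'[OF dc(2) \<eta>_closed[OF zX] dc(1)]
    unfolding z letter_deg.simps by (cases b; simp only: if_True if_False not_True_eq_False not_False_eq_True; metis)
  have ph: "cnj (letter_phase a ?du) = letter_phase ?a' ?dw" if "letter_deg a \<otimes> ?du = ?dw"
    using that iff by (cases b) (auto simp: z)
  have "word_star (Word [a] + u) + w = word_star u + (Word [?a'] + w)"
    by (simp add: word_star_plus ws add.assoc)
  moreover have "letters (Word [a] + u) = a # letters u" "letters (Word [?a'] + w) = ?a' # letters w"
    by (simp_all add: plus_star_word_def)
  ultimately show ?thesis using iff ph dc
    by (cases "letter_deg a \<otimes> ?du = ?dw")
      (simp_all del: letter_deg.simps letter_phase.simps add: mult_single free_star_single ws inner_single mult.assoc mult.left_commute)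
qed

lemma inner_letter:
  assumes a: "fst a \<in> X" and v: "v \<in> F0" and w: "w \<in> F0"
  shows "inner (Poly_Mapping.single (Word [a]) 1 * v) w = inner v (free_star (Poly_Mapping.single (Word [a]) 1) * w)"
  using v
proof (induction v rule: free_induct)
  case (add u x v)
  have "inner (Poly_Mapping.single (Word [a]) 1 * Poly_Mapping.single u x) w =
    inner (Poly_Mapping.single u x) (free_star (Poly_Mapping.single (Word [a]) 1) * w)"
    using w
  proof (induction w rule: free_induct)
    case (add z y w)
    thus ?case using inner_letter_single[OF a, of u z x y] \<open>u \<in> star_words X\<close>
      by (simp add: inner_add_right distrib_left star_words_def)
  qed simp
  thus ?case using add by (simp add: inner_add_left distrib_left)
qed simp

lemma inner_adjoint:
  assumes f: "f \<in> F0" and v: "v \<in> F0" and w: "w \<in> F0"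
  shows "inner (f * v) w = inner v (free_star f * w)"
proof -
  have word: "inner (Poly_Mapping.single (Word l) 1 * v) w = inner v (free_star (Poly_Mapping.single (Word l) 1) * w)"
    if "l \<noteq> []" "over l" "v \<in> F0" "w \<in> F0" for l v w
    using that
  proof (induction l arbitrary: v w rule: list_nonempty_induct)
    case (single a) thus ?case using inner_letter by simp
  next
    case (cons a l)
    let ?a = "Poly_Mapping.single (Word [a]) (1::complex)" and ?l = "Poly_Mapping.single (Word l) (1::complex)"
    have m: "Poly_Mapping.single (Word (a # l)) (1::complex) = ?a * ?l" by (simp add: mult_single plus_star_word_def)
    have c: "?a \<in> F0" "?l \<in> F0" using cons by (auto intro!: free_carrier_single simp: star_words_def)
    have "inner (?a * (?l * v)) w = inner (?l * v) (free_star ?a * w)"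
      using cons c by (intro inner_letter free_carrier_mult) auto
    also have "\<dots> = inner v (free_star ?l * (free_star ?a * w))"
      using cons c by (intro cons.IH free_carrier_mult free_carrier_star) auto
    finally show ?case unfolding m by (simp add: free_star_mult mult.assoc)
  qed
  show ?thesis using f
  proof (induction f rule: free_induct)
    case (add u a f)
    have s: "Poly_Mapping.single u a = free_scale a (Poly_Mapping.single u 1)"
      by (simp add: free_scale_conv mult_single)
    have "inner (Poly_Mapping.single u 1 * v) w = inner v (free_star (Poly_Mapping.single u 1) * w)"
      using word[of "letters u" v w] add v w by (simp add: star_words_def)
    hence "inner (Poly_Mapping.single u a * v) w = inner v (free_star (Poly_Mapping.single u a) * w)"
      unfolding s by (simp only: free_scale_mult_left inner_scale_left inner_scale_right free_star_scale)
    thus ?case using add by (simp only: inner_add_left inner_add_right distrib_right free_star_add)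
  qed (simp add: free_star_0)
qed

abbreviation "EU \<equiv> free_eval D T_total"

definition hnorm :: "'l free_star \<Rightarrow> real" where "hnorm v = sqrt (cnorm D (EU (inner v v)))"

lemma unital_D: obtains q where "unital_seminorm q" "\<And>f. f \<in> FU \<Longrightarrow> q f = cnorm D (EU f)"
  using unital_extension[OF DF.E_seminorm] by metis

lemma EU_nonneg: "f \<in> FU \<Longrightarrow> 0 \<le> cnorm D (EU f)" by (simp add: D.norm_nonneg)

lemma inner_cauchy_schwarz:
  assumes "f \<in> FU" "h \<in> FU"
  shows "cnorm D (EU (inner f h)) \<le> hnorm f * hnorm h"
proof -
  obtain q where q: "unital_seminorm q" "\<And>f. f \<in> FU \<Longrightarrow> q f = cnorm D (EU f)" using unital_D by blast
  obtain K where K: "finite K" "inner f f = (\<Sum>g\<in>K. free_star (twist g f) * twist g f)"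
    "inner f h = (\<Sum>g\<in>K. free_star (twist g f) * twist g h)"
    "inner h f = (\<Sum>g\<in>K. free_star (twist g h) * twist g f)"
    "inner h h = (\<Sum>g\<in>K. free_star (twist g h) * twist g h)"
    by (rule inner_common)
  have "(q (inner f h))\<^sup>2 \<le> q (inner f f) * q (inner h h)"
    unfolding K(2,3,5) using K(1) by (rule unital_seminorm.cauchy_schwarz[OF q(1)])
  hence "(cnorm D (EU (inner f h)))\<^sup>2 \<le> (hnorm f * hnorm h)\<^sup>2"
    using assms by (simp add: q inner_carrier hnorm_def power_mult_distrib EU_nonneg)
  thus ?thesis by (rule power2_le_imp_le) (simp add: hnorm_def EU_nonneg inner_carrier assms)
qed

lemma hnorm_sq: "v \<in> FU \<Longrightarrow> (hnorm v)\<^sup>2 = cnorm D (EU (inner v v))"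
  by (simp add: hnorm_def EU_nonneg inner_carrier)

lemma hnorm_nonneg: "v \<in> FU \<Longrightarrow> 0 \<le> hnorm v" by (simp add: hnorm_def EU_nonneg inner_carrier)

lemma hnorm_tri: assumes v: "v \<in> FU" and w: "w \<in> FU" shows "hnorm (v + w) \<le> hnorm v + hnorm w"
proof (rule power2_le_imp_le)
  note [simp] = v w inner_carrier
  have "(hnorm (v + w))\<^sup>2 = cnorm D (EU (inner v v) \<oplus>\<^bsub>D\<^esub> EU (inner w v) \<oplus>\<^bsub>D\<^esub> (EU (inner v w) \<oplus>\<^bsub>D\<^esub> EU (inner w w)))"
    by (simp add: hnorm_sq free_carrier_add inner_add_left inner_add_right DF.E_add)
  also have "\<dots> \<le> cnorm D (EU (inner v v)) + cnorm D (EU (inner w v)) + (cnorm D (EU (inner v w)) + cnorm D (EU (inner w w)))"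
    by (intro order_trans[OF D.norm_triangle] add_mono D.norm_triangle) auto
  also have "\<dots> \<le> (hnorm v)\<^sup>2 + hnorm w * hnorm v + (hnorm v * hnorm w + (hnorm w)\<^sup>2)"
    using inner_cauchy_schwarz[OF v w] inner_cauchy_schwarz[OF w v] hnorm_sq[OF v] hnorm_sq[OF w] by linarith
  also have "\<dots> = (hnorm v + hnorm w)\<^sup>2" by (simp add: power2_sum)
  finally show "(hnorm (v + w))\<^sup>2 \<le> (hnorm v + hnorm w)\<^sup>2" .
qed (use v w hnorm_nonneg in auto)

lemma hnorm_scale: assumes v: "v \<in> FU" shows "hnorm (free_scale a v) = cmod a * hnorm v"
proof -
  have "EU (inner (free_scale a v) (free_scale a v)) = (a * cnj a) \<odot>\<^bsub>D\<^esub> EU (inner v v)"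
    using v by (simp add: inner_scale_left inner_scale_right free_scale_scale DF.E_scale inner_carrier)
  thus ?thesis using v
    by (simp add: hnorm_def D.norm_smult inner_carrier norm_mult real_sqrt_mult)
qed

lemma hnorm_adjoint: assumes "f \<in> F0" "v \<in> F0" shows "(hnorm (f * v))\<^sup>2 \<le> hnorm v * hnorm (free_star f * f * v)"
proof -
  have "inner (f * v) (f * v) = inner v (free_star f * f * v)"
    using inner_adjoint[of f v "f * v"] assms by (simp add: free_carrier_mult mult.assoc)
  thus ?thesis using inner_cauchy_schwarz[of v "free_star f * f * v"] assms
    by (simp add: hnorm_sq F0_FU free_carrier_mult free_carrier_star)
qed

text \<open>The relation r holds for the operators: it annihilates every vector. Words are enough as
  test vectors because they span \<open>F0\<close>, and the value of \<open>R.op\<close> at r is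
  then 0, which is the form in which \<open>ck_rel\<close> states relations.\<close>

definition vanishes :: "'l free_star \<Rightarrow> bool" where
  "vanishes r \<longleftrightarrow> (\<forall>g. \<forall>u\<in>star_words X. EU (twist g (r * Poly_Mapping.single u 1)) = \<zero>\<^bsub>D\<^esub>)"

lemma hnorm_vanishes:
  assumes r: "r \<in> F0" "vanishes r" and v: "v \<in> F0" shows "hnorm (r * v) = 0"
proof -
  have z: "EU (twist g (r * v)) = \<zero>\<^bsub>D\<^esub>" for g
    using v
  proof (induction v rule: free_induct)
    case 0 thus ?case by (simp add: DF.E_0)
  next
    case (add u a v)
    have s: "Poly_Mapping.single u a = free_scale a (Poly_Mapping.single u 1)"
      by (simp add: free_scale_conv mult_single)
    have c: "r * Poly_Mapping.single u b \<in> FU" "r * v \<in> FU" for b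
      using add r by (auto intro!: F0_FU free_carrier_mult free_carrier_single)
    have "EU (twist g (r * Poly_Mapping.single u a)) = a \<odot>\<^bsub>D\<^esub> EU (twist g (r * Poly_Mapping.single u 1))"
      unfolding s free_scale_mult_right twist_scale using c by (intro DF.E_scale twist_carrier)
    also have "\<dots> = \<zero>\<^bsub>D\<^esub>" using r add by (simp add: vanishes_def)
    finally show ?case using c add.IH by (simp add: distrib_left twist_add DF.E_add twist_carrier)
  qed
  have rv: "r * v \<in> FU" using r v by (auto intro: F0_FU free_carrier_mult)
  have "EU (\<Sum>g\<in>K. free_star (twist g (r * v)) * twist g (r * v)) = \<zero>\<^bsub>D\<^esub>" if "finite K" for K
    using that
  proof (induction K rule: finite_induct)
    case (insert g K)
    thus ?case using z[of g] rv
      by (simp add: DF.E_add DF.E_mult DF.E_star free_carrier_sum free_carrier_mult free_carrier_star twist_carrier)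
  qed (simp add: DF.E_0)
  hence "EU (inner (r * v) (r * v)) = \<zero>\<^bsub>D\<^esub>"
    unfolding inner_eq_sum[OF twist_finite subset_refl, of "r * v" "r * v"] using twist_finite by blast
  thus ?thesis by (simp add: hnorm_def)
qed

text \<open>The coefficient with which the word acts on the fibre of the module over h, on its way
  to the fibre over the degree of the word times h.\<close>

definition word_act :: "('l \<times> bool) list \<Rightarrow> 'g \<Rightarrow> 'l completion" where
  "word_act l h = word_phase l h \<odot>\<^bsub>D\<^esub> word_eval D T_total l"

lemma twist_word:
  assumes l: "l \<noteq> []" "over l" and u: "u \<in> star_words X"
  shows "EU (twist g (Poly_Mapping.single (Word l) a * Poly_Mapping.single u 1)) =
    (if word_deg l \<otimes> word_deg (letters u) = g
     then (a \<odot>\<^bsub>D\<^esub> word_act l (word_deg (letters u))) \<otimes>\<^bsub>D\<^esub> (word_phase (letters u) \<one> \<odot>\<^bsub>D\<^esub> word_eval D T_total (letters u))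
     else \<zero>\<^bsub>D\<^esub>)"
proof -
  have u': "letters u \<noteq> []" "over (letters u)" using u by (auto simp: star_words_def)
  have lu: "letters (Word l + u) = l @ letters u" by (simp add: plus_star_word_def)
  have c: "word_eval D T_total l \<in> carrier D" "word_eval D T_total (letters u) \<in> carrier D"
    by (simp_all add: DF.ev_closed)
  have w: "Word l + u \<in> star_words UNIV" using l by (simp add: star_words_def lu)
  have d: "word_deg (letters u) \<in> carrier G" using u' by simp
  show ?thesis using u' l c d
    by (auto simp: mult_single twist_single DF.E_0 lu word_deg_append word_phase_append DF.E_single[OF w]
        DF.ev_append word_act_def D.mult_smult_left D.mult_smult_right mult.commute mult.left_commute simp flip: D.sa)
qed

text \<open>Words of equal degree send the fibre over h to the same fibre, so it suffices that their
  coefficients in \<open>D\<close> cancel for every h.\<close>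

lemma sum_vanishes:
  assumes K: "finite K" "\<And>i. i \<in> K \<Longrightarrow> w i \<noteq> [] \<and> over (w i) \<and> word_deg (w i) = d"
    and z: "\<And>h. h \<in> carrier G \<Longrightarrow> (\<Oplus>\<^bsub>D\<^esub>i\<in>K. a i \<odot>\<^bsub>D\<^esub> word_act (w i) h) = \<zero>\<^bsub>D\<^esub>"
  shows "vanishes (\<Sum>i\<in>K. Poly_Mapping.single (Word (w i)) (a i))"
  unfolding vanishes_def
proof (intro allI ballI)
  fix g u assume u: "u \<in> star_words X"
  let ?h = "word_deg (letters u)"
  let ?e = "word_phase (letters u) \<one> \<odot>\<^bsub>D\<^esub> word_eval D T_total (letters u)"
  have h: "?h \<in> carrier G" using u by (simp add: star_words_def)
  have e: "?e \<in> carrier D" by (simp add: DF.ev_closed)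
  have wc: "word_act (w i) ?h \<in> carrier D" for i by (simp add: word_act_def DF.ev_closed)
  have c: "Poly_Mapping.single (Word (w i)) (a i) * Poly_Mapping.single u 1 \<in> FU" if "i \<in> K" for i
    using K(2)[OF that] u by (intro free_carrier_mult free_carrier_single) (auto simp: star_words_def)
  have "L \<subseteq> K \<Longrightarrow> EU (twist g ((\<Sum>i\<in>L. Poly_Mapping.single (Word (w i)) (a i)) * Poly_Mapping.single u 1)) =
    (if d \<otimes> ?h = g then (\<Oplus>\<^bsub>D\<^esub>i\<in>L. a i \<odot>\<^bsub>D\<^esub> word_act (w i) ?h) \<otimes>\<^bsub>D\<^esub> ?e else \<zero>\<^bsub>D\<^esub>)" if "finite L" for L
    using that
  proof (induction L rule: finite_induct)
    case empty show ?case using e by (simp add: DF.E_0)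
  next
    case (insert i L)
    let ?f = "\<lambda>i. Poly_Mapping.single (Word (w i)) (a i)" and ?u = "Poly_Mapping.single u (1::complex)"
    have i: "i \<in> K" "L \<subseteq> K" using insert by auto
    have S: "sum ?f L * ?u \<in> FU" unfolding sum_distrib_right using i c by (intro free_carrier_sum) auto
    have F: "(\<Oplus>\<^bsub>D\<^esub>i\<in>L. a i \<odot>\<^bsub>D\<^esub> word_act (w i) ?h) \<in> carrier D" using wc by (intro D.M.finsum_closed) auto
    have "sum ?f (insert i L) * ?u = ?f i * ?u + sum ?f L * ?u" using insert.hyps by (simp add: distrib_right)
    hence "EU (twist g (sum ?f (insert i L) * ?u)) = EU (twist g (?f i * ?u)) \<oplus>\<^bsub>D\<^esub> EU (twist g (sum ?f L * ?u))"
      using DF.E_add[OF twist_carrier[OF c[OF i(1)]] twist_carrier[OF S]] by (simp only: twist_add)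
    moreover have "(\<Oplus>\<^bsub>D\<^esub>j\<in>insert i L. a j \<odot>\<^bsub>D\<^esub> word_act (w j) ?h) =
       a i \<odot>\<^bsub>D\<^esub> word_act (w i) ?h \<oplus>\<^bsub>D\<^esub> (\<Oplus>\<^bsub>D\<^esub>j\<in>L. a j \<odot>\<^bsub>D\<^esub> word_act (w j) ?h)"
      using insert.hyps wc by (intro D.M.finsum_insert) auto
    ultimately show ?case
      using insert.IH[OF i(2)] K(2)[OF i(1)] u e wc F by (simp add: twist_word D.mult_add_left)
  qed
  from this[OF K(1) subset_refl] z[OF h] e
  show "EU (twist g ((\<Sum>i\<in>K. Poly_Mapping.single (Word (w i)) (a i)) * Poly_Mapping.single u 1)) = \<zero>\<^bsub>D\<^esub>" by simp
qed

lemma diff_vanishes: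
  assumes "l \<noteq> []" "over l" "l' \<noteq> []" "over l'" "word_deg l = word_deg l'"
    and "\<And>h. h \<in> carrier G \<Longrightarrow> word_act l h = word_act l' h"
  shows "vanishes (Poly_Mapping.single (Word l) 1 - Poly_Mapping.single (Word l') 1)"
proof -
  \<comment> \<open>The difference is written as a sum over the booleans with coefficients 1 and -1,
    to fit \<open>sum_vanishes\<close>.\<close>
  let ?w = "\<lambda>b. if b then l else l'" and ?a = "\<lambda>b. if b then 1 else -1 :: complex"
  have c: "word_act l h \<in> carrier D" for l h by (simp add: word_act_def DF.ev_closed)
  have "vanishes (\<Sum>b\<in>{True, False}. Poly_Mapping.single (Word (?w b)) (?a b))"
  proof (rule sum_vanishes[where d = "word_deg l"])
    fix h assume h: "h \<in> carrier G"
    have "(\<Oplus>\<^bsub>D\<^esub>b\<in>{True, False}. ?a b \<odot>\<^bsub>D\<^esub> word_act (?w b) h) = word_act l h \<ominus>\<^bsub>D\<^esub> word_act l' h"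
      using c by (simp add: D.diff D.s1)
    thus "(\<Oplus>\<^bsub>D\<^esub>b\<in>{True, False}. ?a b \<odot>\<^bsub>D\<^esub> word_act (?w b) h) = \<zero>\<^bsub>D\<^esub>"
      using assms(6)[OF h] c by (simp add: D.minus_self)
  qed (use assms in auto)
  moreover have "Poly_Mapping.single (Word l') (-1::complex) = - Poly_Mapping.single (Word l') 1"
    by (simp add: single_uminus)
  ultimately show ?thesis by simp
qed

end

section \<open>Untwisted Cuntz-Krieger relations for the operators\<close>

context cocycle_graph begin

abbreviation "gen \<equiv> free_gen :: 'l \<Rightarrow> 'l free_star"

lemma gen_words:
  "gen x = Poly_Mapping.single (Word [(x, False)]) 1"
  "free_star (gen x) = Poly_Mapping.single (Word [(x, True)]) 1"
  "gen x * gen y = Poly_Mapping.single (Word [(x, False), (y, False)]) 1"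
  "free_star (gen x) * gen y = Poly_Mapping.single (Word [(x, True), (y, False)]) 1"
  "gen x * free_star (gen y) = Poly_Mapping.single (Word [(x, False), (y, True)]) 1"
  by (simp_all add: free_gen_def free_star_single word_star_def mult_single plus_star_word_def)

lemma T_star_vertex: "v \<in> vertices \<Lambda> \<Longrightarrow> star D (T v) = T v"
  and T_idem: "v \<in> vertices \<Lambda> \<Longrightarrow> T v \<otimes>\<^bsub>D\<^esub> T v = T v"
  and T_orth: "v \<in> vertices \<Lambda> \<Longrightarrow> w \<in> vertices \<Lambda> \<Longrightarrow> v \<noteq> w \<Longrightarrow> T v \<otimes>\<^bsub>D\<^esub> T w = \<zero>\<^bsub>D\<^esub>"
  and T_comp: "x \<in> X \<Longrightarrow> y \<in> X \<Longrightarrow> src \<Lambda> x = rng \<Lambda> y \<Longrightarrow> T x \<otimes>\<^bsub>D\<^esub> T y = c x y \<odot>\<^bsub>D\<^esub> T (pcomp \<Lambda> x y)"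
  and T_isometry: "x \<in> X \<Longrightarrow> star D (T x) \<otimes>\<^bsub>D\<^esub> T x = T (src \<Lambda> x)"
  and T_sum: "v \<in> vertices \<Lambda> \<Longrightarrow> n \<in> degrees k \<Longrightarrow>
      (\<Oplus>\<^bsub>D\<^esub>x\<in>paths_from \<Lambda> v n. T x \<otimes>\<^bsub>D\<^esub> star D (T x)) = T v"
  using ck_D by (simp_all add: cuntz_krieger_family_def)

lemma T_total: "x \<in> X \<Longrightarrow> T_total x = T x" by (simp add: T_total_def)

lemma vanishes_vertex:
  assumes v: "v \<in> vertices \<Lambda>"
  shows "vanishes (free_star (gen v) - gen v)" "vanishes (gen v * gen v - gen v)"
  \<comment> \<open>Products are rewritten before their factors, so that each becomes a single
    word.\<close>
  unfolding gen_words(3-5) unfolding gen_words(2) unfolding gen_words(1) using v \<sigma>_one vm[OF v]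
  by (intro diff_vanishes; simp add: \<eta>_vertex word_act_def T_total T_star_vertex T_idem)+

lemma single_vanishes:
  assumes "l \<noteq> []" "over l" "\<And>h. h \<in> carrier G \<Longrightarrow> word_act l h = \<zero>\<^bsub>D\<^esub>"
  shows "vanishes (Poly_Mapping.single (Word l) 1)"
  using sum_vanishes[of "{()}" "\<lambda>_. l" "word_deg l" "\<lambda>_. 1"] assms by simp

lemma vanishes_orth:
  assumes "v \<in> vertices \<Lambda>" "w \<in> vertices \<Lambda>" "v \<noteq> w"
  shows "vanishes (gen v * gen w)"
  unfolding gen_words(3-5) unfolding gen_words(2) unfolding gen_words(1) using assms vm
  by (intro single_vanishes) (simp_all add: word_act_def T_total T_orth)

text \<open>Here the twist disappears. \<open>T\<close> contributes
  \<open>\<sigma> (\<eta> x) (\<eta> y)\<close>, the two phases contribute conjugates of sigma, and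
  by the cocycle identity the product is exactly the phase of the composed path.\<close>

lemma vanishes_comp:
  assumes x: "x \<in> X" and y: "y \<in> X" and xy: "src \<Lambda> x = rng \<Lambda> y"
  shows "vanishes (gen x * gen y - gen (pcomp \<Lambda> x y))"
  unfolding gen_words(3-5) unfolding gen_words(2) unfolding gen_words(1)
proof (rule diff_vanishes)
  fix h assume h: "h \<in> carrier G"
  let ?a = "\<sigma> (\<eta> x) (\<eta> y)" and ?b = "\<sigma> (\<eta> x \<otimes> \<eta> y) h" and ?c = "\<sigma> (\<eta> x) (\<eta> y \<otimes> h)" and ?d = "\<sigma> (\<eta> y) h"
  have e: "?a * ?b = ?c * ?d" using x y h by (intro \<sigma>_cocycle) auto
  have u: "cnj ?c * ?c = 1" "cnj ?d * ?d = 1" "cnj ?b * ?b = 1" using x y h by (auto intro!: \<sigma>_cnj)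
  have "cnj ?c * cnj ?d * ?a = cnj ?c * cnj ?d * (?a * ?b) * cnj ?b" using u(3) by (simp add: ac_simps)
  also have "\<dots> = (cnj ?c * ?c) * (cnj ?d * ?d) * cnj ?b" unfolding e by (simp only: ac_simps)
  finally have "cnj ?c * cnj ?d * ?a = cnj ?b" by (simp add: u)
  thus "word_act [(x, False), (y, False)] h = word_act [(pcomp \<Lambda> x y, False)] h"
    using x y xy h by (simp add: word_act_def T_total comp_closed T_comp \<eta>_comp functor_cocycle_def flip: D.sa)
qed (use x y xy in \<open>simp_all add: comp_closed \<eta>_comp\<close>)

lemma vanishes_isometry:
  assumes x: "x \<in> X" shows "vanishes (free_star (gen x) * gen x - gen (src \<Lambda> x))"
  unfolding gen_words(3-5) unfolding gen_words(2) unfolding gen_words(1)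
proof (rule diff_vanishes)
  have v: "src \<Lambda> x \<in> vertices \<Lambda>" by (rule src_vertex[OF x])
  show "word_deg [(x, True), (x, False)] = word_deg [(src \<Lambda> x, False)]" using x v by (simp add: \<eta>_vertex)
  fix h assume h: "h \<in> carrier G"
  have "inv (\<eta> x) \<otimes> (\<eta> x \<otimes> h) = h" using x h by (simp flip: m_assoc)
  thus "word_act [(x, True), (x, False)] h = word_act [(src \<Lambda> x, False)] h"
    using x h v \<sigma>_one \<sigma>_cnj[of "\<eta> x" h]
    by (simp add: word_act_def T_total src_closed T_isometry \<eta>_vertex mult.commute)
qed (use x in \<open>simp_all add: src_closed\<close>)

lemma vanishes_sum:
  assumes v: "v \<in> vertices \<Lambda>" and n: "n \<in> degrees k"
  shows "vanishes (gen v - (\<Sum>x\<in>paths_from \<Lambda> v n. gen x * free_star (gen x)))"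
proof -
  let ?P = "paths_from \<Lambda> v n"
  \<comment> \<open>\<open>None\<close> indexes the vertex term with coefficient 1,
    \<open>Some x\<close> the term of the path x with coefficient -1.\<close>
  let ?K = "insert None (Some ` ?P)"
  let ?w = "case_option [(v, False)] (\<lambda>x. [(x, False), (x, True)])"
  let ?a = "case_option 1 (\<lambda>_. -1) :: 'l option \<Rightarrow> complex"
  have fin: "finite ?P" by (rule finite_paths_from[OF v n])
  have vX: "v \<in> X" by (rule vm[OF v])
  have one: "x \<in> ?P \<Longrightarrow> x \<in> X" for x by (rule pm)
  have act: "word_act [(x, False), (x, True)] h = T x \<otimes>\<^bsub>D\<^esub> star D (T x)" if "x \<in> ?P" "h \<in> carrier G" for x h
    using one[OF that(1)] that(2) \<sigma>_cnj[of "\<eta> x" "inv (\<eta> x) \<otimes> h"] by (simp add: word_act_def T_total D.s1)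
  have actv: "word_act [(v, False)] h = T v" if "h \<in> carrier G" for h
    using that v vX by (simp add: word_act_def T_total \<eta>_vertex \<sigma>_one D.s1)
  have "vanishes (\<Sum>i\<in>?K. Poly_Mapping.single (Word (?w i)) (?a i))"
  proof (rule sum_vanishes[where d = \<one>])
    fix i assume "i \<in> ?K"
    thus "?w i \<noteq> [] \<and> over (?w i) \<and> word_deg (?w i) = \<one>" using one v vX by (auto simp: \<eta>_vertex)
  next
    fix h assume h: "h \<in> carrier G"
    have wc: "word_act l h \<in> carrier D" for l by (simp add: word_act_def DF.ev_closed)
    have "(\<Oplus>\<^bsub>D\<^esub>i\<in>Some ` ?P. ?a i \<odot>\<^bsub>D\<^esub> word_act (?w i) h) =
        (\<Oplus>\<^bsub>D\<^esub>x\<in>?P. ?a (Some x) \<odot>\<^bsub>D\<^esub> word_act (?w (Some x)) h)"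
      using wc by (intro D.M.finsum_reindex) (simp_all add: Pi_iff)
    also have "\<dots> = (\<Oplus>\<^bsub>D\<^esub>x\<in>?P. (-1) \<odot>\<^bsub>D\<^esub> (T x \<otimes>\<^bsub>D\<^esub> star D (T x)))"
      using act[OF _ h] one by (intro D.M.finsum_cong') (simp_all add: Pi_iff)
    also have "\<dots> = (-1) \<odot>\<^bsub>D\<^esub> (\<Oplus>\<^bsub>D\<^esub>x\<in>?P. T x \<otimes>\<^bsub>D\<^esub> star D (T x))"
      using D.finsum_smult_ldistr[OF fin, of "-1" "\<lambda>x. T x \<otimes>\<^bsub>D\<^esub> star D (T x)"] one by (simp add: Pi_iff)
    also have "\<dots> = (-1) \<odot>\<^bsub>D\<^esub> T v" by (simp only: T_sum[OF v n])
    finally have "(\<Oplus>\<^bsub>D\<^esub>i\<in>?K. ?a i \<odot>\<^bsub>D\<^esub> word_act (?w i) h) = T v \<ominus>\<^bsub>D\<^esub> T v"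
      using fin wc vX by (subst D.M.finsum_insert) (auto simp: actv[OF h] D.s1 D.diff)
    thus "(\<Oplus>\<^bsub>D\<^esub>i\<in>?K. ?a i \<odot>\<^bsub>D\<^esub> word_act (?w i) h) = \<zero>\<^bsub>D\<^esub>" using vX by (simp add: D.minus_self)
  qed (use fin in auto)
  also have "(\<Sum>i\<in>?K. Poly_Mapping.single (Word (?w i)) (?a i)) =
      gen v + (\<Sum>x\<in>?P. - (gen x * free_star (gen x)))"
    unfolding gen_words(5) using fin by (simp add: sum.reindex gen_words(1) single_uminus)
  finally show ?thesis by (simp add: sum_negf)
qed

lemma hnorm_congr:
  assumes "f \<in> F0" "f' \<in> F0" "vanishes (f - f')" "v \<in> F0" shows "hnorm (f * v) \<le> hnorm (f' * v)"
proof -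
  have "hnorm (f' * v + (f - f') * v) \<le> hnorm (f' * v) + hnorm ((f - f') * v)"
    using assms by (intro hnorm_tri F0_FU free_carrier_mult free_carrier_diff) auto
  thus ?thesis using hnorm_vanishes[of "f - f'" v] assms by (simp add: free_carrier_diff left_diff_distrib)
qed

text \<open>Operator bounds must come before \<open>R\<close>, whose interpretation needs them, so
  they are read off the relations. For the projection p at the source, |p v|^2 <= |v| |p* p v| <=
  |v| |p v|, hence |p v| <= |v|; then |x v|^2 <= |v| |x* x v| <= |v| |p v|.\<close>

lemma hnorm_gen_le: assumes x: "x \<in> X" and v: "v \<in> F0" shows "hnorm (gen x * v) \<le> hnorm v"
proof -
  let ?s = "gen (src \<Lambda> x)"
  have c: "gen x \<in> F0" "?s \<in> F0" using x by (simp_all add: free_gen_carrier src_closed)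
  note [simp] = free_carrier_mult free_carrier_star
  have nn: "0 \<le> hnorm w" if "w \<in> F0" for w using that by (simp add: hnorm_nonneg F0_FU)
  have "hnorm (free_star ?s * ?s * v) \<le> hnorm (?s * v)"
    using vanishes_isometry[OF src_closed[OF x]] c v x by (intro hnorm_congr) (auto simp: src_src)
  hence "(hnorm (?s * v))\<^sup>2 \<le> hnorm v * hnorm (?s * v)"
    using hnorm_adjoint[OF c(2) v] nn[OF v] by (meson mult_left_mono order_trans)
  hence s: "hnorm (?s * v) \<le> hnorm v"
    using quotient_square_le[of "hnorm (?s * v)" "hnorm v"] nn[OF v] nn[of "?s * v"] c v
    by (simp add: power2_eq_square)
  have "hnorm (free_star (gen x) * gen x * v) \<le> hnorm (?s * v)"
    using vanishes_isometry[OF x] c v by (intro hnorm_congr) auto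
  hence "(hnorm (gen x * v))\<^sup>2 \<le> hnorm v * hnorm v"
    using hnorm_adjoint[OF c(1) v] s nn[OF v] by (meson mult_left_mono order_trans)
  thus ?thesis using power2_le_imp_le[of "hnorm (gen x * v)" "hnorm v"] nn[OF v] by (simp add: power2_eq_square)
qed

lemma hnorm_star_gen_le: assumes x: "x \<in> X" and v: "v \<in> F0" shows "hnorm (free_star (gen x) * v) \<le> hnorm v"
proof -
  have c: "gen x \<in> F0" "free_star (gen x) \<in> F0" "free_star (gen x) * v \<in> F0"
    using x v by (simp_all add: free_gen_carrier free_carrier_star free_carrier_mult)
  have "(hnorm (free_star (gen x) * v))\<^sup>2 \<le> hnorm v * hnorm (gen x * (free_star (gen x) * v))"
    using hnorm_adjoint[OF c(2) v] by (simp add: free_star_free_star mult.assoc)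
  also have "\<dots> \<le> hnorm v * hnorm (free_star (gen x) * v)"
    using hnorm_gen_le[OF x c(3)] v by (intro mult_left_mono) (auto simp: hnorm_nonneg F0_FU)
  finally show ?thesis using quotient_square_le[of "hnorm (free_star (gen x) * v)" "hnorm v"] c v
    by (simp add: power2_eq_square hnorm_nonneg F0_FU)
qed

lemma hnorm_letter_le:
  assumes a: "fst a \<in> X" and v: "v \<in> F0"
  shows "hnorm (Poly_Mapping.single (Word [a]) 1 * v) \<le> hnorm v"
proof (cases "snd a")
  case True
  hence "a = (fst a, True)" by (metis prod.collapse)
  thus ?thesis using hnorm_star_gen_le[OF a v, unfolded gen_words(2)] by metis
next
  case False
  hence "a = (fst a, False)" by (metis prod.collapse)
  thus ?thesis using hnorm_gen_le[OF a v, unfolded gen_words(1)] by metis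
qed

lemma hnorm_word_le:
  assumes "l \<noteq> []" "over l" "v \<in> F0" shows "hnorm (Poly_Mapping.single (Word l) 1 * v) \<le> hnorm v"
  using assms
proof (induction l rule: list_nonempty_induct)
  case (single a) thus ?case using hnorm_letter_le by simp
next
  case (cons a l)
  have "Poly_Mapping.single (Word (a # l)) (1::complex) * v =
      Poly_Mapping.single (Word [a]) 1 * (Poly_Mapping.single (Word l) 1 * v)"
    by (simp add: mult_single plus_star_word_def flip: mult.assoc)
  moreover have "Poly_Mapping.single (Word l) 1 * v \<in> F0"
    using cons by (intro free_carrier_mult free_carrier_single) (auto simp: star_words_def)
  ultimately show ?case using hnorm_letter_le[of a "Poly_Mapping.single (Word l) 1 * v"] cons by simp
qed

sublocale R: left_action F0 F0 hnorm
proof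
  fix f assume "f \<in> F0"
  thus "\<exists>M. \<forall>v\<in>F0. hnorm (f * v) \<le> M * hnorm v"
  proof (induction f rule: free_induct)
    case 0 show ?case using hnorm_scale[of 0 0] by (intro exI[of _ 0]) (auto simp: free_scale_0 free_carrier_0)
  next
    case (add w a f)
    then obtain M where M: "\<forall>v\<in>F0. hnorm (f * v) \<le> M * hnorm v" by blast
    have "hnorm ((Poly_Mapping.single w a + f) * v) \<le> (cmod a + M) * hnorm v" if v: "v \<in> F0" for v
    proof -
      have sw: "Poly_Mapping.single w a = free_scale a (Poly_Mapping.single w 1)"
        by (simp add: free_scale_conv mult_single)
      have c: "Poly_Mapping.single w b * v \<in> FU" "f * v \<in> FU" for b
        using add v by (auto intro!: F0_FU free_carrier_mult free_carrier_single)
      have "hnorm (Poly_Mapping.single w 1 * v) \<le> hnorm v"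
        using add v hnorm_word_le[of "letters w" v] by (simp add: star_words_def)
      hence "hnorm (Poly_Mapping.single w a * v) \<le> cmod a * hnorm v"
        unfolding sw using c by (simp add: free_scale_mult_left hnorm_scale mult_left_mono)
      thus ?thesis using hnorm_tri[OF c(1) c(2), of a] M v by (simp add: distrib_right) fastforce
    qed
    thus ?case by blast
  qed
qed (simp_all add: free_carrier_star free_carrier_mult free_carrier_0 free_carrier_scale hnorm_nonneg hnorm_tri
    hnorm_scale hnorm_adjoint F0_FU)

lemma op_vanishes: assumes "r \<in> F0" "vanishes r" shows "R.op r = 0"
  using R.op_least[of r 0] R.op_nonneg[of r] hnorm_vanishes[OF assms] assms by fastforce

lemma op_ck: "cstar_seminorm X R.op \<and> ck_rel k \<Lambda> (\<lambda>_ _. 1) R.op"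
proof
  show "cstar_seminorm X R.op"
    unfolding cstar_seminorm_def by (simp add: R.op_nonneg R.op_cstar R.op_scale R.op_add R.op_mult)
  show "ck_rel k \<Lambda> (\<lambda>_ _. 1) R.op"
    unfolding ck_rel_def free_scale_one
    by (intro conjI ballI impI op_vanishes vanishes_vertex vanishes_orth vanishes_comp vanishes_isometry vanishes_sum)
      (auto simp: fcl)
qed

text \<open>By \<open>op_ck\<close> the operator seminorm is one of the competitors in the supremum
  that defines the norm of \<open>A\<close>.\<close>

lemma op_le: assumes f: "f \<in> F0" shows "R.op f \<le> cnorm A (AF.E f)"
proof -
  let ?u = "universal_seminorm X (cuntz_krieger_family k \<Lambda> (\<lambda>_ _. 1))"
  have u: "cstar_seminorm X ?u" using universal_ck_seminorm by blast
  interpret U: free_seminorm X ?u by unfold_locales (rule u)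
  have "AF.E f = U.cls (\<lambda>n. f)"
    using U.free_eval_completion[OF f]
    by (simp add: twisted_graph_cstar_def twisted_graph_family_def universal_cstar_def universal_family_def)
  moreover have "cnorm U.C (U.cls (\<lambda>n. f)) = ?u f"
    using U.norm_cls[OF U.CS_const[OF f]] LIMSEQ_const_iff by metis
  ultimately have "cnorm A (AF.E f) = ?u f" by (simp add: twisted_graph_cstar_def universal_cstar_def)
  moreover have "R.op f \<le> ?u f"
    unfolding universal_ck_seminorm_eq using op_ck bdd[OF f] by (intro cSUP_upper2[of _ _ R.op]) auto
  ultimately show ?thesis by simp
qed

section \<open>Homogeneous polynomials and the fibrewise norm estimate\<close>

inductive_set homog :: "'g \<Rightarrow> 'l free_star set" for g where
  zero: "0 \<in> homog g"
| add: "w \<in> star_words X \<Longrightarrow> word_deg (letters w) = g \<Longrightarrow> f \<in> homog g \<Longrightarrow> Poly_Mapping.single w a + f \<in> homog g"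

lemma homog_F0: "f \<in> homog g \<Longrightarrow> f \<in> F0"
  by (induction rule: homog.induct) (auto intro: free_carrier_0 free_carrier_add free_carrier_single)

lemma homog_single: "w \<in> star_words X \<Longrightarrow> word_deg (letters w) = g \<Longrightarrow> Poly_Mapping.single w a \<in> homog g"
  using homog.add[OF _ _ homog.zero, of w g a] by simp

lemma homog_add: "f \<in> homog g \<Longrightarrow> f' \<in> homog g \<Longrightarrow> f + f' \<in> homog g"
  by (induction rule: homog.induct) (auto simp: add.assoc intro: homog.add)

lemma homog_scale: "f \<in> homog g \<Longrightarrow> free_scale a f \<in> homog g"
proof (induction rule: homog.induct)
  case (add w f b)
  have "free_scale a (Poly_Mapping.single w b) = Poly_Mapping.single w (a * b)"
    by (simp add: free_scale_conv mult_single)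
  thus ?case using add by (simp add: free_scale_add homog.add)
qed (simp add: free_scale_conv homog.zero)

lemma homog_mult1:
  assumes u: "u \<in> star_words X" "word_deg (letters u) = g" and f: "f \<in> homog h"
  shows "Poly_Mapping.single u a * f \<in> homog (g \<otimes> h) \<and>
    twist (g \<otimes> h) (Poly_Mapping.single u a * f) = free_scale (cnj (\<sigma> g h)) (twist g (Poly_Mapping.single u a) * twist h f)"
  using f
proof (induction rule: homog.induct)
  case zero show ?case by (simp add: homog.zero free_scale_conv)
next
  case (add w f b)
  have l: "letters (u + w) = letters u @ letters w" by (simp add: plus_star_word_def)
  have o: "over (letters u)" "over (letters w)" using u add by (auto simp: star_words_def)
  have uw: "u + w \<in> star_words X" using u add by (auto simp: star_words_def l)
  have d: "word_deg (letters (u + w)) = g \<otimes> h" using o u add by (simp add: l word_deg_append)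
  have hc: "h \<in> carrier G" using o add by auto
  have "word_phase (letters u @ letters w) \<one> = cnj (\<sigma> g h) * word_phase (letters u) \<one> * word_phase (letters w) \<one>"
    using word_phase_eq[OF o(1), of h] o u add hc by (simp add: word_phase_append)
  hence "twist (g \<otimes> h) (Poly_Mapping.single u a * Poly_Mapping.single w b) =
      free_scale (cnj (\<sigma> g h)) (twist g (Poly_Mapping.single u a) * twist h (Poly_Mapping.single w b))"
    using u add d by (simp add: mult_single twist_single free_scale_conv) (simp add: l ac_simps)
  thus ?case using add.IH homog.add[OF uw d, of _ "a * b"]
    by (simp add: distrib_left mult_single twist_add free_scale_add)
qed

text \<open>\<open>twist\<close> is multiplicative up to \<open>cnj (\<sigma> g h)\<close>,
  precisely the factor that the deformed product will compensate.\<close>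

lemma homog_mult:
  assumes f: "f \<in> homog g" and f': "f' \<in> homog h"
  shows "f * f' \<in> homog (g \<otimes> h) \<and> twist (g \<otimes> h) (f * f') = free_scale (cnj (\<sigma> g h)) (twist g f * twist h f')"
  using f
proof (induction rule: homog.induct)
  case zero show ?case by (simp add: homog.zero free_scale_conv)
next
  case (add w f b)
  show ?case using homog_mult1[OF add(1,2) f', of b] add.IH
    by (simp add: distrib_right twist_add free_scale_add homog_add)
qed

lemma homog_star:
  assumes f: "f \<in> homog g"
  shows "free_star f \<in> homog (inv g) \<and> twist (inv g) (free_star f) = free_scale (\<sigma> g (inv g)) (free_star (twist g f))"
  using f
proof (induction rule: homog.induct)
  case zero show ?case by (simp add: homog.zero free_scale_conv free_star_0)
next
  case (add w f b)
  have o: "over (letters w)" "letters w \<noteq> []" using add by (auto simp: star_words_def)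
  have ws: "word_star w \<in> star_words X" using add
    by (simp add: star_words_def letters_word_star letters_word_star_Nil)
  have d: "word_deg (letters (word_star w)) = inv g" using o add by (simp add: word_star_list_star word_deg_list_star)
  have p: "word_phase (letters (word_star w)) \<one> = \<sigma> g (inv g) * cnj (word_phase (letters w) \<one>)"
    using word_phase_list_star[OF o(1)] add by (simp add: word_star_list_star)
  have "twist (inv g) (free_star (Poly_Mapping.single w b)) = free_scale (\<sigma> g (inv g)) (free_star (twist g (Poly_Mapping.single w b)))"
    using d p add by (simp add: free_star_single twist_single free_scale_conv mult_single ac_simps)
  thus ?case using add.IH homog.add[OF ws d, of _ "cnj b"]
    by (simp add: free_star_add free_star_single twist_add free_scale_add)
qed

lemma inner_homog:
  assumes f: "f \<in> homog g" shows "inner f f = free_star (twist g f) * twist g f"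
proof -
  have "twist h f = 0" if "h \<noteq> g" for h
    using f that by (induction rule: homog.induct) (auto simp: twist_add twist_single)
  hence "{h. twist h f \<noteq> 0} \<subseteq> {g}" by auto
  from inner_eq_sum[OF _ this] show ?thesis by simp
qed

text \<open>A homogeneous vector has a single component, so its norm is the norm of that component
  by the C*-identity.\<close>

lemma hnorm_homog:
  assumes f: "f \<in> homog g" shows "hnorm f = cnorm D (EU (twist g f))"
proof -
  have c: "twist g f \<in> FU" using homog_F0[OF f] by (intro twist_carrier F0_FU)
  hence "hnorm f = sqrt ((cnorm D (EU (twist g f)))\<^sup>2)"
    unfolding hnorm_def inner_homog[OF f] by (simp add: DF.E_mult DF.E_star free_carrier_star D.cstar_identity)
  thus ?thesis using c by (simp add: EU_nonneg)
qed

text \<open>The constant polynomial 1, on which f would display its coefficient directly, is not a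
  vector of \<open>F0\<close>. The vector f* serves instead: it has norm t, the norm of the
  coefficient of f, and f f* has norm t^2, so the operator seminorm of f is at least t.\<close>

theorem norm_twist_le:
  assumes f: "f \<in> homog g" and g: "g \<in> carrier G" shows "cnorm D (EU (twist g f)) \<le> cnorm A (AF.E f)"
proof -
  let ?t = "cnorm D (EU (twist g f))"
  have F: "f \<in> F0" "free_star f \<in> F0" using homog_F0[OF f] by (simp_all add: free_carrier_star)
  have c: "twist g f \<in> FU" using F by (intro twist_carrier F0_FU)
  note fs = homog_star[OF f]
  note ff = homog_mult[OF f conjunct1[OF fs]]
  have n1: "hnorm (free_star f) = ?t"
    using hnorm_homog[OF conjunct1[OF fs]] fs c g
    by (simp add: DF.E_scale DF.E_star free_carrier_star D.norm_smult D.norm_star \<sigma>_norm)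
  have n2: "hnorm (f * free_star f) = ?t\<^sup>2"
  proof -
    have "hnorm (f * free_star f) = cnorm D (EU (twist g f) \<otimes>\<^bsub>D\<^esub> star D (EU (twist g f)))"
      using hnorm_homog[OF conjunct1[OF ff]] ff fs c g
      by (simp add: DF.E_scale DF.E_star DF.E_mult free_carrier_star free_carrier_mult free_carrier_scale
          D.norm_smult \<sigma>_norm D.mult_smult_right)
    also have "\<dots> = ?t\<^sup>2"
      using D.cstar_identity[of "star D (EU (twist g f))"] c by (simp add: D.star_star D.norm_star)
    finally show ?thesis .
  qed
  have "?t * ?t \<le> R.op f * ?t" using R.op_upper[OF F] n1 n2 by (simp add: power2_eq_square)
  hence "?t \<le> R.op f" by (rule quotient_square_le[OF EU_nonneg[OF c] _ R.op_nonneg[OF F(1)]])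
  thus ?thesis using op_le[OF F(1)] by linarith
qed

end

section \<open>Fibres as closed subspaces\<close>

context cstar_algebra begin

definition closed_subspace :: "'a set \<Rightarrow> bool" where
  "closed_subspace W \<longleftrightarrow> W \<subseteq> carrier A \<and> \<zero> \<in> W \<and>
     (\<forall>x\<in>W. \<forall>y\<in>W. x \<oplus> y \<in> W) \<and> (\<forall>a. \<forall>x\<in>W. a \<odot> x \<in> W) \<and>
     (\<forall>x\<in>carrier A. (\<forall>e>0. \<exists>y\<in>W. cnorm A (x \<ominus> y) < e) \<longrightarrow> x \<in> W)"

lemma closed_subspaceD:
  assumes "closed_subspace W"
  shows "x \<in> W \<Longrightarrow> x \<in> carrier A" "\<zero> \<in> W" "x \<in> W \<Longrightarrow> y \<in> W \<Longrightarrow> x \<oplus> y \<in> W" "x \<in> W \<Longrightarrow> a \<odot> x \<in> W"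
    "x \<in> carrier A \<Longrightarrow> (\<And>e. e > 0 \<Longrightarrow> \<exists>y\<in>W. cnorm A (x \<ominus> y) < e) \<Longrightarrow> x \<in> W"
  using assms by (auto simp: closed_subspace_def)

lemma closed_subspace_carrier: "closed_subspace (carrier A)"
  by (simp add: closed_subspace_def)

lemma closed_subspace_diff: assumes W: "closed_subspace W" and x: "x \<in> W" and y: "y \<in> W" shows "x \<ominus> y \<in> W"
  unfolding diff[OF closed_subspaceD(1)[OF W x] closed_subspaceD(1)[OF W y]]
  by (rule closed_subspaceD(3)[OF W x closed_subspaceD(4)[OF W y]])

lemma closed_subspace_conv:
  assumes W: "closed_subspace W" and Y: "\<And>n. Y n \<in> W" and c: "conv_to Y x" shows "x \<in> W"
proof (rule closed_subspaceD(5)[OF W])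
  show x: "x \<in> carrier A" using c by (simp add: conv_to_def)
  fix e :: real assume "e > 0"
  then obtain n where "cnorm A (Y n \<ominus> x) < e"
    using c order_tendstoD(2)[of "\<lambda>n. cnorm A (Y n \<ominus> x)" 0 sequentially e]
    unfolding conv_to_def eventually_sequentially by blast
  thus "\<exists>y\<in>W. cnorm A (x \<ominus> y) < e" using Y ndiff[of "Y n" x] x closed_subspaceD(1)[OF W] by metis
qed

lemma closed_subspace_finsum:
  assumes "closed_subspace W" "\<And>i. i \<in> K \<Longrightarrow> h i \<in> W" shows "finsum A h K \<in> W"
  using assms(2)
proof (induction K rule: infinite_finite_induct)
  case (insert i K)
  have "h j \<in> carrier A" if "j \<in> insert i K" for j using insert.prems[OF that] closed_subspaceD(1)[OF assms(1)] by blast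
  thus ?case using insert closed_subspaceD(3)[OF assms(1)] by (simp add: Pi_iff)
qed (use closed_subspaceD[OF assms(1)] in \<open>simp_all add: M.add.finprod_infinite\<close>)

lemma lin_span_carrier: "S \<subseteq> carrier A \<Longrightarrow> x \<in> lin_span A S \<Longrightarrow> x \<in> carrier A"
  by (rotate_tac 1, induction rule: lin_span.induct) auto

lemma lin_span_add: "S \<subseteq> carrier A \<Longrightarrow> x \<in> lin_span A S \<Longrightarrow> y \<in> lin_span A S \<Longrightarrow> x \<oplus> y \<in> lin_span A S"
proof (rotate_tac 1, induction rule: lin_span.induct)
  case (step x z a)
  hence "a \<odot> x \<oplus> z \<oplus> y = a \<odot> x \<oplus> (z \<oplus> y)"
    using lin_span_carrier[of S] by (intro M.a_assoc) auto
  thus ?case using step by (simp add: lin_span.step)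
qed (simp add: lin_span_carrier)

lemma lin_span_scale: "S \<subseteq> carrier A \<Longrightarrow> x \<in> lin_span A S \<Longrightarrow> b \<odot> x \<in> lin_span A S"
proof (rotate_tac 1, induction rule: lin_span.induct)
  case (step x z a)
  hence "b \<odot> (a \<odot> x \<oplus> z) = (b * a) \<odot> x \<oplus> b \<odot> z"
    using lin_span_carrier[of S] by (simp add: sr sa subset_iff)
  thus ?case using step by (simp add: lin_span.step)
qed (simp add: lin_span.zero)

lemma lin_span_subset:
  assumes "closed_subspace W" "S \<subseteq> W" "x \<in> lin_span A S" shows "x \<in> W"
  using assms(3)
proof (induction rule: lin_span.induct)
  case (step x y a) thus ?case using assms(2) closed_subspaceD(3,4)[OF assms(1)] by blast
qed (rule closed_subspaceD(2)[OF assms(1)])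

lemma closed_span_least:
  assumes W: "closed_subspace W" and S: "S \<subseteq> W" shows "closed_span A S \<subseteq> W"
  using closed_subspaceD(5)[OF W] lin_span_subset[OF W S] by (fastforce simp: closed_span_def)

lemma closed_span_superset: assumes S: "S \<subseteq> carrier A" shows "S \<subseteq> closed_span A S"
proof
  fix x assume x: "x \<in> S"
  hence "x \<in> lin_span A S" using lin_span.step[OF x lin_span.zero, of A 1] S by (auto simp: s1)
  thus "x \<in> closed_span A S" using x S by (auto simp: closed_span_def minus_self intro!: bexI[of _ x])
qed

lemma closed_subspace_closed_span: assumes S: "S \<subseteq> carrier A" shows "closed_subspace (closed_span A S)"
  unfolding closed_subspace_def
proof (intro conjI ballI allI impI)
  note lc = lin_span_carrier[OF S]
  show "closed_span A S \<subseteq> carrier A" by (auto simp: closed_span_def)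
  show "\<zero> \<in> closed_span A S" using lin_span.zero[of A S] by (auto simp: closed_span_def minus_self intro!: bexI[of _ \<zero>])
  {
    fix x y assume xy: "x \<in> closed_span A S" "y \<in> closed_span A S"
    hence c: "x \<in> carrier A" "y \<in> carrier A" by (auto simp: closed_span_def)
    show "x \<oplus> y \<in> closed_span A S" unfolding closed_span_def
    proof (intro CollectI conjI allI impI)
      fix e :: real assume "e > 0"
      hence "e/2 > 0" by simp
      then obtain x' y' where 1: "x' \<in> lin_span A S" "cnorm A (x \<ominus> x') < e/2" "y' \<in> lin_span A S" "cnorm A (y \<ominus> y') < e/2"
        using xy unfolding closed_span_def by blast
      have "cnorm A (x \<oplus> y \<ominus> (x' \<oplus> y')) \<le> cnorm A (x \<ominus> x') + cnorm A (y \<ominus> y')"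
        using 1 c lc by (subst add_diff) (auto intro!: norm_triangle)
      thus "\<exists>z\<in>lin_span A S. cnorm A (x \<oplus> y \<ominus> z) < e"
        using 1 lin_span_add[OF S] by (intro bexI[of _ "x' \<oplus> y'"]) auto
    qed (use c in simp)
  next
    fix a x assume x: "x \<in> closed_span A S"
    hence c: "x \<in> carrier A" by (auto simp: closed_span_def)
    show "a \<odot> x \<in> closed_span A S" unfolding closed_span_def
    proof (intro CollectI conjI allI impI)
      fix e :: real assume e: "e > 0"
      have ca: "cmod a + 1 > 0" by (simp add: add_nonneg_pos)
      hence "e/(cmod a + 1) > 0" using e by simp
      then obtain x' where 1: "x' \<in> lin_span A S" "cnorm A (x \<ominus> x') < e/(cmod a + 1)"
        using x unfolding closed_span_def by blast
      have x'c: "x' \<in> carrier A" using 1 lc by blast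
      have "a \<odot> x \<ominus> a \<odot> x' = a \<odot> (x \<ominus> x')" using c x'c by (simp add: diff sr sa[symmetric])
      hence "cnorm A (a \<odot> x \<ominus> a \<odot> x') = cmod a * cnorm A (x \<ominus> x')" using c x'c by (simp add: norm_smult)
      also have "\<dots> \<le> (cmod a + 1) * cnorm A (x \<ominus> x')" using c x'c by (intro mult_right_mono) (auto simp: norm_nonneg)
      also have "\<dots> < e" using 1 ca by (simp add: pos_less_divide_eq mult.commute)
      finally show "\<exists>z\<in>lin_span A S. cnorm A (a \<odot> x \<ominus> z) < e"
        using 1 lin_span_scale[OF S] by (intro bexI[of _ "a \<odot> x'"]) auto
    qed (use c in simp)
  next
    fix x assume x: "x \<in> carrier A" "\<forall>e>0. \<exists>y\<in>closed_span A S. cnorm A (x \<ominus> y) < e"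
    show "x \<in> closed_span A S" unfolding closed_span_def
    proof (intro CollectI conjI allI impI x(1))
      fix e :: real assume "e > 0"
      hence "e/2 > 0" by simp
      then obtain y where y: "y \<in> closed_span A S" "cnorm A (x \<ominus> y) < e/2" using x by blast
      then obtain z where z: "z \<in> lin_span A S" "cnorm A (y \<ominus> z) < e/2" using \<open>e/2 > 0\<close> unfolding closed_span_def by blast
      have "cnorm A (x \<ominus> z) \<le> cnorm A (x \<ominus> y) + cnorm A (y \<ominus> z)"
        using x(1) y z lc by (intro ntri) (auto simp: closed_span_def)
      thus "\<exists>z\<in>lin_span A S. cnorm A (x \<ominus> z) < e" using y z by (intro bexI[of _ z]) auto
    qed
  }
qed

lemma closed_span_sequence:
  assumes S: "S \<subseteq> carrier A" and x: "x \<in> closed_span A S"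
  obtains Y where "\<And>n. Y n \<in> lin_span A S" "conv_to Y x"
proof -
  have "\<forall>n. \<exists>y\<in>lin_span A S. cnorm A (x \<ominus> y) < 1 / real (Suc n)" using x by (simp add: closed_span_def)
  then obtain Y where Y: "\<And>n. Y n \<in> lin_span A S" "\<And>n. cnorm A (x \<ominus> Y n) < 1 / real (Suc n)" by metis
  have c: "x \<in> carrier A" "\<And>n. Y n \<in> carrier A" using x Y(1) lin_span_carrier[OF S] by (auto simp: closed_span_def)
  have "(\<lambda>n. cnorm A (Y n \<ominus> x)) \<longlonglongrightarrow> 0"
  proof (rule tendsto_sandwich[OF _ _ tendsto_const LIMSEQ_inverse_real_of_nat])
    have "cnorm A (Y n \<ominus> x) \<le> inverse (real (Suc n))" for n
      using Y(2)[of n] ndiff[OF c(1) c(2)[of n]] by (simp add: inverse_eq_divide)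
    thus "\<forall>\<^sub>F n in sequentially. cnorm A (Y n \<ominus> x) \<le> inverse (real (Suc n))" by simp
  qed (use c norm_nonneg in simp)
  hence "conv_to Y x" using c by (auto simp: conv_to_def)
  thus ?thesis using that Y(1) by blast
qed

text \<open>The function \<open>f\<close> allows for conjugate linear maps.\<close>

lemma closed_subspace_preimage:
  assumes C: "cstar_algebra C" and V: "closed_subspace V" and W: "cstar_algebra.closed_subspace C W"
    and \<phi>: "\<And>x. x \<in> V \<Longrightarrow> \<phi> x \<in> carrier C"
    and ad: "\<And>x y. x \<in> V \<Longrightarrow> y \<in> V \<Longrightarrow> \<phi> (x \<oplus> y) = \<phi> x \<oplus>\<^bsub>C\<^esub> \<phi> y"
    and sm: "\<And>a x. x \<in> V \<Longrightarrow> \<phi> (a \<odot> x) = f a \<odot>\<^bsub>C\<^esub> \<phi> x" and f: "f (-1) = -1" "f 0 = 0"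
    and bd: "\<And>x. x \<in> V \<Longrightarrow> cnorm C (\<phi> x) \<le> M * cnorm A x"
  shows "closed_subspace {x \<in> V. \<phi> x \<in> W}"
proof -
  interpret C: cstar_algebra C by (rule C)
  note VD = closed_subspaceD[OF V] and WD = C.closed_subspaceD[OF W]
  have z: "\<phi> \<zero> \<in> W" using sm[OF VD(2), of 0] WD \<phi> VD by (simp add: f C.s0)
  have lim: "x \<in> V \<and> \<phi> x \<in> W" if x: "x \<in> carrier A" and e: "\<And>e. e > 0 \<Longrightarrow> \<exists>y\<in>{x \<in> V. \<phi> x \<in> W}. cnorm A (x \<ominus> y) < e" for x
  proof -
    have xV: "x \<in> V" using e by (intro VD(5)[OF x]) blast
    have "\<phi> x \<in> W"
    proof (rule WD(5)[OF \<phi>[OF xV]])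
      fix e :: real assume "e > 0"
      hence "e / (\<bar>M\<bar> + 1) > 0" by simp
      then obtain y where y: "y \<in> V" "\<phi> y \<in> W" "cnorm A (x \<ominus> y) < e / (\<bar>M\<bar> + 1)" using e by blast
      have yc: "y \<in> carrier A" "\<phi> x \<in> carrier C" "\<phi> y \<in> carrier C" using y xV VD \<phi> by auto
      have d: "x \<ominus> y \<in> V" using closed_subspace_diff[OF V xV y(1)] .
      have "\<phi> x \<ominus>\<^bsub>C\<^esub> \<phi> y = \<phi> (x \<ominus> y)"
        by (simp only: C.diff[OF yc(2,3)] diff[OF x yc(1)] ad[OF xV VD(4)[OF y(1)]] sm[OF y(1)] f)
      hence "cnorm C (\<phi> x \<ominus>\<^bsub>C\<^esub> \<phi> y) \<le> M * cnorm A (x \<ominus> y)" using bd[OF d] by simp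
      also have "\<dots> \<le> (\<bar>M\<bar> + 1) * cnorm A (x \<ominus> y)" using x yc by (intro mult_right_mono) (auto simp: norm_nonneg)
      also have "\<dots> < e" using y(3) by (simp add: pos_less_divide_eq mult.commute)
      finally show "\<exists>y\<in>W. cnorm C (\<phi> x \<ominus>\<^bsub>C\<^esub> y) < e" using y by blast
    qed
    thus ?thesis using xV by simp
  qed
  show ?thesis unfolding closed_subspace_def
  proof (intro conjI ballI allI impI)
    show "{x \<in> V. \<phi> x \<in> W} \<subseteq> carrier A" using VD by auto
    show "\<zero> \<in> {x \<in> V. \<phi> x \<in> W}" using VD z by auto
    fix x assume "x \<in> carrier A" "\<forall>e>0. \<exists>y\<in>{x \<in> V. \<phi> x \<in> W}. cnorm A (x \<ominus> y) < e"
    thus "x \<in> {x \<in> V. \<phi> x \<in> W}" using lim by simp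
  qed (use VD WD ad sm in auto)
qed

lemma closed_subspace_left_mult:
  assumes W: "closed_subspace W" and y: "y \<in> carrier A"
  shows "closed_subspace {x \<in> carrier A. y \<otimes> x \<in> W}"
  using closed_subspace_preimage[OF cstar_algebra_axioms closed_subspace_carrier W, where \<phi> = "\<lambda>x. y \<otimes> x" and f = "\<lambda>a. a" and M = "cnorm A y"] y
  by (simp add: mult_add_right mult_smult_right norm_mult)

lemma closed_subspace_right_mult:
  assumes W: "closed_subspace W" and y: "y \<in> carrier A"
  shows "closed_subspace {x \<in> carrier A. x \<otimes> y \<in> W}"
  using closed_subspace_preimage[OF cstar_algebra_axioms closed_subspace_carrier W, where \<phi> = "\<lambda>x. x \<otimes> y" and f = "\<lambda>a. a" and M = "cnorm A y"] y
  by (simp add: mult_add_left mult_smult_left norm_mult mult.commute)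

lemma closed_subspace_star:
  assumes W: "closed_subspace W"
  shows "closed_subspace {x \<in> carrier A. star A x \<in> W}"
  using closed_subspace_preimage[OF cstar_algebra_axioms closed_subspace_carrier W, where \<phi> = "star A" and f = cnj and M = 1]
  by (simp add: star_add star_smult norm_star)

end

section \<open>The fibres are closed under products and adjoints\<close>

context cocycle_graph begin

abbreviation "fib \<equiv> graph_fibre k \<Lambda> G \<eta>"

definition spanning :: "'g \<Rightarrow> 'l completion set" where
  "spanning g = {s x \<otimes>\<^bsub>A\<^esub> star A (s y) |x y. x \<in> X \<and> y \<in> X \<and> \<eta> x \<otimes> inv (\<eta> y) = g}"

lemma fib_eq: "fib g = closed_span A (spanning g)"
  by (simp add: graph_fibre_def spanning_def)

lemma spanning_carrier: "spanning g \<subseteq> carrier A" by (auto simp: spanning_def)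

lemma closed_subspace_fib: "A.closed_subspace (fib g)"
  unfolding fib_eq by (rule A.closed_subspace_closed_span[OF spanning_carrier])

lemmas fibD = A.closed_subspaceD[OF closed_subspace_fib]

lemma fib_spanning: "x \<in> X \<Longrightarrow> y \<in> X \<Longrightarrow> \<eta> x \<otimes> inv (\<eta> y) = g \<Longrightarrow> s x \<otimes>\<^bsub>A\<^esub> star A (s y) \<in> fib g"
  unfolding fib_eq using A.closed_span_superset[OF spanning_carrier, of g] by (auto simp: spanning_def)

lemma fib_least: "A.closed_subspace W \<Longrightarrow> (\<And>x y. x \<in> X \<Longrightarrow> y \<in> X \<Longrightarrow> \<eta> x \<otimes> inv (\<eta> y) = g \<Longrightarrow> s x \<otimes>\<^bsub>A\<^esub> star A (s y) \<in> W) \<Longrightarrow> fib g \<subseteq> W"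
  unfolding fib_eq by (rule A.closed_span_least) (auto simp: spanning_def)

lemma s_star_vertex: "v \<in> vertices \<Lambda> \<Longrightarrow> star A (s v) = s v"
  and s_idem: "v \<in> vertices \<Lambda> \<Longrightarrow> s v \<otimes>\<^bsub>A\<^esub> s v = s v"
  and s_orth: "v \<in> vertices \<Lambda> \<Longrightarrow> w \<in> vertices \<Lambda> \<Longrightarrow> v \<noteq> w \<Longrightarrow> s v \<otimes>\<^bsub>A\<^esub> s w = \<zero>\<^bsub>A\<^esub>"
  and s_isometry: "x \<in> X \<Longrightarrow> star A (s x) \<otimes>\<^bsub>A\<^esub> s x = s (src \<Lambda> x)"
  and s_sum: "v \<in> vertices \<Lambda> \<Longrightarrow> n \<in> degrees k \<Longrightarrow>
      (\<Oplus>\<^bsub>A\<^esub>x\<in>paths_from \<Lambda> v n. s x \<otimes>\<^bsub>A\<^esub> star A (s x)) = s v"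
  using ck_A by (simp_all add: cuntz_krieger_family_def)

lemma s_comp: "x \<in> X \<Longrightarrow> y \<in> X \<Longrightarrow> src \<Lambda> x = rng \<Lambda> y \<Longrightarrow> s x \<otimes>\<^bsub>A\<^esub> s y = s (pcomp \<Lambda> x y)"
  using ck_A by (simp add: cuntz_krieger_family_def A.s1 comp_closed)

lemma rng_vertex: assumes "x \<in> X" shows "rng \<Lambda> x \<in> vertices \<Lambda>"
  using deg_comp[OF rng_closed[OF assms] assms] comp_rng[OF assms] src_rng[OF assms] rng_closed[OF assms]
  by (simp add: vertices_def paths_def fun_eq_iff)

lemma s_rng: "x \<in> X \<Longrightarrow> s (rng \<Lambda> x) \<otimes>\<^bsub>A\<^esub> s x = s x"
  using s_comp[of "rng \<Lambda> x" x] by (simp add: rng_closed src_rng comp_rng)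

lemma s_src: "x \<in> X \<Longrightarrow> s x \<otimes>\<^bsub>A\<^esub> s (src \<Lambda> x) = s x"
  using s_comp[of x "src \<Lambda> x"] by (simp add: src_closed rng_src comp_src)

lemma s_comp_zero: assumes x: "x \<in> X" and y: "y \<in> X" and ne: "src \<Lambda> x \<noteq> rng \<Lambda> y" shows "s x \<otimes>\<^bsub>A\<^esub> s y = \<zero>\<^bsub>A\<^esub>"
proof -
  have "s x \<otimes>\<^bsub>A\<^esub> s y = (s x \<otimes>\<^bsub>A\<^esub> s (src \<Lambda> x)) \<otimes>\<^bsub>A\<^esub> (s (rng \<Lambda> y) \<otimes>\<^bsub>A\<^esub> s y)" using x y by (simp add: s_src s_rng)
  also have "\<dots> = s x \<otimes>\<^bsub>A\<^esub> (s (src \<Lambda> x) \<otimes>\<^bsub>A\<^esub> s (rng \<Lambda> y)) \<otimes>\<^bsub>A\<^esub> s y" using x y by (simp add: A.mult_assoc src_closed rng_closed)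
  also have "\<dots> = \<zero>\<^bsub>A\<^esub>" using x y ne by (simp add: s_orth src_vertex rng_vertex)
  finally show ?thesis .
qed

lemma s_fib: assumes x: "x \<in> X" shows "s x \<in> fib (\<eta> x)"
proof -
  have v: "src \<Lambda> x \<in> vertices \<Lambda>" by (rule src_vertex[OF x])
  have "s x = s x \<otimes>\<^bsub>A\<^esub> star A (s (src \<Lambda> x))" using x v by (simp add: s_star_vertex s_src)
  also have "\<dots> \<in> fib (\<eta> x)" using x v by (intro fib_spanning) (auto simp: src_closed \<eta>_vertex)
  finally show ?thesis .
qed

text \<open>The range projections of distinct paths \<open>y\<close> from \<open>v\<close> of the same degree sum up to a projection,
  hence are mutually orthogonal.\<close>

lemma s_range_orth:
  assumes v: "v \<in> vertices \<Lambda>" and n: "n \<in> degrees k" and x: "x \<in> paths_from \<Lambda> v n" and y: "y \<in> paths_from \<Lambda> v n" and ne: "x \<noteq> y"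
  shows "star A (s x) \<otimes>\<^bsub>A\<^esub> s y = \<zero>\<^bsub>A\<^esub>"
proof -
  let ?P = "paths_from \<Lambda> v n"
  have P: "\<And>z. z \<in> ?P \<Longrightarrow> z \<in> X" by (rule pm)
  have fin: "finite ?P" by (rule finite_paths_from[OF v n])
  \<comment> \<open>The sum of all a(z)* a(z) is the projection at the source of y, and the term z =
    y alone already equals it. The other terms thus sum to zero, and
    \<open>sum_star_mult_eq_zero\<close> makes each of them vanish.\<close>
  let ?a = "\<lambda>z. star A (s z) \<otimes>\<^bsub>A\<^esub> s y"
  have yX: "y \<in> X" "rng \<Lambda> y = v" using y P by (auto simp: paths_from_def)
  have a: "?a z \<in> carrier A" "star A (?a z) \<otimes>\<^bsub>A\<^esub> ?a z = (star A (s y) \<otimes>\<^bsub>A\<^esub> (s z \<otimes>\<^bsub>A\<^esub> star A (s z))) \<otimes>\<^bsub>A\<^esub> s y" if "z \<in> ?P" for z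
    using P[OF that] yX by (simp_all add: A.star_mult A.star_star A.mult_assoc)
  have "(\<Oplus>\<^bsub>A\<^esub>z\<in>K. star A (?a z) \<otimes>\<^bsub>A\<^esub> ?a z) = (star A (s y) \<otimes>\<^bsub>A\<^esub> (\<Oplus>\<^bsub>A\<^esub>z\<in>K. s z \<otimes>\<^bsub>A\<^esub> star A (s z))) \<otimes>\<^bsub>A\<^esub> s y" if "finite K" "K \<subseteq> ?P" for K
    using that
  proof (induction K rule: finite_induct)
    case (insert z K)
    have c: "w \<in> insert z K \<Longrightarrow> s w \<in> carrier A" for w using insert.prems P by auto
    hence "(\<Oplus>\<^bsub>A\<^esub>w\<in>K. s w \<otimes>\<^bsub>A\<^esub> star A (s w)) \<in> carrier A" by (intro A.M.finsum_closed) auto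
    thus ?case using insert c a(2)[of z] yX by (simp add: Pi_iff A.mult_add_left A.mult_add_right)
  qed (use yX in simp)
  from this[OF fin subset_refl]
  have "(\<Oplus>\<^bsub>A\<^esub>z\<in>?P. star A (?a z) \<otimes>\<^bsub>A\<^esub> ?a z) = star A (s y) \<otimes>\<^bsub>A\<^esub> s v \<otimes>\<^bsub>A\<^esub> s y" by (simp only: s_sum[OF v n])
  also have "\<dots> = s (src \<Lambda> y)" using yX s_rng[OF yX(1)] v vm by (simp add: A.mult_assoc s_isometry)
  finally have tot: "(\<Oplus>\<^bsub>A\<^esub>z\<in>?P. star A (?a z) \<otimes>\<^bsub>A\<^esub> ?a z) = s (src \<Lambda> y)" .
  have ay: "star A (?a y) \<otimes>\<^bsub>A\<^esub> ?a y = s (src \<Lambda> y)"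
    using yX by (simp add: s_isometry s_star_vertex s_idem src_vertex)
  have sc: "s (src \<Lambda> y) \<in> carrier A" using yX by (simp add: src_closed)
  let ?r = "\<Oplus>\<^bsub>A\<^esub>z\<in>?P - {y}. star A (?a z) \<otimes>\<^bsub>A\<^esub> ?a z"
  have rc: "?r \<in> carrier A" using a(1) by (intro A.M.finsum_closed) auto
  have "(\<Oplus>\<^bsub>A\<^esub>z\<in>insert y (?P - {y}). star A (?a z) \<otimes>\<^bsub>A\<^esub> ?a z) = star A (?a y) \<otimes>\<^bsub>A\<^esub> ?a y \<oplus>\<^bsub>A\<^esub> ?r"
    using fin a(1) y by (intro A.M.finsum_insert) auto
  hence "s (src \<Lambda> y) \<oplus>\<^bsub>A\<^esub> ?r = s (src \<Lambda> y)" using tot ay y by (simp add: insert_absorb)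
  hence "?r = \<zero>\<^bsub>A\<^esub>" using A.M.add.l_cancel_one[OF sc rc] by simp
  thus ?thesis using A.sum_star_mult_eq_zero[of "?P - {y}" ?a x] fin a(1) x ne by auto
qed

lemma factor_path:
  assumes z: "z \<in> paths_from \<Lambda> v n" and m: "m \<in> degrees k" and le: "\<And>i. m i \<le> n i"
  obtains a b where "a \<in> paths_from \<Lambda> v m" "b \<in> X" "src \<Lambda> a = rng \<Lambda> b" "pcomp \<Lambda> a b = z"
proof -
  have zX: "z \<in> X" "deg \<Lambda> z = n" "rng \<Lambda> z = v" using z by (auto simp: paths_from_def paths_def)
  have n: "n \<in> degrees k" using deg_closed[OF zX(1)] zX by simp
  have "(\<lambda>i. n i - m i) \<in> degrees k" using n by (simp add: degrees_def)
  moreover have "deg \<Lambda> z = (\<lambda>i. m i + (n i - m i))" using zX le by (simp add: fun_eq_iff)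
  ultimately obtain a b where ab: "a \<in> X" "b \<in> X" "src \<Lambda> a = rng \<Lambda> b" "pcomp \<Lambda> a b = z" "deg \<Lambda> a = m"
    using factorisation[OF zX(1) m, of "\<lambda>i. n i - m i"] by (auto dest!: ex1_implies_ex)
  moreover have "rng \<Lambda> a = v" using rng_comp[OF ab(1-3)] ab(4) zX(3) by simp
  ultimately show ?thesis using that by (auto simp: paths_from_def paths_def)
qed

text \<open>Factor z as a b with a of the degree of y. Range orthogonality leaves only the case a =
  y, in which the isometry relation cancels y and b remains.\<close>

lemma star_s_mult_path:
  assumes y: "y \<in> X" and z: "z \<in> paths_from \<Lambda> (rng \<Lambda> y) n" and le: "\<And>i. deg \<Lambda> y i \<le> n i"
  shows "star A (s y) \<otimes>\<^bsub>A\<^esub> s z = \<zero>\<^bsub>A\<^esub> \<or> (\<exists>b\<in>X. star A (s y) \<otimes>\<^bsub>A\<^esub> s z = s b \<and> \<eta> z = \<eta> y \<otimes> \<eta> b)"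
proof -
  have dy: "deg \<Lambda> y \<in> degrees k" by (rule deg_closed[OF y])
  have yP: "y \<in> paths_from \<Lambda> (rng \<Lambda> y) (deg \<Lambda> y)" using y by (simp add: paths_from_def paths_def)
  obtain a b where ab: "a \<in> paths_from \<Lambda> (rng \<Lambda> y) (deg \<Lambda> y)" "b \<in> X" "src \<Lambda> a = rng \<Lambda> b" "pcomp \<Lambda> a b = z"
    using factor_path[OF z dy le] by metis
  have aX: "a \<in> X" using ab pm by blast
  have "star A (s y) \<otimes>\<^bsub>A\<^esub> s z = (star A (s y) \<otimes>\<^bsub>A\<^esub> s a) \<otimes>\<^bsub>A\<^esub> s b"
    using s_comp[OF aX ab(2,3)] ab y aX by (simp add: A.mult_assoc)
  moreover have "star A (s y) \<otimes>\<^bsub>A\<^esub> s a = \<zero>\<^bsub>A\<^esub>" if "a \<noteq> y"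
    using s_range_orth[OF rng_vertex[OF y] dy yP ab(1)] that by auto
  moreover have "(star A (s y) \<otimes>\<^bsub>A\<^esub> s a) \<otimes>\<^bsub>A\<^esub> s b = s b \<and> \<eta> z = \<eta> y \<otimes> \<eta> b" if "a = y"
    using that ab y s_rng[OF ab(2)] \<eta>_comp[OF y ab(2)] by (simp add: s_isometry)
  ultimately show ?thesis using ab by (cases "a = y") auto
qed

text \<open>At a common range v, insert the sum of s w s w* over the finitely many paths w from v
  whose degree is the join of the degrees of y and z. By \<open>star_s_mult_path\<close> every term
  is 0 or a spanning element of the right degree.\<close>

lemma star_s_mult_s: assumes y: "y \<in> X" and z: "z \<in> X" shows "star A (s y) \<otimes>\<^bsub>A\<^esub> s z \<in> fib (inv (\<eta> y) \<otimes> \<eta> z)"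
proof (cases "rng \<Lambda> y = rng \<Lambda> z")
  case False
  have "star A (s y) \<otimes>\<^bsub>A\<^esub> s z = star A (s (rng \<Lambda> y) \<otimes>\<^bsub>A\<^esub> s y) \<otimes>\<^bsub>A\<^esub> (s (rng \<Lambda> z) \<otimes>\<^bsub>A\<^esub> s z)" using y z by (simp add: s_rng)
  also have "\<dots> = star A (s y) \<otimes>\<^bsub>A\<^esub> (s (rng \<Lambda> y) \<otimes>\<^bsub>A\<^esub> s (rng \<Lambda> z)) \<otimes>\<^bsub>A\<^esub> s z"
    using y z by (simp add: A.star_mult A.mult_assoc rng_closed s_star_vertex rng_vertex)
  also have "\<dots> = \<zero>\<^bsub>A\<^esub>" using y z False by (simp add: s_orth rng_vertex)
  finally show ?thesis using fibD(2) by simp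
next
  case True
  let ?v = "rng \<Lambda> y"
  define n where "n i = max (deg \<Lambda> y i) (deg \<Lambda> z i)" for i
  have n: "n \<in> degrees k" using deg_closed[OF y] deg_closed[OF z] by (simp add: n_def degrees_def)
  have le: "deg \<Lambda> y i \<le> n i" "deg \<Lambda> z i \<le> n i" for i by (simp_all add: n_def)
  let ?P = "paths_from \<Lambda> ?v n"
  have v: "?v \<in> vertices \<Lambda>" by (rule rng_vertex[OF y])
  have P: "\<And>w. w \<in> ?P \<Longrightarrow> w \<in> X" by (rule pm)
  let ?W = "{x \<in> carrier A. star A (s y) \<otimes>\<^bsub>A\<^esub> x \<in> {u \<in> carrier A. u \<otimes>\<^bsub>A\<^esub> s z \<in> fib (inv (\<eta> y) \<otimes> \<eta> z)}}"
  have W: "A.closed_subspace ?W"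
    using y z by (intro A.closed_subspace_left_mult A.closed_subspace_right_mult closed_subspace_fib) auto
  have "(\<Oplus>\<^bsub>A\<^esub>w\<in>?P. s w \<otimes>\<^bsub>A\<^esub> star A (s w)) \<in> ?W"
  proof (rule A.closed_subspace_finsum[OF W])
    fix w assume w: "w \<in> ?P"
    have wX: "w \<in> X" using P[OF w] .
    have "star A (s y) \<otimes>\<^bsub>A\<^esub> (s w \<otimes>\<^bsub>A\<^esub> star A (s w)) \<otimes>\<^bsub>A\<^esub> s z = (star A (s y) \<otimes>\<^bsub>A\<^esub> s w) \<otimes>\<^bsub>A\<^esub> star A (star A (s z) \<otimes>\<^bsub>A\<^esub> s w)"
      using wX y z by (simp add: A.mult_assoc A.star_mult A.star_star)
    also have "\<dots> \<in> fib (inv (\<eta> y) \<otimes> \<eta> z)"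
    proof -
      have 1: "star A (s y) \<otimes>\<^bsub>A\<^esub> s w = \<zero>\<^bsub>A\<^esub> \<or> (\<exists>b\<in>X. star A (s y) \<otimes>\<^bsub>A\<^esub> s w = s b \<and> \<eta> w = \<eta> y \<otimes> \<eta> b)"
        using star_s_mult_path[OF y w le(1)] .
      have 2: "star A (s z) \<otimes>\<^bsub>A\<^esub> s w = \<zero>\<^bsub>A\<^esub> \<or> (\<exists>b\<in>X. star A (s z) \<otimes>\<^bsub>A\<^esub> s w = s b \<and> \<eta> w = \<eta> z \<otimes> \<eta> b)"
        using star_s_mult_path[OF z _ le(2)] w True by simp
      have "s b \<otimes>\<^bsub>A\<^esub> star A (s b') \<in> fib (inv (\<eta> y) \<otimes> \<eta> z)"
        if "b \<in> X" "b' \<in> X" "\<eta> w = \<eta> y \<otimes> \<eta> b" "\<eta> w = \<eta> z \<otimes> \<eta> b'" for b b'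
      proof (rule fib_spanning[OF that(1,2)])
        have "\<eta> b = inv (\<eta> y) \<otimes> \<eta> w" "\<eta> b' = inv (\<eta> z) \<otimes> \<eta> w" using that y z wX by (simp_all add: inv_solve_left)
        thus "\<eta> b \<otimes> inv (\<eta> b') = inv (\<eta> y) \<otimes> \<eta> z" using y z wX
          by (simp add: inv_mult_group m_assoc) (simp flip: m_assoc)
      qed
      thus ?thesis using 1 2 fibD(2) y z wX by auto
    qed
    finally show "s w \<otimes>\<^bsub>A\<^esub> star A (s w) \<in> ?W" using wX y by simp
  qed
  hence "star A (s y) \<otimes>\<^bsub>A\<^esub> s ?v \<otimes>\<^bsub>A\<^esub> s z \<in> fib (inv (\<eta> y) \<otimes> \<eta> z)" unfolding s_sum[OF v n] by simp
  thus ?thesis using s_rng[OF z] y z True by (simp add: A.mult_assoc rng_closed)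
qed

lemma s_mult_fib: assumes x: "x \<in> X" and h: "h \<in> carrier G" and b: "b \<in> fib h" shows "s x \<otimes>\<^bsub>A\<^esub> b \<in> fib (\<eta> x \<otimes> h)"
proof -
  have "fib h \<subseteq> {b \<in> carrier A. s x \<otimes>\<^bsub>A\<^esub> b \<in> fib (\<eta> x \<otimes> h)}"
  proof (rule fib_least[OF A.closed_subspace_left_mult[OF closed_subspace_fib s_closed[OF x]]])
    fix a c assume ac: "a \<in> X" "c \<in> X" "\<eta> a \<otimes> inv (\<eta> c) = h"
    have e: "s x \<otimes>\<^bsub>A\<^esub> (s a \<otimes>\<^bsub>A\<^esub> star A (s c)) = (s x \<otimes>\<^bsub>A\<^esub> s a) \<otimes>\<^bsub>A\<^esub> star A (s c)" using ac x by (simp add: A.mult_assoc)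
    show "s a \<otimes>\<^bsub>A\<^esub> star A (s c) \<in> {b \<in> carrier A. s x \<otimes>\<^bsub>A\<^esub> b \<in> fib (\<eta> x \<otimes> h)}"
    proof (cases "src \<Lambda> x = rng \<Lambda> a")
      case True
      thus ?thesis using ac x by (auto simp: e s_comp comp_closed \<eta>_comp m_assoc intro!: fib_spanning)
    qed (use ac x fibD(2) in \<open>simp add: e s_comp_zero\<close>)
  qed
  thus ?thesis using b by blast
qed

lemma fib_mult_star_s: assumes x: "x \<in> X" and h: "h \<in> carrier G" and b: "b \<in> fib h" shows "b \<otimes>\<^bsub>A\<^esub> star A (s x) \<in> fib (h \<otimes> inv (\<eta> x))"
proof -
  have "fib h \<subseteq> {b \<in> carrier A. b \<otimes>\<^bsub>A\<^esub> star A (s x) \<in> fib (h \<otimes> inv (\<eta> x))}"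
  proof (rule fib_least[OF A.closed_subspace_right_mult[OF closed_subspace_fib]])
    fix a c assume ac: "a \<in> X" "c \<in> X" "\<eta> a \<otimes> inv (\<eta> c) = h"
    have e: "(s a \<otimes>\<^bsub>A\<^esub> star A (s c)) \<otimes>\<^bsub>A\<^esub> star A (s x) = s a \<otimes>\<^bsub>A\<^esub> star A (s x \<otimes>\<^bsub>A\<^esub> s c)"
      using ac x by (simp add: A.mult_assoc A.star_mult)
    show "s a \<otimes>\<^bsub>A\<^esub> star A (s c) \<in> {b \<in> carrier A. b \<otimes>\<^bsub>A\<^esub> star A (s x) \<in> fib (h \<otimes> inv (\<eta> x))}"
    proof (cases "src \<Lambda> x = rng \<Lambda> c")
      case True
      thus ?thesis using ac x by (auto simp: e s_comp comp_closed \<eta>_comp m_assoc inv_mult_group intro!: fib_spanning)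
    qed (use ac x fibD(2) in \<open>simp add: e s_comp_zero\<close>)
  qed (use x in simp)
  thus ?thesis using b by blast
qed

text \<open>For spanning elements the inner product of an adjoint with a generator is handled by
  \<open>star_s_mult_s\<close>. Closedness then extends the claim in one variable at a time.\<close>

lemma fib_mult:
  assumes g: "g \<in> carrier G" and h: "h \<in> carrier G" and b: "b \<in> fib g" and d: "d \<in> fib h"
  shows "b \<otimes>\<^bsub>A\<^esub> d \<in> fib (g \<otimes> h)"
proof -
  have gen: "s x \<otimes>\<^bsub>A\<^esub> star A (s y) \<otimes>\<^bsub>A\<^esub> (s z \<otimes>\<^bsub>A\<^esub> star A (s w)) \<in> fib (g \<otimes> h)"
    if "x \<in> X" "y \<in> X" "\<eta> x \<otimes> inv (\<eta> y) = g" "z \<in> X" "w \<in> X" "\<eta> z \<otimes> inv (\<eta> w) = h" for x y z w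
  proof -
    have "s x \<otimes>\<^bsub>A\<^esub> (star A (s y) \<otimes>\<^bsub>A\<^esub> s z) \<otimes>\<^bsub>A\<^esub> star A (s w) \<in> fib (\<eta> x \<otimes> (inv (\<eta> y) \<otimes> \<eta> z) \<otimes> inv (\<eta> w))"
      using that by (intro fib_mult_star_s s_mult_fib star_s_mult_s) auto
    moreover have "\<eta> x \<otimes> (inv (\<eta> y) \<otimes> \<eta> z) \<otimes> inv (\<eta> w) = g \<otimes> h" using that by (auto simp: m_assoc)
    ultimately show ?thesis using that by (simp add: A.mult_assoc)
  qed
  have "fib g \<subseteq> {b \<in> carrier A. b \<otimes>\<^bsub>A\<^esub> d \<in> fib (g \<otimes> h)}"
  proof (rule fib_least[OF A.closed_subspace_right_mult[OF closed_subspace_fib]])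
    show "d \<in> carrier A" using d fibD(1) by blast
    fix x y assume xy: "x \<in> X" "y \<in> X" "\<eta> x \<otimes> inv (\<eta> y) = g"
    have "fib h \<subseteq> {d \<in> carrier A. s x \<otimes>\<^bsub>A\<^esub> star A (s y) \<otimes>\<^bsub>A\<^esub> d \<in> fib (g \<otimes> h)}"
      by (rule fib_least[OF A.closed_subspace_left_mult[OF closed_subspace_fib]]) (use xy gen in auto)
    thus "s x \<otimes>\<^bsub>A\<^esub> star A (s y) \<in> {b \<in> carrier A. b \<otimes>\<^bsub>A\<^esub> d \<in> fib (g \<otimes> h)}" using d xy by auto
  qed
  thus ?thesis using b by blast
qed

lemma fib_star: assumes g: "g \<in> carrier G" and b: "b \<in> fib g" shows "star A b \<in> fib (inv g)"
proof -
  have "fib g \<subseteq> {b \<in> carrier A. star A b \<in> fib (inv g)}"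
  proof (rule fib_least[OF A.closed_subspace_star[OF closed_subspace_fib]])
    fix x y assume xy: "x \<in> X" "y \<in> X" "\<eta> x \<otimes> inv (\<eta> y) = g"
    hence "\<eta> y \<otimes> inv (\<eta> x) = inv g" by (auto simp: inv_mult_group)
    thus "s x \<otimes>\<^bsub>A\<^esub> star A (s y) \<in> {b \<in> carrier A. star A b \<in> fib (inv g)}"
      using xy fib_spanning[of y x "inv g"] by (simp add: A.star_mult A.star_star)
  qed
  thus ?thesis using b by blast
qed

end

section \<open>Universal algebras of relations\<close>

definition generates :: "'a cstar \<Rightarrow> 'a set \<Rightarrow> bool" where
  "generates C S \<longleftrightarrow> (\<forall>Y. cstar_algebra.closed_subspace C Y \<and> S \<subseteq> Y \<and>
     (\<forall>u\<in>Y. \<forall>v\<in>Y. u \<otimes>\<^bsub>C\<^esub> v \<in> Y) \<and> (\<forall>u\<in>Y. star C u \<in> Y) \<longrightarrow> Y = carrier C)"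

lemma (in free_seminorm) completion_generates: "generates C (completion_gen X p ` X)"
  unfolding generates_def
proof (intro allI impI)
  interpret C: cstar_algebra C by (rule completion_cstar)
  fix Y assume Y: "C.closed_subspace Y \<and> completion_gen X p ` X \<subseteq> Y \<and>
     (\<forall>u\<in>Y. \<forall>v\<in>Y. u \<otimes>\<^bsub>C\<^esub> v \<in> Y) \<and> (\<forall>u\<in>Y. star C u \<in> Y)"
  hence W: "C.closed_subspace Y" by blast
  note D = C.closed_subspaceD[OF W]
  show "Y = carrier C"
  proof (rule completion_generated)
    show "Y \<subseteq> carrier C" using D(1) by blast
    fix Z u assume "\<And>n. Z n \<in> Y" "u \<in> carrier C" "(\<lambda>n. cnorm C (Z n \<ominus>\<^bsub>C\<^esub> u)) \<longlonglongrightarrow> 0"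
    thus "u \<in> Y" using D(1) by (intro C.closed_subspace_conv[OF W, of Z u]) (auto simp: C.conv_to_def)
  qed (use Y D(2,3,4) in blast)+
qed

lemma (in free_seminorm) norm_free_eval_completion:
  assumes "f \<in> F0" shows "cnorm C (free_eval C (completion_gen X p) f) = p f"
  unfolding free_eval_completion[OF assms]
  using norm_cls[OF CS_const[OF assms]] LIMSEQ_const_iff by metis

section \<open>Suprema of C*-seminorms and universal properties\<close>

lemma sup_cstar_seminorm:
  assumes P: "\<And>p. p \<in> P \<Longrightarrow> cstar_seminorm X p" and ne: "P \<noteq> {}"
    and bd: "\<And>f. f \<in> free_carrier X \<Longrightarrow> bdd_above ((\<lambda>p. p f) ` P)"
  shows "cstar_seminorm X (\<lambda>f. SUP p\<in>P. p f)"
proof -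
  let ?u = "\<lambda>f. SUP p\<in>P. p f"
  have fs: "free_seminorm X p" if "p \<in> P" for p using P[OF that] by (simp add: free_seminorm_def)
  note nn = free_seminorm.nn[OF fs] and pc = free_seminorm.pc[OF fs] and ps = free_seminorm.ps[OF fs]
    and pt = free_seminorm.pt[OF fs] and pm = free_seminorm.pm[OF fs]
  have up: "p f \<le> ?u f" if "p \<in> P" "f \<in> free_carrier X" for p f using that bd by (intro cSUP_upper) auto
  have le: "?u f \<le> M" if "\<And>p. p \<in> P \<Longrightarrow> p f \<le> M" for f M using that ne by (intro cSUP_least) auto
  have u0: "0 \<le> ?u f" if "f \<in> free_carrier X" for f using ne up nn that by (meson ex_in_conv order_trans)
  note cl = free_carrier_star free_carrier_mult free_carrier_scale
  show ?thesis unfolding cstar_seminorm_def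
  proof (intro ballI conjI allI)
    fix f assume f: "f \<in> free_carrier X"
    show "0 \<le> ?u f" by (rule u0[OF f])
    have "?u (free_star f * f) \<le> (?u f)\<^sup>2"
    proof (rule le)
      fix p assume p: "p \<in> P"
      show "p (free_star f * f) \<le> (?u f)\<^sup>2" unfolding pc[OF p f] by (intro power_mono up nn p f)
    qed
    moreover have "?u f \<le> sqrt (?u (free_star f * f))"
      using up[of _ "free_star f * f"] pc f by (intro le real_le_rsqrt) (auto simp: cl)
    from power_mono[OF this u0[OF f], of 2] have "(?u f)\<^sup>2 \<le> ?u (free_star f * f)"
      using u0[of "free_star f * f"] f by (simp add: cl)
    ultimately show "?u (free_star f * f) = (?u f)\<^sup>2" by simp
    have scale: "?u (free_scale a h) \<le> cmod a * ?u h" if "h \<in> free_carrier X" for a h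
    proof (rule le)
      fix p assume p: "p \<in> P"
      show "p (free_scale a h) \<le> cmod a * ?u h" unfolding ps[OF p that] by (intro mult_left_mono up p that norm_ge_zero)
    qed
    fix a
    show "?u (free_scale a f) = cmod a * ?u f"
    proof (cases "a = 0")
      case True thus ?thesis using scale[OF f, of 0] u0[of "free_scale 0 f"] f by (simp add: cl)
    next
      case False
      have "?u f \<le> cmod (1/a) * ?u (free_scale a f)"
        using scale[of "free_scale a f" "1/a"] f False by (simp add: cl free_scale_scale free_scale_one)
      hence "cmod a * ?u f \<le> ?u (free_scale a f)" using False by (simp add: norm_divide pos_le_divide_eq mult.commute)
      thus ?thesis using scale[OF f, of a] by simp
    qed
    fix g assume g: "g \<in> free_carrier X"
    show "?u (f + g) \<le> ?u f + ?u g"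
    proof (rule le)
      fix p assume p: "p \<in> P"
      show "p (f + g) \<le> ?u f + ?u g" using pt[OF p f g] up[OF p f] up[OF p g] by linarith
    qed
    show "?u (f * g) \<le> ?u f * ?u g"
    proof (rule le)
      fix p assume p: "p \<in> P"
      show "p (f * g) \<le> ?u f * ?u g"
        by (rule order_trans[OF pm[OF p f g] mult_mono[OF up[OF p f] up[OF p g] u0[OF f] nn[OF p g]]])
    qed
  qed
qed

lemma seminorm_bound_of_gens:
  assumes P: "\<And>p. p \<in> P \<Longrightarrow> cstar_seminorm X p"
    and bd: "\<And>x. x \<in> X \<Longrightarrow> \<exists>M. \<forall>p\<in>P. p (free_gen x) \<le> M" and f: "f \<in> free_carrier X"
  shows "\<exists>M. \<forall>p\<in>P. p f \<le> M"
proof -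
  have fs: "free_seminorm X p" if "p \<in> P" for p using P[OF that] by (simp add: free_seminorm_def)
  have word: "\<exists>M\<ge>0. \<forall>p\<in>P. p (Poly_Mapping.single (Word l) 1) \<le> M" if "l \<noteq> []" "fst ` set l \<subseteq> X" for l
    using that
  proof (induction l rule: list_nonempty_induct)
    have letter: "\<exists>M\<ge>0. \<forall>p\<in>P. p (Poly_Mapping.single (Word [a]) 1) \<le> M" if "fst a \<in> X" for a
    proof -
      obtain M where M: "\<forall>p\<in>P. p (free_gen (fst a)) \<le> M" using bd \<open>fst a \<in> X\<close> by blast
      have "Poly_Mapping.single (Word [a]) (1::complex) = (if snd a then free_star (free_gen (fst a)) else free_gen (fst a))"
        by (cases a) (simp add: free_gen_def free_star_single word_star_def)
      moreover have "\<forall>p\<in>P. p (free_star (free_gen (fst a))) \<le> M"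
        using M free_seminorm.pstar[OF fs free_gen_carrier[OF \<open>fst a \<in> X\<close>]] by metis
      ultimately have "\<forall>p\<in>P. p (Poly_Mapping.single (Word [a]) 1) \<le> max M 0"
        using M by (auto simp: le_max_iff_disj)
      thus ?thesis by (meson max.cobounded2)
    qed
    {
      case (single a) thus ?case using letter by simp
    next
      case (cons a l)
      obtain M where M: "M \<ge> 0" "\<forall>p\<in>P. p (Poly_Mapping.single (Word l) 1) \<le> M" using cons by auto
      obtain L where L: "L \<ge> 0" "\<forall>p\<in>P. p (Poly_Mapping.single (Word [a]) 1) \<le> L" using letter cons by (auto dest!: letter)
      have c: "Poly_Mapping.single (Word [a]) 1 \<in> free_carrier X" "Poly_Mapping.single (Word l) 1 \<in> free_carrier X"
        using cons by (auto intro!: free_carrier_single simp: star_words_def)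
      have e: "Poly_Mapping.single (Word (a # l)) (1::complex) = Poly_Mapping.single (Word [a]) 1 * Poly_Mapping.single (Word l) 1"
        by (simp add: mult_single plus_star_word_def)
      have "p (Poly_Mapping.single (Word (a # l)) 1) \<le> L * M" if p: "p \<in> P" for p
        unfolding e using free_seminorm.pm[OF fs[OF p] c] M L p free_seminorm.nn[OF fs[OF p] c(2)]
        by (meson mult_mono order_trans)
      thus ?case using M(1) L(1) by (meson mult_nonneg_nonneg)
    }
  qed
  show ?thesis using f
  proof (induction f rule: free_induct)
    case 0 thus ?case using free_seminorm.p0[OF fs] by (metis order_refl)
  next
    case (add w a f)
    obtain M where M: "\<forall>p\<in>P. p (Poly_Mapping.single w 1) \<le> M" using word[of "letters w"] add(1) by (auto simp: star_words_def)
    obtain L where L: "\<forall>p\<in>P. p f \<le> L" using add by blast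
    have s: "Poly_Mapping.single w a = free_scale a (Poly_Mapping.single w 1)" by (simp add: free_scale_conv mult_single)
    have c: "Poly_Mapping.single w b \<in> free_carrier X" for b using add by (intro free_carrier_single)
    have "p (Poly_Mapping.single w a + f) \<le> cmod a * M + L" if p: "p \<in> P" for p
    proof -
      have "p (Poly_Mapping.single w a) \<le> cmod a * M"
        unfolding s free_seminorm.ps[OF fs[OF p] c] using M p by (intro mult_left_mono) auto
      thus ?thesis using free_seminorm.pt[OF fs[OF p] c add(2), of a] L p by fastforce
    qed
    thus ?case by blast
  qed
qed

text \<open>The relations must be expressible as the vanishing of the seminorm on a set of
  polynomials, a condition stable under suprema. The uniform bound on generators makes the supremum
  finite; otherwise \<open>Sup\<close> over the reals would carry no information.\<close>

locale universal_relations =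
  fixes X :: "'x set" and R :: "'x completion cstar \<Rightarrow> ('x \<Rightarrow> 'x completion) \<Rightarrow> bool" and N :: "'x free_star set"
  assumes N: "N \<subseteq> free_carrier X"
    and R: "cstar_seminorm X p \<Longrightarrow> R (completion X p) (completion_gen X p) \<longleftrightarrow> (\<forall>r\<in>N. p r = 0)"
    and bounded: "x \<in> X \<Longrightarrow> \<exists>M. \<forall>p. cstar_seminorm X p \<and> (\<forall>r\<in>N. p r = 0) \<longrightarrow> p (free_gen x) \<le> M"
begin

abbreviation (input) "P \<equiv> {p. cstar_seminorm X p \<and> (\<forall>r\<in>N. p r = 0)}"

lemma universal_seminorm_SUP: "universal_seminorm X R = (\<lambda>f. SUP p\<in>P. p f)"
proof
  show "universal_seminorm X R f = (SUP p\<in>P. p f)" for f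
    unfolding universal_seminorm_def by (rule arg_cong[of _ _ Sup]) (use R in auto)
qed

lemma bdd_above_P: "f \<in> free_carrier X \<Longrightarrow> bdd_above ((\<lambda>p. p f) ` P)"
  using seminorm_bound_of_gens[of P X f] bounded by (auto simp: bdd_above_def)

lemma zero_P: "(\<lambda>_. 0) \<in> P" by (simp add: cstar_seminorm_def)

lemma universal_seminorm_P: "cstar_seminorm X (universal_seminorm X R)" "r \<in> N \<Longrightarrow> universal_seminorm X R r = 0"
proof -
  have "cstar_seminorm X (\<lambda>f. SUP p\<in>P. p f)"
    using zero_P bdd_above_P by (intro sup_cstar_seminorm) blast+
  thus "cstar_seminorm X (universal_seminorm X R)" by (simp add: universal_seminorm_SUP)
  show "universal_seminorm X R r = 0" if "r \<in> N"
  proof -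
    have "(\<lambda>p. p r) ` P = {0}" using that zero_P by (auto intro!: image_eqI[of _ _ "\<lambda>_. 0"])
    thus ?thesis by (simp add: universal_seminorm_SUP)
  qed
qed

lemma universal_R: "R (universal_cstar X R) (universal_family X R)"
  unfolding universal_cstar_def universal_family_def using R universal_seminorm_P by simp

lemma universal_generates: "generates (universal_cstar X R) (universal_family X R ` X)"
  unfolding universal_cstar_def universal_family_def
  by (rule free_seminorm.completion_generates) (simp add: free_seminorm_def universal_seminorm_P)

lemma universal_hom:
  assumes C: "cstar_algebra C" and \<pi>: "\<pi> \<in> X \<rightarrow> carrier C" and z: "\<And>r. r \<in> N \<Longrightarrow> free_eval C \<pi> r = \<zero>\<^bsub>C\<^esub>"
  shows "\<exists>\<phi>\<in>star_hom (universal_cstar X R) C. \<forall>x\<in>X. \<phi> (universal_family X R x) = \<pi> x"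
proof -
  interpret F: cstar_family C X \<pi> using C \<pi> by (simp add: cstar_family_def cstar_family_axioms_def)
  have "(\<lambda>f. cnorm C (F.E f)) \<in> P" using F.E_seminorm z by simp
  hence "cnorm C (F.E f) \<le> universal_seminorm X R f" if "f \<in> free_carrier X" for f
    unfolding universal_seminorm_SUP using bdd_above_P[OF that] by (intro cSUP_upper2[of _ _ "\<lambda>f. cnorm C (F.E f)"]) auto
  thus ?thesis unfolding universal_cstar_def universal_family_def
    using universal_seminorm_P(1) by (intro F.hom_exists) auto
qed

end

text \<open>This makes the unit fibre a C*-algebra in its own right, to which
  \<open>star_hom_contractive\<close> applies.\<close>

lemma (in cstar_algebra) subalgebra:
  assumes W: "closed_subspace W" and mu: "\<And>x y. x \<in> W \<Longrightarrow> y \<in> W \<Longrightarrow> x \<otimes> y \<in> W" and st: "\<And>x. x \<in> W \<Longrightarrow> star A x \<in> W"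
  shows "cstar_algebra (A\<lparr>carrier := W\<rparr>)"
proof -
  let ?B = "A\<lparr>carrier := W\<rparr>"
  note D = closed_subspaceD[OF W]
  have ag: "abelian_group ?B"
  proof (rule abelian_groupI)
    fix x assume "x \<in> carrier ?B"
    hence x: "x \<in> W" by simp
    have "(-1) \<odot> x \<oplus> x = \<zero>" using sl[of x "-1" 1] D(1)[OF x] by (simp add: s0 s1)
    thus "\<exists>y\<in>carrier ?B. y \<oplus>\<^bsub>?B\<^esub> x = \<zero>\<^bsub>?B\<^esub>" using D(4)[OF x, of "-1"] by auto
  qed (use D(2,3) in \<open>simp_all add: M.a_ac D(1)\<close>)
  interpret B: abelian_group ?B by (rule ag)
  have minus: "x \<ominus>\<^bsub>?B\<^esub> y = x \<ominus> y" if "x \<in> W" "y \<in> W" for x y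
  proof -
    have "(-1) \<odot> y \<oplus> y = \<zero>" using sl[of y "-1" 1] D(1)[OF that(2)] by (simp add: s0 s1)
    hence "\<ominus>\<^bsub>?B\<^esub> y = (-1) \<odot> y" using D(4)[OF that(2)] that by (intro B.minus_equality) auto
    thus ?thesis using that D(1) by (simp add: a_minus_def neg)
  qed
  have c: "x \<in> carrier A" if "x \<in> W" for x using D(1) that by blast
  show ?thesis
  proof (intro cstar_algebra.intro Module.moduleI cstar_algebra_axioms.intro)
    show "cring complex_ring" by (rule R.cring_axioms)
    show "abelian_group ?B" by (rule ag)
    fix Y :: "nat \<Rightarrow> 'a" assume Y: "\<And>n. Y n \<in> carrier ?B" "\<And>e. 0 < e \<Longrightarrow> \<exists>N. \<forall>m\<ge>N. \<forall>n\<ge>N. cnorm ?B (Y m \<ominus>\<^bsub>?B\<^esub> Y n) < e"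
    hence YW: "\<And>n. Y n \<in> W" by simp
    have "\<exists>x\<in>carrier A. (\<lambda>n. cnorm A (Y n \<ominus> x)) \<longlonglongrightarrow> 0"
      using Y(2) c[OF YW] by (intro complete) (simp_all add: minus[OF YW YW])
    then obtain x where x: "x \<in> carrier A" "(\<lambda>n. cnorm A (Y n \<ominus> x)) \<longlonglongrightarrow> 0" by blast
    hence xW: "x \<in> W" using c[OF YW] by (intro closed_subspace_conv[OF W YW]) (auto simp: conv_to_def)
    thus "\<exists>x\<in>carrier ?B. (\<lambda>n. cnorm ?B (Y n \<ominus>\<^bsub>?B\<^esub> x)) \<longlonglongrightarrow> 0"
      using x by (intro bexI[of _ x]) (simp_all add: minus[OF YW xW])
  qed (use D(2,3,4) mu st c in \<open>simp_all add: sl sr sa s1 mult_assoc mult_add_left mult_add_right mult_smult_left mult_smult_right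
      star_star star_add star_smult star_mult norm_nonneg norm_eq_zero_iff norm_triangle norm_smult norm_mult cstar_identity\<close>)
qed

section \<open>The algebra of the deformed bundle\<close>

context cocycle_graph begin

abbreviation "BB \<equiv> deform G (graph_bundle k \<Lambda> G \<eta>) \<sigma>"
abbreviation "BT \<equiv> Sigma (carrier G) fib"

lemma BB_simps [simp]:
  "btotal BB = BT" "bproj BB = fst" "badd BB (g, x) (h, y) = (g, x \<oplus>\<^bsub>A\<^esub> y)" "bscale BB a (g, x) = (g, a \<odot>\<^bsub>A\<^esub> x)"
  "bmult BB (g, x) (h, y) = (g \<otimes> h, \<sigma> g h \<odot>\<^bsub>A\<^esub> (x \<otimes>\<^bsub>A\<^esub> y))"
  "bstar BB (g, x) = (inv g, cnj (\<sigma> g (inv g)) \<odot>\<^bsub>A\<^esub> star A x)"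
  by (simp_all add: deform_def graph_bundle_def Let_def)

lemma fibre_BB: "fibre BB g = {g} \<times> (if g \<in> carrier G then fib g else {})"
  by (auto simp: fibre_def)

lemma fib_carrier [simp]: "x \<in> fib g \<Longrightarrow> x \<in> carrier A" by (rule fibD(1))

lemma bmult_closed: "g \<in> carrier G \<Longrightarrow> h \<in> carrier G \<Longrightarrow> x \<in> fib g \<Longrightarrow> y \<in> fib h \<Longrightarrow> \<sigma> g h \<odot>\<^bsub>A\<^esub> (x \<otimes>\<^bsub>A\<^esub> y) \<in> fib (g \<otimes> h)"
  by (intro fibD(4) fib_mult)

lemma bstar_closed: "g \<in> carrier G \<Longrightarrow> x \<in> fib g \<Longrightarrow> cnj (\<sigma> g (inv g)) \<odot>\<^bsub>A\<^esub> star A x \<in> fib (inv g)"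
  by (intro fibD(4) fib_star)

text \<open>Nondegeneracy is not part of the definition; it turns out to be automatic for the C*-algebra
  generated by the image.\<close>

definition bundle_morphism :: "'c cstar \<Rightarrow> ('g \<times> 'l completion \<Rightarrow> 'c) \<Rightarrow> bool" where
  "bundle_morphism C \<pi> \<longleftrightarrow> cstar_algebra C \<and> \<pi> \<in> BT \<rightarrow> carrier C \<and>
     (\<forall>g\<in>carrier G. \<forall>x\<in>fib g. \<forall>y\<in>fib g. \<pi> (g, x \<oplus>\<^bsub>A\<^esub> y) = \<pi> (g, x) \<oplus>\<^bsub>C\<^esub> \<pi> (g, y)) \<and>
     (\<forall>g\<in>carrier G. \<forall>x\<in>fib g. \<forall>a. \<pi> (g, a \<odot>\<^bsub>A\<^esub> x) = a \<odot>\<^bsub>C\<^esub> \<pi> (g, x)) \<and>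
     (\<forall>g\<in>carrier G. \<forall>h\<in>carrier G. \<forall>x\<in>fib g. \<forall>y\<in>fib h.
        \<pi> (g \<otimes> h, \<sigma> g h \<odot>\<^bsub>A\<^esub> (x \<otimes>\<^bsub>A\<^esub> y)) = \<pi> (g, x) \<otimes>\<^bsub>C\<^esub> \<pi> (h, y)) \<and>
     (\<forall>g\<in>carrier G. \<forall>x\<in>fib g. star C (\<pi> (g, x)) = \<pi> (inv g, cnj (\<sigma> g (inv g)) \<odot>\<^bsub>A\<^esub> star A x))"

lemma bundle_morphismD:
  assumes "bundle_morphism C \<pi>" and g: "g \<in> carrier G" "x \<in> fib g"
  shows "cstar_algebra C" "\<pi> (g, x) \<in> carrier C"
    "y \<in> fib g \<Longrightarrow> \<pi> (g, x \<oplus>\<^bsub>A\<^esub> y) = \<pi> (g, x) \<oplus>\<^bsub>C\<^esub> \<pi> (g, y)"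
    "\<pi> (g, a \<odot>\<^bsub>A\<^esub> x) = a \<odot>\<^bsub>C\<^esub> \<pi> (g, x)"
    "h \<in> carrier G \<Longrightarrow> y \<in> fib h \<Longrightarrow> \<pi> (g, x) \<otimes>\<^bsub>C\<^esub> \<pi> (h, y) = \<pi> (g \<otimes> h, \<sigma> g h \<odot>\<^bsub>A\<^esub> (x \<otimes>\<^bsub>A\<^esub> y))"
    "star C (\<pi> (g, x)) = \<pi> (inv g, cnj (\<sigma> g (inv g)) \<odot>\<^bsub>A\<^esub> star A x)"
  using assms by (auto simp: bundle_morphism_def)

lemma bundle_representation_iff:
  "bundle_representation G BB C \<pi> \<longleftrightarrow> bundle_morphism C \<pi> \<and>
     closed_span C {\<pi> b \<otimes>\<^bsub>C\<^esub> x |b x. b \<in> fibre BB \<one> \<and> x \<in> carrier C} = carrier C"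
  unfolding bundle_representation_def bundle_morphism_def
  by (auto simp: fibre_BB)

lemma \<sigma>_inv: assumes g: "g \<in> carrier G" shows "\<sigma> (inv g) g = \<sigma> g (inv g)"
  using \<sigma>_cocycle[of g "inv g" g] g by (simp add: \<sigma>_one)

text \<open>The factors from the deformed involution and the deformed product are conjugate and
  cancel, so b* b and b b* are those of the undeformed bundle.\<close>

lemma bundle_morphism_star_mult:
  assumes m: "bundle_morphism C \<pi>" and g: "g \<in> carrier G" and x: "x \<in> fib g"
  shows "star C (\<pi> (g, x)) \<otimes>\<^bsub>C\<^esub> \<pi> (g, x) = \<pi> (\<one>, star A x \<otimes>\<^bsub>A\<^esub> x)"
    "\<pi> (g, x) \<otimes>\<^bsub>C\<^esub> star C (\<pi> (g, x)) = \<pi> (\<one>, x \<otimes>\<^bsub>A\<^esub> star A x)"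
proof -
  note D = bundle_morphismD[OF m]
  have c: "cnj (\<sigma> g (inv g)) * \<sigma> g (inv g) = 1" using g by (intro \<sigma>_cnj) auto
  have ig: "inv g \<in> carrier G" "cnj (\<sigma> g (inv g)) \<odot>\<^bsub>A\<^esub> star A x \<in> fib (inv g)" using g x bstar_closed by auto
  show "star C (\<pi> (g, x)) \<otimes>\<^bsub>C\<^esub> \<pi> (g, x) = \<pi> (\<one>, star A x \<otimes>\<^bsub>A\<^esub> x)"
    unfolding D(6)[OF g x] D(5)[OF ig g x]
    using g x c by (simp add: A.mult_smult_left \<sigma>_inv A.s1 mult.commute flip: A.sa)
  show "\<pi> (g, x) \<otimes>\<^bsub>C\<^esub> star C (\<pi> (g, x)) = \<pi> (\<one>, x \<otimes>\<^bsub>A\<^esub> star A x)"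
    unfolding D(6)[OF g x] D(5)[OF g x ig]
    using g x c by (simp add: A.mult_smult_right A.s1 mult.commute flip: A.sa)
qed

text \<open>The C*-identity reduces to the unit fibre. There the deformation is trivial because
  \<open>\<sigma> \<one> \<one>\<close> is 1, so the morphism restricts to a *-homomorphism of
  C*-algebras.\<close>

lemma bundle_morphism_contractive:
  assumes m: "bundle_morphism C \<pi>" and g: "g \<in> carrier G" and x: "x \<in> fib g"
  shows "cnorm C (\<pi> (g, x)) \<le> cnorm A x"
proof -
  note D = bundle_morphismD[OF m]
  interpret C: cstar_algebra C by (rule D(1)[OF g x])
  let ?A = "A\<lparr>carrier := fib \<one>\<rparr>"
  have A1: "cstar_algebra ?A"
    using fib_mult[of \<one> \<one>] fib_star[of \<one>] by (intro A.subalgebra closed_subspace_fib) auto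
  have "(\<lambda>x. \<pi> (\<one>, x)) \<in> star_hom ?A C"
    unfolding star_hom_def
    using D(2,3,4)[of \<one>] D(5)[of \<one> _ \<one>] D(6)[of \<one>] fib_mult[of \<one> \<one>] fib_star[of \<one>]
    by (auto simp: \<sigma>_one A.s1)
  note con = star_hom_contractive[OF A1 C.cstar_algebra_axioms this]
  have xx: "star A x \<otimes>\<^bsub>A\<^esub> x \<in> fib \<one>" using fib_mult[OF _ g fib_star[OF g x] x] g by simp
  have "(cnorm C (\<pi> (g, x)))\<^sup>2 = cnorm C (\<pi> (\<one>, star A x \<otimes>\<^bsub>A\<^esub> x))"
    using C.cstar_identity[OF D(2)[OF g x]] bundle_morphism_star_mult(1)[OF m g x] by simp
  also have "\<dots> \<le> (cnorm A x)\<^sup>2" using con[of "star A x \<otimes>\<^bsub>A\<^esub> x"] xx x A.cstar_identity[of x] by simp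
  finally show ?thesis using A.norm_nonneg[OF fib_carrier[OF x]] by (rule power2_le_imp_le)
qed

text \<open>Contractivity makes preimages of closed subspaces closed, so membership needs checking
  on the spanning elements only.\<close>

lemma bundle_morphism_preimage:
  assumes m: "bundle_morphism C \<pi>" and g: "g \<in> carrier G" and W: "cstar_algebra.closed_subspace C W"
    and gen: "\<And>x y. x \<in> X \<Longrightarrow> y \<in> X \<Longrightarrow> \<eta> x \<otimes> inv (\<eta> y) = g \<Longrightarrow> \<pi> (g, s x \<otimes>\<^bsub>A\<^esub> star A (s y)) \<in> W"
    and x: "x \<in> fib g"
  shows "\<pi> (g, x) \<in> W"
proof -
  note D = bundle_morphismD[OF m g]
  have "A.closed_subspace {x \<in> fib g. \<pi> (g, x) \<in> W}"
    by (rule A.closed_subspace_preimage[OF D(1)[OF x] closed_subspace_fib W, where f = "\<lambda>a. a" and M = 1])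
      (use D bundle_morphism_contractive[OF m g] in auto)
  from fib_least[OF this, of g] gen x show ?thesis by (auto simp: fib_spanning)
qed

text \<open>Every spanning element absorbs on the left the projection at the range of its first
  path, and this projection lies in the unit fibre. So the closed right ideal N contains the image
  of the bundle.\<close>

lemma bundle_morphism_nondegenerate:
  assumes m: "bundle_morphism C \<pi>" and gen: "generates C (\<pi> ` BT)"
  shows "closed_span C {\<pi> b \<otimes>\<^bsub>C\<^esub> x |b x. b \<in> fibre BB \<one> \<and> x \<in> carrier C} = carrier C"
proof -
  note D = bundle_morphismD[OF m]
  interpret C: cstar_algebra C using m by (simp add: bundle_morphism_def)
  let ?S = "{\<pi> b \<otimes>\<^bsub>C\<^esub> x |b x. b \<in> fibre BB \<one> \<and> x \<in> carrier C}"
  define N where "N = closed_span C ?S"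
  have S: "?S \<subseteq> carrier C" using D(2) by (auto simp: fibre_BB)
  have N: "C.closed_subspace N" unfolding N_def by (rule C.closed_subspace_closed_span[OF S])
  have SN: "?S \<subseteq> N" unfolding N_def by (rule C.closed_span_superset[OF S])
  note ND = C.closed_subspaceD[OF N]
  have ideal: "u \<otimes>\<^bsub>C\<^esub> v \<in> N" if u: "u \<in> N" and v: "v \<in> carrier C" for u v
  proof -
    have "closed_span C ?S \<subseteq> {u \<in> carrier C. u \<otimes>\<^bsub>C\<^esub> v \<in> N}"
    proof (rule C.closed_span_least[OF C.closed_subspace_right_mult[OF N v]], safe)
      fix b x assume b: "b \<in> fibre BB \<one>" and x: "x \<in> carrier C"
      have pb: "\<pi> b \<in> carrier C" using b D(2) by (auto simp: fibre_BB)
      show "\<pi> b \<otimes>\<^bsub>C\<^esub> x \<in> carrier C" using pb x by simp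
      have "\<pi> b \<otimes>\<^bsub>C\<^esub> x \<otimes>\<^bsub>C\<^esub> v = \<pi> b \<otimes>\<^bsub>C\<^esub> (x \<otimes>\<^bsub>C\<^esub> v)" using pb x v by (simp add: C.mult_assoc)
      also have "\<dots> \<in> ?S" using b C.mult_closed[OF x v] by blast
      finally show "\<pi> b \<otimes>\<^bsub>C\<^esub> x \<otimes>\<^bsub>C\<^esub> v \<in> N" using SN by blast
    qed
    thus ?thesis using u by (auto simp: N_def)
  qed
  have \<pi>N: "\<pi> (g, x) \<in> N" if g: "g \<in> carrier G" and x: "x \<in> fib g" for g x
  proof (rule bundle_morphism_preimage[OF m g N _ x])
    fix a c assume ac: "a \<in> X" "c \<in> X" "\<eta> a \<otimes> inv (\<eta> c) = g"
    let ?y = "s a \<otimes>\<^bsub>A\<^esub> star A (s c)" and ?r = "rng \<Lambda> a"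
    have y: "?y \<in> fib g" using ac by (rule fib_spanning)
    have r: "?r \<in> X" "?r \<in> vertices \<Lambda>" using ac by (simp_all add: rng_closed rng_vertex)
    have r1: "s ?r \<in> fib \<one>" using s_fib[OF r(1)] r by (simp add: \<eta>_vertex)
    have "s ?r \<otimes>\<^bsub>A\<^esub> ?y = ?y" using ac r s_rng[of a] by (simp flip: A.mult_assoc)
    hence "\<pi> (g, ?y) = \<pi> (\<one>, s ?r) \<otimes>\<^bsub>C\<^esub> \<pi> (g, ?y)"
      using D(5)[OF one_closed r1 g y] g y by (simp add: \<sigma>_one A.s1)
    also have "\<dots> \<in> ?S" using r1 D(2)[OF g y] by (auto simp: fibre_BB)
    finally show "\<pi> (g, ?y) \<in> N" using SN by blast
  qed
  \<comment> \<open>N is known only as a right ideal; its largest self-adjoint part is a closed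
    *-subalgebra, as \<open>generates\<close> demands.\<close>
  let ?Y = "{u \<in> N. star C u \<in> N}"
  have Y: "C.closed_subspace ?Y"
    by (rule C.closed_subspace_preimage[OF C.cstar_algebra_axioms N N, where f = cnj and M = 1])
      (simp_all add: ND(1) C.star_add C.star_smult C.norm_star)
  have "\<pi> ` BT \<subseteq> ?Y" using \<pi>N D(6) bstar_closed by auto
  moreover have "\<forall>u\<in>?Y. \<forall>v\<in>?Y. u \<otimes>\<^bsub>C\<^esub> v \<in> ?Y" using ideal ND(1) C.star_mult by auto
  moreover have "\<forall>u\<in>?Y. star C u \<in> ?Y" using ND(1) by (auto simp: C.star_star)
  ultimately have "?Y = carrier C" using gen Y unfolding generates_def by blast
  thus ?thesis using ND(1) unfolding N_def by blast
qed

section \<open>Polynomial relations and the universal property of the bundle algebra\<close>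

abbreviation "bgen \<equiv> free_gen :: 'g \<times> 'l completion \<Rightarrow> ('g \<times> 'l completion) free_star"

definition bundle_relations :: "('g \<times> 'l completion) free_star set" where
  "bundle_relations =
     {bgen (g, x \<oplus>\<^bsub>A\<^esub> y) - (bgen (g, x) + bgen (g, y)) |g x y. g \<in> carrier G \<and> x \<in> fib g \<and> y \<in> fib g} \<union>
     {bgen (g, a \<odot>\<^bsub>A\<^esub> x) - free_scale a (bgen (g, x)) |g x a. g \<in> carrier G \<and> x \<in> fib g} \<union>
     {bgen (g \<otimes> h, \<sigma> g h \<odot>\<^bsub>A\<^esub> (x \<otimes>\<^bsub>A\<^esub> y)) - bgen (g, x) * bgen (h, y) |g h x y.
        g \<in> carrier G \<and> h \<in> carrier G \<and> x \<in> fib g \<and> y \<in> fib h} \<union>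
     {free_star (bgen (g, x)) - bgen (inv g, cnj (\<sigma> g (inv g)) \<odot>\<^bsub>A\<^esub> star A x) |g x. g \<in> carrier G \<and> x \<in> fib g}"

lemma bundle_relations_carrier: "bundle_relations \<subseteq> free_carrier BT"
  unfolding bundle_relations_def
  by (auto intro!: free_carrier_diff free_carrier_add free_carrier_scale free_carrier_mult free_carrier_star free_gen_carrier
      fib_mult fib_star fibD(3,4))

lemma bundle_morphism_relations:
  assumes C: "cstar_algebra C" and \<pi>: "\<pi> \<in> BT \<rightarrow> carrier C"
  shows "bundle_morphism C \<pi> \<longleftrightarrow> (\<forall>r\<in>bundle_relations. free_eval C \<pi> r = \<zero>\<^bsub>C\<^esub>)"
proof -
  interpret F: cstar_family C BT \<pi> using C \<pi> by (simp add: cstar_family_def cstar_family_axioms_def)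
  have g: "bgen (g, x) \<in> free_carrier BT" "\<pi> (g, x) \<in> carrier C" "F.E (bgen (g, x)) = \<pi> (g, x)"
    if "g \<in> carrier G" "x \<in> fib g" for g x
    using that \<pi> by (auto simp: free_gen_carrier F.E_gen)
  note cl = fibD(3,4) bmult_closed bstar_closed
  have e1: "F.E (bgen (g, x \<oplus>\<^bsub>A\<^esub> y) - (bgen (g, x) + bgen (g, y))) = \<zero>\<^bsub>C\<^esub> \<longleftrightarrow> \<pi> (g, x \<oplus>\<^bsub>A\<^esub> y) = \<pi> (g, x) \<oplus>\<^bsub>C\<^esub> \<pi> (g, y)"
    if "g \<in> carrier G" "x \<in> fib g" "y \<in> fib g" for g x y
    using that g cl by (simp add: F.E_diff F.E_add free_carrier_add F.diff0)
  have e2: "F.E (bgen (g, a \<odot>\<^bsub>A\<^esub> x) - free_scale a (bgen (g, x))) = \<zero>\<^bsub>C\<^esub> \<longleftrightarrow> \<pi> (g, a \<odot>\<^bsub>A\<^esub> x) = a \<odot>\<^bsub>C\<^esub> \<pi> (g, x)"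
    if "g \<in> carrier G" "x \<in> fib g" for g x a
    using that g cl by (simp add: F.E_diff F.E_scale free_carrier_scale F.diff0)
  have e3: "F.E (bgen (g \<otimes> h, \<sigma> g h \<odot>\<^bsub>A\<^esub> (x \<otimes>\<^bsub>A\<^esub> y)) - bgen (g, x) * bgen (h, y)) = \<zero>\<^bsub>C\<^esub> \<longleftrightarrow>
      \<pi> (g \<otimes> h, \<sigma> g h \<odot>\<^bsub>A\<^esub> (x \<otimes>\<^bsub>A\<^esub> y)) = \<pi> (g, x) \<otimes>\<^bsub>C\<^esub> \<pi> (h, y)"
    if "g \<in> carrier G" "h \<in> carrier G" "x \<in> fib g" "y \<in> fib h" for g h x y
    using that g cl by (simp add: F.E_diff F.E_mult free_carrier_mult F.diff0)
  have e4: "F.E (free_star (bgen (g, x)) - bgen (inv g, cnj (\<sigma> g (inv g)) \<odot>\<^bsub>A\<^esub> star A x)) = \<zero>\<^bsub>C\<^esub> \<longleftrightarrow>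
      star C (\<pi> (g, x)) = \<pi> (inv g, cnj (\<sigma> g (inv g)) \<odot>\<^bsub>A\<^esub> star A x)"
    if "g \<in> carrier G" "x \<in> fib g" for g x
    using that g cl by (simp add: F.E_diff F.E_star free_carrier_star F.diff0)
  show ?thesis
  proof
    assume m: "bundle_morphism C \<pi>"
    show "\<forall>r\<in>bundle_relations. F.E r = \<zero>\<^bsub>C\<^esub>"
    proof
      fix r assume "r \<in> bundle_relations"
      thus "F.E r = \<zero>\<^bsub>C\<^esub>" unfolding bundle_relations_def
        by (elim UnE CollectE exE conjE) (simp_all add: e1 e2 e3 e4 m[unfolded bundle_morphism_def])
    qed
  next
    assume r: "\<forall>r\<in>bundle_relations. F.E r = \<zero>\<^bsub>C\<^esub>"
    show "bundle_morphism C \<pi>"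
      unfolding bundle_morphism_def
    proof (intro conjI ballI allI C \<pi>)
      fix g x assume gx: "g \<in> carrier G" "x \<in> fib g"
      show "\<pi> (g, x \<oplus>\<^bsub>A\<^esub> y) = \<pi> (g, x) \<oplus>\<^bsub>C\<^esub> \<pi> (g, y)" if "y \<in> fib g" for y
        using r gx that unfolding e1[OF gx that, symmetric] bundle_relations_def by blast
      show "\<pi> (g, a \<odot>\<^bsub>A\<^esub> x) = a \<odot>\<^bsub>C\<^esub> \<pi> (g, x)" for a
        using r gx unfolding e2[OF gx, symmetric] bundle_relations_def by blast
      show "star C (\<pi> (g, x)) = \<pi> (inv g, cnj (\<sigma> g (inv g)) \<odot>\<^bsub>A\<^esub> star A x)"
        using r gx unfolding e4[OF gx, symmetric] bundle_relations_def by blast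
    next
      fix g h x y assume gx: "g \<in> carrier G" "h \<in> carrier G" "x \<in> fib g" "y \<in> fib h"
      show "\<pi> (g \<otimes> h, \<sigma> g h \<odot>\<^bsub>A\<^esub> (x \<otimes>\<^bsub>A\<^esub> y)) = \<pi> (g, x) \<otimes>\<^bsub>C\<^esub> \<pi> (h, y)"
        using r gx unfolding e3[OF gx, symmetric] bundle_relations_def by blast
    qed
  qed
qed

lemma completion_bundle_morphism:
  assumes p: "cstar_seminorm BT p"
  shows "bundle_morphism (completion BT p) (completion_gen BT p) \<longleftrightarrow> (\<forall>r\<in>bundle_relations. p r = 0)"
proof -
  interpret S: free_seminorm BT p by unfold_locales (rule p)
  interpret C: cstar_algebra S.C by (rule S.completion_cstar)
  have gc: "completion_gen BT p \<in> BT \<rightarrow> carrier S.C"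
    by (simp add: Pi_iff completion_gen_def S.cls_in S.CS_const free_gen_carrier)
  interpret F: cstar_family S.C BT "completion_gen BT p" by unfold_locales (rule gc)
  have "F.E r = \<zero>\<^bsub>S.C\<^esub> \<longleftrightarrow> p r = 0" if "r \<in> bundle_relations" for r
    using S.norm_free_eval_completion[of r] C.norm_eq_zero_iff[OF F.E_closed[of r]] bundle_relations_carrier that by auto
  thus ?thesis unfolding bundle_morphism_relations[OF S.completion_cstar gc] by blast
qed

text \<open>Nondegeneracy is no polynomial identity; in a completion it follows from generation by
  \<open>bundle_morphism_nondegenerate\<close>. The bound on the generator of (g, x) is the norm of
  x.\<close>

sublocale U: universal_relations BT "bundle_representation G BB" bundle_relations
proof
  show "bundle_relations \<subseteq> free_carrier BT" by (rule bundle_relations_carrier)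
  fix p :: "('g \<times> 'l completion) free_star \<Rightarrow> real"
  assume p: "cstar_seminorm BT p"
  show "bundle_representation G BB (completion BT p) (completion_gen BT p) \<longleftrightarrow> (\<forall>r\<in>bundle_relations. p r = 0)"
    unfolding bundle_representation_iff completion_bundle_morphism[OF p, symmetric]
    using bundle_morphism_nondegenerate free_seminorm.completion_generates[OF free_seminorm.intro[OF p]] by blast
next
  fix b assume "b \<in> BT"
  then obtain g x where b: "b = (g, x)" "g \<in> carrier G" "x \<in> fib g" by auto
  have "p (bgen b) \<le> cnorm A x" if p: "cstar_seminorm BT p" "\<forall>r\<in>bundle_relations. p r = 0" for p
  proof -
    interpret S: free_seminorm BT p by unfold_locales (rule p)
    have bc: "bgen b \<in> free_carrier BT" using b by (simp add: free_gen_carrier)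
    have "cnorm S.C (completion_gen BT p b) = p (bgen b)"
      using S.norm_cls[OF S.CS_const[OF bc]] LIMSEQ_const_iff unfolding completion_gen_def by metis
    thus ?thesis using bundle_morphism_contractive[of S.C "completion_gen BT p" g x] b
        completion_bundle_morphism[OF p(1)] p(2) by simp
  qed
  thus "\<exists>M. \<forall>p. cstar_seminorm BT p \<and> (\<forall>r\<in>bundle_relations. p r = 0) \<longrightarrow> p (bgen b) \<le> M" by blast
qed

abbreviation "CB \<equiv> bundle_cstar G BB"
abbreviation "\<pi>\<sigma> \<equiv> bundle_canonical G BB"

lemma canonical_bundle_morphism: "bundle_morphism CB \<pi>\<sigma>"
  using iffD1[OF bundle_representation_iff U.universal_R] unfolding bundle_cstar_def bundle_canonical_def BB_simps(1) by blast

lemma canonical_generates: "generates CB (\<pi>\<sigma> ` BT)"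
  using U.universal_generates by (simp add: bundle_cstar_def bundle_canonical_def)

lemma bundle_cstar_universal:
  assumes m: "bundle_morphism C \<pi>"
  shows "\<exists>\<phi>\<in>star_hom CB C. \<forall>b\<in>BT. \<phi> (\<pi>\<sigma> b) = \<pi> b"
proof -
  have C: "cstar_algebra C" "\<pi> \<in> BT \<rightarrow> carrier C" using m by (auto simp: bundle_morphism_def)
  show ?thesis
    using U.universal_hom[OF C] m bundle_morphism_relations[OF C] by (simp add: bundle_cstar_def bundle_canonical_def)
qed

end

section \<open>The isomorphism\<close>

lemma (in cstar_algebra) cv_diff: assumes "conv_to Y y" "conv_to Z z" shows "conv_to (\<lambda>n. Y n \<ominus> Z n) (y \<ominus> z)"
  using cv_add[OF assms(1) cv_smult[OF assms(2), of "-1"]] cvD[OF assms(1)] cvD[OF assms(2)] by (simp add: diff)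

lemma star_hom_comp: "\<phi> \<in> star_hom A B \<Longrightarrow> \<psi> \<in> star_hom B C \<Longrightarrow> \<psi> \<circ> \<phi> \<in> star_hom A C"
  by (auto simp: star_hom_def Pi_iff)

text \<open>The fixed points are the kernel of the bounded linear map that sends x to its image
  minus x, whose norm is at most 2 by contractivity.\<close>

lemma (in cstar_algebra) closed_subspace_fixed:
  assumes \<phi>: "\<phi> \<in> star_hom A A" shows "closed_subspace {x \<in> carrier A. \<phi> x = x}"
proof -
  note hom = star_homD[OF \<phi>]
  have "x = \<zero>" if x: "x \<in> carrier A" "\<forall>e>0. cnorm A (x \<ominus> \<zero>) < e" for x
  proof -
    have "cnorm A x \<le> 0"
    proof (rule field_le_epsilon)
      show "cnorm A x \<le> 0 + e" if "e > 0" for e using x that by (simp add: diff less_imp_le)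
    qed
    thus ?thesis using norm_nonneg[OF x(1)] norm_eq_zero_iff[OF x(1)] by simp
  qed
  hence Z: "closed_subspace {\<zero>}" by (auto simp: closed_subspace_def)
  have bd: "cnorm A (\<phi> x \<ominus> x) \<le> 2 * cnorm A x" if x: "x \<in> carrier A" for x
    using norm_triangle[of "\<phi> x" "(-1) \<odot> x"] star_hom_contractive[OF cstar_algebra_axioms cstar_algebra_axioms \<phi> x] x hom(1)[OF x]
    by (simp add: diff norm_smult)
  have "closed_subspace {x \<in> carrier A. \<phi> x \<ominus> x \<in> {\<zero>}}"
    by (rule closed_subspace_preimage[OF cstar_algebra_axioms closed_subspace_carrier Z, where f = "\<lambda>a. a" and M = 2])
      (simp_all add: hom add_diff bd, simp_all add: hom diff sr sa[symmetric] mult.commute)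
  moreover have "\<phi> x \<ominus> x \<in> {\<zero>} \<longleftrightarrow> \<phi> x = x" if "x \<in> carrier A" for x using that hom(1) by (simp add: diff0)
  ultimately show ?thesis by (simp cong: conj_cong)
qed

lemma (in cstar_algebra) star_hom_fixes_generated:
  assumes \<phi>: "\<phi> \<in> star_hom A A" and gen: "generates A S" and S: "S \<subseteq> carrier A" "\<And>x. x \<in> S \<Longrightarrow> \<phi> x = x" and x: "x \<in> carrier A"
  shows "\<phi> x = x"
proof -
  have "{x \<in> carrier A. \<phi> x = x} = carrier A"
    using gen closed_subspace_fixed[OF \<phi>] S star_homD[OF \<phi>] unfolding generates_def by (elim allE[of _ "{x \<in> carrier A. \<phi> x = x}"] impE) auto
  thus ?thesis using x by blast
qed

section \<open>The inverse homomorphism and the isomorphism\<close>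

context cocycle_graph begin

lemma homog_diff: "f \<in> homog g \<Longrightarrow> f' \<in> homog g \<Longrightarrow> f - f' \<in> homog g"
  using homog_add[OF _ homog_scale[of f' g "-1"]] by (simp add: free_scale_minus1)

lemma EU_twist_closed: "f \<in> homog g \<Longrightarrow> twist g f \<in> FU" using homog_F0 F0_FU twist_carrier by blast

lemma norm_twist_diff_le:
  assumes g: "g \<in> carrier G" and f: "f \<in> homog g" "f' \<in> homog g"
  shows "cnorm D (EU (twist g f) \<ominus>\<^bsub>D\<^esub> EU (twist g f')) \<le> cnorm A (AF.E f \<ominus>\<^bsub>A\<^esub> AF.E f')"
  using norm_twist_le[OF homog_diff[OF f] g] homog_F0[OF f(1)] homog_F0[OF f(2)] EU_twist_closed[OF f(1)] EU_twist_closed[OF f(2)]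
  by (simp add: twist_diff DF.E_diff AF.E_diff)

text \<open>The closed graph of the map to be constructed: polynomials of degree g are evaluated in
  \<open>A\<close> as they stand and in \<open>D\<close> after twisting. An element of a fibre has
  many approximating polynomials, and \<open>norm_twist_le\<close> makes the relation single-valued
  and defined on the whole fibre.\<close>

definition twisted_limit :: "'g \<Rightarrow> 'l completion \<Rightarrow> 'l completion \<Rightarrow> bool" where
  "twisted_limit g x d \<longleftrightarrow> (\<exists>F. (\<forall>n. F n \<in> homog g) \<and> A.conv_to (\<lambda>n. AF.E (F n)) x \<and>
     D.conv_to (\<lambda>n. EU (twist g (F n))) d)"

lemma twisted_limit_carrier: "twisted_limit g x d \<Longrightarrow> d \<in> carrier D"
  by (auto simp: twisted_limit_def D.conv_to_def)

lemma twisted_limit_unique: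
  assumes g: "g \<in> carrier G" and d: "twisted_limit g x d" "twisted_limit g x d'" shows "d = d'"
proof -
  obtain F where "\<forall>n. F n \<in> homog g" and Fc: "A.conv_to (\<lambda>n. AF.E (F n)) x" "D.conv_to (\<lambda>n. EU (twist g (F n))) d"
    using d(1) unfolding twisted_limit_def by blast
  hence F: "F n \<in> homog g" for n by blast
  note F0 = homog_F0[OF F] EU_twist_closed[OF F]
  obtain F' where "\<forall>n. F' n \<in> homog g" and F'c: "A.conv_to (\<lambda>n. AF.E (F' n)) x" "D.conv_to (\<lambda>n. EU (twist g (F' n))) d'"
    using d(2) unfolding twisted_limit_def by blast
  hence F': "F' n \<in> homog g" for n by blast
  note F'0 = homog_F0[OF F'] EU_twist_closed[OF F']
  have c: "x \<in> carrier A" "d \<in> carrier D" "d' \<in> carrier D" using Fc F'c A.cvD(2) D.cvD(2) by blast+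
  have "(\<lambda>n. cnorm A (AF.E (F n) \<ominus>\<^bsub>A\<^esub> AF.E (F' n))) \<longlonglongrightarrow> 0"
    using A.cv_norm[OF A.cv_diff[OF Fc(1) F'c(1)]] c by (simp add: A.minus_self)
  moreover have "(\<lambda>n. cnorm D (EU (twist g (F n)) \<ominus>\<^bsub>D\<^esub> EU (twist g (F' n)))) \<longlonglongrightarrow> cnorm D (d \<ominus>\<^bsub>D\<^esub> d')"
    by (rule D.cv_norm[OF D.cv_diff[OF Fc(2) F'c(2)]])
  ultimately have "cnorm D (d \<ominus>\<^bsub>D\<^esub> d') \<le> 0"
    using norm_twist_diff_le[OF g F F'] by (intro LIMSEQ_le) auto
  thus ?thesis using D.norm_nonneg[of "d \<ominus>\<^bsub>D\<^esub> d'"] D.norm_eq_zero_iff[of "d \<ominus>\<^bsub>D\<^esub> d'"] D.diff0[OF c(2,3)] c by simp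
qed

lemma lin_span_homog: "y \<in> lin_span A (spanning g) \<Longrightarrow> \<exists>f\<in>homog g. AF.E f = y"
proof (induction rule: lin_span.induct)
  case zero show ?case using homog.zero AF.E_0 by blast
next
  case (step x y a)
  then obtain u v f where x: "x = s u \<otimes>\<^bsub>A\<^esub> star A (s v)" "u \<in> X" "v \<in> X" "\<eta> u \<otimes> inv (\<eta> v) = g"
    and f: "f \<in> homog g" "AF.E f = y" by (auto simp: spanning_def)
  let ?w = "Word [(u, False), (v, True)]"
  have w: "?w \<in> star_words X" "word_deg (letters ?w) = g" using x by (auto simp: star_words_def)
  have "AF.E (Poly_Mapping.single ?w a + f) = a \<odot>\<^bsub>A\<^esub> x \<oplus>\<^bsub>A\<^esub> y"
    using x f w homog_F0[OF f(1)] by (simp add: AF.E_add free_carrier_single AF.E_single)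
  thus ?case using homog.add[OF w f(1), of a] by blast
qed

lemma twisted_limit_exists:
  assumes g: "g \<in> carrier G" and x: "x \<in> fib g" shows "\<exists>d. twisted_limit g x d"
proof -
  obtain Y where Y: "\<And>n. Y n \<in> lin_span A (spanning g)" "A.conv_to Y x"
    using A.closed_span_sequence[OF spanning_carrier] x unfolding fib_eq by metis
  have "\<exists>f. f \<in> homog g \<and> AF.E f = Y n" for n using lin_span_homog[OF Y(1)] by blast
  then obtain F where F: "\<And>n. F n \<in> homog g" "\<And>n. AF.E (F n) = Y n" by metis
  have c: "Y n \<in> carrier A" "x \<in> carrier A" for n using A.cvD[OF Y(2)] by auto
  have tc: "EU (twist g (F n)) \<in> carrier D" for n using EU_twist_closed[OF F(1)] by simp
  have "\<exists>N. \<forall>m\<ge>N. \<forall>n\<ge>N. cnorm D (EU (twist g (F m)) \<ominus>\<^bsub>D\<^esub> EU (twist g (F n))) < e" if "e > 0" for e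
  proof -
    have "(\<lambda>n. cnorm A (Y n \<ominus>\<^bsub>A\<^esub> x)) \<longlonglongrightarrow> 0" using Y(2) by (simp add: A.conv_to_def)
    hence "\<forall>\<^sub>F n in sequentially. cnorm A (Y n \<ominus>\<^bsub>A\<^esub> x) < e/2" using \<open>e > 0\<close> by (intro order_tendstoD(2)) auto
    then obtain N where N: "\<And>n. n \<ge> N \<Longrightarrow> cnorm A (Y n \<ominus>\<^bsub>A\<^esub> x) < e/2" by (auto simp: eventually_sequentially)
    have "cnorm D (EU (twist g (F m)) \<ominus>\<^bsub>D\<^esub> EU (twist g (F n))) < e" if "m \<ge> N" "n \<ge> N" for m n
      using norm_twist_diff_le[OF g F(1)[of m] F(1)[of n]] A.ntri[OF c(1)[of m] c(2) c(1)[of n]]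
        A.ndiff[OF c(2) c(1)[of n]] N[OF that(1)] N[OF that(2)] F(2) by simp
    thus ?thesis by blast
  qed
  with D.complete[of "\<lambda>n. EU (twist g (F n))"] tc
  obtain d where "d \<in> carrier D" "(\<lambda>n. cnorm D (EU (twist g (F n)) \<ominus>\<^bsub>D\<^esub> d)) \<longlonglongrightarrow> 0" by blast
  hence "D.conv_to (\<lambda>n. EU (twist g (F n))) d" using tc by (auto simp: D.conv_to_def)
  thus ?thesis unfolding twisted_limit_def using Y(2) by (intro exI[of _ d] exI[of _ F]) (simp add: F)
qed

lemma twisted_limit_add:
  assumes "twisted_limit g x d" "twisted_limit g y e" shows "twisted_limit g (x \<oplus>\<^bsub>A\<^esub> y) (d \<oplus>\<^bsub>D\<^esub> e)"
proof -
  obtain F where "\<forall>n. F n \<in> homog g" and Fc: "A.conv_to (\<lambda>n. AF.E (F n)) x" "D.conv_to (\<lambda>n. EU (twist g (F n))) d"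
    using assms(1) unfolding twisted_limit_def by blast
  hence F: "F n \<in> homog g" for n by blast
  note F0 = homog_F0[OF F] EU_twist_closed[OF F]
  obtain H where "\<forall>n. H n \<in> homog g" and Hc: "A.conv_to (\<lambda>n. AF.E (H n)) y" "D.conv_to (\<lambda>n. EU (twist g (H n))) e"
    using assms(2) unfolding twisted_limit_def by blast
  hence H: "H n \<in> homog g" for n by blast
  note H0 = homog_F0[OF H] EU_twist_closed[OF H]
  show ?thesis unfolding twisted_limit_def
    using A.cv_add[OF Fc(1) Hc(1)] D.cv_add[OF Fc(2) Hc(2)] homog_add[OF F H] F0 H0
    by (intro exI[of _ "\<lambda>n. F n + H n"]) (simp add: AF.E_add twist_add DF.E_add)
qed

lemma twisted_limit_scale:
  assumes "twisted_limit g x d" shows "twisted_limit g (a \<odot>\<^bsub>A\<^esub> x) (a \<odot>\<^bsub>D\<^esub> d)"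
proof -
  obtain F where "\<forall>n. F n \<in> homog g" and Fc: "A.conv_to (\<lambda>n. AF.E (F n)) x" "D.conv_to (\<lambda>n. EU (twist g (F n))) d"
    using assms unfolding twisted_limit_def by blast
  hence F: "F n \<in> homog g" for n by blast
  note F0 = homog_F0[OF F] EU_twist_closed[OF F]
  show ?thesis unfolding twisted_limit_def
    using A.cv_smult[OF Fc(1)] D.cv_smult[OF Fc(2)] homog_scale[OF F] F0
    by (intro exI[of _ "\<lambda>n. free_scale a (F n)"]) (simp add: AF.E_scale twist_scale DF.E_scale)
qed

lemma twisted_limit_mult:
  assumes "twisted_limit g x d" "twisted_limit h y e"
  shows "twisted_limit (g \<otimes> h) (x \<otimes>\<^bsub>A\<^esub> y) (cnj (\<sigma> g h) \<odot>\<^bsub>D\<^esub> (d \<otimes>\<^bsub>D\<^esub> e))"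
proof -
  obtain F where "\<forall>n. F n \<in> homog g" and Fc: "A.conv_to (\<lambda>n. AF.E (F n)) x" "D.conv_to (\<lambda>n. EU (twist g (F n))) d"
    using assms(1) unfolding twisted_limit_def by blast
  hence F: "F n \<in> homog g" for n by blast
  note F0 = homog_F0[OF F] EU_twist_closed[OF F]
  obtain H where "\<forall>n. H n \<in> homog h" and Hc: "A.conv_to (\<lambda>n. AF.E (H n)) y" "D.conv_to (\<lambda>n. EU (twist h (H n))) e"
    using assms(2) unfolding twisted_limit_def by blast
  hence H: "H n \<in> homog h" for n by blast
  note H0 = homog_F0[OF H] EU_twist_closed[OF H]
  show ?thesis unfolding twisted_limit_def
    using A.cv_mult[OF Fc(1) Hc(1)] D.cv_smult[OF D.cv_mult[OF Fc(2) Hc(2)]] homog_mult[OF F H] F0 H0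
    by (intro exI[of _ "\<lambda>n. F n * H n"]) (simp add: AF.E_mult DF.E_mult DF.E_scale free_carrier_mult)
qed

lemma twisted_limit_star:
  assumes "twisted_limit g x d" shows "twisted_limit (inv g) (star A x) (\<sigma> g (inv g) \<odot>\<^bsub>D\<^esub> star D d)"
proof -
  obtain F where "\<forall>n. F n \<in> homog g" and Fc: "A.conv_to (\<lambda>n. AF.E (F n)) x" "D.conv_to (\<lambda>n. EU (twist g (F n))) d"
    using assms unfolding twisted_limit_def by blast
  hence F: "F n \<in> homog g" for n by blast
  note F0 = homog_F0[OF F] EU_twist_closed[OF F]
  show ?thesis unfolding twisted_limit_def
    using A.cv_star[OF Fc(1)] D.cv_smult[OF D.cv_star[OF Fc(2)]] homog_star[OF F] F0
    by (intro exI[of _ "\<lambda>n. free_star (F n)"]) (simp add: AF.E_star DF.E_star DF.E_scale free_carrier_star)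
qed

lemma twisted_limit_gen: assumes x: "x \<in> X" shows "twisted_limit (\<eta> x) (s x) (T x)"
proof -
  have w: "Word [(x, False)] \<in> star_words X" "word_deg (letters (Word [(x, False)])) = \<eta> x"
    using x by (auto simp: star_words_def)
  have h: "gen x \<in> homog (\<eta> x)" unfolding gen_words(1) by (rule homog_single[OF w])
  have "twist (\<eta> x) (gen x) = gen x" unfolding gen_words(1) twist_single using x by (simp add: \<sigma>_one)
  hence "EU (twist (\<eta> x) (gen x)) = T x" using x by (simp add: DF.E_gen T_total)
  thus ?thesis unfolding twisted_limit_def using h x
    by (intro exI[of _ "\<lambda>_. gen x"]) (simp add: AF.E_gen A.cv_const D.cv_const)
qed

definition untwist :: "'g \<times> 'l completion \<Rightarrow> 'l completion" where
  "untwist b = (THE d. twisted_limit (fst b) (snd b) d)"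

lemma untwist_eq: assumes g: "g \<in> carrier G" and d: "twisted_limit g x d" shows "untwist (g, x) = d"
  unfolding untwist_def fst_conv snd_conv by (rule the_equality) (rule d, rule twisted_limit_unique[OF g _ d])

lemma untwist_limit: "g \<in> carrier G \<Longrightarrow> x \<in> fib g \<Longrightarrow> twisted_limit g x (untwist (g, x))"
  using twisted_limit_exists untwist_eq by metis

text \<open>The conjugate factors picked up by \<open>twist\<close> in products, and the factor
  picked up in adjoints, cancel against those of the deformed operations.\<close>

lemma untwist_bundle_morphism: "bundle_morphism D untwist"
  unfolding bundle_morphism_def
proof (intro conjI ballI allI)
  show "cstar_algebra D" by (rule cstar_D)
  show "untwist \<in> BT \<rightarrow> carrier D" by (auto intro: twisted_limit_carrier[OF untwist_limit])
next
  fix g x assume gx: "g \<in> carrier G" "x \<in> fib g"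
  note L = untwist_limit[OF gx]
  have d: "untwist (g, x) \<in> carrier D" by (rule twisted_limit_carrier[OF L])
  show "untwist (g, x \<oplus>\<^bsub>A\<^esub> y) = untwist (g, x) \<oplus>\<^bsub>D\<^esub> untwist (g, y)" if "y \<in> fib g" for y
    by (rule untwist_eq[OF gx(1) twisted_limit_add[OF L untwist_limit[OF gx(1) that]]])
  show "untwist (g, a \<odot>\<^bsub>A\<^esub> x) = a \<odot>\<^bsub>D\<^esub> untwist (g, x)" for a
    by (rule untwist_eq[OF gx(1) twisted_limit_scale[OF L]])
  have "untwist (inv g, cnj (\<sigma> g (inv g)) \<odot>\<^bsub>A\<^esub> star A x) =
      cnj (\<sigma> g (inv g)) \<odot>\<^bsub>D\<^esub> (\<sigma> g (inv g) \<odot>\<^bsub>D\<^esub> star D (untwist (g, x)))"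
    using gx by (intro untwist_eq twisted_limit_scale twisted_limit_star[OF L]) auto
  thus "star D (untwist (g, x)) = untwist (inv g, cnj (\<sigma> g (inv g)) \<odot>\<^bsub>A\<^esub> star A x)"
    using gx d \<sigma>_cnj[of g "inv g"] by (simp add: D.s1 flip: D.sa)
next
  fix g h x y assume gx: "g \<in> carrier G" "h \<in> carrier G" "x \<in> fib g" "y \<in> fib h"
  note L = untwist_limit[OF gx(1,3)] and M = untwist_limit[OF gx(2,4)]
  have d: "untwist (g, x) \<in> carrier D" "untwist (h, y) \<in> carrier D" using L M twisted_limit_carrier by blast+
  have "untwist (g \<otimes> h, \<sigma> g h \<odot>\<^bsub>A\<^esub> (x \<otimes>\<^bsub>A\<^esub> y)) =
      \<sigma> g h \<odot>\<^bsub>D\<^esub> (cnj (\<sigma> g h) \<odot>\<^bsub>D\<^esub> (untwist (g, x) \<otimes>\<^bsub>D\<^esub> untwist (h, y)))"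
    using gx by (intro untwist_eq twisted_limit_scale twisted_limit_mult[OF L M]) auto
  thus "untwist (g \<otimes> h, \<sigma> g h \<odot>\<^bsub>A\<^esub> (x \<otimes>\<^bsub>A\<^esub> y)) = untwist (g, x) \<otimes>\<^bsub>D\<^esub> untwist (h, y)"
    using gx d \<sigma>_cnj[of g h] by (simp add: D.s1 mult.commute flip: D.sa)
qed

lemma bundle_morphism_finsum:
  assumes m: "bundle_morphism C \<pi>" and g: "g \<in> carrier G" and K: "finite K" "\<And>i. i \<in> K \<Longrightarrow> h i \<in> fib g"
  shows "\<pi> (g, finsum A h K) = finsum C (\<lambda>i. \<pi> (g, h i)) K"
  using K
proof (induction K rule: finite_induct)
  note D = bundle_morphismD[OF m g]
  interpret C: cstar_algebra C by (rule D(1)[OF fibD(2)])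
  {
    case empty show ?case using D(4)[OF fibD(2), of 0] D(2)[OF fibD(2)] by (simp add: C.s0)
  next
    case (insert i K)
    have hc: "h j \<in> carrier A" "\<pi> (g, h j) \<in> carrier C" if "j \<in> insert i K" for j
      using insert.prems[OF that] D(2) by auto
    have "finsum A h (insert i K) = h i \<oplus>\<^bsub>A\<^esub> finsum A h K" using insert.hyps hc by (intro A.M.finsum_insert) auto
    moreover have "finsum C (\<lambda>i. \<pi> (g, h i)) (insert i K) = \<pi> (g, h i) \<oplus>\<^bsub>C\<^esub> finsum C (\<lambda>i. \<pi> (g, h i)) K"
      using insert.hyps hc by (intro C.M.finsum_insert) auto
    moreover have "finsum A h K \<in> fib g" using insert.prems by (intro A.closed_subspace_finsum closed_subspace_fib) auto
    ultimately show ?case using insert D(3)[of "h i" "finsum A h K"] by simp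
  }
qed

definition t :: "'l \<Rightarrow> ('g \<times> 'l completion) completion" where "t x = \<pi>\<sigma> (\<eta> x, s x)"

text \<open>The factor \<open>c x y\<close> is the one introduced by the deformed product. The other
  relations involve only the unit fibre and products of an element with its adjoint, where the
  deformation is invisible.\<close>

lemma t_ck: "cuntz_krieger_family k \<Lambda> c CB t"
proof -
  note m = canonical_bundle_morphism
  note D = bundle_morphismD[OF m]
  interpret C: cstar_algebra CB by (rule D(1)[OF one_closed fibD(2)])
  have sv: "s v \<in> fib \<one>" if "v \<in> vertices \<Lambda>" for v using s_fib[OF vm[OF that]] that by (simp add: \<eta>_vertex)
  note sf = s_fib and E = \<eta>_closed
  have zero: "\<pi>\<sigma> (\<one>, \<zero>\<^bsub>A\<^esub>) = \<zero>\<^bsub>CB\<^esub>"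
    using D(4)[OF one_closed fibD(2), of 0] D(2)[OF one_closed fibD(2)] by (simp add: C.s0)
  show ?thesis unfolding cuntz_krieger_family_def
  proof (intro conjI ballI impI)
    show "cstar_algebra CB" by (rule C.cstar_algebra_axioms)
    show "t \<in> X \<rightarrow> carrier CB" using D(2) sf by (auto simp: t_def)
  next
    fix v assume v: "v \<in> vertices \<Lambda>"
    show "star CB (t v) = t v" using D(6)[OF one_closed sv[OF v]] v vm[OF v] by (simp add: t_def \<eta>_vertex \<sigma>_one s_star_vertex A.s1)
    show "t v \<otimes>\<^bsub>CB\<^esub> t v = t v" using D(5)[OF one_closed sv[OF v] one_closed sv[OF v]] v vm[OF v]
      by (simp add: t_def \<eta>_vertex \<sigma>_one s_idem A.s1)
    show "t v \<otimes>\<^bsub>CB\<^esub> t w = \<zero>\<^bsub>CB\<^esub>" if w: "w \<in> vertices \<Lambda>" "v \<noteq> w" for w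
      using D(5)[OF one_closed sv[OF v] one_closed sv[OF w(1)]] v w by (simp add: t_def \<eta>_vertex \<sigma>_one s_orth zero)
    fix n assume n: "n \<in> degrees k"
    have P: "x \<in> X" if "x \<in> paths_from \<Lambda> v n" for x using that by (rule pm)
    have xx: "s x \<otimes>\<^bsub>A\<^esub> star A (s x) \<in> fib \<one>" if "x \<in> X" for x using fib_spanning[OF that that refl] that by simp
    have "(\<Oplus>\<^bsub>CB\<^esub>x\<in>paths_from \<Lambda> v n. t x \<otimes>\<^bsub>CB\<^esub> star CB (t x)) = (\<Oplus>\<^bsub>CB\<^esub>x\<in>paths_from \<Lambda> v n. \<pi>\<sigma> (\<one>, s x \<otimes>\<^bsub>A\<^esub> star A (s x)))"
      using bundle_morphism_star_mult(2)[OF m E sf] D(2)[OF one_closed xx] P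
      by (intro C.M.finsum_cong') (auto simp: t_def)
    also have "\<dots> = \<pi>\<sigma> (\<one>, s v)"
      using bundle_morphism_finsum[OF m one_closed finite_paths_from[OF v n], of "\<lambda>x. s x \<otimes>\<^bsub>A\<^esub> star A (s x)"] xx P s_sum[OF v n] by simp
    finally show "t v = (\<Oplus>\<^bsub>CB\<^esub>x\<in>paths_from \<Lambda> v n. t x \<otimes>\<^bsub>CB\<^esub> star CB (t x))" using v by (simp add: t_def \<eta>_vertex)
  next
    fix x assume x: "x \<in> X"
    show "star CB (t x) \<otimes>\<^bsub>CB\<^esub> t x = t (src \<Lambda> x)"
      using bundle_morphism_star_mult(1)[OF m E[OF x] sf[OF x]] x by (simp add: t_def s_isometry \<eta>_vertex src_vertex)
    fix y assume y: "y \<in> X" and xy: "src \<Lambda> x = rng \<Lambda> y"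
    have xyX: "pcomp \<Lambda> x y \<in> X" using x y xy by (rule comp_closed)
    show "t x \<otimes>\<^bsub>CB\<^esub> t y = c x y \<odot>\<^bsub>CB\<^esub> t (pcomp \<Lambda> x y)"
      using D(5)[OF E[OF x] sf[OF x] E[OF y] sf[OF y]] D(4)[OF E[OF xyX] sf[OF xyX], of "c x y"] x y xy
      by (simp add: t_def s_comp \<eta>_comp functor_cocycle_def)
  qed
qed

lemma twisted_graph_generates: "generates D (T ` X)"
  unfolding twisted_graph_cstar_def twisted_graph_family_def universal_cstar_def universal_family_def
  using universal_ck_seminorm by (intro free_seminorm.completion_generates free_seminorm.intro) blast

text \<open>Both composites of the two homomorphisms fix generators. For \<open>D\<close> these are
  the \<open>T x\<close>; for \<open>CB\<close> they are the images of all fibre elements, and by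
  continuity it suffices to treat s a s b*, whose image is a scalar multiple of t a t b*.\<close>

theorem twisted_graph_iso:
  "\<exists>\<phi>\<in>star_iso D CB. \<forall>x\<in>X. \<phi> (T x) = \<pi>\<sigma> (\<eta> x, s x)"
proof -
  note m = canonical_bundle_morphism
  note MD = bundle_morphismD[OF m]
  interpret C: cstar_algebra CB by (rule MD(1)[OF one_closed fibD(2)])
  obtain \<phi> where \<phi>: "\<phi> \<in> star_hom D CB" "\<And>x. x \<in> X \<Longrightarrow> \<phi> (T x) = t x"
    using twisted_graph_cstar_universal[OF t_ck] by blast
  obtain \<psi> where \<psi>: "\<psi> \<in> star_hom CB D" "\<And>b. b \<in> BT \<Longrightarrow> \<psi> (\<pi>\<sigma> b) = untwist b"
    using bundle_cstar_universal[OF untwist_bundle_morphism] by blast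
  have \<psi>t: "\<psi> (t x) = T x" if "x \<in> X" for x
    using \<psi>(2)[of "(\<eta> x, s x)"] untwist_eq[OF _ twisted_limit_gen[OF that]] that by (simp add: t_def s_fib)
  have 1: "(\<psi> \<circ> \<phi>) d = d" if "d \<in> carrier D" for d
    by (rule D.star_hom_fixes_generated[OF star_hom_comp[OF \<phi>(1) \<psi>(1)] twisted_graph_generates _ _ that]) (auto simp: \<phi>(2) \<psi>t)
  let ?\<chi> = "\<phi> \<circ> \<psi>"
  have \<chi>: "?\<chi> \<in> star_hom CB CB" by (rule star_hom_comp[OF \<psi>(1) \<phi>(1)])
  note \<chi>D = star_homD[OF \<chi>]
  have tc: "t x \<in> carrier CB" "?\<chi> (t x) = t x" if "x \<in> X" for x
    using that MD(2)[OF \<eta>_closed s_fib] by (simp_all add: \<phi>(2) \<psi>t) (simp add: t_def)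
  have fixed: "?\<chi> (\<pi>\<sigma> (g, x)) = \<pi>\<sigma> (g, x)" if g: "g \<in> carrier G" and x: "x \<in> fib g" for g x
  proof -
    have "\<pi>\<sigma> (g, x) \<in> {u \<in> carrier CB. ?\<chi> u = u}"
    proof (rule bundle_morphism_preimage[OF m g C.closed_subspace_fixed[OF \<chi>] _ x])
      fix a b assume ab: "a \<in> X" "b \<in> X" "\<eta> a \<otimes> inv (\<eta> b) = g"
      let ?h = "\<eta> b" and ?y = "s a \<otimes>\<^bsub>A\<^esub> star A (s b)"
      \<comment> \<open>The first factor comes from the deformed product of a with the adjoint of b,
        the second from the deformed involution of b. Being unimodular, the scalar can be divided
        out.\<close>
      let ?z = "\<sigma> (\<eta> a) (inv ?h) * cnj (\<sigma> ?h (inv ?h))"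
      have y: "?y \<in> fib g" using ab by (rule fib_spanning)
      have h: "?h \<in> carrier G" "\<eta> a \<in> carrier G" using ab by auto
      have z: "cmod ?z = 1" using h by (simp add: norm_mult \<sigma>_norm)
      have "t a \<otimes>\<^bsub>CB\<^esub> star CB (t b) = \<pi>\<sigma> (g, ?z \<odot>\<^bsub>A\<^esub> ?y)"
        unfolding t_def MD(6)[OF h(1) s_fib[OF ab(2)]] MD(5)[OF h(2) s_fib[OF ab(1)] inv_closed[OF h(1)] bstar_closed[OF h(1) s_fib[OF ab(2)]]]
        using ab by (simp add: A.mult_smult_right A.sa)
      also have "\<dots> = ?z \<odot>\<^bsub>CB\<^esub> \<pi>\<sigma> (g, ?y)" by (rule MD(4)[OF g y])
      finally have e: "cnj ?z \<odot>\<^bsub>CB\<^esub> (t a \<otimes>\<^bsub>CB\<^esub> star CB (t b)) = (cnj ?z * ?z) \<odot>\<^bsub>CB\<^esub> \<pi>\<sigma> (g, ?y)"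
        using MD(2)[OF g y] by (simp only: C.sa)
      have "cnj ?z * ?z = 1" using z by (metis complex_norm_square mult.commute of_real_1 one_power2)
      hence "\<pi>\<sigma> (g, ?y) = cnj ?z \<odot>\<^bsub>CB\<^esub> (t a \<otimes>\<^bsub>CB\<^esub> star CB (t b))" using e MD(2)[OF g y] by (simp only: C.s1)
      moreover have "?\<chi> (cnj ?z \<odot>\<^bsub>CB\<^esub> (t a \<otimes>\<^bsub>CB\<^esub> star CB (t b))) = cnj ?z \<odot>\<^bsub>CB\<^esub> (t a \<otimes>\<^bsub>CB\<^esub> star CB (t b))"
        using \<chi>D tc ab by (simp del: o_apply)
      ultimately show "\<pi>\<sigma> (g, ?y) \<in> {u \<in> carrier CB. ?\<chi> u = u}" using MD(2)[OF g y] by simp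
    qed
    thus ?thesis by blast
  qed
  have 2: "?\<chi> u = u" if "u \<in> carrier CB" for u
    by (rule C.star_hom_fixes_generated[OF \<chi> canonical_generates _ _ that]) (use MD(2) fixed in auto)
  have "bij_betw \<phi> (carrier D) (carrier CB)"
    by (rule bij_betw_byWitness[of _ \<psi>]) (use 1 2 star_homD(1)[OF \<phi>(1)] star_homD(1)[OF \<psi>(1)] in auto)
  thus ?thesis using \<phi> by (auto simp: star_iso_def t_def)
qed

end

theorem corollary4p9:
  fixes k :: nat
    and \<Lambda> :: "'l graph_data"
    and G :: "('g, 'm) monoid_scheme"
    and \<eta> :: "'l \<Rightarrow> 'g"
    and \<sigma> :: "'g \<Rightarrow> 'g \<Rightarrow> complex"
  assumes "k_graph k \<Lambda>"
    and "row_finite_no_sources k \<Lambda>"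
    and "group G"
    and "graph_functor \<Lambda> G \<eta>"
    and "\<sigma> \<in> two_cocycles G"
  defines "B \<equiv> graph_bundle k \<Lambda> G \<eta>"
    and "c\<^sub>\<sigma> \<equiv> functor_cocycle \<sigma> \<eta>"
  shows "\<exists>\<phi> \<in> star_iso (twisted_graph_cstar k \<Lambda> c\<^sub>\<sigma>) (bundle_cstar G (deform G B \<sigma>)).
           \<forall>\<xi> \<in> morphs \<Lambda>. \<phi> (twisted_graph_family k \<Lambda> c\<^sub>\<sigma> \<xi>) =
             bundle_canonical G (deform G B \<sigma>) (\<eta> \<xi>, graph_family k \<Lambda> \<xi>)"
proof -
  interpret cocycle_graph k \<Lambda> G \<eta> \<sigma>
    using assms(1-5) by (simp add: cocycle_graph_def cocycle_graph_axioms_def)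
  show ?thesis unfolding B_def c\<^sub>\<sigma>_def by (rule twisted_graph_iso)
qed

end
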